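(* Let $(X,\bar g)$ be a cylindrical manifold of dimension $n\ge3$ with tame ends $Z\times[0,\infty)$ and $\partial_\infty\bar g=h$, and set $\bar C=[\bar g]$. (1) If $\lambda(\mathcal L_h)\ge0$, then $Y^{cyl}_{\bar C}(X)>-\infty$, and hence $Y^{h\text{-}cyl}(X)>-\infty$. In particular, if $R_h\ge0$ on $Z$, then $Y^{cyl}_{\bar C}(X)>-\infty$ and $Y^{h\text{-}cyl}(X)>-\infty$. (2) If $\lambda(\mathcal L_h)=0$, then $Y^{cyl}_{\bar C}(X)\le0$, and hence $Y^{h\text{-}cyl}(X)\le0$. In particular, if $R_h\equiv0$ on $Z$, then $Y^{cyl}_{\bar C}(X)\le0$ and $Y^{h\text{-}cyl}(X)\le0$.
   Context: An open manifold with tame ends $Z\times[0,\infty)$ is a connected noncompact manifold $X$ without boundary having a relatively compact open submanifold $W\subset X$ with $\partial\overline W=Z=\bigsqcup_{j=1}^m Z_j$, each $Z_j$ a connected closed $(n-1)$-manifold, such that $X\setminus W\cong Z\times[0,\infty)$. A cylindrical metric on $X$ is a complete Riemannian metric $\bar g$ such that, in some coordinate system $(x,t)$ on $Z\times[0,\infty)$, $\bar g(x,t)=h(x)+dt^2$ on $Z\times[1,\infty)$ for some Riemannian metric $h$ on $Z$; one writes $\partial_\infty\bar g=h$; $(X,\bar g)$ is then called a cylindrical manifold. With $\alpha_n=\frac{4(n-1)}{n-2}$ and $L^{1,2}_{\bar g}(X)$ the Sobolev space of functions square-integrable with their first weak derivatives, $$Y^{cyl}_{\bar C}(X)=\inf_{u\in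 L^{1,2}_{\bar g}(X),\,u\not\equiv0}\frac{\int_X(\alpha_n|du|^2+R_{\bar g}u^2)\,d\sigma_{\bar g}}{\left(\int_X|u|^{\frac{2n}{n-2}}d\sigma_{\bar g}\right)^{\frac{n-2}{n}}},\qquad Y^{h\text{-}cyl}(X)=\sup_{\bar g\text{ cylindrical},\ \partial_\infty\bar g=h}Y^{cyl}_{[\bar g]}(X).$$ $\lambda(\mathcal L_h)$ is the first eigenvalue of $\mathcal L_h=-\alpha_n\Delta_h+R_h$ on $(Z,h)$ (note $n=\dim Z+1$), i.e. the infimum over $u\in L^{1,2}(Z)$, $u\not\equiv0$, of $\int_Z(\alpha_n|du|^2+R_hu^2)d\sigma_h/\int_Zu^2d\sigma_h$. *)

theory Defs
  imports "HOL-Analysis.Analysis"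
begin

section \<open>Smooth maps between Euclidean spaces\<close>

fun Ck_on :: "nat \<Rightarrow> 'a::euclidean_space set \<Rightarrow> ('a \<Rightarrow> 'b::real_normed_vector) \<Rightarrow> bool" where
  "Ck_on 0 V f \<longleftrightarrow> continuous_on V f"
| "Ck_on (Suc k) V f \<longleftrightarrow> (\<forall>y\<in>V. f differentiable (at y)) \<and>
     (\<forall>b\<in>Basis. Ck_on k V (\<lambda>y. frechet_derivative f (at y) b))"

text \<open>Used for open \<open>V\<close> only.\<close>

definition smooth_on :: "'a::euclidean_space set \<Rightarrow> ('a \<Rightarrow> 'b::real_normed_vector) \<Rightarrow> bool" where
  "smooth_on V f \<longleftrightarrow> (\<forall>k. Ck_on k V f)"

definition partial :: "'n \<Rightarrow> (real^'n \<Rightarrow> 'b::real_normed_vector) \<Rightarrow> real^'n \<Rightarrow> 'b" where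
  "partial i f y = frechet_derivative f (at y) (axis i 1)"


section \<open>Smooth manifolds\<close>

text \<open>
  A manifold is a whole topological type (Hausdorff and second countable by its sort) together
  with a smooth atlas, which need not be maximal. Charts map onto open subsets of a Euclidean
  space, so manifolds have no boundary; manifolds with boundary only occur as subsets.
\<close>

type_synonym ('a, 'e) chart = "'a set \<times> ('a \<Rightarrow> 'e)"

abbreviation chart_inv :: "('a, 'e) chart \<Rightarrow> 'e \<Rightarrow> 'a" where
  "chart_inv c \<equiv> inv_into (fst c) (snd c)"

definition is_chart :: "('a::topological_space, 'e::euclidean_space) chart \<Rightarrow> bool" where
  "is_chart c \<longleftrightarrow> open (fst c) \<and> open (snd c ` fst c) \<and>
     homeomorphism (fst c) (snd c ` fst c) (snd c) (chart_inv c)"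

definition smooth_atlas ::
  "('a::{t2_space,second_countable_topology}, 'e::euclidean_space) chart set \<Rightarrow> bool" where
  "smooth_atlas A \<longleftrightarrow> (\<forall>c\<in>A. is_chart c) \<and> (\<Union>c\<in>A. fst c) = UNIV \<and>
     (\<forall>c\<in>A. \<forall>d\<in>A. smooth_on (snd c ` (fst c \<inter> fst d)) (snd d \<circ> chart_inv c))"

definition chart_at :: "('a, 'e) chart set \<Rightarrow> 'a \<Rightarrow> ('a, 'e) chart" where
  "chart_at A p = (SOME c. c \<in> A \<and> p \<in> fst c)"

definition smooth_map_open ::
  "('a::topological_space, 'e::euclidean_space) chart set \<Rightarrow>
   ('b::topological_space, 'f::euclidean_space) chart set \<Rightarrow> 'a set \<Rightarrow> ('a \<Rightarrow> 'b) \<Rightarrow> bool" where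
  "smooth_map_open A B U F \<longleftrightarrow> continuous_on U F \<and>
     (\<forall>c\<in>A. \<forall>d\<in>B. smooth_on (snd c ` (U \<inter> fst c \<inter> F -` fst d)) (snd d \<circ> F \<circ> chart_inv c))"

text \<open>Smoothness on an arbitrary subset: local extendability to smooth maps on open sets.\<close>

definition smooth_map ::
  "('a::topological_space, 'e::euclidean_space) chart set \<Rightarrow>
   ('b::topological_space, 'f::euclidean_space) chart set \<Rightarrow> 'a set \<Rightarrow> ('a \<Rightarrow> 'b) \<Rightarrow> bool" where
  "smooth_map A B S f \<longleftrightarrow>
     (\<forall>p\<in>S. \<exists>U F. open U \<and> p \<in> U \<and> smooth_map_open A B U F \<and> (\<forall>q\<in>S \<inter> U. F q = f q))"

definition diffeomorphism ::
  "('a::topological_space, 'e::euclidean_space) chart set \<Rightarrow>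
   ('b::topological_space, 'f::euclidean_space) chart set \<Rightarrow> 'a set \<Rightarrow> 'b set \<Rightarrow> ('a \<Rightarrow> 'b) \<Rightarrow> bool" where
  "diffeomorphism A B S T f \<longleftrightarrow> bij_betw f S T \<and>
     smooth_map A B S f \<and> smooth_map B A T (inv_into S f)"

definition cylinder_atlas :: "('z, 'e) chart set \<Rightarrow> ('z \<times> real, 'e \<times> real) chart set" where
  "cylinder_atlas A = (\<lambda>c. (fst c \<times> UNIV, \<lambda>(x, t). (snd c x, t))) ` A"


section \<open>Riemannian geometry in charts\<close>

text \<open>
  Tensor fields are given by their components in every chart of the atlas, subject to the
  transformation law. For a metric \<open>g\<close>, the matrix \<open>g c p\<close> is the Gram matrix at \<open>p\<close> of the
  coordinate frame of \<open>c\<close>.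
\<close>

type_synonym ('a, 'n) metric = "('a, real^'n) chart \<Rightarrow> 'a \<Rightarrow> real^'n^'n"
type_synonym ('a, 'n) covector_field = "('a, real^'n) chart \<Rightarrow> 'a \<Rightarrow> real^'n"

definition transition_jacobian ::
  "('a, real^'n) chart \<Rightarrow> ('a, real^'n) chart \<Rightarrow> 'a \<Rightarrow> real^'n^'n" where
  "transition_jacobian c d p = matrix (frechet_derivative (snd d \<circ> chart_inv c) (at (snd c p)))"

definition riemannian_metric ::
  "('a::{t2_space,second_countable_topology}, real^'n) chart set \<Rightarrow> ('a, 'n) metric \<Rightarrow> bool" where
  "riemannian_metric A g \<longleftrightarrow>
     (\<forall>c\<in>A. smooth_on (snd c ` fst c) (\<lambda>y. g c (chart_inv c y)) \<and>
        (\<forall>p\<in>fst c. transpose (g c p) = g c p \<and> (\<forall>v. v \<noteq> 0 \<longrightarrow> v \<bullet> (g c p *v v) > 0))) \<and>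
     (\<forall>c\<in>A. \<forall>d\<in>A. \<forall>p\<in>fst c \<inter> fst d.
        g c p = transpose (transition_jacobian c d p) ** g d p ** transition_jacobian c d p)"

subsection \<open>Completeness\<close>

definition piecewise_C1_curve ::
  "('a::topological_space, real^'n) chart set \<Rightarrow> (real \<Rightarrow> 'a) \<Rightarrow> bool" where
  "piecewise_C1_curve A \<gamma> \<longleftrightarrow> continuous_on {0..1} \<gamma> \<and>
     (\<exists>S. finite S \<and> (\<forall>c\<in>A. (snd c \<circ> \<gamma>) C1_differentiable_on {t \<in> {0..1} - S. \<gamma> t \<in> fst c}))"

definition speed ::
  "('a, real^'n) chart set \<Rightarrow> ('a, 'n) metric \<Rightarrow> (real \<Rightarrow> 'a) \<Rightarrow> real \<Rightarrow> real" where
  "speed A g \<gamma> t =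
     (let c = chart_at A (\<gamma> t); v = vector_derivative (snd c \<circ> \<gamma>) (at t)
      in sqrt (v \<bullet> (g c (\<gamma> t) *v v)))"

definition curve_length ::
  "('a, real^'n) chart set \<Rightarrow> ('a, 'n) metric \<Rightarrow> (real \<Rightarrow> 'a) \<Rightarrow> ennreal" where
  "curve_length A g \<gamma> = (\<integral>\<^sup>+t\<in>{0..1}. ennreal (speed A g \<gamma> t) \<partial>lborel)"

definition riemannian_dist ::
  "('a::topological_space, real^'n) chart set \<Rightarrow> ('a, 'n) metric \<Rightarrow> 'a \<Rightarrow> 'a \<Rightarrow> ennreal" where
  "riemannian_dist A g p q =
     (INF \<gamma> \<in> {\<gamma>. piecewise_C1_curve A \<gamma> \<and> \<gamma> 0 = p \<and> \<gamma> 1 = q}. curve_length A g \<gamma>)"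

definition complete_metric ::
  "('a::topological_space, real^'n) chart set \<Rightarrow> ('a, 'n) metric \<Rightarrow> bool" where
  "complete_metric A g \<longleftrightarrow>
     (\<forall>s :: nat \<Rightarrow> 'a.
        (\<forall>e>0. \<exists>N. \<forall>i\<ge>N. \<forall>j\<ge>N. riemannian_dist A g (s i) (s j) < e) \<longrightarrow>
        (\<exists>p. (\<lambda>i. riemannian_dist A g (s i) p) \<longlonglongrightarrow> 0))"

subsection \<open>Scalar curvature\<close>

text \<open>In the next three definitions \<open>G\<close> is the Gram matrix as a function of the coordinates.\<close>

definition christoffel :: "(real^'n \<Rightarrow> real^'n^'n) \<Rightarrow> 'n \<Rightarrow> 'n \<Rightarrow> 'n \<Rightarrow> real^'n \<Rightarrow> real" where
  "christoffel G k i j y =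
     (1/2) * (\<Sum>l\<in>UNIV. matrix_inv (G y) $ k $ l *
        (partial i (\<lambda>y. G y $ j $ l) y + partial j (\<lambda>y. G y $ i $ l) y
           - partial l (\<lambda>y. G y $ i $ j) y))"

definition ricci :: "(real^'n \<Rightarrow> real^'n^'n) \<Rightarrow> 'n \<Rightarrow> 'n \<Rightarrow> real^'n \<Rightarrow> real" where
  "ricci G i j y =
     (\<Sum>k\<in>UNIV. partial k (christoffel G k i j) y - partial j (christoffel G k i k) y
        + (\<Sum>l\<in>UNIV. christoffel G k k l y * christoffel G l i j y
                   - christoffel G k j l y * christoffel G l i k y))"

definition scalar_curvature_coord :: "(real^'n \<Rightarrow> real^'n^'n) \<Rightarrow> real^'n \<Rightarrow> real" where
  "scalar_curvature_coord G y = (\<Sum>i\<in>UNIV. \<Sum>j\<in>UNIV. matrix_inv (G y) $ i $ j * ricci G i j y)"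

definition scalar_curvature ::
  "('a, real^'n) chart set \<Rightarrow> ('a, 'n) metric \<Rightarrow> 'a \<Rightarrow> real" where
  "scalar_curvature A g p =
     (let c = chart_at A p in scalar_curvature_coord (\<lambda>y. g c (chart_inv c y)) (snd c p))"

subsection \<open>Riemannian measure\<close>

text \<open>The unique Borel measure that in each chart has density \<open>sqrt (det g)\<close>.\<close>

definition riemannian_measure ::
  "('a::topological_space, real^'n) chart set \<Rightarrow> ('a, 'n) metric \<Rightarrow> 'a measure" where
  "riemannian_measure A g =
     (THE \<mu>. sets \<mu> = sets borel \<and>
        (\<forall>c\<in>A. \<forall>S\<in>sets borel. S \<subseteq> fst c \<longrightarrow>
           emeasure \<mu> S =
             (\<integral>\<^sup>+y\<in>snd c ` S. ennreal (sqrt (det (g c (chart_inv c y)))) \<partial>lborel)))"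


section \<open>The Sobolev space of square-integrable functions with their first derivatives\<close>

definition test_function :: "(real^'n) set \<Rightarrow> (real^'n \<Rightarrow> real) \<Rightarrow> bool" where
  "test_function V \<psi> \<longleftrightarrow> smooth_on UNIV \<psi> \<and>
     compact (closure {y. \<psi> y \<noteq> 0}) \<and> closure {y. \<psi> y \<noteq> 0} \<subseteq> V"

definition weak_gradient_on ::
  "(real^'n) set \<Rightarrow> (real^'n \<Rightarrow> real) \<Rightarrow> (real^'n \<Rightarrow> real^'n) \<Rightarrow> bool" where
  "weak_gradient_on V f D \<longleftrightarrow>
     (\<forall>K. compact K \<and> K \<subseteq> V \<longrightarrow> set_integrable lborel K f \<and> set_integrable lborel K D) \<and>
     (\<forall>\<psi> i. test_function V \<psi> \<longrightarrow>
        (LINT y|lborel. f y * partial i \<psi> y) = - (LINT y|lborel. D y $ i * \<psi> y))"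

definition weak_differential ::
  "('a, real^'n) chart set \<Rightarrow> ('a \<Rightarrow> real) \<Rightarrow> ('a, 'n) covector_field \<Rightarrow> bool" where
  "weak_differential A u \<omega> \<longleftrightarrow>
     (\<forall>c\<in>A. weak_gradient_on (snd c ` fst c)
        (\<lambda>y. u (chart_inv c y)) (\<lambda>y. \<omega> c (chart_inv c y))) \<and>
     (\<forall>c\<in>A. \<forall>d\<in>A. \<forall>p\<in>fst c \<inter> fst d.
        \<omega> c p = transpose (transition_jacobian c d p) *v \<omega> d p)"

definition conorm_sq ::
  "('a, real^'n) chart set \<Rightarrow> ('a, 'n) metric \<Rightarrow> ('a, 'n) covector_field \<Rightarrow> 'a \<Rightarrow> real" where
  "conorm_sq A g \<omega> p = (let c = chart_at A p in \<omega> c p \<bullet> (matrix_inv (g c p) *v \<omega> c p))"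

text \<open>
  Pairs \<open>(u, \<omega>)\<close> with \<open>\<omega> = du\<close> weakly and both square-integrable. Since \<open>\<omega>\<close> is determined
  almost everywhere by \<open>u\<close>, the functionals below depend on \<open>u\<close> only.
\<close>

definition sobolev ::
  "('a::topological_space, real^'n) chart set \<Rightarrow> ('a, 'n) metric \<Rightarrow>
   (('a \<Rightarrow> real) \<times> ('a, 'n) covector_field) set" where
  "sobolev A g = {(u, \<omega>). u \<in> borel_measurable borel \<and> weak_differential A u \<omega> \<and>
     integrable (riemannian_measure A g) (\<lambda>p. (u p)\<^sup>2) \<and>
     integrable (riemannian_measure A g) (conorm_sq A g \<omega>)}"

definition sobolev_nonzero ::
  "('a::topological_space, real^'n) chart set \<Rightarrow> ('a, 'n) metric \<Rightarrow>
   (('a \<Rightarrow> real) \<times> ('a, 'n) covector_field) set" where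
  "sobolev_nonzero A g =
     {(u, \<omega>) \<in> sobolev A g. \<not> (AE p in riemannian_measure A g. u p = 0)}"


section \<open>The functionals\<close>

definition alpha :: "nat \<Rightarrow> real" where
  "alpha n = 4 * (real n - 1) / (real n - 2)"

definition yamabe_energy ::
  "real \<Rightarrow> ('a::topological_space, real^'n) chart set \<Rightarrow> ('a, 'n) metric \<Rightarrow>
   ('a \<Rightarrow> real) \<Rightarrow> ('a, 'n) covector_field \<Rightarrow> real" where
  "yamabe_energy a A g u \<omega> =
     (LINT p|riemannian_measure A g. a * conorm_sq A g \<omega> p + scalar_curvature A g p * (u p)\<^sup>2)"

text \<open>
  The first eigenvalue of \<open>\<L>\<^sub>h = - \<alpha>\<^sub>n \<Delta>\<^sub>h + R\<^sub>h\<close> on \<open>Z\<close>, where \<open>n = dim Z + 1\<close>.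
\<close>

definition first_eigenvalue ::
  "('z::topological_space, real^'m) chart set \<Rightarrow> ('z, 'm) metric \<Rightarrow> ereal" where
  "first_eigenvalue A h =
     (INF (u, \<omega>) \<in> sobolev_nonzero A h.
        ereal (yamabe_energy (alpha (CARD('m) + 1)) A h u \<omega> /
               (LINT p|riemannian_measure A h. (u p)\<^sup>2)))"

text \<open>
  \<open>cyl_yamabe A g\<close> is the constant of the conformal class of the cylindrical metric \<open>g\<close>,
  computed with \<open>g\<close> as representative. For such metrics the scalar curvature is bounded and the
  Sobolev embedding holds, so all integrals are finite and the denominator is positive.
\<close>

definition cyl_yamabe ::
  "('x::topological_space, real^'n) chart set \<Rightarrow> ('x, 'n) metric \<Rightarrow> ereal" where
  "cyl_yamabe A g =
     (let n = real CARD('n) in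
      INF (u, \<omega>) \<in> sobolev_nonzero A g.
        ereal (yamabe_energy (alpha CARD('n)) A g u \<omega> /
               (LINT p|riemannian_measure A g. \<bar>u p\<bar> powr (2 * n / (n - 2))) powr ((n - 2) / n)))"


section \<open>Cylindrical manifolds\<close>

text \<open>
  \<open>Z\<close> is a closed manifold of its own; \<open>Z\<^sub>1, \<dots>, Z\<^sub>m\<close> are its components, which are finitely many
  by compactness. A coordinate system \<open>\<Phi>\<close> on the end identifies \<open>Z \<times> [0,\<infinity>)\<close> with \<open>X - W\<close>, with
  \<open>Z \<times> {0}\<close> corresponding to the boundary of the closure of \<open>W\<close>.
\<close>

definition end_coordinates ::
  "('x::{t2_space,second_countable_topology}, real^'n) chart set \<Rightarrow>
   ('z::{t2_space,second_countable_topology}, real^'m) chart set \<Rightarrow>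
   'x set \<Rightarrow> ('z \<times> real \<Rightarrow> 'x) \<Rightarrow> bool" where
  "end_coordinates AX AZ W \<Phi> \<longleftrightarrow>
     diffeomorphism (cylinder_atlas AZ) AX (UNIV \<times> {0..}) (- W) \<Phi> \<and>
     \<Phi> ` (UNIV \<times> {0}) = frontier (closure W)"

definition tame_ends ::
  "('x::{t2_space,second_countable_topology}, real^'n) chart set \<Rightarrow>
   ('z::{t2_space,second_countable_topology}, real^'m) chart set \<Rightarrow> 'x set \<Rightarrow> bool" where
  "tame_ends AX AZ W \<longleftrightarrow>
     CARD('n) = CARD('m) + 1 \<and>
     smooth_atlas AX \<and> connected (UNIV :: 'x set) \<and> \<not> compact (UNIV :: 'x set) \<and>
     smooth_atlas AZ \<and> compact (UNIV :: 'z set) \<and>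
     open W \<and> compact (closure W) \<and> (\<exists>\<Phi>. end_coordinates AX AZ W \<Phi>)"

text \<open>
  The pullback of \<open>g\<close> along \<open>\<Phi>\<close> equals \<open>h + dt\<^sup>2\<close> on \<open>Z \<times> [1,\<infinity>)\<close>; tangent vectors of the
  cylinder have components in \<open>\<real>\<^sup>m \<times> \<real>\<close>.
\<close>

definition product_on_end ::
  "('x, real^'n) chart set \<Rightarrow> ('z, real^'m) chart set \<Rightarrow>
   ('x, 'n) metric \<Rightarrow> ('z, 'm) metric \<Rightarrow> ('z \<times> real \<Rightarrow> 'x) \<Rightarrow> bool" where
  "product_on_end AX AZ g h \<Phi> \<longleftrightarrow>
     (\<forall>c\<in>AZ. \<forall>d\<in>AX. \<forall>x\<in>fst c. \<forall>t\<ge>1. \<Phi> (x, t) \<in> fst d \<longrightarrow>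
        (let D = frechet_derivative (\<lambda>(y, s). snd d (\<Phi> (chart_inv c y, s))) (at (snd c x, t))
         in \<forall>v w. D v \<bullet> (g d (\<Phi> (x, t)) *v D w) = fst v \<bullet> (h c x *v fst w) + snd v * snd w))"

text \<open>\<open>g\<close> is a cylindrical metric on \<open>X\<close> and \<open>h\<close> is its limit \<open>\<partial>\<^sub>\<infinity>g\<close>.\<close>

definition cylindrical_metric ::
  "('x::{t2_space,second_countable_topology}, real^'n) chart set \<Rightarrow>
   ('z::{t2_space,second_countable_topology}, real^'m) chart set \<Rightarrow> 'x set \<Rightarrow>
   ('x, 'n) metric \<Rightarrow> ('z, 'm) metric \<Rightarrow> bool" where
  "cylindrical_metric AX AZ W g h \<longleftrightarrow>
     riemannian_metric AX g \<and> complete_metric AX g \<and> riemannian_metric AZ h \<and>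
     (\<exists>\<Phi>. end_coordinates AX AZ W \<Phi> \<and> product_on_end AX AZ g h \<Phi>)"

definition h_cyl_yamabe ::
  "('x::{t2_space,second_countable_topology}, real^'n) chart set \<Rightarrow>
   ('z::{t2_space,second_countable_topology}, real^'m) chart set \<Rightarrow> 'x set \<Rightarrow>
   ('z, 'm) metric \<Rightarrow> ereal" where
  "h_cyl_yamabe AX AZ W h = (SUP g \<in> {g. cylindrical_metric AX AZ W g h}. cyl_yamabe AX g)"

end

(*
Write p = 2n/(n-2) and N = int |u|^p.

Lower bound: for almost every t the restriction of u to the slice Z x {t} is a Sobolev function, and
the metric is h + dt^2 on the end, so there the energy of u is at least the integral over t of the
energies of the slices for the operator L_h, which are nonnegative when the first eigenvalue is.
The rest of X is compact. Its scalar curvature is bounded below by some -C, and by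
u^2 <= s + s^(1-p/2) |u|^p with s = N^(2/p) its integral of u^2 is at most a constant times N^(2/p).

Upper bound: if the first eigenvalue is 0, choose v on Z with energy at most T^-2 int v^2 and put
u(z,t) = beta((t-2)/T) v(z) with a fixed bump function beta on [0,1]. The energy of u is O(1/T) int v^2,
while int u^2 is a multiple of T int v^2 and, by the same inequality on the support of u, is O(T) N^(2/p).
So the quotient of u is O(1/T).
*)
theory Submission
  imports Defs "HOL-Computational_Algebra.Polynomial"
begin

section \<open>Calculus of smooth maps\<close>

text \<open>All quantities are given by components in the charts of an arbitrary atlas, and nothing
  guarantees charts adapted to the product structure of the end. Hence measure, scalar curvature and
  weak differentials are first shown to be independent of the chart; product charts can then be
  adjoined.

  The obstacle in the lower bound is the slices: for one test function the weak identity holds on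
  almost every slice, but there are uncountably many test functions. Countably many bumps with dense
  centres decide the matter, by continuity in the centre and mollification.

  No Sobolev embedding is used. If \<open>|u|^p\<close> is not integrable or has integral 0, the
  denominator is 0 and so is the quotient; a non-integrable energy density also gives quotient 0.
  Zero lies on the right side of both bounds.

  The tolerance T^-2 balances the two parts of the energy of the test functions: the slice energy
  and the square of the derivative of the cutoff are both of size T^-2 on an interval of length
  T.\<close>

lemma frechet_derivative_eqI: "(f has_derivative f') (at x) \<Longrightarrow> frechet_derivative f (at x) = f'"
  using frechet_derivative_at by metis

text \<open>Two-sided derivatives at points of an open set see only nearby values, so equality on
  \<open>V\<close> passes to all derivatives. One direction is proved for arbitrary \<open>f\<close>
  and \<open>g\<close>; the other is its mirror image.\<close>

lemma Ck_on_cong: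
  assumes "open V" "\<And>y. y \<in> V \<Longrightarrow> f y = g y"
  shows "Ck_on k V f \<longleftrightarrow> Ck_on k V g"
proof -
  have *: "Ck_on k V g" if "\<And>y. y \<in> V \<Longrightarrow> f y = g y" "Ck_on k V f" for f g
    using that
  proof (induction k arbitrary: f g)
    case 0 then show ?case using continuous_on_cong by force
  next
    case (Suc k)
    have d: "(g has_derivative frechet_derivative f (at y)) (at y)" if "y \<in> V" for y
    proof (rule has_derivative_transform_within_open[OF _ assms(1) that])
      show "(f has_derivative frechet_derivative f (at y)) (at y)"
        using Suc.prems(2) that by (simp add: frechet_derivative_works[symmetric])
    qed (rule Suc.prems(1))
    moreover have "Ck_on k V (\<lambda>y. frechet_derivative g (at y) b)" if "b \<in> Basis" for b
    proof (rule Suc.IH[where f="\<lambda>y. frechet_derivative f (at y) b"])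
      show "frechet_derivative f (at y) b = frechet_derivative g (at y) b" if "y \<in> V" for y
        by (simp add: frechet_derivative_eqI[OF d[OF that]])
      show "Ck_on k V (\<lambda>y. frechet_derivative f (at y) b)" using that Suc.prems(2) by simp
    qed
    ultimately show ?case by (auto simp: differentiable_def)
  qed
  show ?thesis using *[of f g] *[of g f] assms by auto
qed

text \<open>Lets the derivative be supplied by a formula instead of through
  \<open>frechet_derivative\<close>; the closure properties below combine it with the rules of
  calculus in an induction on the order.\<close>

lemma Ck_on_SucI:
  assumes "open V" "\<And>y. y \<in> V \<Longrightarrow> (f has_derivative f' y) (at y)"
    "\<And>b. b \<in> Basis \<Longrightarrow> Ck_on k V (\<lambda>y. f' y b)"
  shows "Ck_on (Suc k) V f"
proof -
  have "Ck_on k V (\<lambda>y. frechet_derivative f (at y) b)" if "b \<in> Basis" for b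
    by (rule iffD2[OF Ck_on_cong[OF assms(1)]], subst frechet_derivative_eqI[OF assms(2)], assumption)
      (use assms(3) that in auto)
  then show ?thesis using assms(2) by (auto simp: differentiable_def)
qed

lemma Ck_on_derivative:
  "Ck_on (Suc k) V f \<Longrightarrow> y \<in> V \<Longrightarrow> (f has_derivative frechet_derivative f (at y)) (at y)"
  by (auto simp: frechet_derivative_works[symmetric])

lemma Ck_on_continuous: "Ck_on k V f \<Longrightarrow> continuous_on V f"
  by (cases k) (auto intro!: continuous_at_imp_continuous_on differentiable_imp_continuous_within)

lemma Ck_on_SucD: "Ck_on (Suc k) V f \<Longrightarrow> Ck_on k V f"
proof (induction k arbitrary: f)
  case 0 then show ?case using Ck_on_continuous[OF 0] by simp
next
  case (Suc k) 
  have "\<forall>b\<in>Basis. Ck_on k V (\<lambda>y. frechet_derivative f (at y) b)"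
    using Suc.prems Suc.IH by (auto simp del: Ck_on.simps simp: Ck_on.simps(2)[of "Suc k"])
  with Suc.prems show ?case by simp
qed

lemma Ck_on_subset: "Ck_on k V f \<Longrightarrow> U \<subseteq> V \<Longrightarrow> Ck_on k U f"
  by (induction k arbitrary: f) (auto intro: continuous_on_subset)

lemma Ck_on_local:
  assumes "\<And>y. y \<in> V \<Longrightarrow> \<exists>U. open U \<and> y \<in> U \<and> Ck_on k U f"
  shows "Ck_on k V f"
  using assms
proof (induction k arbitrary: f)
  case 0
  then show ?case
    by (simp add: continuous_on_eq_continuous_within)
      (metis UNIV_I at_within_open continuous_within_subset subset_UNIV)
next
  case (Suc k)
  have "f differentiable (at y)" if "y \<in> V" for y using Suc.prems[OF that] by auto
  moreover have "Ck_on k V (\<lambda>y. frechet_derivative f (at y) b)" if "b \<in> Basis" for b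
  proof (rule Suc.IH)
    fix y assume "y \<in> V"
    from Suc.prems[OF this] that show "\<exists>U. open U \<and> y \<in> U \<and> Ck_on k U (\<lambda>y. frechet_derivative f (at y) b)" by auto
  qed
  ultimately show ?case by simp
qed

lemma Ck_on_const: "Ck_on k V (\<lambda>_. c)"
  by (induction k arbitrary: c) auto

lemma Ck_on_bounded_linear: "bounded_linear h \<Longrightarrow> Ck_on k V h"
proof (cases k)
  case (Suc n)
  assume "bounded_linear h"
  then have "frechet_derivative h (at y) = h" for y
    by (intro frechet_derivative_eqI bounded_linear_imp_has_derivative)
  with \<open>bounded_linear h\<close> Suc show ?thesis
    by (auto simp: Ck_on_const bounded_linear_imp_differentiable)
qed (auto simp: linear_continuous_on)

lemma Ck_on_add:
  assumes "open V" "Ck_on k V f" "Ck_on k V g"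
  shows "Ck_on k V (\<lambda>y. f y + g y)"
  using assms(2,3)
proof (induction k arbitrary: f g)
  case (Suc k)
  show ?case
    by (rule Ck_on_SucI[OF assms(1)], rule has_derivative_add[OF Ck_on_derivative[OF Suc.prems(1)] Ck_on_derivative[OF Suc.prems(2)]])
      (use Suc in auto)
qed (auto intro: continuous_intros)

text \<open>The product rule yields two terms of the same shape, one order lower. Stated for bounded
  bilinear maps, it covers products, scalings, inner products and products of matrices at
  once.\<close>

lemma Ck_on_bilinear:
  fixes f :: "'d::euclidean_space \<Rightarrow> _"
  assumes "bounded_bilinear B" "open V" "Ck_on k V f" "Ck_on k V g"
  shows "Ck_on k V (\<lambda>y. B (f y) (g y))"
  using assms(3,4)
proof (induction k arbitrary: f g)
  case 0 then show ?case using bounded_bilinear.continuous_on[OF assms(1)] by simp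
next
  case (Suc k)
  show ?case
  proof (rule Ck_on_SucI[OF assms(2)])
    fix y assume "y \<in> V"
    then show "((\<lambda>y. B (f y) (g y)) has_derivative (\<lambda>h. B (f y) (frechet_derivative g (at y) h)
        + B (frechet_derivative f (at y) h) (g y))) (at y)"
      using bounded_bilinear.FDERIV[OF assms(1)] Ck_on_derivative[OF Suc.prems(1)] Ck_on_derivative[OF Suc.prems(2)]
      by blast
  next
    fix b :: 'd assume b: "b \<in> Basis"
    from b Suc.prems have "Ck_on k V (\<lambda>y. frechet_derivative f (at y) b)" "Ck_on k V (\<lambda>y. frechet_derivative g (at y) b)"
      by auto
    then show "Ck_on k V (\<lambda>y. B (f y) (frechet_derivative g (at y) b)
        + B (frechet_derivative f (at y) b) (g y))"
      using Suc.prems[THEN Ck_on_SucD] by (intro Ck_on_add assms Suc.IH)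
  qed
qed

lemma Ck_on_linear_compose:
  assumes "bounded_linear h" "open V" "Ck_on k V f"
  shows "Ck_on k V (\<lambda>y. h (f y))"
  using assms(3)
proof (induction k arbitrary: f)
  case 0 then show ?case using bounded_linear.continuous_on[OF assms(1)] by simp
next
  case (Suc k)
  show ?case
    by (rule Ck_on_SucI[OF assms(2)], rule bounded_linear.has_derivative[OF assms(1) Ck_on_derivative[OF Suc.prems]])
      (use Suc in auto)
qed

lemma Ck_on_sum:
  assumes "open V" "\<And>i. i \<in> I \<Longrightarrow> Ck_on k V (f i)"
  shows "Ck_on k V (\<lambda>y. \<Sum>i\<in>I. f i y)"
  using assms(2)
  by (induction I rule: infinite_finite_induct) (auto simp: Ck_on_const intro: Ck_on_add[OF assms(1)])

lemma Ck_on_compose: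
  assumes "open V" "open U" "F ` V \<subseteq> U" "Ck_on k V F" "Ck_on k U g"
  shows "Ck_on k V (\<lambda>y. g (F y))"
  using assms(4,5)
proof (induction k arbitrary: g)
  case 0 then show ?case using assms(3) by (auto intro: continuous_on_compose2)
next
  case (Suc k)
  show ?case
  proof (rule Ck_on_SucI[OF assms(1)])
    fix y assume y: "y \<in> V"
    then have "F y \<in> U" using assms by auto
    have "((\<lambda>y. g (F y)) has_derivative (\<lambda>h. frechet_derivative g (at (F y)) (frechet_derivative F (at y) h))) (at y)"
      using diff_chain_at[OF Ck_on_derivative[OF Suc.prems(1) y] Ck_on_derivative[OF Suc.prems(2) \<open>F y \<in> U\<close>]]
      by (simp add: o_def)
    \<comment> \<open>\<open>Ck_on\<close> controls derivatives only in fixed basis directions,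
      whereas the chain rule applies the derivative of \<open>g\<close> to a moving vector.
      Expanding that vector in the basis reduces the step to sums and products.\<close>
    moreover have "frechet_derivative g (at (F y)) v = (\<Sum>e\<in>Basis. (v \<bullet> e) *\<^sub>R frechet_derivative g (at (F y)) e)" for v
    proof -
      interpret bounded_linear "frechet_derivative g (at (F y))"
        using Ck_on_derivative[OF Suc.prems(2) \<open>F y \<in> U\<close>] has_derivative_bounded_linear by blast
      show ?thesis by (subst (1) euclidean_representation[of v, symmetric], simp only: sum scaleR)
    qed
    ultimately show "((\<lambda>y. g (F y)) has_derivative (\<lambda>h. \<Sum>e\<in>Basis. (frechet_derivative F (at y) h \<bullet> e)
       *\<^sub>R frechet_derivative g (at (F y)) e)) (at y)" by (rule has_derivative_eq_rhs[OF _ ext])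
  next
    fix b :: 'a assume b: "b \<in> Basis"
    have "Ck_on k V (\<lambda>y. frechet_derivative F (at y) b)" using Suc.prems b by auto
    then have "Ck_on k V (\<lambda>y. frechet_derivative F (at y) b \<bullet> e)" for e
      by (rule Ck_on_bilinear[OF bounded_bilinear_inner assms(1) _ Ck_on_const])
    moreover have "Ck_on k V (\<lambda>y. frechet_derivative g (at (F y)) e)" if "e \<in> Basis" for e
    proof (rule Suc.IH)
      show "Ck_on k V F" using Suc.prems(1) by (rule Ck_on_SucD)
      show "Ck_on k U (\<lambda>x. frechet_derivative g (at x) e)" using Suc.prems(2) that by simp
    qed
    ultimately show "Ck_on k V (\<lambda>y. \<Sum>e\<in>Basis. (frechet_derivative F (at y) b \<bullet> e)
       *\<^sub>R frechet_derivative g (at (F y)) e)"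
      by (intro Ck_on_sum assms Ck_on_bilinear[OF bounded_bilinear_scaleR]) 
  qed
qed

lemma smooth_on_cong:
  "open V \<Longrightarrow> (\<And>y. y \<in> V \<Longrightarrow> f y = g y) \<Longrightarrow> smooth_on V f \<longleftrightarrow> smooth_on V g"
  unfolding smooth_on_def using Ck_on_cong by blast

lemma smooth_on_differentiable: "smooth_on V f \<Longrightarrow> y \<in> V \<Longrightarrow> f differentiable (at y)"
  unfolding smooth_on_def using Ck_on.simps(2) by blast

lemma smooth_on_has_derivative:
  "smooth_on V f \<Longrightarrow> y \<in> V \<Longrightarrow> (f has_derivative frechet_derivative f (at y)) (at y)"
  unfolding smooth_on_def using Ck_on_derivative by blast

lemma smooth_on_continuous: "smooth_on V f \<Longrightarrow> continuous_on V f"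
  unfolding smooth_on_def using Ck_on_continuous by blast

lemma smooth_on_subset: "smooth_on V f \<Longrightarrow> U \<subseteq> V \<Longrightarrow> smooth_on U f"
  unfolding smooth_on_def using Ck_on_subset by blast

lemma smooth_on_local:
  "(\<And>y. y \<in> V \<Longrightarrow> \<exists>U. open U \<and> y \<in> U \<and> smooth_on U f) \<Longrightarrow> smooth_on V f"
  unfolding smooth_on_def by (intro allI Ck_on_local) blast

lemma smooth_on_const [simp]: "smooth_on V (\<lambda>_. c)"
  unfolding smooth_on_def using Ck_on_const by blast

lemma smooth_on_bounded_linear: "bounded_linear h \<Longrightarrow> smooth_on V h"
  unfolding smooth_on_def using Ck_on_bounded_linear by blast

lemma smooth_on_ident [simp]: "smooth_on V (\<lambda>x. x)"
  by (rule smooth_on_bounded_linear) simp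

lemma smooth_on_add: "open V \<Longrightarrow> smooth_on V f \<Longrightarrow> smooth_on V g \<Longrightarrow> smooth_on V (\<lambda>y. f y + g y)"
  unfolding smooth_on_def using Ck_on_add by blast

lemma smooth_on_bilinear:
  "bounded_bilinear B \<Longrightarrow> open V \<Longrightarrow> smooth_on V f \<Longrightarrow> smooth_on V g \<Longrightarrow> smooth_on V (\<lambda>y. B (f y) (g y))"
  unfolding smooth_on_def using Ck_on_bilinear by blast

lemmas smooth_on_mult = smooth_on_bilinear[OF bounded_bilinear_mult]
lemmas smooth_on_scaleR = smooth_on_bilinear[OF bounded_bilinear_scaleR]
lemmas smooth_on_inner = smooth_on_bilinear[OF bounded_bilinear_inner]

lemma smooth_on_sum:
  "open V \<Longrightarrow> (\<And>i. i \<in> I \<Longrightarrow> smooth_on V (f i)) \<Longrightarrow> smooth_on V (\<lambda>y. \<Sum>i\<in>I. f i y)"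
  unfolding smooth_on_def using Ck_on_sum[of V I] by blast

lemma smooth_on_prod:
  fixes f :: "'i \<Rightarrow> 'a::euclidean_space \<Rightarrow> 'b::real_normed_field"
  assumes "open V" shows "(\<And>i. i \<in> I \<Longrightarrow> smooth_on V (f i)) \<Longrightarrow> smooth_on V (\<lambda>y. \<Prod>i\<in>I. f i y)"
  by (induction I rule: infinite_finite_induct) (auto intro: smooth_on_mult[OF assms])

lemma smooth_on_compose:
  "open V \<Longrightarrow> open U \<Longrightarrow> F ` V \<subseteq> U \<Longrightarrow> smooth_on V F \<Longrightarrow> smooth_on U g \<Longrightarrow> smooth_on V (\<lambda>y. g (F y))"
  unfolding smooth_on_def using Ck_on_compose by blast

lemma smooth_on_linear_compose:
  "bounded_linear h \<Longrightarrow> open V \<Longrightarrow> smooth_on V f \<Longrightarrow> smooth_on V (\<lambda>y. h (f y))"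
  unfolding smooth_on_def using Ck_on_linear_compose by blast

lemmas smooth_on_vec_nth = smooth_on_linear_compose[OF bounded_linear_vec_nth]
lemmas smooth_on_minus = smooth_on_linear_compose[OF bounded_linear_minus[OF bounded_linear_ident]]

lemma smooth_on_diff: "open V \<Longrightarrow> smooth_on V f \<Longrightarrow> smooth_on V g \<Longrightarrow> smooth_on V (\<lambda>y. f y - g y)"
  using smooth_on_add[of V f "\<lambda>y. - g y"] smooth_on_minus[of V g] by simp

lemma smooth_on_frechet_derivative:
  assumes "open V" "smooth_on V f"
  shows "smooth_on V (\<lambda>y. frechet_derivative f (at y) b)"
proof -
  have "smooth_on V (\<lambda>y. \<Sum>e\<in>Basis. (b \<bullet> e) *\<^sub>R frechet_derivative f (at y) e)"
  proof (intro smooth_on_sum smooth_on_scaleR assms smooth_on_const)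
    show "smooth_on V (\<lambda>y. frechet_derivative f (at y) e)" if "e \<in> Basis" for e
      using assms(2) that Ck_on.simps(2) unfolding smooth_on_def by blast
  qed
  moreover have "frechet_derivative f (at y) b = (\<Sum>e\<in>Basis. (b \<bullet> e) *\<^sub>R frechet_derivative f (at y) e)"
    if "y \<in> V" for y
  proof -
    interpret bounded_linear "frechet_derivative f (at y)"
      using smooth_on_has_derivative[OF assms(2) that] has_derivative_bounded_linear by blast
    show ?thesis by (subst (1) euclidean_representation[of b, symmetric], simp only: sum scaleR)
  qed
  ultimately show ?thesis using smooth_on_cong[OF assms(1)] by (metis (no_types, lifting))
qed

lemma smooth_on_partial: "open V \<Longrightarrow> smooth_on V f \<Longrightarrow> smooth_on V (partial i f)"
  using smooth_on_frechet_derivative[of V f "axis i 1"] unfolding partial_def[abs_def] .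

lemma smooth_on_vec:
  assumes "open V" "\<And>i. smooth_on V (\<lambda>y. f y $ i)"
  shows "smooth_on V (f :: _ \<Rightarrow> 'b::real_normed_vector ^ 'n)"
proof -
  have bl: "bounded_linear (\<lambda>x::'b. axis i x :: 'b^'n)" for i
    by (rule bounded_linear_intro[where K=1]) (auto simp: axis_def vec_eq_iff norm_vec_def L2_set_def if_distrib[of norm] if_distrib[of "\<lambda>x. x^2"] cong: if_cong)
  have "smooth_on V (\<lambda>y. \<Sum>i\<in>UNIV. axis i (f y $ i))"
    by (intro smooth_on_sum assms smooth_on_linear_compose[OF bl])
  also have "(\<lambda>y. \<Sum>i\<in>UNIV. axis i (f y $ i)) = f"
    by (auto simp: fun_eq_iff vec_eq_iff axis_def if_distrib sum.delta cong: if_cong)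
  finally show ?thesis .
qed

lemma smooth_on_fst: "open V \<Longrightarrow> smooth_on V f \<Longrightarrow> smooth_on V (\<lambda>y. fst (f y))"
  and smooth_on_snd: "open V \<Longrightarrow> smooth_on V f \<Longrightarrow> smooth_on V (\<lambda>y. snd (f y))"
  by (auto intro: smooth_on_linear_compose bounded_linear_fst bounded_linear_snd)

lemma smooth_on_Pair:
  assumes "open V" "smooth_on V f" "smooth_on V g"
  shows "smooth_on V (\<lambda>y. (f y, g y))"
proof -
  have "smooth_on V (\<lambda>y. (f y, 0) + (0, g y))"
    by (intro smooth_on_add assms smooth_on_linear_compose[where h="\<lambda>x. (x, 0)"]
       smooth_on_linear_compose[where h="\<lambda>x. (0, x)"] bounded_linear_Pair bounded_linear_ident bounded_linear_zero)
  then show ?thesis by simp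
qed

lemma smooth_on_inverse_real: "smooth_on {x::real. x \<noteq> 0} inverse"
  unfolding smooth_on_def
proof
  fix k
  have o: "open {x::real. x \<noteq> 0}" by (auto intro: open_Collect_neq continuous_intros)
  show "Ck_on k {x::real. x \<noteq> 0} inverse"
  proof (induction k)
    case (Suc k)
    show ?case
    proof (rule Ck_on_SucI[OF o])
      show "(inverse has_derivative (\<lambda>h. - (inverse y * h * inverse y))) (at y)" if "y \<in> {x. x \<noteq> 0}" for y::real
        using that has_derivative_inverse'[of y] by simp
      show "Ck_on k {x::real. x \<noteq> 0} (\<lambda>y. - (inverse y * b * inverse y))" for b::real
        using Ck_on_bilinear[OF bounded_bilinear_mult o Ck_on_const[of _ _ "-b"] Ck_on_bilinear[OF bounded_bilinear_mult o Suc Suc]]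
        by (simp add: mult_ac)
    qed
  qed (auto intro: continuous_intros)
qed

lemma smooth_on_divide:
  fixes f g :: "'a::euclidean_space \<Rightarrow> real"
  assumes "open V" "smooth_on V f" "smooth_on V g" "\<And>y. y \<in> V \<Longrightarrow> g y \<noteq> 0"
  shows "smooth_on V (\<lambda>y. f y / g y)"
proof -
  have "smooth_on V (\<lambda>y. inverse (g y))"
    by (rule smooth_on_compose[OF assms(1) _ _ assms(3) smooth_on_inverse_real])
      (use assms in \<open>auto intro: open_Collect_neq continuous_intros\<close>)
  from smooth_on_mult[OF assms(1,2) this] show ?thesis by (simp add: divide_inverse)
qed

lemma smooth_on_abs:
  fixes f :: "'a::euclidean_space \<Rightarrow> real"
  assumes "open V" "smooth_on V f" "\<And>y. y \<in> V \<Longrightarrow> f y \<noteq> 0"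
  shows "smooth_on V (\<lambda>y. \<bar>f y\<bar>)"
proof (rule smooth_on_compose[OF assms(1) _ _ assms(2)])
  show "open {x::real. x \<noteq> 0}" by (auto intro: open_Collect_neq continuous_intros)
  show "smooth_on {x::real. x \<noteq> 0} abs"
  proof (rule smooth_on_local)
    fix y::real assume "y \<in> {x. x \<noteq> 0}"
    then consider "y > 0" | "y < 0" by force
    then show "\<exists>U. open U \<and> y \<in> U \<and> smooth_on U abs"
    proof cases
      case 1
      then have "smooth_on {0<..} (abs::real\<Rightarrow>real)"
        using smooth_on_cong[of "{0<..}" abs "\<lambda>x::real. x"] by auto
      with 1 show ?thesis by (intro exI[of _ "{0<..}"]) auto
    next
      case 2
      then have "smooth_on {..<0} (abs::real\<Rightarrow>real)"
        using smooth_on_cong[of "{..<0}" abs "\<lambda>x::real. - x"] smooth_on_minus[of "{..<0}" "\<lambda>x. x"]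
        by (metis abs_of_neg lessThan_iff open_lessThan smooth_on_ident)
      with 2 show ?thesis by (intro exI[of _ "{..<0}"]) auto
    qed
  qed
qed (use assms in auto)

section \<open>Smoothness of determinants and inverse matrices\<close>

lemma smooth_on_det:
  assumes "open V" "\<And>i j. smooth_on V (\<lambda>y. A y $ i $ j)"
  shows "smooth_on V (\<lambda>y. det (A y :: real^'n^'n))"
  unfolding det_def by (intro smooth_on_sum smooth_on_mult smooth_on_prod smooth_on_const assms)

text \<open>Cramer's rule writes the entries of the inverse as quotients of polynomials in the
  entries; this is how smoothness of a metric passes to its inverse.\<close>

lemma matrix_inv_cramer:
  fixes A :: "real^'n^'n"
  assumes "det A \<noteq> 0"
  shows "matrix_inv A $ k $ l = det (\<chi> i j. if j = k then (if i = l then 1 else 0) else A $ i $ j) / det A"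
proof -
  have "A ** matrix_inv A = mat 1"
    using assms unfolding invertible_det_nz[symmetric] matrix_inv_def invertible_def by (metis (mono_tags, lifting) someI_ex)
  then have "A *v column l (matrix_inv A) = axis l 1"
    by (metis matrix_vector_mul_assoc matrix_vector_mul_lid matrix_vector_mult_basis)
  then have "column l (matrix_inv A) = (\<chi> k. det (\<chi> i j. if j = k then axis l 1 $ i else A $ i $ j) / det A)"
    using cramer[OF assms] by blast
  then have "column l (matrix_inv A) $ k = det (\<chi> i j. if j = k then axis l 1 $ i else A $ i $ j) / det A"
    by simp
  moreover have "(\<chi> i j. if j = k then axis l 1 $ i else A $ i $ j) = (\<chi> i j. if j = k then (if i = l then 1 else 0) else A $ i $ j)"
    by (simp add: vec_eq_iff axis_def)
  ultimately show ?thesis by (simp add: column_def)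
qed

lemma smooth_on_matrix_inv:
  fixes A :: "_ \<Rightarrow> real^'n^'n"
  assumes "open V" "\<And>i j. smooth_on V (\<lambda>y. A y $ i $ j)" "\<And>y. y \<in> V \<Longrightarrow> det (A y) \<noteq> 0"
  shows "smooth_on V (\<lambda>y. matrix_inv (A y) $ k $ l)"
proof -
  have "smooth_on V (\<lambda>y. det (\<chi> i j. if j = k then (if i = l then 1 else 0) else A y $ i $ j) / det (A y))"
  proof (intro smooth_on_divide smooth_on_det assms)
    fix i j show "smooth_on V (\<lambda>y. (\<chi> i j. if j = k then (if i = l then 1 else 0) else A y $ i $ j) $ i $ j)"
      using assms(2) by (cases "j = k"; cases "i = l") auto
  qed
  then show ?thesis
    using smooth_on_cong[OF assms(1), of "\<lambda>y. matrix_inv (A y) $ k $ l"] assms(3)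
    by (simp add: matrix_inv_cramer)
qed

subsection \<open>Bump functions\<close>

text \<open>The functions \<open>poly p (1 / s) * exp (- 1 / s)\<close>, continued by 0, form a
  class closed under differentiation, which gives smoothness to all orders at one stroke.\<close>

definition exp_recip :: "real poly \<Rightarrow> real \<Rightarrow> real" where
  "exp_recip p s = (if s \<le> 0 then 0 else poly p (1 / s) * exp (- 1 / s))"

lemma poly_exp_tendsto_0: "((\<lambda>x::real. poly p x * exp (- x)) \<longlongrightarrow> 0) at_top"
proof -
  have "((\<lambda>x. coeff p i * (x ^ i / exp x)) \<longlongrightarrow> coeff p i * 0) at_top" for i
    by (intro tendsto_intros tendsto_power_div_exp_0)
  then have "((\<lambda>x. \<Sum>i\<le>degree p. coeff p i * (x ^ i / exp x)) \<longlongrightarrow> (\<Sum>i\<le>degree p. coeff p i * 0)) at_top"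
    by (intro tendsto_sum)
  then show ?thesis by (simp add: poly_altdef sum_distrib_right exp_minus divide_inverse mult.assoc)
qed

lemma exp_recip_right_tendsto_0: "((\<lambda>s. poly p (1 / s) * exp (- 1 / s)) \<longlongrightarrow> 0) (at_right (0::real))"
  using filterlim_compose[OF poly_exp_tendsto_0 filterlim_inverse_at_top_right, of p]
  by (simp add: inverse_eq_divide)

lemma exp_recip_has_derivative:
  "(exp_recip p has_real_derivative exp_recip (monom 1 2 * (p - pderiv p)) s) (at s)"
proof -
  consider "s > 0" | "s = 0" | "s < 0" by linarith
  then show ?thesis
  proof cases
    case 1
    have "((\<lambda>s. poly p (1 / s) * exp (- 1 / s)) has_real_derivative
         poly (monom 1 2 * (p - pderiv p)) (1 / s) * exp (- 1 / s)) (at s)"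
      using 1 by (auto intro!: derivative_eq_intros simp: poly_monom field_simps power2_eq_square)
    then have "((\<lambda>s. poly p (1 / s) * exp (- 1 / s)) has_real_derivative
         exp_recip (monom 1 2 * (p - pderiv p)) s) (at s)"
      using 1 by (simp add: exp_recip_def)
    then show ?thesis
      by (rule has_field_derivative_transform_within_open[of _ _ _ "{0<..}"]) (use 1 in \<open>auto simp: exp_recip_def\<close>)
  next
    case 2
    have "((\<lambda>y. (exp_recip p y - exp_recip p 0) / (y - 0)) \<longlongrightarrow> 0) (at 0)"
    proof (rule filterlim_split_at_real)
      show "((\<lambda>y. (exp_recip p y - exp_recip p 0) / (y - 0)) \<longlongrightarrow> 0) (at_left 0)"
        by (rule tendsto_eventually) (auto simp: eventually_at_left_field exp_recip_def intro!: exI[of _ "-1"])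
      \<comment> \<open>Dividing by \<open>y\<close> multiplies the polynomial in
        \<open>1 / y\<close> by its variable, so the difference quotient at 0 is again of this form,
        with polynomial \<open>pCons 0 p\<close>.\<close>
      show "((\<lambda>y. (exp_recip p y - exp_recip p 0) / (y - 0)) \<longlongrightarrow> 0) (at_right 0)"
        by (rule Lim_transform_eventually[OF exp_recip_right_tendsto_0[of "pCons 0 p"]])
          (auto simp: eventually_at_right_field exp_recip_def intro!: exI[of _ 1])
    qed
    then show ?thesis using 2 by (simp add: has_field_derivative_iff exp_recip_def)
  next
    case 3
    have "((\<lambda>s. 0) has_real_derivative exp_recip (monom 1 2 * (p - pderiv p)) s) (at s)"
      using 3 by (auto simp: exp_recip_def)
    then show ?thesis
      by (rule has_field_derivative_transform_within_open[of _ _ _ "{..<0}"]) (use 3 in \<open>auto simp: exp_recip_def\<close>)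
  qed
qed

lemma smooth_on_exp_recip: "smooth_on UNIV (exp_recip p)"
proof -
  have "Ck_on k UNIV (exp_recip p)" for k
  proof (induction k arbitrary: p)
    case 0
    then show ?case using exp_recip_has_derivative DERIV_isCont continuous_at_imp_continuous_on by (metis Ck_on.simps(1))
  next
    case (Suc k)
    show ?case
    proof (rule Ck_on_SucI)
      show "(exp_recip p has_derivative (\<lambda>h. h * exp_recip (monom 1 2 * (p - pderiv p)) y)) (at y)" for y
        using exp_recip_has_derivative by (simp add: has_field_derivative_def mult.commute[of _ "exp_recip _ _"])
    qed (use Suc in \<open>auto intro!: Ck_on_bilinear[OF bounded_bilinear_mult] Ck_on_const\<close>)
  qed
  then show ?thesis by (simp add: smooth_on_def)
qed

text \<open>For positive \<open>k\<close> the parameter does not affect the support, a ball of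
  radius \<open>r\<close>, but as \<open>k\<close> grows the function increases to the indicator of
  the open ball. Fixed \<open>k\<close> serves for mollifiers and partitions of unity, growing
  \<open>k\<close> for recovering integrals over balls.\<close>

definition bump :: "real \<Rightarrow> 'a::euclidean_space \<Rightarrow> real \<Rightarrow> 'a \<Rightarrow> real" where
  "bump k x r y = exp_recip 1 (k * (r\<^sup>2 - (y - x) \<bullet> (y - x)))"

lemma smooth_on_bump: "smooth_on UNIV (bump k x r)"
proof -
  have "smooth_on UNIV (\<lambda>y. exp_recip 1 (k * (r\<^sup>2 - (y - x) \<bullet> (y - x))))"
    by (rule smooth_on_compose[of UNIV UNIV], simp, simp, simp)
      (intro smooth_on_mult smooth_on_diff smooth_on_inner open_UNIV smooth_on_const smooth_on_ident smooth_on_exp_recip)+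
  then show ?thesis by (simp add: bump_def[abs_def])
qed

lemma bump_nonneg: "0 \<le> bump k x r y" and bump_le_1: "bump k x r y \<le> 1"
  by (auto simp: bump_def exp_recip_def)

lemma bump_pos_iff:
  assumes "k > 0" "r > 0" shows "0 < bump k x r y \<longleftrightarrow> dist x y < r"
proof -
  have "(y - x) \<bullet> (y - x) = (dist x y)\<^sup>2" by (metis dist_commute dist_norm power2_norm_eq_inner)
  moreover have "(dist x y)\<^sup>2 < r\<^sup>2 \<longleftrightarrow> dist x y < r"
    using assms by (metis abs_le_square_iff abs_of_nonneg abs_of_pos linorder_not_le zero_le_dist)
  ultimately show ?thesis using assms by (auto simp: bump_def exp_recip_def mult_le_0_iff)
qed

lemma bump_support:
  assumes "k > 0" "r > 0" shows "closure {y. bump k x r y \<noteq> 0} = cball x r"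
proof -
  have "{y. bump k x r y \<noteq> 0} = ball x r"
    using bump_pos_iff[OF assms, of x] bump_nonneg[of k x r] by (auto simp: less_le)
  then show ?thesis using assms by simp
qed

lemma bump_tendsto:
  assumes "r > 0"
  shows "(\<lambda>k. bump (real (Suc k)) x r y) \<longlonglongrightarrow> indicator (ball x r) y"
proof (cases "dist x y < r")
  case True
  define s where "s = r\<^sup>2 - (y - x) \<bullet> (y - x)"
  have "s > 0" using bump_pos_iff[of 1 r x y] assms True by (auto simp: bump_def exp_recip_def s_def split: if_splits)
  then have "bump (real (Suc k)) x r y = exp (- (1 / s) * inverse (real (Suc k)))" for k
    by (auto simp: bump_def exp_recip_def s_def[symmetric] mult_le_0_iff divide_inverse)
  moreover have "(\<lambda>k. exp (- (1 / s) * inverse (real (Suc k)))) \<longlonglongrightarrow> exp (- (1/s) * 0)"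
    by (intro tendsto_intros LIMSEQ_inverse_real_of_nat)
  ultimately show ?thesis using True by simp
next
  case False
  then have "bump (real (Suc k)) x r y = 0" for k
    using bump_pos_iff[of "real (Suc k)" r x y] assms bump_nonneg[of "real (Suc k)" x r y] by auto
  with False show ?thesis by simp
qed

section \<open>Scalar curvature does not depend on the coordinates\<close>

lemma partial_eqI: "(f has_derivative f') (at y) \<Longrightarrow> partial i f y = f' (axis i 1)"
  by (simp add: partial_def frechet_derivative_eqI)

lemma partial_cong:
  assumes "open V" "y \<in> V" "\<And>z. z \<in> V \<Longrightarrow> f z = g z" "f differentiable (at y)"
  shows "partial i f y = partial i g y"
  unfolding partial_def using frechet_derivative_transform_within_open[OF assms(4,1,2)] assms(3) by metis

lemma partial_add:
  "f differentiable (at y) \<Longrightarrow> g differentiable (at y) \<Longrightarrow> partial i (\<lambda>y. f y + g y) y = partial i f y + partial i g y"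
  unfolding partial_def frechet_derivative_works
  by (subst frechet_derivative_eqI, rule has_derivative_add, assumption+) simp

lemma partial_linear:
  "bounded_linear h \<Longrightarrow> f differentiable (at y) \<Longrightarrow> partial i (\<lambda>y. h (f y)) y = h (partial i f y)"
  unfolding partial_def frechet_derivative_works
  by (subst frechet_derivative_eqI, rule bounded_linear.has_derivative, assumption+) simp

lemma partial_bilinear:
  "bounded_bilinear B \<Longrightarrow> f differentiable (at y) \<Longrightarrow> g differentiable (at y) \<Longrightarrow>
    partial i (\<lambda>y. B (f y) (g y)) y = B (partial i f y) (g y) + B (f y) (partial i g y)"
  unfolding partial_def frechet_derivative_works
  by (subst frechet_derivative_eqI, rule bounded_bilinear.FDERIV, assumption+) simp

lemmas partial_mult = partial_bilinear[OF bounded_bilinear_mult]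

lemma partial_sum:
  "(\<And>j. j \<in> I \<Longrightarrow> f j differentiable (at y)) \<Longrightarrow> partial i (\<lambda>y. \<Sum>j\<in>I. f j y) y = (\<Sum>j\<in>I. partial i (f j) y)"
  unfolding partial_def frechet_derivative_works
  by (subst frechet_derivative_eqI, rule has_derivative_sum, blast) simp

lemma derivative_eq_sum_partial:
  assumes "f differentiable (at y)"
  shows "frechet_derivative f (at y) v = (\<Sum>i\<in>UNIV. v $ i *\<^sub>R partial i f y)"
proof -
  interpret bounded_linear "frechet_derivative f (at y)"
    using assms frechet_derivative_works has_derivative_bounded_linear by blast
  have "v = (\<Sum>i\<in>UNIV. v $ i *\<^sub>R axis i 1)"
    using basis_expansion[of v] by (simp add: scalar_mult_eq_scaleR)
  then have "frechet_derivative f (at y) v = frechet_derivative f (at y) (\<Sum>i\<in>UNIV. v $ i *\<^sub>R axis i 1)" by simp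
  then show ?thesis by (simp only: sum scaleR partial_def)
qed

lemma partial_compose:
  fixes F :: "real^'n \<Rightarrow> real^'k"
  assumes "F differentiable (at y)" "g differentiable (at (F y))"
  shows "partial i (\<lambda>y. g (F y)) y = (\<Sum>a\<in>UNIV. partial i F y $ a *\<^sub>R partial a g (F y))"
proof -
  have "partial i (\<lambda>y. g (F y)) y = frechet_derivative g (at (F y)) (partial i F y)"
    using frechet_derivative_compose[OF assms] by (simp add: partial_def o_def)
  then show ?thesis by (simp add: derivative_eq_sum_partial[OF assms(2)])
qed

lemma partial_nth: "f differentiable (at y) \<Longrightarrow> partial i (\<lambda>y. f y $ a) y = partial i f y $ a"
  by (rule partial_linear[OF bounded_linear_vec_nth])

section \<open>Symmetry of second partial derivatives\<close>

lemma line_has_derivative: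
  fixes f :: "real^'n \<Rightarrow> real"
  assumes "f differentiable (at (z + s *\<^sub>R axis i 1))"
  shows "((\<lambda>s. f (z + s *\<^sub>R axis i 1)) has_real_derivative partial i f (z + s *\<^sub>R axis i 1)) (at s)"
proof -
  have "((\<lambda>s. z + s *\<^sub>R axis i 1) has_derivative (\<lambda>h. h *\<^sub>R axis i 1)) (at s)"
    by (auto intro!: derivative_eq_intros)
  from diff_chain_at[OF this assms[unfolded frechet_derivative_works]]
  have "((\<lambda>s. f (z + s *\<^sub>R axis i 1)) has_derivative (\<lambda>h. frechet_derivative f (at (z + s *\<^sub>R axis i 1)) (h *\<^sub>R axis i 1))) (at s)"
    by (simp add: o_def)
  moreover have "frechet_derivative f (at (z + s *\<^sub>R axis i 1)) (h *\<^sub>R axis i 1) = partial i f (z + s *\<^sub>R axis i 1) * h" for h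
    using linear_frechet_derivative[OF assms] by (simp add: partial_def linear_scale)
  ultimately show ?thesis by (simp add: has_field_derivative_def)
qed

text \<open>The mean value theorem in direction \<open>i\<close>, applied to the increment in
  direction \<open>j\<close>, and then once more in direction \<open>j\<close>. The bound
  \<open>2 * h < r\<close> keeps the whole square in the ball.\<close>

lemma second_difference:
  fixes f :: "real^'n \<Rightarrow> real"
  assumes "open V" "smooth_on V f" "ball y r \<subseteq> V" "0 < h" "2 * h < r"
  shows "\<exists>s t. 0 < s \<and> s < h \<and> 0 < t \<and> t < h \<and>
    f (y + h *\<^sub>R axis i 1 + h *\<^sub>R axis j 1) - f (y + h *\<^sub>R axis i 1) - f (y + h *\<^sub>R axis j 1) + f y
     = h\<^sup>2 * partial j (partial i f) (y + s *\<^sub>R axis i 1 + t *\<^sub>R axis j 1)"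
proof -
  have inV: "y + s *\<^sub>R axis i 1 + t *\<^sub>R axis j 1 \<in> V" if "0 \<le> s" "s \<le> h" "0 \<le> t" "t \<le> h" for s t
  proof -
    have "norm (s *\<^sub>R axis i 1 + t *\<^sub>R axis j 1 :: real^'n) \<le> \<bar>s\<bar> + \<bar>t\<bar>"
      using norm_triangle_ineq[of "s *\<^sub>R axis i 1 :: real^'n" "t *\<^sub>R axis j 1"] by simp
    then have "dist y (y + s *\<^sub>R axis i 1 + t *\<^sub>R axis j 1) < r"
    proof -
      have "dist y (y + s *\<^sub>R axis i 1 + t *\<^sub>R axis j 1) = norm (s *\<^sub>R axis i 1 + t *\<^sub>R axis j 1 :: real^'n)"
        by (metis add.assoc add_diff_cancel_left' dist_commute dist_norm)
      with \<open>norm _ \<le> _\<close> that assms(5) show ?thesis by simp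
    qed
    then show ?thesis using assms(3) by auto
  qed
  let ?\<phi> = "\<lambda>s. f ((y + h *\<^sub>R axis j 1) + s *\<^sub>R axis i 1) - f (y + s *\<^sub>R axis i 1)"
  let ?\<phi>' = "\<lambda>s. partial i f ((y + h *\<^sub>R axis j 1) + s *\<^sub>R axis i 1) - partial i f (y + s *\<^sub>R axis i 1)"
  have "(?\<phi> has_real_derivative ?\<phi>' s) (at s)" if "0 \<le> s" "s \<le> h" for s
    using inV[of s h] inV[of s 0] that assms(4)
    by (intro DERIV_diff line_has_derivative smooth_on_differentiable[OF assms(2)]) (auto simp: algebra_simps)
  from MVT2[OF assms(4) this] obtain s where s: "0 < s" "s < h" "?\<phi> h - ?\<phi> 0 = h * ?\<phi>' s" by auto
  let ?\<psi> = "\<lambda>t. partial i f ((y + s *\<^sub>R axis i 1) + t *\<^sub>R axis j 1)"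
  have "(?\<psi> has_real_derivative partial j (partial i f) ((y + s *\<^sub>R axis i 1) + t *\<^sub>R axis j 1)) (at t)"
    if "0 \<le> t" "t \<le> h" for t
    using inV[of s t] that s
    by (intro line_has_derivative smooth_on_differentiable[OF smooth_on_partial[OF assms(1,2)]]) auto
  from MVT2[OF assms(4) this] obtain t where t: "0 < t" "t < h"
    "?\<psi> h - ?\<psi> 0 = h * partial j (partial i f) ((y + s *\<^sub>R axis i 1) + t *\<^sub>R axis j 1)" by auto
  have "?\<phi>' s = ?\<psi> h - ?\<psi> 0" by (simp add: algebra_simps)
  then have "?\<phi> h - ?\<phi> 0 = h\<^sup>2 * partial j (partial i f) (y + s *\<^sub>R axis i 1 + t *\<^sub>R axis j 1)"
    using s(3) t(3) by (simp add: power2_eq_square)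
  with s t show ?thesis by (intro exI[of _ s] exI[of _ t]) (auto simp: algebra_simps)
qed

text \<open>The second difference quotient is symmetric in the two directions and converges to
  either mixed derivative, by continuity of the latter.\<close>

lemma partial_commute_real:
  fixes f :: "real^'n \<Rightarrow> real"
  assumes V: "open V" "y \<in> V" and f: "smooth_on V f"
  shows "partial i (partial j f) y = partial j (partial i f) y"
proof -
  obtain r where r: "r > 0" "ball y r \<subseteq> V" using V open_contains_ball by blast
  define D where "D i j = partial j (partial i f)" for i j
  have cont: "isCont (D i j) y" for i j
    using smooth_on_continuous[OF smooth_on_partial[OF V(1) smooth_on_partial[OF V(1) f]]] V
    unfolding D_def by (metis continuous_on_eq_continuous_at)
  \<comment> \<open>With the factor 3, \<open>2 * h k < r\<close> holds already for k = 0, as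
    \<open>second_difference\<close> requires.\<close>
  define h where "h k = r / (3 * real (Suc k))" for k
  have h: "0 < h k" "2 * h k < r" for k
  proof -
    show "0 < h k" using r by (simp add: h_def)
    have "h k \<le> r / 3" unfolding h_def using r by (intro frac_le) auto
    then show "2 * h k < r" using r by linarith
  qed
  have "(\<lambda>k. (r / 3) * inverse (real (Suc k))) \<longlonglongrightarrow> (r/3) * 0"
    by (rule tendsto_mult[OF tendsto_const LIMSEQ_inverse_real_of_nat])
  moreover have "h = (\<lambda>k. (r / 3) * inverse (real (Suc k)))" by (rule ext) (simp only: h_def divide_inverse inverse_mult_distrib mult.assoc)
  ultimately have h0: "h \<longlonglongrightarrow> 0" by simp
  define Q where "Q k = (f (y + h k *\<^sub>R axis i 1 + h k *\<^sub>R axis j 1) - f (y + h k *\<^sub>R axis i 1)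
       - f (y + h k *\<^sub>R axis j 1) + f y) / (h k)\<^sup>2" for k
  \<comment> \<open>Stated for any sequence given by this formula, so that it can be used a second
    time with \<open>i\<close> and \<open>j\<close> exchanged.\<close>
  have *: "X \<longlonglongrightarrow> D i j y"
    if X: "\<And>k. X k = (f (y + h k *\<^sub>R axis i 1 + h k *\<^sub>R axis j 1) - f (y + h k *\<^sub>R axis i 1)
       - f (y + h k *\<^sub>R axis j 1) + f y) / (h k)\<^sup>2" for X i j
  proof -
    have "\<forall>k. \<exists>s t. 0 < s \<and> s < h k \<and> 0 < t \<and> t < h k \<and> X k = D i j (y + s *\<^sub>R axis i 1 + t *\<^sub>R axis j 1)"
    proof
      fix k
      obtain s t where "0 < s" "s < h k" "0 < t" "t < h k" "f (y + h k *\<^sub>R axis i 1 + h k *\<^sub>R axis j 1) - f (y + h k *\<^sub>R axis i 1)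
       - f (y + h k *\<^sub>R axis j 1) + f y = (h k)\<^sup>2 * D i j (y + s *\<^sub>R axis i 1 + t *\<^sub>R axis j 1)"
        using second_difference[OF V(1) f r(2) h(1)[of k] h(2)[of k], of i j] unfolding D_def by blast
      with h(1)[of k] show "\<exists>s t. 0 < s \<and> s < h k \<and> 0 < t \<and> t < h k \<and> X k = D i j (y + s *\<^sub>R axis i 1 + t *\<^sub>R axis j 1)"
        unfolding X by (intro exI[of _ s] exI[of _ t]) auto
    qed
    then obtain s t where st: "\<And>k. 0 < s k \<and> s k < h k \<and> 0 < t k \<and> t k < h k \<and>
        X k = D i j (y + s k *\<^sub>R axis i 1 + t k *\<^sub>R axis j 1)" by metis
    have "s \<longlonglongrightarrow> 0" "t \<longlonglongrightarrow> 0"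
      by (rule tendsto_sandwich[OF _ _ tendsto_const h0]; rule always_eventually; use st less_imp_le in blast)+
    then have "(\<lambda>k. y + s k *\<^sub>R axis i 1 + t k *\<^sub>R axis j 1) \<longlonglongrightarrow> y + 0 *\<^sub>R axis i 1 + 0 *\<^sub>R axis j 1"
      by (intro tendsto_intros)
    then have "(\<lambda>k. D i j (y + s k *\<^sub>R axis i 1 + t k *\<^sub>R axis j 1)) \<longlonglongrightarrow> D i j y"
      using cont isCont_tendsto_compose by fastforce
    moreover have "X = (\<lambda>k. D i j (y + s k *\<^sub>R axis i 1 + t k *\<^sub>R axis j 1))" using st by auto
    ultimately show ?thesis by simp
  qed
  have "Q \<longlonglongrightarrow> D i j y" by (rule *) (simp add: Q_def)
  moreover have "Q \<longlonglongrightarrow> D j i y" by (rule *) (simp add: Q_def algebra_simps)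
  ultimately show ?thesis unfolding D_def using LIMSEQ_unique by blast
qed

lemma partial_commute:
  fixes f :: "real^'n \<Rightarrow> real^'k"
  assumes V: "open V" "y \<in> V" and f: "smooth_on V f"
  shows "partial i (partial j f) y = partial j (partial i f) y"
proof -
  have "partial i (partial j f) y $ a = partial i (partial j (\<lambda>y. f y $ a)) y" for a i j
  proof -
    have "partial i (partial j f) y $ a = partial i (\<lambda>y. partial j f y $ a) y"
      using partial_nth[OF smooth_on_differentiable[OF smooth_on_partial[OF V(1) f] V(2)]] by simp
    also have "\<dots> = partial i (partial j (\<lambda>y. f y $ a)) y"
      by (rule partial_cong[OF V]) (use V in \<open>auto simp: partial_nth smooth_on_differentiable[OF f]
         intro: smooth_on_differentiable[OF smooth_on_vec_nth[OF V(1) smooth_on_partial[OF V(1) f]]]\<close>)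
    finally show ?thesis .
  qed
  then show ?thesis
    using partial_commute_real[OF V smooth_on_vec_nth[OF V(1) f]] by (simp add: vec_eq_iff)
qed

section \<open>Connection and curvature as matrices\<close>

lemma bounded_bilinear_matrix_mult: "bounded_bilinear (\<lambda>(A::real^'n^'k) (B::real^'m^'n). A ** B)"
  unfolding bilinear_conv_bounded_bilinear[symmetric] bilinear_def
  by (auto intro!: linearI simp: vec_eq_iff matrix_matrix_mult_def algebra_simps sum.distrib sum_distrib_left)

lemma bounded_bilinear_matrix_vector_mult: "bounded_bilinear (\<lambda>(A::real^'n^'k) (v::real^'n). A *v v)"
  unfolding bilinear_conv_bounded_bilinear[symmetric] bilinear_def
  by (auto intro!: linearI simp: vec_eq_iff matrix_vector_mult_def algebra_simps sum.distrib sum_distrib_left)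

lemmas matmul_simps =
  bounded_bilinear.add_left[OF bounded_bilinear_matrix_mult] bounded_bilinear.add_right[OF bounded_bilinear_matrix_mult]
  bounded_bilinear.diff_left[OF bounded_bilinear_matrix_mult] bounded_bilinear.diff_right[OF bounded_bilinear_matrix_mult]

lemmas matmul_sum =
  bounded_bilinear.sum_left[OF bounded_bilinear_matrix_mult] bounded_bilinear.sum_right[OF bounded_bilinear_matrix_mult]
  bounded_bilinear.scaleR_left[OF bounded_bilinear_matrix_mult] bounded_bilinear.scaleR_right[OF bounded_bilinear_matrix_mult]

lemma matrix_inv_mult:
  fixes A :: "real^'n^'n" assumes "det A \<noteq> 0"
  shows "A ** matrix_inv A = mat 1" "matrix_inv A ** A = mat 1"
  using assms unfolding invertible_det_nz[symmetric] matrix_inv_def invertible_def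
  by (metis (mono_tags, lifting) someI_ex)+

definition christoffel_matrix :: "(real^'n \<Rightarrow> real^'n^'n) \<Rightarrow> 'n \<Rightarrow> real^'n \<Rightarrow> real^'n^'n" where
  "christoffel_matrix G i y = (\<chi> k j. christoffel G k i j y)"

text \<open>With the Christoffel symbols collected into matrices this is the curvature endomorphism
  of two coordinate vectors: exterior derivative of the connection form plus commutator. In this
  form a change of coordinates acts like a change of gauge.\<close>

definition curvature_matrix :: "(real^'n \<Rightarrow> real^'n^'n) \<Rightarrow> 'n \<Rightarrow> 'n \<Rightarrow> real^'n \<Rightarrow> real^'n^'n" where
  "curvature_matrix G i j y = partial i (christoffel_matrix G j) y - partial j (christoffel_matrix G i) y
     + (christoffel_matrix G i y ** christoffel_matrix G j y - christoffel_matrix G j y ** christoffel_matrix G i y)"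

lemma jacobian_eq_partial: "matrix (frechet_derivative F (at y)) = (\<chi> a i. partial i F y $ a)"
  by (simp add: matrix_def partial_def)

locale metric_coords =
  fixes V :: "(real^'n) set" and G :: "real^'n \<Rightarrow> real^'n^'n"
  assumes openV: "open V" and smoothG: "smooth_on V G"
    and sym: "y \<in> V \<Longrightarrow> transpose (G y) = G y" and det: "y \<in> V \<Longrightarrow> det (G y) \<noteq> 0"
begin

lemma symc: "y \<in> V \<Longrightarrow> G y $ i $ j = G y $ j $ i"
  using arg_cong[OF sym, of y "\<lambda>A. A $ j $ i"] by (simp add: transpose_def)

lemma smoothGc: "smooth_on V (\<lambda>y. G y $ i $ j)"
  by (intro smooth_on_vec_nth openV smoothG)

lemma partial_symc: assumes y: "y \<in> V"
  shows "partial k (\<lambda>y. G y $ i $ j) y = partial k (\<lambda>y. G y $ j $ i) y"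
  by (rule partial_cong[OF openV y symc]) (auto intro: smooth_on_differentiable[OF smoothGc y])

lemma christoffel_sym: assumes y: "y \<in> V" shows "christoffel G k i j y = christoffel G k j i y"
  unfolding christoffel_def partial_symc[OF y, of _ i j] by (rule arg_cong[where f="(*) _"], rule sum.cong) (auto simp: algebra_simps)

lemma smooth_christoffel: "smooth_on V (christoffel G k i j)"
  unfolding christoffel_def[abs_def]
  by (intro smooth_on_mult smooth_on_sum smooth_on_const openV smooth_on_matrix_inv smoothGc det
      smooth_on_diff smooth_on_add smooth_on_partial)

lemma smooth_christoffel_matrix: "smooth_on V (christoffel_matrix G i)"
  by (intro smooth_on_vec openV) (simp add: christoffel_matrix_def smooth_christoffel)

text \<open>Multiplication by the metric removes the inverse matrix and leaves Christoffel symbols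
  of the first kind, whose transformation is easier to follow.\<close>

lemma christoffel_lower:
  assumes y: "y \<in> V"
  shows "(G y ** christoffel_matrix G i y) $ l $ j = (1/2) * (partial i (\<lambda>y. G y $ j $ l) y
     + partial j (\<lambda>y. G y $ i $ l) y - partial l (\<lambda>y. G y $ i $ j) y)"
proof -
  define c where "c = (\<chi> l. (1/2) * (partial i (\<lambda>y. G y $ j $ l) y
     + partial j (\<lambda>y. G y $ i $ l) y - partial l (\<lambda>y. G y $ i $ j) y))"
  have "column j (christoffel_matrix G i y) = matrix_inv (G y) *v c"
    by (simp add: vec_eq_iff column_def christoffel_matrix_def christoffel_def c_def matrix_vector_mult_def
        sum_distrib_left mult_ac)
  then have "G y *v column j (christoffel_matrix G i y) = c"
    using det[OF y] by (simp add: matrix_vector_mul_assoc matrix_inv_mult)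
  moreover have "(G y *v column j (christoffel_matrix G i y)) $ l = (G y ** christoffel_matrix G i y) $ l $ j"
    by (simp add: matrix_vector_mult_def matrix_matrix_mult_def column_def)
  ultimately show ?thesis by (simp add: c_def)
qed

lemma partial_christoffel_nth:
  assumes y: "y \<in> V"
  shows "partial m (christoffel G k i j) y = partial m (christoffel_matrix G i) y $ k $ j"
proof -
  have d: "christoffel_matrix G i differentiable (at y)"
    by (rule smooth_on_differentiable[OF smooth_christoffel_matrix y])
  have "partial m (\<lambda>y. christoffel_matrix G i y $ k $ j) y = partial m (christoffel_matrix G i) y $ k $ j"
    using partial_linear[OF bounded_linear_compose[OF bounded_linear_vec_nth[of j] bounded_linear_vec_nth[of k]] d]
    by (simp add: o_def)
  then show ?thesis by (simp add: christoffel_matrix_def)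
qed

text \<open>Ricci as a trace of the curvature. The index order in \<open>ricci\<close> differs from
  that of the matrices; the symmetry of the Christoffel symbols, also under a derivative, reconciles
  them.\<close>

lemma ricci_eq:
  assumes y: "y \<in> V" shows "ricci G i j y = (\<Sum>k\<in>UNIV. curvature_matrix G k j y $ k $ i)"
proof -
  have "partial k (christoffel G k i j) y = partial k (christoffel G k j i) y" for k
    by (rule partial_cong[OF openV y christoffel_sym smooth_on_differentiable[OF smooth_christoffel y]])
  moreover have "partial j (christoffel G k i k) y = partial j (christoffel G k k i) y" for k
    by (rule partial_cong[OF openV y christoffel_sym smooth_on_differentiable[OF smooth_christoffel y]])
  ultimately show ?thesis
    unfolding ricci_def curvature_matrix_def
    by (simp add: partial_christoffel_nth[OF y] matrix_matrix_mult_def christoffel_matrix_def[of _ _ y]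
        christoffel_sym[OF y, of _ i] sum_subtractf)
qed

end


section \<open>Transformation of connection and curvature under a change of coordinates\<close>

lemma smooth_on_matrix_mult:
  fixes A :: "'a::euclidean_space \<Rightarrow> real^'n^'k" and B :: "'a \<Rightarrow> real^'m^'n"
  shows "open U \<Longrightarrow> smooth_on U A \<Longrightarrow> smooth_on U B \<Longrightarrow> smooth_on U (\<lambda>y. A y ** B y)"
  by (rule smooth_on_bilinear[OF bounded_bilinear_matrix_mult])

lemma bounded_linear_transpose: "bounded_linear (transpose :: real^'n^'m \<Rightarrow> _)"
  by (intro linear_conv_bounded_linear[THEN iffD1] linearI) (auto simp: transpose_def vec_eq_iff)

text \<open>\<open>G'\<close> is the pullback of \<open>G\<close> under the coordinate change
  \<open>F\<close> with Jacobian \<open>M\<close>. Transition maps between charts are the main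
  instance; the identity map is another.\<close>

locale metric_change =
  fixes V :: "(real^'n) set" and G and U :: "(real^'n) set" and F :: "real^'n \<Rightarrow> real^'n" and G' and M
  assumes G: "metric_coords V G"
    and openU: "open U" and FU: "F ` U \<subseteq> V" and smoothF: "smooth_on U F"
    and M: "M = (\<lambda>y. matrix (frechet_derivative F (at y)))"
    and detM: "y \<in> U \<Longrightarrow> det (M y) \<noteq> 0"
    and G'_eq: "y \<in> U \<Longrightarrow> G' y = transpose (M y) ** G (F y) ** M y"
begin

interpretation G: metric_coords V G by (rule G)

lemma F_in: "y \<in> U \<Longrightarrow> F y \<in> V" using FU by auto

lemma M_eq: "M = (\<lambda>y. \<chi> a i. partial i F y $ a)" by (simp add: M jacobian_eq_partial fun_eq_iff)

lemma M_nth: "M y $ a $ i = partial i F y $ a" by (simp add: M_eq)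

lemma smoothM: "smooth_on U M"
  by (intro smooth_on_vec openU) (simp add: M_nth smooth_on_vec_nth[OF openU smooth_on_partial[OF openU smoothF]])

lemma smoothGF: "smooth_on U (\<lambda>y. G (F y))"
  by (rule smooth_on_compose[OF openU G.openV FU smoothF G.smoothG])

lemma G': "metric_coords U G'"
proof
  have "smooth_on U (\<lambda>y. transpose (M y) ** G (F y) ** M y)"
    by (intro smooth_on_matrix_mult openU smooth_on_linear_compose[OF bounded_linear_transpose] smoothM smoothGF)
  then show "smooth_on U G'"
    using smooth_on_cong[OF openU, of G' "\<lambda>y. transpose (M y) ** G (F y) ** M y"] G'_eq by simp
  fix y assume y: "y \<in> U"
  show "transpose (G' y) = G' y"
    by (simp add: G'_eq[OF y] matrix_transpose_mul G.sym[OF F_in[OF y]] matrix_mul_assoc)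
  show "det (G' y) \<noteq> 0"
    using detM[OF y] G.det[OF F_in[OF y]] by (simp add: G'_eq[OF y] det_mul)
qed (rule openU)

interpretation G': metric_coords U G' by (rule G')

lemma partial_M_nth: assumes y: "y \<in> U" shows "partial i M y $ a $ j = partial i (partial j F) y $ a"
proof -
  have "partial i M y $ a $ j = partial i (\<lambda>y. M y $ a $ j) y"
    using partial_linear[OF bounded_linear_compose[OF bounded_linear_vec_nth[of j] bounded_linear_vec_nth[of a]]
        smooth_on_differentiable[OF smoothM y]] by (simp add: o_def)
  then show ?thesis
    by (simp add: M_nth partial_nth[OF smooth_on_differentiable[OF smooth_on_partial[OF openU smoothF] y]])
qed

text \<open>Derivatives of a Jacobian are second derivatives of \<open>F\<close>. This symmetry
  removes the non-tensorial terms below.\<close>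

lemma partial_M_commute: "y \<in> U \<Longrightarrow> partial i M y $ a $ j = partial j M y $ a $ i"
  by (simp add: partial_M_nth partial_commute[OF openU _ smoothF])

text \<open>The pullback of the connection form of \<open>G\<close> under \<open>F\<close>.\<close>

definition A :: "'n \<Rightarrow> real^'n \<Rightarrow> real^'n^'n" where
  "A i y = (\<Sum>b\<in>UNIV. M y $ b $ i *\<^sub>R christoffel_matrix G b (F y))"

text \<open>Every entry of \<open>G'\<close> is an inner product
  \<open>m j \<bullet> (G (F y) *v m l)\<close> of columns of \<open>M\<close>; in its derivative
  \<open>h\<close> comes from the columns and \<open>P\<close> from the metric along
  \<open>F\<close>.\<close>

lemma partial_G'_nth:
  assumes y: "y \<in> U"
  defines "P \<equiv> \<lambda>i. \<Sum>c\<in>UNIV. M y $ c $ i *\<^sub>R partial c G (F y)"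
  defines "m \<equiv> \<lambda>j. column j (M y)" and "h \<equiv> \<lambda>i j. column j (partial i M y)"
  shows "partial i (\<lambda>y. G' y $ j $ l) y = h i j \<bullet> (G (F y) *v m l) + m j \<bullet> (G (F y) *v h i l) + m j \<bullet> (P i *v m l)"
proof -
  have d: "M differentiable (at y)" "(\<lambda>y. G (F y)) differentiable (at y)"
    using smooth_on_differentiable[OF smoothM y] smooth_on_differentiable[OF smoothGF y] by auto
  have bl: "bounded_linear (\<lambda>A::real^'n^'n. column k A)" for k
    by (intro linear_conv_bounded_linear[THEN iffD1] linearI) (auto simp: column_def vec_eq_iff)
  have bv: "bounded_bilinear (\<lambda>(A::real^'n^'n) (v::real^'n). A *v v)" by (rule bounded_bilinear_matrix_vector_mult)
  have dc: "(\<lambda>y. column k (M y)) differentiable (at y)" for k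
    using differentiable_compose[OF bounded_linear_imp_differentiable[OF bl] d(1)] .
  have dv: "(\<lambda>y. G (F y) *v column k (M y)) differentiable (at y)" for k
    using smooth_on_differentiable[OF smooth_on_bilinear[OF bv openU smoothGF smooth_on_linear_compose[OF bl openU smoothM]] y] .
  have pGF: "partial i (\<lambda>y. G (F y)) y = P i"
    using partial_compose[OF smooth_on_differentiable[OF smoothF y] smooth_on_differentiable[OF G.smoothG F_in[OF y]]]
    by (simp add: P_def M_nth)
  have "G' y $ j $ l = column j (M y) \<bullet> (G (F y) *v column l (M y))" if "y \<in> U" for y
    using G'_eq[OF that] by (simp add: transpose_def matrix_matrix_mult_def matrix_vector_mult_def column_def inner_vec_def
      sum_distrib_left sum_distrib_right mult_ac) (subst sum.swap, intro sum.cong refl, simp)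
  then have "partial i (\<lambda>y. G' y $ j $ l) y = partial i (\<lambda>y. column j (M y) \<bullet> (G (F y) *v column l (M y))) y"
    by (intro partial_cong[OF openU y] smooth_on_differentiable[OF G'.smoothGc y])
  also have "\<dots> = partial i (\<lambda>y. column j (M y)) y \<bullet> (G (F y) *v m l) + m j \<bullet> partial i (\<lambda>y. G (F y) *v column l (M y)) y"
    unfolding m_def by (rule partial_bilinear[OF bounded_bilinear_inner dc dv])
  also have "partial i (\<lambda>y. G (F y) *v column l (M y)) y = P i *v m l + G (F y) *v partial i (\<lambda>y. column l (M y)) y"
    unfolding m_def by (subst partial_bilinear[OF bv d(2) dc]) (simp add: pGF)
  finally show ?thesis
    by (simp add: partial_linear[OF bl d(1)] h_def inner_right_distrib)
qed

lemma lower_A: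
  assumes y: "y \<in> U"
  defines "P \<equiv> \<lambda>i. \<Sum>c\<in>UNIV. M y $ c $ i *\<^sub>R partial c G (F y)"
  defines "m \<equiv> \<lambda>j. column j (M y)"
  shows "m l \<bullet> ((G (F y) ** A i y) *v m j) = (1/2) * (m j \<bullet> (P i *v m l) + m i \<bullet> (P j *v m l) - m i \<bullet> (P l *v m j))"
proof -
  define d where "d b q p = partial b (\<lambda>y. G y $ q $ p) (F y)" for b q p
  \<comment> \<open>The derivative of the metric in direction \<open>u\<close>, evaluated on
    \<open>v\<close> and \<open>w\<close>. The three terms of the Koszul formula differ only in the
    order of these arguments.\<close>
  define T where "T u v w = (\<Sum>b\<in>UNIV. \<Sum>q\<in>UNIV. \<Sum>p\<in>UNIV. u $ b * v $ q * w $ p * d b q p)" for u v w :: "real^'n"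
  have Gnth: "partial b G (F y) $ q $ p = d b q p" for b q p
    using partial_linear[OF bounded_linear_compose[OF bounded_linear_vec_nth[of p] bounded_linear_vec_nth[of q]]
        smooth_on_differentiable[OF G.smoothG F_in[OF y]]] by (simp add: o_def d_def)
  have PT: "v \<bullet> (P i *v w) = T (m i) v w" for v w i
  proof -
    have "v \<bullet> (P i *v w) = (\<Sum>q\<in>UNIV. \<Sum>p\<in>UNIV. \<Sum>b\<in>UNIV. m i $ b * v $ q * w $ p * d b q p)"
      by (simp add: P_def m_def inner_vec_def matrix_vector_mult_def Gnth column_def sum_distrib_left sum_distrib_right mult_ac)
    also have "\<dots> = T (m i) v w"
      unfolding T_def by (subst (2) sum.swap, subst sum.swap, rule refl)
    finally show ?thesis .
  qed
  have l: "(G (F y) ** christoffel_matrix G b (F y)) $ p $ q = (1/2) * (d b q p + d q b p - d p b q)" for b p q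
    by (simp add: G.christoffel_lower[OF F_in[OF y]] d_def)
  have "m l \<bullet> ((G (F y) ** A i y) *v m j)
     = (\<Sum>p\<in>UNIV. \<Sum>q\<in>UNIV. \<Sum>b\<in>UNIV. (1/2) * (m i $ b * m j $ q * m l $ p * (d b q p + d q b p - d p b q)))"
    by (simp add: A_def matmul_sum inner_vec_def matrix_vector_mult_def l column_def m_def sum_distrib_left sum_distrib_right mult_ac)
  also have "\<dots> = (\<Sum>b\<in>UNIV. \<Sum>q\<in>UNIV. \<Sum>p\<in>UNIV. (1/2) * (m i $ b * m j $ q * m l $ p * (d b q p + d q b p - d p b q)))"
    by (subst (2) sum.swap, subst sum.swap, subst (2) sum.swap, rule refl)
  also have "\<dots> = (1/2) * (T (m i) (m j) (m l) + (\<Sum>b\<in>UNIV. \<Sum>q\<in>UNIV. \<Sum>p\<in>UNIV. m i $ b * m j $ q * m l $ p * d q b p)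
       - (\<Sum>b\<in>UNIV. \<Sum>q\<in>UNIV. \<Sum>p\<in>UNIV. m i $ b * m j $ q * m l $ p * d p b q))"
    unfolding T_def by (simp only: distrib_left right_diff_distrib sum.distrib sum_subtractf sum_distrib_left)
  also have "(\<Sum>b\<in>UNIV. \<Sum>q\<in>UNIV. \<Sum>p\<in>UNIV. m i $ b * m j $ q * m l $ p * d q b p) = T (m j) (m i) (m l)"
    unfolding T_def by (subst sum.swap) (simp add: mult_ac)
  also have "(\<Sum>b\<in>UNIV. \<Sum>q\<in>UNIV. \<Sum>p\<in>UNIV. m i $ b * m j $ q * m l $ p * d p b q) = T (m l) (m i) (m j)"
    unfolding T_def by (subst (2) sum.swap, subst sum.swap) (simp add: mult_ac)
  finally show ?thesis by (simp add: PT)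
qed

text \<open>The inhomogeneous transformation law of a connection. Both sides are compared after
  multiplication by the invertible matrix \<open>transpose (M y) ** G (F y)\<close>, which turns the
  right-hand side into Christoffel symbols of the first kind of \<open>G'\<close>.\<close>

lemma christoffel_change:
  assumes y: "y \<in> U"
  shows "partial i M y + A i y ** M y = M y ** christoffel_matrix G' i y"
proof -
  define P where "P i = (\<Sum>c\<in>UNIV. M y $ c $ i *\<^sub>R partial c G (F y))" for i
  define m where "m j = column j (M y)" for j
  define h where "h i j = column j (partial i M y)" for i j
  have hs: "h i j = h j i" for i j
    using partial_M_commute[OF y] by (simp add: h_def column_def)
  let ?X = "transpose (M y) ** G (F y)"
  have gs: "v \<bullet> (G (F y) *v w) = w \<bullet> (G (F y) *v v)" for v w
    by (metis G.sym F_in y dot_lmul_matrix inner_commute transpose_matrix_vector)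
  have "(?X ** (partial i M y + A i y ** M y)) $ l $ j = (G' y ** christoffel_matrix G' i y) $ l $ j" for l j
  proof -
    have "(?X ** (partial i M y + A i y ** M y)) $ l $ j = (?X *v column j (partial i M y + A i y ** M y)) $ l"
      by (simp add: matrix_vector_mult_def matrix_matrix_mult_def column_def)
    also have "column j (partial i M y + A i y ** M y) = h i j + A i y *v m j"
      by (simp add: vec_eq_iff h_def m_def column_def matrix_vector_mult_def matrix_matrix_mult_def)
    also have "(?X *v (h i j + A i y *v m j)) $ l = m l \<bullet> (G (F y) *v (h i j + A i y *v m j))"
    proof -
      have "(transpose (M y) *v x) $ l = m l \<bullet> x" for x
        by (simp only: m_def matrix_vector_mult_def transpose_def column_def inner_vec_def vec_lambda_beta inner_real_def)
      then show ?thesis by (simp only: matrix_vector_mul_assoc[symmetric])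
    qed
    also have "\<dots> = m l \<bullet> (G (F y) *v h i j) + m l \<bullet> ((G (F y) ** A i y) *v m j)"
      by (simp add: matrix_vector_right_distrib inner_add_right matrix_vector_mul_assoc)
    \<comment> \<open>The Koszul formula for \<open>G'\<close> contains six terms with
      \<open>h\<close>. Since \<open>h\<close> and the metric are symmetric, four of them cancel and
      the other two are equal.\<close>
    also have "\<dots> = (G' y ** christoffel_matrix G' i y) $ l $ j"
      using gs[of "m l" "h i j"] gs[of "m j" "h i l"] gs[of "m i" "h j l"] hs[of j i] hs[of l j] hs[of l i]
      by (simp add: G'.christoffel_lower[OF y] partial_G'_nth[OF y, folded P_def m_def h_def]
          lower_A[OF y, folded P_def m_def] field_simps)
    finally show ?thesis .
  qed
  then have "?X ** (partial i M y + A i y ** M y) = ?X ** (M y ** christoffel_matrix G' i y)"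
    by (simp add: vec_eq_iff G'_eq[OF y] matrix_mul_assoc)
  moreover have "det ?X \<noteq> 0" using detM[OF y] G.det[OF F_in[OF y]] by (simp add: det_mul)
  ultimately show ?thesis
    by (metis matrix_inv_mult(2) matrix_mul_assoc matrix_mul_lid)
qed

text \<open>Differentiating the transformation law of the connection and antisymmetrizing in
  \<open>i\<close>, \<open>j\<close> removes the second derivatives of \<open>M\<close>; what is
  left is tensorial.\<close>

lemma curvature_change:
  assumes y: "y \<in> U"
  shows "M y ** curvature_matrix G' i j y =
    (\<Sum>c\<in>UNIV. \<Sum>b\<in>UNIV. (M y $ c $ i * M y $ b $ j) *\<^sub>R curvature_matrix G c b (F y)) ** M y"
proof -
  let ?C = "\<lambda>b. christoffel_matrix G b (F y)" and ?C' = "\<lambda>i. christoffel_matrix G' i y"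
  let ?dC = "\<lambda>c b. partial c (christoffel_matrix G b) (F y)"
  have smA: "smooth_on U (A j)" for j
    unfolding A_def[abs_def]
    by (intro smooth_on_sum smooth_on_scaleR openU smooth_on_compose[OF openU G.openV FU smoothF G.smooth_christoffel_matrix]
        smooth_on_vec_nth smoothM)
  have dM: "M differentiable (at y)" and dA: "A j differentiable (at y)"
    and dC: "christoffel_matrix G' j differentiable (at y)"
    and dCF: "christoffel_matrix G j differentiable (at (F y))"
    and dCF': "(\<lambda>y. christoffel_matrix G j (F y)) differentiable (at y)"
    and dMc: "(\<lambda>y. M y $ b $ j) differentiable (at y)" for j b
    by (intro smooth_on_differentiable[OF smoothM y] smooth_on_differentiable[OF smA y]
        smooth_on_differentiable[OF G'.smooth_christoffel_matrix y]
        smooth_on_differentiable[OF G.smooth_christoffel_matrix F_in[OF y]]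
        smooth_on_differentiable[OF smooth_on_compose[OF openU G.openV FU smoothF G.smooth_christoffel_matrix] y]
        smooth_on_differentiable[OF smooth_on_vec_nth[OF openU smooth_on_vec_nth[OF openU smoothM]] y])+
  have pM: "partial i M y = M y ** ?C' i - A i y ** M y" for i
    using christoffel_change[OF y, of i] by (simp add: algebra_simps)
  have smpM: "smooth_on U (partial j M)" for j by (intro smooth_on_partial openU smoothM)
  have MM: "partial i (partial j M) y = partial j (partial i M) y"
  proof -
    have "partial i (partial j M) y $ a $ b = partial i (partial j (\<lambda>y. M y $ a $ b)) y" for i j a b
    proof -
      have bl: "bounded_linear (\<lambda>A::real^'n^'n. A $ a $ b)"
        by (rule bounded_linear_compose[OF bounded_linear_vec_nth bounded_linear_vec_nth])
      have "partial i (partial j M) y $ a $ b = partial i (\<lambda>y. partial j M y $ a $ b) y"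
        using partial_linear[OF bl smooth_on_differentiable[OF smpM y]] by simp
      also have "\<dots> = partial i (partial j (\<lambda>y. M y $ a $ b)) y"
      proof (rule partial_cong[OF openU y])
        show "partial j M z $ a $ b = partial j (\<lambda>y. M y $ a $ b) z" if "z \<in> U" for z
          using partial_linear[OF bl smooth_on_differentiable[OF smoothM that]] by simp
        show "(\<lambda>y. partial j M y $ a $ b) differentiable at y"
          by (rule smooth_on_differentiable[OF smooth_on_vec_nth[OF openU smooth_on_vec_nth[OF openU smpM]] y])
      qed
      finally show ?thesis .
    qed
    then show ?thesis
      using partial_commute_real[OF openU y smooth_on_vec_nth[OF openU smooth_on_vec_nth[OF openU smoothM]]]
      by (simp add: vec_eq_iff)
  qed
  have dd: "partial i M y ** ?C' j + M y ** partial i (christoffel_matrix G' j) y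
      = partial i (partial j M) y + (partial i (A j) y ** M y + A j y ** partial i M y)" for i j
  proof -
    have "partial i (\<lambda>y. M y ** christoffel_matrix G' j y) y = partial i (\<lambda>y. partial j M y + A j y ** M y) y"
      by (rule partial_cong[OF openU y]) (auto simp: christoffel_change
         intro: smooth_on_differentiable[OF smooth_on_matrix_mult[OF openU smoothM G'.smooth_christoffel_matrix] y])
    also have "\<dots> = partial i (partial j M) y + partial i (\<lambda>y. A j y ** M y) y"
      by (intro partial_add smooth_on_differentiable[OF smpM y] smooth_on_differentiable[OF smooth_on_matrix_mult[OF openU smA smoothM] y])
    also have "partial i (\<lambda>y. A j y ** M y) y = partial i (A j) y ** M y + A j y ** partial i M y"
      by (rule partial_bilinear[OF bounded_bilinear_matrix_mult dA dM])
    finally show ?thesis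
      by (simp add: partial_bilinear[OF bounded_bilinear_matrix_mult dM dC])
  qed
  \<comment> \<open>The two instances of \<open>dd\<close> are subtracted. By \<open>MM\<close> the
    second derivatives of \<open>M\<close> cancel, and \<open>pM\<close> eliminates the first
    ones.\<close>
  have *: "M y ** curvature_matrix G' i j y = (partial i (A j) y - partial j (A i) y + (A i y ** A j y - A j y ** A i y)) ** M y"
    using dd[of i j] dd[of j i] MM unfolding curvature_matrix_def pM
    by (simp add: matmul_simps matrix_mul_assoc) (simp add: algebra_simps)
  \<comment> \<open>The first sum contains the derivative of the Jacobian. It is symmetric in
    \<open>i\<close> and \<open>j\<close> and disappears from the difference formed below.\<close>
  have pA: "partial i (A j) y = (\<Sum>b\<in>UNIV. partial i M y $ b $ j *\<^sub>R ?C b)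
       + (\<Sum>c\<in>UNIV. \<Sum>b\<in>UNIV. (M y $ c $ i * M y $ b $ j) *\<^sub>R ?dC c b)" for i j
  proof -
    have d1: "(\<lambda>y. M y $ b $ j *\<^sub>R christoffel_matrix G b (F y)) differentiable (at y)" for b
      by (intro smooth_on_differentiable[OF _ y] smooth_on_scaleR openU smooth_on_compose[OF openU G.openV FU smoothF G.smooth_christoffel_matrix]
        smooth_on_vec_nth smoothM)
    have "partial i (\<lambda>y. M y $ b $ j) y = partial i M y $ b $ j" for b
      using partial_linear[OF bounded_linear_compose[OF bounded_linear_vec_nth[of j] bounded_linear_vec_nth[of b]] dM]
      by (simp add: o_def)
    moreover have "partial i (\<lambda>y. christoffel_matrix G b (F y)) y = (\<Sum>c\<in>UNIV. M y $ c $ i *\<^sub>R ?dC c b)" for b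
      using partial_compose[OF smooth_on_differentiable[OF smoothF y] dCF] by (simp add: M_nth)
    ultimately have "partial i (\<lambda>y. M y $ b $ j *\<^sub>R christoffel_matrix G b (F y)) y =
       partial i M y $ b $ j *\<^sub>R ?C b + (\<Sum>c\<in>UNIV. (M y $ c $ i * M y $ b $ j) *\<^sub>R ?dC c b)" for b
      by (subst partial_bilinear[OF bounded_bilinear_scaleR dMc dCF']) (simp add: scaleR_sum_right mult.commute)
    then have "partial i (A j) y = (\<Sum>b\<in>UNIV. partial i M y $ b $ j *\<^sub>R ?C b
        + (\<Sum>c\<in>UNIV. (M y $ c $ i * M y $ b $ j) *\<^sub>R ?dC c b))"
      unfolding A_def[abs_def] by (subst partial_sum[OF d1]) simp
    also have "\<dots> = (\<Sum>b\<in>UNIV. partial i M y $ b $ j *\<^sub>R ?C b)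
       + (\<Sum>c\<in>UNIV. \<Sum>b\<in>UNIV. (M y $ c $ i * M y $ b $ j) *\<^sub>R ?dC c b)"
      unfolding sum.distrib by (subst (2) sum.swap, rule refl)
    finally show ?thesis .
  qed
  have "partial i (A j) y - partial j (A i) y = (\<Sum>c\<in>UNIV. \<Sum>b\<in>UNIV. (M y $ c $ i * M y $ b $ j) *\<^sub>R ?dC c b)
    - (\<Sum>c\<in>UNIV. \<Sum>b\<in>UNIV. (M y $ c $ j * M y $ b $ i) *\<^sub>R ?dC c b)"
    unfolding pA by (simp add: partial_M_commute[OF y, of i _ j])
  also have "(\<Sum>c\<in>UNIV. \<Sum>b\<in>UNIV. (M y $ c $ j * M y $ b $ i) *\<^sub>R ?dC c b)
      = (\<Sum>c\<in>UNIV. \<Sum>b\<in>UNIV. (M y $ c $ i * M y $ b $ j) *\<^sub>R ?dC b c)"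
    by (subst sum.swap) (simp add: mult.commute)
  finally have 1: "partial i (A j) y - partial j (A i) y =
     (\<Sum>c\<in>UNIV. \<Sum>b\<in>UNIV. (M y $ c $ i * M y $ b $ j) *\<^sub>R (?dC c b - ?dC b c))"
    by (simp add: sum_subtractf scaleR_diff_right)
  have 2: "A i y ** A j y = (\<Sum>c\<in>UNIV. \<Sum>b\<in>UNIV. (M y $ c $ i * M y $ b $ j) *\<^sub>R (?C c ** ?C b))" for i j
    by (simp add: A_def matmul_sum scaleR_sum_right sum_distrib_left) (subst sum.swap, simp add: mult.commute)
  have "A j y ** A i y = (\<Sum>c\<in>UNIV. \<Sum>b\<in>UNIV. (M y $ c $ i * M y $ b $ j) *\<^sub>R (?C b ** ?C c))"
    unfolding 2 by (subst sum.swap) (simp add: mult.commute)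
  then show ?thesis
    unfolding * 1 by (simp add: 2 curvature_matrix_def sum.distrib sum_subtractf scaleR_diff_right scaleR_add_right)
qed

lemma sum_rotate: "(\<Sum>c\<in>C. \<Sum>q\<in>Q. \<Sum>b\<in>B. f c q b :: real) = (\<Sum>b\<in>B. \<Sum>q\<in>Q. \<Sum>c\<in>C. f c q b)"
proof -
  have "(\<Sum>c\<in>C. \<Sum>q\<in>Q. \<Sum>b\<in>B. f c q b) = (\<Sum>c\<in>C. \<Sum>b\<in>B. \<Sum>q\<in>Q. f c q b)"
    by (intro sum.cong refl sum.swap)
  also have "\<dots> = (\<Sum>b\<in>B. \<Sum>c\<in>C. \<Sum>q\<in>Q. f c q b)" by (rule sum.swap)
  also have "\<dots> = (\<Sum>b\<in>B. \<Sum>q\<in>Q. \<Sum>c\<in>C. f c q b)" by (intro sum.cong refl sum.swap)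
  finally show ?thesis .
qed

text \<open>In the trace \<open>M\<close> meets its inverse, so only the two free indices still see
  the Jacobian.\<close>

lemma ricci_change:
  assumes y: "y \<in> U"
  shows "ricci G' i j y = (\<Sum>b\<in>UNIV. \<Sum>q\<in>UNIV. M y $ q $ i * M y $ b $ j * ricci G q b (F y))"
proof -
  let ?N = "matrix_inv (M y)"
  let ?R = "\<lambda>c b. curvature_matrix G c b (F y)"
  define T where "T c = (\<Sum>b\<in>UNIV. M y $ b $ j *\<^sub>R ?R c b)" for c
  have "curvature_matrix G' k j y = ?N ** ((\<Sum>c\<in>UNIV. M y $ c $ k *\<^sub>R T c) ** M y)" for k
  proof -
    have "M y ** curvature_matrix G' k j y = (\<Sum>c\<in>UNIV. M y $ c $ k *\<^sub>R T c) ** M y"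
      unfolding curvature_change[OF y] T_def by (simp add: scaleR_sum_right)
    then show ?thesis using matrix_inv_mult(2)[OF detM[OF y]] by (metis matrix_mul_assoc matrix_mul_lid)
  qed
  then have "curvature_matrix G' k j y $ k $ i = (\<Sum>c\<in>UNIV. M y $ c $ k * (?N ** (T c ** M y)) $ k $ i)" for k
    by (simp add: matmul_sum)
  then have "ricci G' i j y = (\<Sum>c\<in>UNIV. \<Sum>k\<in>UNIV. M y $ c $ k * (?N ** (T c ** M y)) $ k $ i)"
    unfolding G'.ricci_eq[OF y] by simp (rule sum.swap)
  also have "\<dots> = (\<Sum>c\<in>UNIV. (M y ** (?N ** (T c ** M y))) $ c $ i)"
    by (simp add: matrix_matrix_mult_def[of "M y"])
  also have "\<dots> = (\<Sum>c\<in>UNIV. (T c ** M y) $ c $ i)"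
    by (simp add: matrix_mul_assoc matrix_inv_mult(1)[OF detM[OF y]])
  also have "\<dots> = (\<Sum>c\<in>UNIV. \<Sum>q\<in>UNIV. \<Sum>b\<in>UNIV. M y $ q $ i * M y $ b $ j * ?R c b $ c $ q)"
    by (simp add: T_def matrix_matrix_mult_def sum_distrib_left sum_distrib_right mult_ac)
  also have "\<dots> = (\<Sum>b\<in>UNIV. \<Sum>q\<in>UNIV. \<Sum>c\<in>UNIV. M y $ q $ i * M y $ b $ j * ?R c b $ c $ q)"
    by (rule sum_rotate)
  finally show ?thesis by (simp add: G.ricci_eq[OF F_in[OF y]] sum_distrib_left)
qed

text \<open>Scalar curvature is the trace of the inverse metric times Ricci, and under the two
  transformation laws this product is merely conjugated by \<open>M\<close>.\<close>

theorem scalar_curvature_coord_change: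
  assumes y: "y \<in> U" shows "scalar_curvature_coord G' y = scalar_curvature_coord G (F y)"
proof -
  define Ric where "Ric = (\<chi> q b. ricci G q b (F y))"
  define Ric' where "Ric' = (\<chi> i j. ricci G' i j y)"
  let ?N = "matrix_inv (M y)" and ?H = "matrix_inv (G (F y))"
  have tr: "(\<Sum>i\<in>UNIV. \<Sum>j\<in>UNIV. P $ i $ j * Q $ i $ j) = trace (transpose P ** Q)" for P Q :: "real^'n^'n"
    by (simp add: trace_def matrix_matrix_mult_def transpose_def) (rule sum.swap)
  have "Ric' = transpose (M y) ** (Ric ** M y)"
    by (simp add: vec_eq_iff Ric'_def Ric_def ricci_change[OF y] matrix_matrix_mult_def transpose_def sum_distrib_left mult_ac)
      (intro allI, subst sum.swap, intro sum.cong refl, simp)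
  moreover have "matrix_inv (G' y) = ?N ** ?H ** transpose ?N"
  proof -
    have "G' y ** (?N ** ?H ** transpose ?N) = transpose (M y) ** (G (F y) ** (M y ** ?N) ** ?H) ** transpose ?N"
      by (simp add: G'_eq[OF y] matrix_mul_assoc)
    also have "\<dots> = transpose (M y) ** transpose ?N"
      by (simp add: matrix_inv_mult[OF detM[OF y]] matrix_inv_mult[OF G.det[OF F_in[OF y]]])
    also have "\<dots> = mat 1"
      by (simp add: matrix_transpose_mul[symmetric] matrix_inv_mult[OF detM[OF y]] transpose_mat)
    finally show ?thesis
      by (metis matrix_inv_mult(2)[OF G'.det[OF y]] matrix_mul_assoc matrix_mul_lid matrix_mul_rid)
  qed
  moreover have "scalar_curvature_coord G' y = trace (transpose (matrix_inv (G' y)) ** Ric')"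
    unfolding tr[symmetric] by (simp add: scalar_curvature_coord_def Ric'_def)
  ultimately have "scalar_curvature_coord G' y =
      trace (transpose (?N ** ?H ** transpose ?N) ** (transpose (M y) ** (Ric ** M y)))"
    by simp
  also have "transpose (?N ** ?H ** transpose ?N) ** (transpose (M y) ** (Ric ** M y))
      = ?N ** (transpose ?H ** (transpose (M y ** ?N) ** (Ric ** M y)))"
    by (simp add: matrix_transpose_mul matrix_mul_assoc)
  also have "\<dots> = ?N ** (transpose ?H ** Ric ** M y)"
    by (simp add: matrix_inv_mult[OF detM[OF y]] transpose_mat matrix_mul_assoc)
  also have "trace \<dots> = trace (transpose ?H ** Ric ** M y ** ?N)" by (rule trace_mul_sym)
  also have "\<dots> = trace (transpose ?H ** Ric)"
    by (simp add: matrix_mul_assoc[symmetric] matrix_inv_mult[OF detM[OF y]])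
  also have "\<dots> = scalar_curvature_coord G (F y)"
    unfolding scalar_curvature_coord_def tr[symmetric] by (simp add: Ric_def)
  finally show ?thesis .
qed

end

section \<open>Change of variables\<close>

text \<open>The library's change of variables theorem requires a well-ordered index type; this copy
  of a finite type provides one.\<close>

typedef 'a wellordered = "UNIV :: 'a set" by simp

instance wellordered :: (finite) finite
proof
  have "UNIV = range (Abs_wellordered :: 'a \<Rightarrow> _)" by (metis Rep_wellordered_inverse surj_def)
  then show "finite (UNIV :: 'a wellordered set)" by (metis finite_imageI finite_class.finite_UNIV)
qed

instantiation wellordered :: (finite) wellorder
begin

definition "x \<le> y \<longleftrightarrow> to_nat (Rep_wellordered x) \<le> to_nat (Rep_wellordered y)"
definition "x < y \<longleftrightarrow> to_nat (Rep_wellordered x) < to_nat (Rep_wellordered y)"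

instance
proof
  fix P :: "'a wellordered \<Rightarrow> bool" and a
  assume step: "\<And>x. (\<And>y. y < x \<Longrightarrow> P y) \<Longrightarrow> P x"
  show "P a"
    by (induction a rule: measure_induct_rule[where f="\<lambda>x. to_nat (Rep_wellordered x)"])
      (auto intro: step simp: less_wellordered_def)
qed (auto simp: less_wellordered_def less_eq_wellordered_def Rep_wellordered_inject)

end

lemma bij_Rep_wellordered: "bij Rep_wellordered"
  by (metis (mono_tags) Rep_wellordered_inject Abs_wellordered_inverse UNIV_I bij_def injI surj_def)

text \<open>Conjugating permutations by \<open>b\<close> is a bijection that preserves signs and
  matches the products in the Leibniz formula.\<close>

lemma det_reindex:
  fixes A :: "'a::comm_ring_1^'n^'n" and b :: "'k::finite \<Rightarrow> 'n"
  assumes b: "bij b"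
  shows "det (\<chi> i j. A $ b i $ b j) = det A"
proof -
  have bb: "bij_betw b UNIV UNIV" and inj: "inj b" using b by (auto simp: bij_def)
  have mp: "map_permutation UNIV b p i = b (p (inv b i))" for p i
    using b by (simp add: map_permutation_def bij_def restrict_id_def)
  have "det A = (\<Sum>q\<in>{q. q permutes (UNIV::'n set)}. of_int (sign q) * (\<Prod>i\<in>UNIV. A $ i $ q i))"
    by (simp add: det_def)
  also have "\<dots> = (\<Sum>p\<in>{p. p permutes (UNIV::'k set)}. of_int (sign (map_permutation UNIV b p)) * (\<Prod>i\<in>UNIV. A $ i $ map_permutation UNIV b p i))"
  proof (rule sum.reindex_bij_witness[where i="map_permutation UNIV b" and j="map_permutation UNIV (inv b)"])
    fix q :: "'n \<Rightarrow> 'n" assume "q \<in> {q. q permutes UNIV}"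
    then show "map_permutation UNIV (inv b) q \<in> {p. p permutes UNIV}"
      by (auto intro!: map_permutation_permutes bij_imp_bij_inv b)
    show *: "map_permutation UNIV b (map_permutation UNIV (inv b) q) = q"
      using b by (auto simp: fun_eq_iff mp map_permutation_def restrict_id_def bij_imp_bij_inv bij_is_surj
         surj_imp_inj_inv inv_inv_eq bij_is_inj surj_f_inv_f)
    show "of_int (sign (map_permutation UNIV b (map_permutation UNIV (inv b) q))) *
         (\<Prod>i\<in>UNIV. A $ i $ map_permutation UNIV b (map_permutation UNIV (inv b) q) i) = of_int (sign q) * (\<Prod>i\<in>UNIV. A $ i $ q i)"
      by (simp only: *)
  next
    fix p :: "'k \<Rightarrow> 'k" assume "p \<in> {q. q permutes UNIV}"
    then show "map_permutation UNIV b p \<in> {p. p permutes UNIV}"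
      by (auto intro!: map_permutation_permutes b)
    show "map_permutation UNIV (inv b) (map_permutation UNIV b p) = p"
      using b by (auto simp: fun_eq_iff mp map_permutation_def restrict_id_def bij_imp_bij_inv bij_is_surj
         inv_inv_eq bij_is_inj)
  qed
  also have "\<dots> = (\<Sum>p\<in>{p. p permutes (UNIV::'k set)}. of_int (sign p) * (\<Prod>i\<in>UNIV. A $ b i $ b (p i)))"
  proof (rule sum.cong[OF refl])
    fix p :: "'k \<Rightarrow> 'k" assume "p \<in> {q. q permutes UNIV}"
    then have "sign (map_permutation UNIV b p) = sign p" by (intro sign_map_permutation inj) auto
    moreover have "(\<Prod>i\<in>UNIV. A $ i $ map_permutation UNIV b p i) = (\<Prod>i\<in>UNIV. A $ b i $ b (p i))"
      using prod.reindex_bij_betw[OF bb, of "\<lambda>i. A $ i $ map_permutation UNIV b p i"] inj by (simp add: mp)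
    ultimately show "of_int (sign (map_permutation UNIV b p)) * (\<Prod>i\<in>UNIV. A $ i $ map_permutation UNIV b p i)
       = of_int (sign p) * (\<Prod>i\<in>UNIV. A $ b i $ b (p i))" by simp
  qed
  finally show ?thesis by (simp add: det_def)
qed

text \<open>A linear map that matches standard bases takes boxes to boxes with the same side
  lengths, and Lebesgue measure is determined by its values on boxes.\<close>

lemma lborel_distr_basis:
  fixes T :: "'a::euclidean_space \<Rightarrow> 'b::euclidean_space"
  assumes T: "linear T" "bij_betw T Basis Basis"
  shows "distr lborel borel T = lborel"
proof (rule sym, rule lborel_eqI)
  have m: "T \<in> borel_measurable borel"
    using T(1) by (intro borel_measurable_continuous_onI linear_continuous_on) (simp add: linear_conv_bounded_linear)
  have inner: "T x \<bullet> T e = x \<bullet> e" if "e \<in> Basis" for x e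
  proof -
    have "T x \<bullet> T e = (\<Sum>f\<in>Basis. (x \<bullet> f) * (T f \<bullet> T e))"
      by (subst (1) euclidean_representation[of x, symmetric])
        (simp only: linear_sum[OF T(1)] linear_scale[OF T(1)] inner_sum_left inner_scaleR_left)
    also have "\<dots> = (\<Sum>f\<in>Basis. (x \<bullet> f) * (if f = e then 1 else 0))"
    proof (intro sum.cong refl)
      fix f :: 'a assume f: "f \<in> Basis"
      have "T f \<in> Basis" "T e \<in> Basis" "T f = T e \<longleftrightarrow> f = e"
        using T(2) f that by (auto simp: bij_betw_def inj_on_def)
      then show "x \<bullet> f * (T f \<bullet> T e) = x \<bullet> f * (if f = e then 1 else 0)" by (simp add: inner_Basis)
    qed
    finally show ?thesis using that by (simp add: if_distrib cong: if_cong)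
  qed
  fix l u :: 'b assume lu: "\<And>b. b \<in> Basis \<Longrightarrow> l \<bullet> b \<le> u \<bullet> b"
  define l' u' where "l' = (\<Sum>e\<in>Basis. (l \<bullet> T e) *\<^sub>R e)" and "u' = (\<Sum>e\<in>Basis. (u \<bullet> T e) *\<^sub>R e)"
  have l': "l' \<bullet> e = l \<bullet> T e" "u' \<bullet> e = u \<bullet> T e" if "e \<in> Basis" for e using that by (auto simp: l'_def u'_def)
  have TB: "T e \<in> Basis" if "e \<in> Basis" for e using T(2) that by (auto simp: bij_betw_def)
  have "T -` box l u = box l' u'"
  proof -
    have "T x \<in> box l u \<longleftrightarrow> (\<forall>e\<in>Basis. l \<bullet> T e < T x \<bullet> T e \<and> T x \<bullet> T e < u \<bullet> T e)" for x
      unfolding mem_box bij_betw_imp_surj_on[OF T(2), symmetric] by blast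
    then show ?thesis by (auto simp: mem_box inner l')
  qed
  then have "emeasure (distr lborel borel T) (box l u) = emeasure lborel (box l' u')"
    using m by (simp add: emeasure_distr)
  also have "\<dots> = (\<Prod>e\<in>Basis. (u' - l') \<bullet> e)"
    using lu TB by (intro emeasure_lborel_box) (auto simp: l')
  also have "(\<Prod>e\<in>Basis. (u' - l') \<bullet> e) = (\<Prod>e\<in>Basis. (u - l) \<bullet> T e)"
    by (intro prod.cong) (auto simp: inner_diff_left l')
  also have "\<dots> = (\<Prod>b\<in>Basis. (u - l) \<bullet> b)"
    by (rule prod.reindex_bij_betw[OF T(2)])
  finally show "emeasure (distr lborel borel T) (box l u) = (\<Prod>b\<in>Basis. (u - l) \<bullet> b)" .
qed simp

text \<open>Change of variables enters as an equivalence for each finite value \<open>r\<close>.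
  Applied to every \<open>r\<close> it also settles the infinite case: if one side is infinite, the
  other has no finite value.\<close>

lemma emeasure_image_wellorder:
  fixes F :: "real^'n::{finite,wellorder} \<Rightarrow> real^'n::_"
  assumes S: "S \<in> sets borel" "F ` S \<in> sets borel"
    and der: "\<And>y. y \<in> S \<Longrightarrow> (F has_derivative F' y) (at y)" and inj: "inj_on F S"
    and m: "(\<lambda>y. indicator S y * \<bar>det (matrix (F' y))\<bar>) \<in> borel_measurable borel"
  shows "emeasure lborel (F ` S) = (\<integral>\<^sup>+y\<in>S. ennreal \<bar>det (matrix (F' y))\<bar> \<partial>lborel)"
proof -
  let ?J = "\<integral>\<^sup>+y\<in>S. ennreal \<bar>det (matrix (F' y))\<bar> \<partial>lborel"
  have J: "?J = (\<integral>\<^sup>+y. ennreal (indicator S y * \<bar>det (matrix (F' y))\<bar>) \<partial>lebesgue)"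
    using m by (subst nn_integral_completion) (auto intro!: nn_integral_cong simp: indicator_def)
  have *: "emeasure lborel (F ` S) = ennreal r \<longleftrightarrow> ?J = ennreal r" if "r \<ge> 0" for r
  proof -
    have "?J = ennreal r \<longleftrightarrow> ((\<lambda>y. indicator S y * \<bar>det (matrix (F' y))\<bar>) has_integral r) UNIV"
      unfolding J using m that
      by (subst has_integral_iff_nn_integral_lebesgue) (auto intro: measurable_completion)
    also have "\<dots> \<longleftrightarrow> ((\<lambda>y. \<bar>det (matrix (F' y))\<bar>) has_integral r) S"
      by (subst has_integral_restrict_UNIV[symmetric], rule arg_cong[where f="\<lambda>f. (f has_integral r) UNIV"])
        (auto simp: fun_eq_iff indicator_def)
    also have "\<dots> \<longleftrightarrow> F ` S \<in> lmeasurable \<and> measure lebesgue (F ` S) = r"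
      using has_measure_differentiable_image[of S F F' r] S der inj
      by (auto intro: has_derivative_at_withinI)
    also have "\<dots> \<longleftrightarrow> emeasure lborel (F ` S) = ennreal r"
    proof -
      have "emeasure lebesgue (F ` S) = emeasure lborel (F ` S)" "F ` S \<in> sets lebesgue" using S(2) by simp_all
      then show ?thesis
        using that by (cases "emeasure lborel (F ` S)") (auto simp: fmeasurable_def measure_def)
    qed
    finally show ?thesis by simp
  qed
  show ?thesis
  proof (cases "emeasure lborel (F ` S)")
    case (real r) then show ?thesis using *[of r] by simp
  next
    case top then show ?thesis using * by (cases ?J) auto
  qed
qed

text \<open>Conjugation by the relabelling \<open>R\<close> of the coordinates, which preserves
  Lebesgue measure and, by \<open>det_reindex\<close>, the Jacobian determinant.\<close>

lemma emeasure_image: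
  fixes F :: "real^'n \<Rightarrow> real^'n"
  assumes S: "S \<in> sets borel" "F ` S \<in> sets borel"
    and der: "\<And>y. y \<in> S \<Longrightarrow> (F has_derivative F' y) (at y)" and inj: "inj_on F S"
    and m: "(\<lambda>y. indicator S y * \<bar>det (matrix (F' y))\<bar>) \<in> borel_measurable borel"
  shows "emeasure lborel (F ` S) = (\<integral>\<^sup>+y\<in>S. ennreal \<bar>det (matrix (F' y))\<bar> \<partial>lborel)"
proof -
  let ?b = "Rep_wellordered :: 'n wellordered \<Rightarrow> 'n"
  note b = bij_Rep_wellordered[where 'a='n]
  define R :: "real^'n \<Rightarrow> real^'n wellordered" where "R x = (\<chi> i. x $ ?b i)" for x
  define Q :: "real^'n wellordered \<Rightarrow> real^'n" where "Q x = (\<chi> i. x $ inv ?b i)" for x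
  have RQ [simp]: "R (Q x) = x" "Q (R z) = z" for x z
    using b by (auto simp: R_def Q_def vec_eq_iff bij_is_inj bij_is_surj surj_f_inv_f)
  have lin: "linear R" "linear Q" by (auto intro!: linearI simp: R_def Q_def vec_eq_iff)
  have Rax: "R (axis i 1) = axis (inv ?b i) 1" for i
    using b by (auto simp: R_def axis_def vec_eq_iff) (metis bij_inv_eq_iff)+
  have Qax: "Q (axis i 1) = axis (?b i) 1" for i by (metis RQ(2) Rax b bij_inv_eq_iff)
  have "bij_betw R Basis Basis"
    by (rule bij_betw_byWitness[where f'=Q]) (auto simp: Basis_vec_def Rax Qax)
  then have dR: "distr lborel borel R = lborel" by (rule lborel_distr_basis[OF lin(1)])
  have bl: "bounded_linear R" "bounded_linear Q" using lin by (simp_all add: linear_conv_bounded_linear)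
  have mR [measurable]: "R \<in> borel_measurable borel" "Q \<in> borel_measurable borel"
    using bl by (auto intro!: borel_measurable_continuous_onI linear_continuous_on)
  have vim: "R ` X = Q -` X" for X by (auto simp: image_iff) (metis RQ(1))
  have bor: "R ` X \<in> sets borel" if "X \<in> sets borel" for X
    unfolding vim using measurable_sets[OF mR(2) that] by simp
  have em: "emeasure lborel (R ` X) = emeasure lborel X" if "X \<in> sets borel" for X
  proof -
    have "emeasure lborel (R ` X) = emeasure (distr lborel borel R) (R ` X)" by (simp add: dR)
    also have "\<dots> = emeasure lborel (R -` R ` X)" using bor[OF that] by (simp add: emeasure_distr)
    also have "R -` R ` X = X" by (auto simp: image_iff) (metis RQ(2))
    finally show ?thesis .
  qed
  have det: "det (matrix (R \<circ> f \<circ> Q)) = det (matrix f)" for f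
  proof -
    have "matrix (R \<circ> f \<circ> Q) = (\<chi> i j. matrix f $ ?b i $ ?b j)"
      by (simp add: matrix_def vec_eq_iff Qax) (simp add: R_def)
    then show ?thesis by (simp add: det_reindex[OF b])
  qed
  have im: "(R \<circ> F \<circ> Q) ` (R ` S) = R ` F ` S" by (simp add: image_image)
  have "emeasure lborel (F ` S) = emeasure lborel ((R \<circ> F \<circ> Q) ` (R ` S))"
    unfolding im using S(2) by (simp add: em)
  also have "\<dots> = (\<integral>\<^sup>+y\<in>R ` S. ennreal \<bar>det (matrix (R \<circ> F' (Q y) \<circ> Q))\<bar> \<partial>lborel)"
  proof (rule emeasure_image_wellorder)
    show "((R \<circ> F \<circ> Q) has_derivative (R \<circ> F' (Q y) \<circ> Q)) (at y)" if "y \<in> R ` S" for y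
      using that der by (intro diff_chain_at bounded_linear_imp_has_derivative bl) auto
    show "inj_on (R \<circ> F \<circ> Q) (R ` S)"
      using inj by (auto simp: inj_on_def) (metis RQ(2))
    have "(\<lambda>y. indicator S (Q y) * \<bar>det (matrix (F' (Q y)))\<bar>) \<in> borel_measurable borel"
      using measurable_compose[OF mR(2) m] by simp
    moreover have "indicator (R ` S) y = (indicator S (Q y) :: real)" for y unfolding vim by (simp add: indicator_def)
    ultimately show "(\<lambda>y. indicator (R ` S) y * \<bar>det (matrix (R \<circ> F' (Q y) \<circ> Q))\<bar>) \<in> borel_measurable borel"
      by (simp add: det)
  qed (use S bor im in auto)
  also have "\<dots> = (\<integral>\<^sup>+y. ennreal (indicator S (Q y) * \<bar>det (matrix (F' (Q y)))\<bar>) \<partial>distr lborel borel R)"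
    unfolding vim det dR by (intro nn_integral_cong) (auto simp: indicator_def)
  also have "\<dots> = (\<integral>\<^sup>+y. ennreal (indicator S y * \<bar>det (matrix (F' y))\<bar>) \<partial>lborel)"
    using measurable_compose[OF mR(2) m] by (subst nn_integral_distr) auto
  also have "\<dots> = (\<integral>\<^sup>+y\<in>S. ennreal \<bar>det (matrix (F' y))\<bar> \<partial>lborel)"
    by (intro nn_integral_cong) (auto simp: indicator_def)
  finally show ?thesis .
qed

lemma borel_measurable_indicator_mult:
  fixes f :: "'a::topological_space \<Rightarrow> real"
  assumes "continuous_on V f" "open V" "S \<in> sets borel" "S \<subseteq> V"
  shows "(\<lambda>y. indicator S y * f y) \<in> borel_measurable borel"
proof -
  have "(\<lambda>y. indicator V y *\<^sub>R f y) \<in> borel_measurable borel"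
    using borel_measurable_continuous_on_indicator[OF _ assms(1)] assms(2) by simp
  then have "(\<lambda>y. indicator S y * (indicator V y *\<^sub>R f y)) \<in> borel_measurable borel"
    using assms(3) by measurable
  moreover have "(\<lambda>y. indicator S y * (indicator V y *\<^sub>R f y)) = (\<lambda>y. indicator S y * f y)"
    using assms(4) by (auto simp: fun_eq_iff indicator_def)
  ultimately show ?thesis by simp
qed

section \<open>Integrals under a diffeomorphism of open sets\<close>

definition jacobian :: "(real^'n \<Rightarrow> real^'k) \<Rightarrow> real^'n \<Rightarrow> real^'n^'k" where
  "jacobian F y = matrix (frechet_derivative F (at y))"

locale diffeo =
  fixes U V :: "(real^'n) set" and F G :: "real^'n \<Rightarrow> real^'n"
  assumes openU: "open U" and openV: "open V"
    and smoothF: "smooth_on U F" and smoothG: "smooth_on V G"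
    and FU: "F ` U \<subseteq> V" and GV: "G ` V \<subseteq> U"
    and GF: "y \<in> U \<Longrightarrow> G (F y) = y" and FG: "x \<in> V \<Longrightarrow> F (G x) = x"
begin

abbreviation "J \<equiv> jacobian F"

lemma F_in: "y \<in> U \<Longrightarrow> F y \<in> V" and G_in: "x \<in> V \<Longrightarrow> G x \<in> U" using FU GV by auto

lemma derF: "y \<in> U \<Longrightarrow> (F has_derivative frechet_derivative F (at y)) (at y)"
  by (rule smooth_on_has_derivative[OF smoothF])

lemma swap: "diffeo V U G F"
  using openU openV smoothF smoothG FU GV GF FG by unfold_locales auto

lemma smoothJ: "smooth_on U (\<lambda>y. J y $ a $ i)"
  using smooth_on_vec_nth[OF openU smooth_on_partial[OF openU smoothF]] by (simp add: jacobian_def jacobian_eq_partial)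

lemma J_mult: assumes y: "y \<in> U" shows "matrix (frechet_derivative G (at (F y))) ** J y = mat 1"
proof -
  have "((\<lambda>y. y) has_derivative (frechet_derivative G (at (F y)) \<circ> frechet_derivative F (at y))) (at y)"
    using diff_chain_at[OF derF[OF y] smooth_on_has_derivative[OF smoothG F_in[OF y]]]
    by (rule has_derivative_transform_within_open[OF _ openU y]) (simp add: GF)
  then have "frechet_derivative G (at (F y)) \<circ> frechet_derivative F (at y) = (\<lambda>x. x)"
    using has_derivative_unique[OF _ has_derivative_ident] by blast
  moreover have "linear (frechet_derivative F (at y))" "linear (frechet_derivative G (at (F y)))"
    using linear_frechet_derivative smooth_on_differentiable smoothF smoothG y F_in by blast+
  ultimately show ?thesis
    using matrix_compose[of "frechet_derivative F (at y)" "frechet_derivative G (at (F y))"]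
    by (simp add: jacobian_def matrix_def axis_def mat_def)
qed

lemma det_J: "y \<in> U \<Longrightarrow> det (J y) \<noteq> 0"
  using J_mult det_mul[of _ "J y"] by (metis det_I mult_zero_right zero_neq_one)

lemma emeasure_image_F:
  assumes S: "S \<in> sets borel" "S \<subseteq> U"
  shows "F ` S \<in> sets borel" "emeasure lborel (F ` S) = (\<integral>\<^sup>+y\<in>S. ennreal \<bar>det (J y)\<bar> \<partial>lborel)"
proof -
  have "F ` S = V \<inter> G -` S" using S(2) FU FG GF by force
  moreover have "G \<in> borel_measurable (restrict_space borel V)"
    by (rule borel_measurable_continuous_on_restrict[OF smooth_on_continuous[OF smoothG]])
  ultimately show b: "F ` S \<in> sets borel"
    using measurable_sets[of G "restrict_space borel V" borel S] S(1) openV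
    by (simp add: space_restrict_space sets_restrict_space_iff Int_commute)
  show "emeasure lborel (F ` S) = (\<integral>\<^sup>+y\<in>S. ennreal \<bar>det (J y)\<bar> \<partial>lborel)"
    unfolding jacobian_def
  proof (rule emeasure_image[OF S(1) b])
    show "inj_on F S" using GF S(2) by (metis inj_onI subsetD)
    show "(\<lambda>y. indicator S y * \<bar>det (matrix (frechet_derivative F (at y)))\<bar>) \<in> borel_measurable borel"
      using smooth_on_continuous[OF smooth_on_det[OF openU smoothJ]] S openU
      by (intro borel_measurable_indicator_mult[of U] continuous_on_rabs) (auto simp: jacobian_def)
  qed (use S derF in auto)
qed

text \<open>Change of variables as an identity of measures, from which the formulas for nonnegative
  and for integrable functions follow alike. Continuing \<open>F\<close> by 0 off \<open>U\<close>
  makes it Borel on the whole space.\<close>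

lemma lborel_image:
  defines "F0 \<equiv> \<lambda>y. if y \<in> U then F y else 0"
  shows "F0 \<in> borel_measurable borel" "(\<lambda>y. indicator U y * \<bar>det (J y)\<bar>) \<in> borel_measurable borel"
    "density lborel (indicator V) = distr (density lborel (\<lambda>y. ennreal (indicator U y * \<bar>det (J y)\<bar>))) borel F0"
proof -
  show [measurable]: "F0 \<in> borel_measurable borel"
    unfolding F0_def using openU smooth_on_continuous[OF smoothF]
    by (intro borel_measurable_continuous_on_if) auto
  show [measurable]: "(\<lambda>y. indicator U y * \<bar>det (J y)\<bar>) \<in> borel_measurable borel"
    using smooth_on_continuous[OF smooth_on_det[OF openU smoothJ]] openU
    by (intro borel_measurable_indicator_mult[of U] continuous_on_rabs) auto
  have [measurable]: "V \<in> sets borel" "U \<in> sets borel" using openU openV by auto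
  show "density lborel (indicator V) = distr (density lborel (\<lambda>y. ennreal (indicator U y * \<bar>det (J y)\<bar>))) borel F0"
  proof (rule measure_eqI)
    fix S assume "S \<in> sets (density lborel (indicator V))"
    then have S[measurable]: "S \<in> sets borel" by simp
    have SV: "F ` (U \<inter> F0 -` S) = V \<inter> S" using FU FG GF GV by (force simp: F0_def)
    have [measurable]: "U \<inter> F0 -` S \<in> sets borel"
      using measurable_sets[OF \<open>F0 \<in> _\<close> S] by (intro sets.Int) auto
    have "emeasure (density lborel (indicator V)) S = emeasure lborel (V \<inter> S)"
      by (subst emeasure_density) (auto simp: indicator_inter_arith[symmetric])
    also have "\<dots> = (\<integral>\<^sup>+y\<in>U \<inter> F0 -` S. ennreal \<bar>det (J y)\<bar> \<partial>lborel)"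
      unfolding SV[symmetric] by (rule emeasure_image_F) auto
    also have "\<dots> = emeasure (distr (density lborel (\<lambda>y. ennreal (indicator U y * \<bar>det (J y)\<bar>))) borel F0) S"
    proof -
      have "F0 -` S \<in> sets borel" using measurable_sets[OF \<open>F0 \<in> _\<close> S] by simp
      then have "emeasure (distr (density lborel (\<lambda>y. ennreal (indicator U y * \<bar>det (J y)\<bar>))) borel F0) S
         = (\<integral>\<^sup>+y\<in>F0 -` S. ennreal (indicator U y * \<bar>det (J y)\<bar>) \<partial>lborel)"
        by (subst emeasure_distr) (auto simp: emeasure_density)
      also have "\<dots> = (\<integral>\<^sup>+y\<in>U \<inter> F0 -` S. ennreal \<bar>det (J y)\<bar> \<partial>lborel)"
        by (intro nn_integral_cong) (auto split: split_indicator)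
      finally show ?thesis by simp
    qed
    finally show "emeasure (density lborel (indicator V)) S = emeasure (distr (density lborel (\<lambda>y. ennreal (indicator U y * \<bar>det (J y)\<bar>))) borel F0) S" .
  qed simp
qed

lemma nn_integral_image:
  assumes f: "(\<lambda>x. indicator V x * f x) \<in> borel_measurable borel"
  shows "(\<integral>\<^sup>+x. indicator V x * f x \<partial>lborel) = (\<integral>\<^sup>+y. indicator U y * (ennreal \<bar>det (J y)\<bar> * f (F y)) \<partial>lborel)"
proof -
  note [measurable] = lborel_image(1,2) f
  have [measurable]: "V \<in> sets borel" using openV by simp
  \<comment> \<open>The indicator is doubled: one copy becomes the density, the other keeps the
    integrand measurable, since nothing is assumed of \<open>f\<close> outside
    \<open>V\<close>.\<close>
  have "(\<integral>\<^sup>+x. indicator V x * f x \<partial>lborel) = (\<integral>\<^sup>+x. indicator V x * (indicator V x * f x) \<partial>lborel)"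
    by (intro nn_integral_cong) (auto simp: indicator_def)
  also have "\<dots> = (\<integral>\<^sup>+x. indicator V x * f x \<partial>density lborel (indicator V))"
    by (subst nn_integral_density) auto
  also have "\<dots> = (\<integral>\<^sup>+y. ennreal (indicator U y * \<bar>det (J y)\<bar>) *
       (indicator V (if y \<in> U then F y else 0) * f (if y \<in> U then F y else 0)) \<partial>lborel)"
    unfolding lborel_image(3) by (subst nn_integral_distr, measurable, subst nn_integral_density, measurable)
  also have "\<dots> = (\<integral>\<^sup>+y. indicator U y * (ennreal \<bar>det (J y)\<bar> * f (F y)) \<partial>lborel)"
    using FU by (intro nn_integral_cong) (auto simp: indicator_def)
  finally show ?thesis .
qed

lemma integral_image:
  fixes f :: "_ \<Rightarrow> real"
  assumes f: "(\<lambda>x. indicator V x * f x) \<in> borel_measurable borel"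
  shows "integrable lborel (\<lambda>x. indicator V x * f x) \<longleftrightarrow> integrable lborel (\<lambda>y. indicator U y * (\<bar>det (J y)\<bar> * f (F y)))"
    "(LINT x|lborel. indicator V x * f x) = (LINT y|lborel. indicator U y * (\<bar>det (J y)\<bar> * f (F y)))"
proof -
  note [measurable] = lborel_image(1,2) f
  let ?F = "\<lambda>y. if y \<in> U then F y else 0"
  have [measurable]: "V \<in> sets borel" using openV by simp
  have e: "(\<lambda>x. indicator V x *\<^sub>R (indicator V x * f x)) = (\<lambda>x. indicator V x * f x)"
    by (auto simp: indicator_def fun_eq_iff)
  have eU: "(\<lambda>y. (indicator U y * \<bar>det (J y)\<bar>) *\<^sub>R (indicator V (?F y) * f (?F y)))
     = (\<lambda>y. indicator U y * (\<bar>det (J y)\<bar> * f (F y)))"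
    using FU by (auto simp: indicator_def fun_eq_iff)
  have d: "density lborel (indicator V) = density lborel (\<lambda>x. ennreal (indicator V x))"
    by (rule arg_cong[where f="density lborel"]) (auto simp: fun_eq_iff split: split_indicator)
  show "integrable lborel (\<lambda>x. indicator V x * f x) \<longleftrightarrow> integrable lborel (\<lambda>y. indicator U y * (\<bar>det (J y)\<bar> * f (F y)))"
    using integrable_density[of "\<lambda>x. indicator V x * f x" lborel "indicator V"]
      integrable_density[of "\<lambda>y. indicator V (?F y) * f (?F y)" lborel "\<lambda>y. indicator U y * \<bar>det (J y)\<bar>"]
      integrable_distr_eq[of ?F "density lborel (\<lambda>y. ennreal (indicator U y * \<bar>det (J y)\<bar>))" borel "\<lambda>x. indicator V x * f x"]
    unfolding e eU d[symmetric] lborel_image(3)[symmetric] by simp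
  show "(LINT x|lborel. indicator V x * f x) = (LINT y|lborel. indicator U y * (\<bar>det (J y)\<bar> * f (F y)))"
    using integral_density[of "\<lambda>x. indicator V x * f x" lborel "indicator V"]
      integral_density[of "\<lambda>y. indicator V (?F y) * f (?F y)" lborel "\<lambda>y. indicator U y * \<bar>det (J y)\<bar>"]
      integral_distr[of ?F "density lborel (\<lambda>y. ennreal (indicator U y * \<bar>det (J y)\<bar>))" borel "\<lambda>x. indicator V x * f x"]
    unfolding e eU d[symmetric] lborel_image(3)[symmetric] by simp
qed

end

section \<open>Charts and the Riemannian measure\<close>

lemma is_chart_image_open:
  assumes "is_chart c" "open W" "W \<subseteq> fst c" shows "open (snd c ` W)"
proof -
  have h: "homeomorphism (fst c) (snd c ` fst c) (snd c) (chart_inv c)" and o: "open (snd c ` fst c)"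
    using assms(1) by (auto simp: is_chart_def)
  have "snd c ` W = snd c ` fst c \<inter> chart_inv c -` W"
    using assms(3) homeomorphism_apply1[OF h] by (auto simp: image_iff)
  then show ?thesis
    using continuous_on_open_vimage[OF o] homeomorphism_cont2[OF h] assms(2) by (metis Int_commute)
qed

lemma is_chart_simps:
  assumes "is_chart c"
  shows "open (fst c)" "open (snd c ` fst c)" "p \<in> fst c \<Longrightarrow> chart_inv c (snd c p) = p"
    "y \<in> snd c ` fst c \<Longrightarrow> snd c (chart_inv c y) = y" "y \<in> snd c ` fst c \<Longrightarrow> chart_inv c y \<in> fst c"
    "continuous_on (fst c) (snd c)" "continuous_on (snd c ` fst c) (chart_inv c)" "inj_on (snd c) (fst c)"
proof -
  have h: "homeomorphism (fst c) (snd c ` fst c) (snd c) (chart_inv c)"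
    using assms by (auto simp: is_chart_def)
  show "open (fst c)" "open (snd c ` fst c)" using assms by (auto simp: is_chart_def)
  show "p \<in> fst c \<Longrightarrow> chart_inv c (snd c p) = p" using homeomorphism_apply1[OF h] .
  show "y \<in> snd c ` fst c \<Longrightarrow> snd c (chart_inv c y) = y" "y \<in> snd c ` fst c \<Longrightarrow> chart_inv c y \<in> fst c"
    by (auto simp: f_inv_into_f inv_into_into)
  show "continuous_on (fst c) (snd c)" "continuous_on (snd c ` fst c) (chart_inv c)"
    using h by (auto simp: homeomorphism_def)
  show "inj_on (snd c) (fst c)" using homeomorphism_apply1[OF h] by (metis inj_onI)
qed

lemma chart_inv_image: "is_chart c \<Longrightarrow> W \<subseteq> fst c \<Longrightarrow> snd c ` W = {y \<in> snd c ` fst c. chart_inv c y \<in> W}"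
  using is_chart_simps(3)[of c] by (auto simp: image_iff) 

text \<open>Outside the image of the chart, \<^term>\<open>chart_inv c\<close> is a single unspecified value.\<close>

lemma chart_inv_measurable [measurable]:
  assumes "is_chart c" shows "chart_inv c \<in> borel_measurable borel"
proof -
  have "chart_inv c = (\<lambda>y. if y \<in> snd c ` fst c then chart_inv c y else (SOME x. False))"
  proof
    fix y
    have "(\<lambda>x. x \<in> fst c \<and> snd c x = y) = (\<lambda>x. False)" if "y \<notin> snd c ` fst c" using that by auto
    then show "chart_inv c y = (if y \<in> snd c ` fst c then chart_inv c y else (SOME x. False))"
      by (auto simp: inv_into_def)
  qed
  also have "\<dots> \<in> borel_measurable borel"
    using is_chart_simps[OF assms] by (intro borel_measurable_continuous_on_if) auto
  finally show ?thesis .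
qed

lemma chart_image_borel:
  assumes "is_chart c" "S \<in> sets borel" "S \<subseteq> fst c" shows "snd c ` S \<in> sets borel"
proof -
  have "snd c ` S = snd c ` fst c \<inter> chart_inv c -` S" using chart_inv_image[OF assms(1,3)] by auto
  then show ?thesis
    using measurable_sets[OF chart_inv_measurable[OF assms(1)] assms(2)] is_chart_simps(2)[OF assms(1)] by simp
qed

text \<open>The coordinate volume carried back to the manifold, as a measure on the whole space
  concentrated on \<open>fst c\<close>, so that measures of different charts can be compared and
  glued.\<close>

definition chart_measure :: "('a::{t2_space,second_countable_topology}, 'n) metric \<Rightarrow> ('a, real^'n) chart \<Rightarrow> 'a measure" where
  "chart_measure g c = distr (density lborel
     (\<lambda>y. ennreal (indicator (snd c ` fst c) y * sqrt (det (g c (chart_inv c y)))))) borel (chart_inv c)"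

lemma sets_chart_measure [simp]: "sets (chart_measure g c) = sets borel"
  and space_chart_measure [simp]: "space (chart_measure g c) = UNIV"
  by (simp_all add: chart_measure_def)

text \<open>The segment from the identity matrix to \<open>H\<close> consists of positive definite
  matrices; the determinant never vanishes along it and keeps the sign it has at the
  identity.\<close>

lemma det_posdef:
  fixes H :: "real^'n^'n"
  assumes "transpose H = H" "\<And>v. v \<noteq> 0 \<Longrightarrow> v \<bullet> (H *v v) > 0"
  shows "det H > 0"
proof -
  define D where "D s = det ((1 - s) *\<^sub>R mat 1 + s *\<^sub>R H)" for s :: real
  have nz: "D s \<noteq> 0" if "0 \<le> s" "s \<le> 1" for s
  proof
    assume "D s = 0"
    then have "\<not> invertible ((1 - s) *\<^sub>R mat 1 + s *\<^sub>R H)" by (simp add: invertible_det_nz D_def)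
    then obtain v :: "real^'n" where v: "v \<noteq> 0" "((1 - s) *\<^sub>R mat 1 + s *\<^sub>R H) *v v = 0"
      unfolding invertible_left_inverse matrix_left_invertible_ker by auto
    have "v \<bullet> (((1 - s) *\<^sub>R mat 1 + s *\<^sub>R H) *v v) = (1 - s) * (v \<bullet> v) + s * (v \<bullet> (H *v v))"
      by (simp add: matrix_vector_mult_add_rdistrib scaleR_matrix_vector_assoc[symmetric] inner_add_right)
    then have "(1 - s) * (v \<bullet> v) + s * (v \<bullet> (H *v v)) = 0" using v(2) by simp
    moreover have "v \<bullet> v > 0" "v \<bullet> (H *v v) > 0" using v(1) assms(2) by auto
    ultimately show False
      using that by (smt (verit) mult_nonneg_nonneg mult_pos_pos)
  qed
  have "continuous_on {0..1} D"
    unfolding D_def det_def by (intro continuous_intros)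
  moreover have "D 0 = 1" by (simp add: D_def)
  ultimately have "D 1 > 0"
    using IVT2'[of D 1 0 0] nz by (smt (verit) nz)
  then show ?thesis by (simp add: D_def)
qed

section \<open>Transition maps and their Jacobians\<close>

locale smooth_manifold =
  fixes A :: "('a::{t2_space,second_countable_topology}, real^'n) chart set"
  assumes atlas: "smooth_atlas A"
begin

lemma chart: "c \<in> A \<Longrightarrow> is_chart c" using atlas by (auto simp: smooth_atlas_def)

lemma open_chart: "c \<in> A \<Longrightarrow> open (fst c)" by (rule is_chart_simps(1)[OF chart])

lemma chart_exists: "\<exists>c\<in>A. p \<in> fst c" using atlas by (auto simp: smooth_atlas_def)

lemma chart_at: "chart_at A p \<in> A" "p \<in> fst (chart_at A p)"
  using someI_ex[OF chart_exists[unfolded Bex_def], of p] unfolding chart_at_def by blast+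

lemma smooth_transition:
  "c \<in> A \<Longrightarrow> d \<in> A \<Longrightarrow> smooth_on (snd c ` (fst c \<inter> fst d)) (\<lambda>y. snd d (chart_inv c y))"
  using atlas by (auto simp: smooth_atlas_def o_def)

lemma transition_diffeo:
  assumes "c \<in> A" "d \<in> A" "open W" "W \<subseteq> fst c" "W \<subseteq> fst d"
  shows "diffeo (snd c ` W) (snd d ` W) (\<lambda>y. snd d (chart_inv c y)) (\<lambda>y. snd c (chart_inv d y))"
proof
  show "open (snd c ` W)" "open (snd d ` W)" using assms chart is_chart_image_open by blast+
  show "smooth_on (snd c ` W) (\<lambda>y. snd d (chart_inv c y))" "smooth_on (snd d ` W) (\<lambda>y. snd c (chart_inv d y))"
    using smooth_transition[OF assms(1,2)] smooth_transition[OF assms(2,1)] assms(4,5)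
    by (auto elim!: smooth_on_subset)
qed (use assms is_chart_simps(3)[OF chart[OF assms(1)]] is_chart_simps(3)[OF chart[OF assms(2)]] in \<open>auto simp: subset_iff\<close>)

lemma jacobian_eq: "transition_jacobian c d p = jacobian (\<lambda>y. snd d (chart_inv c y)) (snd c p)"
  by (simp add: transition_jacobian_def jacobian_def o_def)

lemma Union_charts: "\<Union>(fst ` A) = UNIV" using atlas by (auto simp: smooth_atlas_def)

lemma jacobian_cocycle:
  assumes "c \<in> A" "d \<in> A" "e \<in> A" "p \<in> fst c" "p \<in> fst d" "p \<in> fst e"
  shows "transition_jacobian c e p = transition_jacobian d e p ** transition_jacobian c d p"
proof -
  define W where "W = fst c \<inter> fst d \<inter> fst e"
  have W: "open W" "W \<subseteq> fst c" "W \<subseteq> fst d" "W \<subseteq> fst e"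
    using open_chart[OF assms(1)] open_chart[OF assms(2)] open_chart[OF assms(3)] by (auto simp: W_def)
  interpret cd: diffeo "snd c ` W" "snd d ` W" "\<lambda>y. snd d (chart_inv c y)" "\<lambda>y. snd c (chart_inv d y)"
    by (rule transition_diffeo[OF assms(1,2) W(1,2,3)])
  interpret de: diffeo "snd d ` W" "snd e ` W" "\<lambda>y. snd e (chart_inv d y)" "\<lambda>y. snd d (chart_inv e y)"
    by (rule transition_diffeo[OF assms(2,3) W(1,3,4)])
  have p: "snd c p \<in> snd c ` W" and pd: "snd d (chart_inv c (snd c p)) = snd d p" "snd d p \<in> snd d ` W"
    using assms is_chart_simps(3)[OF chart[OF assms(1)]] by (auto simp: W_def)
  let ?F = "frechet_derivative (\<lambda>y. snd d (chart_inv c y)) (at (snd c p))"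
  let ?G = "frechet_derivative (\<lambda>y. snd e (chart_inv d y)) (at (snd d p))"
  have "((\<lambda>y. snd e (chart_inv c y)) has_derivative (?G \<circ> ?F)) (at (snd c p))"
  proof (rule has_derivative_transform_within_open[OF _ cd.openU p])
    show "((\<lambda>y. snd e (chart_inv d y)) \<circ> (\<lambda>y. snd d (chart_inv c y)) has_derivative (?G \<circ> ?F)) (at (snd c p))"
      using diff_chain_at[OF cd.derF[OF p]] de.derF[OF pd(2)] pd by simp
    show "((\<lambda>y. snd e (chart_inv d y)) \<circ> (\<lambda>y. snd d (chart_inv c y))) y = snd e (chart_inv c y)"
      if "y \<in> snd c ` W" for y
      using that is_chart_simps(3)[OF chart[OF assms(1)]] is_chart_simps(3)[OF chart[OF assms(2)]] W by (auto simp: subset_iff)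
  qed
  then have "transition_jacobian c e p = matrix (?G \<circ> ?F)"
    by (simp add: transition_jacobian_def o_def[of "snd e"] frechet_derivative_eqI)
  also have "\<dots> = matrix ?G ** matrix ?F"
    using has_derivative_linear[OF cd.derF[OF p]] has_derivative_linear[OF de.derF[OF pd(2)]]
    by (rule matrix_compose)
  finally show ?thesis by (simp add: transition_jacobian_def o_def)
qed

lemma jacobian_refl: assumes "c \<in> A" "p \<in> fst c" shows "transition_jacobian c c p = mat 1"
proof -
  note ch = is_chart_simps[OF chart[OF assms(1)]]
  have "((\<lambda>y. snd c (chart_inv c y)) has_derivative (\<lambda>y. y)) (at (snd c p))"
    by (rule has_derivative_transform_within_open[OF has_derivative_ident ch(2)]) (use assms ch in auto)
  then show ?thesis
    by (simp add: transition_jacobian_def o_def frechet_derivative_eqI matrix_def axis_def mat_def vec_eq_iff)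
qed

lemma jacobian_inverse:
  assumes "c \<in> A" "d \<in> A" "p \<in> fst c" "p \<in> fst d"
  shows "transition_jacobian d c p ** transition_jacobian c d p = mat 1"
  using jacobian_cocycle[OF assms(1,2,1,3,4,3)] jacobian_refl[OF assms(1,3)] by simp

end

locale riemannian = smooth_manifold A
  for A :: "('a::{t2_space,second_countable_topology}, real^'n) chart set" +
  fixes g :: "('a, 'n) metric"
  assumes metric: "riemannian_metric A g"
begin

lemma metric_change:
  "c \<in> A \<Longrightarrow> d \<in> A \<Longrightarrow> p \<in> fst c \<Longrightarrow> p \<in> fst d \<Longrightarrow>
    g c p = transpose (transition_jacobian c d p) ** g d p ** transition_jacobian c d p"
  using metric unfolding riemannian_metric_def by blast+

lemma metric_sym: "c \<in> A \<Longrightarrow> p \<in> fst c \<Longrightarrow> transpose (g c p) = g c p"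
  and metric_pos: "c \<in> A \<Longrightarrow> p \<in> fst c \<Longrightarrow> v \<noteq> 0 \<Longrightarrow> v \<bullet> (g c p *v v) > 0"
  using metric unfolding riemannian_metric_def by blast+

lemma det_metric: "c \<in> A \<Longrightarrow> p \<in> fst c \<Longrightarrow> det (g c p) > 0"
  by (intro det_posdef metric_sym metric_pos)

lemma smooth_metric: "c \<in> A \<Longrightarrow> smooth_on (snd c ` fst c) (\<lambda>y. g c (chart_inv c y))"
  using metric unfolding riemannian_metric_def by blast+

lemma metric_coords: "c \<in> A \<Longrightarrow> metric_coords (snd c ` fst c) (\<lambda>y. g c (chart_inv c y))"
proof
  assume c: "c \<in> A"
  show "open (snd c ` fst c)" by (rule is_chart_simps(2)[OF chart[OF c]])
  show "smooth_on (snd c ` fst c) (\<lambda>y. g c (chart_inv c y))" by (rule smooth_metric[OF c])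
  fix y assume "y \<in> snd c ` fst c"
  then have "chart_inv c y \<in> fst c" by (rule is_chart_simps(5)[OF chart[OF c]])
  with c show "transpose (g c (chart_inv c y)) = g c (chart_inv c y)" "det (g c (chart_inv c y)) \<noteq> 0"
    using metric_sym det_metric by (auto simp: less_imp_neq[symmetric])
qed

lemma sqrt_det_continuous:
  assumes "c \<in> A" shows "continuous_on (snd c ` fst c) (\<lambda>y. sqrt (det (g c (chart_inv c y))))"
proof -
  interpret metric_coords "snd c ` fst c" "\<lambda>y. g c (chart_inv c y)" by (rule metric_coords[OF assms])
  show ?thesis by (intro continuous_on_real_sqrt smooth_on_continuous smooth_on_det openV smoothGc)
qed

lemma volume_density_measurable [measurable]:
  "c \<in> A \<Longrightarrow> (\<lambda>y. indicator (snd c ` fst c) y * sqrt (det (g c (chart_inv c y)))) \<in> borel_measurable borel"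
  using is_chart_simps(2)[OF chart]
  by (intro borel_measurable_indicator_mult[of "snd c ` fst c"] sqrt_det_continuous) auto

lemma nn_integral_chart_measure:
  assumes "c \<in> A" "f \<in> borel_measurable borel"
  shows "(\<integral>\<^sup>+p. f p \<partial>chart_measure g c) =
     (\<integral>\<^sup>+y. ennreal (indicator (snd c ` fst c) y * sqrt (det (g c (chart_inv c y)))) * f (chart_inv c y) \<partial>lborel)"
proof -
  note [measurable] = chart_inv_measurable[OF chart[OF assms(1)]] assms(2) volume_density_measurable[OF assms(1)]
  show ?thesis
    unfolding chart_measure_def by (subst nn_integral_distr, measurable, subst nn_integral_density, measurable)
qed

lemma emeasure_chart_measure:
  assumes "c \<in> A" "S \<in> sets borel" "S \<subseteq> fst c"
  shows "emeasure (chart_measure g c) S = (\<integral>\<^sup>+y\<in>snd c ` S. ennreal (sqrt (det (g c (chart_inv c y)))) \<partial>lborel)"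
proof -
  have "emeasure (chart_measure g c) S = (\<integral>\<^sup>+p. indicator S p \<partial>chart_measure g c)" using assms(2) by simp
  also have "\<dots> = (\<integral>\<^sup>+y. ennreal (indicator (snd c ` fst c) y * sqrt (det (g c (chart_inv c y)))) * indicator S (chart_inv c y) \<partial>lborel)"
    using assms(2) by (intro nn_integral_chart_measure assms(1)) simp
  also have "\<dots> = (\<integral>\<^sup>+y\<in>snd c ` S. ennreal (sqrt (det (g c (chart_inv c y)))) \<partial>lborel)"
    unfolding chart_inv_image[OF chart[OF assms(1)] assms(3)]
    by (intro nn_integral_cong) (auto split: split_indicator)
  finally show ?thesis .
qed

lemma chart_measure_agree:
  assumes "c \<in> A" "d \<in> A" and S: "S \<in> sets borel" "S \<subseteq> fst c" "S \<subseteq> fst d"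
  shows "emeasure (chart_measure g c) S = emeasure (chart_measure g d) S"
proof -
  define W where "W = fst c \<inter> fst d"
  note ch = chart[OF assms(1)] chart[OF assms(2)]
  have W: "open W" "W \<subseteq> fst c" "W \<subseteq> fst d" using open_chart[OF assms(1)] open_chart[OF assms(2)] by (auto simp: W_def)
  interpret diffeo "snd c ` W" "snd d ` W" "\<lambda>y. snd d (chart_inv c y)" "\<lambda>y. snd c (chart_inv d y)"
    by (rule transition_diffeo[OF assms(1,2) W])
  define f where "f x = indicator (snd d ` S) x * ennreal (sqrt (det (g d (chart_inv d x))))" for x
  have "(\<lambda>x. ennreal (indicator (snd d ` fst d) x * sqrt (det (g d (chart_inv d x))))) \<in> borel_measurable borel"
    using volume_density_measurable[OF assms(2)] by measurable
  then have "(\<lambda>x. indicator (snd d ` S) x * ennreal (indicator (snd d ` fst d) x * sqrt (det (g d (chart_inv d x))))) \<in> borel_measurable borel"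
    using chart_image_borel[OF ch(2) S(1,3)] by measurable
  also have "(\<lambda>x. indicator (snd d ` S) x * ennreal (indicator (snd d ` fst d) x * sqrt (det (g d (chart_inv d x)))))
      = (\<lambda>x. indicator (snd d ` W) x * f x)"
    using S(2,3) by (auto simp: fun_eq_iff W_def f_def split: split_indicator)
  finally have m: "(\<lambda>x. indicator (snd d ` W) x * f x) \<in> borel_measurable borel" .
  have "emeasure (chart_measure g d) S = (\<integral>\<^sup>+x. indicator (snd d ` W) x * f x \<partial>lborel)"
    unfolding emeasure_chart_measure[OF assms(2) S(1,3)] f_def using S(2,3)
    by (intro nn_integral_cong) (auto simp: W_def split: split_indicator)
  also have "\<dots> = (\<integral>\<^sup>+y. indicator (snd c ` W) y * (ennreal \<bar>det (J y)\<bar> * f (snd d (chart_inv c y))) \<partial>lborel)"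
    by (rule nn_integral_image[OF m])
  also have "\<dots> = (\<integral>\<^sup>+y\<in>snd c ` S. ennreal (sqrt (det (g c (chart_inv c y)))) \<partial>lborel)"
  proof (intro nn_integral_cong)
    fix y
    show "indicator (snd c ` W) y * (ennreal \<bar>det (J y)\<bar> * f (snd d (chart_inv c y)))
        = ennreal (sqrt (det (g c (chart_inv c y)))) * indicator (snd c ` S) y"
    proof (cases "y \<in> snd c ` W")
      case True
      then obtain p where p: "p \<in> W" "y = snd c p" by auto
      have pc: "p \<in> fst c" "p \<in> fst d" using p W by auto
      \<comment> \<open>The law of the metric produces the square of the Jacobian determinant, and
        its root is exactly the factor from the change of variables.\<close>
      have "det (g c p) = (det (J y))\<^sup>2 * det (g d p)"
        using metric_change[OF assms(1,2) pc] by (simp add: jacobian_eq p det_mul power2_eq_square)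
      then have "sqrt (det (g c p)) = \<bar>det (J y)\<bar> * sqrt (det (g d p))" by (simp add: real_sqrt_mult)
      moreover have "snd d p \<in> snd d ` S \<longleftrightarrow> p \<in> S" "snd c p \<in> snd c ` S \<longleftrightarrow> p \<in> S"
        by (auto simp: inj_on_image_mem_iff[OF is_chart_simps(8)[OF ch(2)] pc(2) S(3)]
            inj_on_image_mem_iff[OF is_chart_simps(8)[OF ch(1)] pc(1) S(2)])
      ultimately show ?thesis
        using True p pc is_chart_simps(3)[OF ch(1)] is_chart_simps(3)[OF ch(2)] det_metric[OF assms(2) pc(2)]
        by (auto simp: f_def ennreal_mult indicator_def)
    qed (use S W_def in \<open>auto split: split_indicator\<close>)
  qed
  finally show ?thesis by (simp add: emeasure_chart_measure[OF assms(1) S(1,2)])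
qed

end

section \<open>Comparing and gluing measures along a countable cover\<close>

lemma countable_cover_nat:
  fixes \<U> :: "'a::second_countable_topology set set"
  assumes "\<And>U. U \<in> \<U> \<Longrightarrow> open U" "\<U> \<noteq> {}"
  obtains c :: "nat \<Rightarrow> 'a set" where "\<And>n. c n \<in> \<U>" "(\<Union>n. c n) = \<Union>\<U>"
proof -
  obtain \<U>' where U': "\<U>' \<subseteq> \<U>" "countable \<U>'" "\<Union>\<U>' = \<Union>\<U>" using Lindelof[of \<U>] assms(1) by metis
  obtain U0 where "U0 \<in> \<U>" using assms(2) by auto
  define \<V> where "\<V> = insert U0 \<U>'"
  have V: "\<V> \<subseteq> \<U>" "countable \<V>" "\<V> \<noteq> {}" "\<Union>\<V> = \<Union>\<U>" using U' \<open>U0 \<in> \<U>\<close> by (auto simp: \<V>_def)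
  show thesis
  proof (rule that[of "from_nat_into \<V>"])
    show "from_nat_into \<V> n \<in> \<U>" for n using from_nat_into[OF V(3)] V(1) by blast
    show "(\<Union>n. from_nat_into \<V> n) = \<Union>\<U>" using range_from_nat_into[OF V(3,2)] V(4) by simp
  qed
qed

text \<open>The cover is made countable by Lindelof and then disjoint; each piece lies in one member
  of the cover, where the two measures agree.\<close>

lemma measure_eqI_cover:
  fixes M N :: "'a::second_countable_topology measure"
  assumes "sets M = sets borel" "sets N = sets borel"
    and \<U>: "\<And>U. U \<in> \<U> \<Longrightarrow> open U"
    and eq: "\<And>U S. U \<in> \<U> \<Longrightarrow> S \<in> sets borel \<Longrightarrow> S \<subseteq> U \<Longrightarrow> emeasure M S = emeasure N S"
    and z: "emeasure M (- \<Union>\<U>) = 0" "emeasure N (- \<Union>\<U>) = 0"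
  shows "M = N"
proof -
  obtain c :: "nat \<Rightarrow> 'a set" where c: "\<And>n. c n \<in> insert {} \<U>" "(\<Union>n. c n) = \<Union>\<U>"
    using countable_cover_nat[of "insert {} \<U>"] \<U> by (metis Union_insert insert_iff insert_not_empty open_empty sup_bot_left)
  have oc: "open (c n)" for n using c(1)[of n] \<U> by auto
  define D where "D = disjointed c"
  have D: "disjoint_family D" "(\<Union>n. D n) = \<Union>\<U>" "D n \<subseteq> c n" "D n \<in> sets borel" for n
  proof -
    show "disjoint_family D" by (simp add: D_def disjoint_family_disjointed)
    show "(\<Union>n. D n) = \<Union>\<U>" by (simp add: D_def UN_disjointed_eq c(2))
    show "D n \<subseteq> c n" by (simp add: D_def disjointed_subset)
    show "D n \<in> sets borel" using oc by (auto simp: D_def disjointed_def intro!: sets.Diff sets.finite_UN)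
  qed
  have *: "emeasure K S = (\<Sum>n. emeasure K (S \<inter> D n))"
    if K: "sets K = sets borel" "emeasure K (- \<Union>\<U>) = 0" and S: "S \<in> sets borel" for K :: "'a measure" and S
  proof -
    have "open (\<Union>\<U>)" using \<U> by blast
    then have n: "- \<Union>\<U> \<in> null_sets K" using K by (intro null_setsI) auto
    have [simp]: "S - \<Union>\<U> \<in> null_sets K" by (rule null_sets_subset[OF n]) (use K S \<open>open (\<Union>\<U>)\<close> in auto)
    have "emeasure K S = emeasure K ((S \<inter> \<Union>\<U>) \<union> (S - \<Union>\<U>))" by (rule arg_cong[where f="emeasure K"]) auto
    also have "\<dots> = emeasure K (S \<inter> \<Union>\<U>)"
      using K S \<open>open (\<Union>\<U>)\<close> by (intro emeasure_Un_null_set) auto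
    also have "S \<inter> \<Union>\<U> = (\<Union>n. S \<inter> D n)" using D(2) by auto
    also have "emeasure K (\<Union>n. S \<inter> D n) = (\<Sum>n. emeasure K (S \<inter> D n))"
      using K S D by (intro suminf_emeasure[symmetric]) (auto simp: disjoint_family_on_def)
    finally show ?thesis .
  qed
  show ?thesis
  proof (rule measure_eqI)
    fix S assume "S \<in> sets M"
    then have S: "S \<in> sets borel" using assms(1) by simp
    have "emeasure M (S \<inter> D n) = emeasure N (S \<inter> D n)" for n
      using c(1)[of n] D(3)[of n] D(4)[of n] S eq[of "c n" "S \<inter> D n"] by auto
    then show "emeasure M S = emeasure N S"
      by (simp add: *[OF assms(1) z(1) S] *[OF assms(2) z(2) S])
  qed (use assms in simp)
qed

text \<open>Countable additivity is the interchange of two sums of nonnegative terms.\<close>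

lemma measure_glue:
  fixes M :: "nat \<Rightarrow> 'a::second_countable_topology measure"
  assumes "\<And>n. sets (M n) = sets borel" "\<And>n. D n \<in> sets borel"
  obtains \<mu> where "sets \<mu> = sets borel" "\<And>S. S \<in> sets borel \<Longrightarrow> emeasure \<mu> S = (\<Sum>n. emeasure (M n) (S \<inter> D n))"
proof -
  define \<mu> where "\<mu> = measure_of UNIV (sets borel) (\<lambda>S. \<Sum>n. emeasure (M n) (S \<inter> D n))"
  have sets: "sets \<mu> = sets borel" unfolding \<mu>_def by (subst sets_measure_of) (auto simp: sets.sigma_sets_eq[of borel, simplified])
  have "emeasure \<mu> S = (\<Sum>n. emeasure (M n) (S \<inter> D n))" if "S \<in> sets borel" for S
  proof (rule emeasure_measure_of[OF \<mu>_def])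
    show "positive (sets \<mu>) (\<lambda>S. \<Sum>n. emeasure (M n) (S \<inter> D n))" by (simp add: positive_def)
    show "countably_additive (sets \<mu>) (\<lambda>S. \<Sum>n. emeasure (M n) (S \<inter> D n))"
    proof (rule countably_additiveI)
      fix X :: "nat \<Rightarrow> 'a set" assume X: "range X \<subseteq> sets \<mu>" "disjoint_family X"
      have "(\<Sum>i. \<Sum>n. emeasure (M n) (X i \<inter> D n)) = (\<integral>\<^sup>+i. (\<Sum>n. emeasure (M n) (X i \<inter> D n)) \<partial>count_space UNIV)"
        by (simp add: nn_integral_count_space_nat)
      also have "\<dots> = (\<Sum>n. \<integral>\<^sup>+i. emeasure (M n) (X i \<inter> D n) \<partial>count_space UNIV)"
        by (rule nn_integral_suminf) simp
      also have "\<dots> = (\<Sum>n. \<Sum>i. emeasure (M n) (X i \<inter> D n))" by (simp add: nn_integral_count_space_nat)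
      also have "\<dots> = (\<Sum>n. emeasure (M n) ((\<Union>i. X i) \<inter> D n))"
      proof (intro suminf_cong)
        fix n
        have "(\<Sum>i. emeasure (M n) (X i \<inter> D n)) = emeasure (M n) (\<Union>i. X i \<inter> D n)"
          using X assms sets by (intro suminf_emeasure) (auto simp: disjoint_family_on_def)
        then show "(\<Sum>i. emeasure (M n) (X i \<inter> D n)) = emeasure (M n) ((\<Union>i. X i) \<inter> D n)" by simp
      qed
      finally show "(\<Sum>i. \<Sum>n. emeasure (M n) (X i \<inter> D n)) = (\<Sum>n. emeasure (M n) ((\<Union>i. X i) \<inter> D n))" .
    qed
  qed (use that sets in auto)
  with sets show thesis by (rule that)
qed

context riemannian
begin

text \<open>The condition under the definite description in \<open>riemannian_measure\<close>,
  rephrased with chart measures. The description acquires its meaning from the uniqueness and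
  existence shown next.\<close>

definition is_volume :: "'a measure \<Rightarrow> bool" where
  "is_volume \<mu> \<longleftrightarrow> sets \<mu> = sets borel \<and>
    (\<forall>c\<in>A. \<forall>S\<in>sets borel. S \<subseteq> fst c \<longrightarrow> emeasure \<mu> S = emeasure (chart_measure g c) S)"

lemma is_volume_unique: "is_volume \<mu> \<Longrightarrow> is_volume \<nu> \<Longrightarrow> \<mu> = \<nu>"
  by (rule measure_eqI_cover[where \<U>="fst ` A"]) (auto simp: is_volume_def Union_charts dest: open_chart)

text \<open>The space is cut into countably many Borel pieces, each inside one chart, and the chart
  measures are glued along them. Agreement on overlaps makes the result correct in every
  chart.\<close>

lemma is_volume_exists: "\<exists>\<mu>. is_volume \<mu>"
proof -
  have o: "open U" if "U \<in> fst ` A" for U using that open_chart by blast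
  have ne: "fst ` A \<noteq> {}" using Union_charts by fastforce
  obtain W :: "nat \<Rightarrow> 'a set" where W: "\<And>n. W n \<in> fst ` A" "(\<Union>n. W n) = \<Union>(fst ` A)"
    by (rule countable_cover_nat[of "fst ` A", OF _ ne]) (erule o, rule that)
  have "\<forall>n. \<exists>c. c \<in> A \<and> W n = fst c" using W(1) by blast
  from choice[OF this] obtain c where c: "\<And>n. c n \<in> A" "\<And>n. W n = fst (c n)" by blast
  define D where "D = disjointed W"
  have oW: "open (W n)" for n using c is_chart_simps(1)[OF chart] by simp
  have D: "disjoint_family D" "(\<Union>n. D n) = UNIV" "D n \<subseteq> fst (c n)" "D n \<in> sets borel" for n
  proof -
    show "disjoint_family D" by (simp add: D_def disjoint_family_disjointed)
    show "(\<Union>n. D n) = UNIV" by (simp only: D_def UN_disjointed_eq W(2) Union_charts)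
    show "D n \<subseteq> fst (c n)" by (simp add: D_def disjointed_subset c(2)[symmetric])
    show "D n \<in> sets borel" using oW by (auto simp: D_def disjointed_def intro!: sets.Diff sets.finite_UN)
  qed
  obtain \<mu> where \<mu>: "sets \<mu> = sets borel"
      "\<And>S. S \<in> sets borel \<Longrightarrow> emeasure \<mu> S = (\<Sum>n. emeasure (chart_measure g (c n)) (S \<inter> D n))"
    using measure_glue[of "\<lambda>n. chart_measure g (c n)" D] D(4) by auto
  have "emeasure \<mu> S = emeasure (chart_measure g d) S" if "d \<in> A" "S \<in> sets borel" "S \<subseteq> fst d" for d S
  proof -
    have "emeasure \<mu> S = (\<Sum>n. emeasure (chart_measure g d) (S \<inter> D n))"
      unfolding \<mu>(2)[OF that(2)] using that D(3,4) c(1)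
      by (intro suminf_cong chart_measure_agree) auto
    also have "\<dots> = emeasure (chart_measure g d) (\<Union>n. S \<inter> D n)"
      using that D(1,4) by (intro suminf_emeasure) (auto simp: disjoint_family_on_def)
    also have "(\<Union>n. S \<inter> D n) = S" using D(2) by auto
    finally show ?thesis .
  qed
  with \<mu>(1) show ?thesis by (auto simp: is_volume_def)
qed

abbreviation "vol \<equiv> riemannian_measure A g"

lemma is_volume_iff: "is_volume \<mu> \<longleftrightarrow> sets \<mu> = sets borel \<and>
        (\<forall>c\<in>A. \<forall>S\<in>sets borel. S \<subseteq> fst c \<longrightarrow>
           emeasure \<mu> S = (\<integral>\<^sup>+y\<in>snd c ` S. ennreal (sqrt (det (g c (chart_inv c y)))) \<partial>lborel))"
  unfolding is_volume_def using emeasure_chart_measure by auto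

lemma is_volume_vol: "is_volume vol"
  unfolding riemannian_measure_def is_volume_iff[symmetric]
  using is_volume_exists is_volume_unique by (metis theI')

lemma vol_eqI: "is_volume \<mu> \<Longrightarrow> vol = \<mu>"
  using is_volume_vol is_volume_unique by blast

lemma sets_vol [simp, measurable_cong]: "sets vol = sets borel"
  and space_vol [simp]: "space vol = UNIV"
  and emeasure_vol: "c \<in> A \<Longrightarrow> S \<in> sets borel \<Longrightarrow> S \<subseteq> fst c \<Longrightarrow> emeasure vol S = emeasure (chart_measure g c) S"
proof -
  show "sets vol = sets borel" using is_volume_vol by (simp add: is_volume_def)
  from sets_eq_imp_space_eq[OF this] show "space vol = UNIV" by simp
  show "c \<in> A \<Longrightarrow> S \<in> sets borel \<Longrightarrow> S \<subseteq> fst c \<Longrightarrow> emeasure vol S = emeasure (chart_measure g c) S"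
    using is_volume_vol by (simp add: is_volume_def)
qed

lemma vol_chart: assumes "c \<in> A" shows "density vol (indicator (fst c)) = chart_measure g c"
proof (rule measure_eqI)
  fix S assume "S \<in> sets (density vol (indicator (fst c)))"
  then have S: "S \<in> sets borel" by simp
  have o: "fst c \<in> sets borel" using is_chart_simps(1)[OF chart[OF assms]] by simp
  have "emeasure (density vol (indicator (fst c))) S = emeasure vol (fst c \<inter> S)"
    using S o by (subst emeasure_density) (auto simp: indicator_inter_arith[symmetric])
  also have "\<dots> = emeasure (chart_measure g c) (fst c \<inter> S)" using S o assms by (intro emeasure_vol) auto
  also have "\<dots> = (\<integral>\<^sup>+p. indicator (fst c \<inter> S) p \<partial>chart_measure g c)" using S o by simp
  also have "\<dots> = (\<integral>\<^sup>+p. indicator S p \<partial>chart_measure g c)"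
  proof (subst (1 2) nn_integral_chart_measure[OF assms])
    show "(\<integral>\<^sup>+y. ennreal (indicator (snd c ` fst c) y * sqrt (det (g c (chart_inv c y)))) * indicator (fst c \<inter> S) (chart_inv c y) \<partial>lborel)
      = (\<integral>\<^sup>+y. ennreal (indicator (snd c ` fst c) y * sqrt (det (g c (chart_inv c y)))) * indicator S (chart_inv c y) \<partial>lborel)"
      using is_chart_simps(5)[OF chart[OF assms]] by (intro nn_integral_cong) (auto split: split_indicator)
  qed (use S o in auto)
  also have "\<dots> = emeasure (chart_measure g c) S" using S by simp
  finally show "emeasure (density vol (indicator (fst c))) S = emeasure (chart_measure g c) S" .
qed simp

lemma nn_integral_chart:
  assumes "c \<in> A" "f \<in> borel_measurable borel"
  shows "(\<integral>\<^sup>+p. indicator (fst c) p * f p \<partial>vol) =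
     (\<integral>\<^sup>+y. ennreal (indicator (snd c ` fst c) y * sqrt (det (g c (chart_inv c y)))) * f (chart_inv c y) \<partial>lborel)"
proof -
  have "(\<integral>\<^sup>+p. indicator (fst c) p * f p \<partial>vol) = (\<integral>\<^sup>+p. f p \<partial>density vol (indicator (fst c)))"
    using assms(2) open_chart[OF assms(1)] by (subst nn_integral_density) (auto simp: measurable_cong_sets[OF sets_vol refl])
  then show ?thesis by (simp add: vol_chart[OF assms(1)] nn_integral_chart_measure[OF assms])
qed

text \<open>The density is bounded on a closed coordinate ball, so every point has a neighbourhood
  of finite volume, and finitely many of these cover a compact set.\<close>

lemma vol_compact_finite: assumes "compact K" shows "emeasure vol K < \<infinity>"
proof -
  have "\<exists>W. open W \<and> p \<in> W \<and> emeasure vol W < \<infinity>" for p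
  proof -
    define c where "c = chart_at A p"
    have c: "c \<in> A" "p \<in> fst c" using chart_at by (auto simp: c_def)
    note ch = is_chart_simps[OF chart[OF c(1)]]
    obtain r where r: "r > 0" "cball (snd c p) r \<subseteq> snd c ` fst c"
      using ch(2) c(2) by (metis imageI open_contains_cball)
    define W where "W = fst c \<inter> snd c -` ball (snd c p) r"
    have "open W" unfolding W_def using ch(1,6) by (simp add: continuous_on_open_vimage Int_commute)
    have im: "snd c ` W \<subseteq> cball (snd c p) r" by (auto simp: W_def less_imp_le)
    have "compact ((\<lambda>y. sqrt (det (g c (chart_inv c y)))) ` cball (snd c p) r)"
      by (intro compact_continuous_image continuous_on_subset[OF sqrt_det_continuous[OF c(1)] r(2)]) simp
    then obtain B where B: "\<And>y. y \<in> cball (snd c p) r \<Longrightarrow> sqrt (det (g c (chart_inv c y))) \<le> B"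
      by (meson bounded_imp_bdd_above bdd_above.E compact_imp_bounded imageI)
    have "emeasure vol W = (\<integral>\<^sup>+y\<in>snd c ` W. ennreal (sqrt (det (g c (chart_inv c y)))) \<partial>lborel)"
      using \<open>open W\<close> c by (subst emeasure_vol[OF c(1)], auto simp: W_def) (subst emeasure_chart_measure[OF c(1)], auto)
    also have "\<dots> \<le> (\<integral>\<^sup>+y. ennreal B * indicator (cball (snd c p) r) y \<partial>lborel)"
      using im B by (intro nn_integral_mono) (auto split: split_indicator intro!: ennreal_leI)
    also have "\<dots> = ennreal B * emeasure lborel (cball (snd c p) r)" by (simp add: nn_integral_cmult_indicator)
    also have "\<dots> < \<infinity>" using emeasure_bounded_finite[of "cball (snd c p) r"] by (simp add: ennreal_mult_less_top)
    finally show ?thesis using \<open>open W\<close> c r by (intro exI[of _ W]) (auto simp: W_def)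
  qed
  then obtain W where W: "\<And>p. open (W p)" "\<And>p. p \<in> W p" "\<And>p. emeasure vol (W p) < \<infinity>" by metis
  obtain F where F: "finite F" "K \<subseteq> (\<Union>p\<in>F. W p)"
    using compactE_image[OF assms, of UNIV W] W by (metis UNIV_I UN_iff subsetI)
  have "emeasure vol K \<le> emeasure vol (\<Union>p\<in>F. W p)" using F W(1) by (intro emeasure_mono) auto
  also have "\<dots> \<le> (\<Sum>p\<in>F. emeasure vol (W p))" using W(1) F(1) by (intro emeasure_subadditive_finite) auto
  also have "\<dots> < \<infinity>"     using F(1) by (induction F rule: finite_induct) (use W(3) in \<open>auto simp: ennreal_add_less_top\<close>)
  finally show ?thesis .
qed

text \<open>\<open>scalar_curvature\<close> uses an arbitrarily chosen chart at each point;
  invariance under transition maps frees it from that choice. Continuity in \<open>p\<close> becomes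
  accessible only through this.\<close>

theorem scalar_curvature_chart:
  assumes "c \<in> A" "p \<in> fst c"
  shows "scalar_curvature A g p = scalar_curvature_coord (\<lambda>y. g c (chart_inv c y)) (snd c p)"
proof -
  define d where "d = chart_at A p"
  have d: "d \<in> A" "p \<in> fst d" using chart_at by (auto simp: d_def)
  define W where "W = fst c \<inter> fst d"
  have W: "open W" "W \<subseteq> fst c" "W \<subseteq> fst d"
    using open_chart[OF assms(1)] open_chart[OF d(1)] by (auto simp: W_def)
  let ?F = "\<lambda>y. snd c (chart_inv d y)"
  interpret dc: diffeo "snd d ` W" "snd c ` W" ?F "\<lambda>y. snd d (chart_inv c y)"
    by (rule transition_diffeo[OF d(1) assms(1) W(1,3,2)])
  have inv: "chart_inv c (?F y) = chart_inv d y" "chart_inv d y \<in> W" "snd d (chart_inv d y) = y" if "y \<in> snd d ` W" for y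
    using that is_chart_simps(3)[OF chart[OF assms(1)]] is_chart_simps(3)[OF chart[OF d(1)]] W by (auto simp: subset_iff)
  interpret metric_change "snd c ` fst c" "\<lambda>y. g c (chart_inv c y)" "snd d ` W" ?F "\<lambda>y. g d (chart_inv d y)"
    "\<lambda>y. matrix (frechet_derivative ?F (at y))"
  proof (rule metric_change.intro)
    show "metric_coords (snd c ` fst c) (\<lambda>y. g c (chart_inv c y))" by (rule metric_coords[OF assms(1)])
    show "?F ` snd d ` W \<subseteq> snd c ` fst c" by (rule order.trans[OF dc.FU image_mono[OF W(2)]])
    show "det (matrix (frechet_derivative ?F (at y))) \<noteq> 0" if "y \<in> snd d ` W" for y
      using dc.det_J[OF that] by (simp add: jacobian_def)
    show "g d (chart_inv d y) = transpose (matrix (frechet_derivative ?F (at y))) ** g c (chart_inv c (?F y)) ** matrix (frechet_derivative ?F (at y))"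
      if "y \<in> snd d ` W" for y
      using metric_change[OF d(1) assms(1), of "chart_inv d y"] inv[OF that] W
      by (auto simp: transition_jacobian_def o_def)
  qed (rule dc.openU dc.smoothF refl)+
  have "snd d p \<in> snd d ` W" using assms d by (auto simp: W_def)
  from scalar_curvature_coord_change[OF this] show ?thesis
    using is_chart_simps(3)[OF chart[OF d(1)] d(2)] by (simp add: scalar_curvature_def Let_def d_def[symmetric])
qed

lemma continuous_scalar_curvature: "continuous_on UNIV (scalar_curvature A g)"
proof (intro continuous_at_imp_continuous_on ballI)
  fix p
  obtain c where c: "c \<in> A" "p \<in> fst c" using chart_exists by metis
  note ch = is_chart_simps[OF chart[OF c(1)]]
  interpret metric_coords "snd c ` fst c" "\<lambda>y. g c (chart_inv c y)" by (rule metric_coords[OF c(1)])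
  have "smooth_on (snd c ` fst c) (scalar_curvature_coord (\<lambda>y. g c (chart_inv c y)))"
    unfolding scalar_curvature_coord_def[abs_def] ricci_def
    by (intro smooth_on_sum smooth_on_mult smooth_on_matrix_inv smoothGc det openV smooth_on_add smooth_on_diff
        smooth_on_partial smooth_christoffel)
  from smooth_on_continuous[OF this]
  have "continuous_on (fst c) (\<lambda>p. scalar_curvature_coord (\<lambda>y. g c (chart_inv c y)) (snd c p))"
    by (rule continuous_on_compose2[OF _ ch(6)]) auto
  then have "continuous_on (fst c) (scalar_curvature A g)"
    by (rule continuous_on_eq) (simp add: scalar_curvature_chart[OF c(1)])
  then show "isCont (scalar_curvature A g) p"
    using ch(1) c(2) continuous_on_eq_continuous_at by blast
qed

end

section \<open>Weak gradients\<close>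

lemma smooth_on_zero: "open V \<Longrightarrow> (\<And>y. y \<in> V \<Longrightarrow> f y = 0) \<Longrightarrow> smooth_on V f"
  using smooth_on_cong[of V f "\<lambda>_. 0"] by simp

lemma partial_eq_0:
  assumes "y \<notin> closure {y. \<psi> y \<noteq> 0}" shows "partial i \<psi> y = 0"
proof -
  have "(\<psi> has_derivative (\<lambda>_. 0)) (at y)"
  proof (rule has_derivative_transform_within_open[OF has_derivative_const])
    show "open (- closure {y. \<psi> y \<noteq> 0})" "y \<in> - closure {y. \<psi> y \<noteq> 0}" using assms by auto
    show "0 = \<psi> z" if "z \<in> - closure {y. \<psi> y \<noteq> 0}" for z using that closure_subset[of "{y. \<psi> y \<noteq> 0}"] by auto
  qed
  then show ?thesis by (simp add: partial_eqI)
qed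

lemma support_0: "y \<notin> closure {y. \<psi> y \<noteq> 0} \<Longrightarrow> \<psi> y = 0"
  using closure_subset[of "{y. \<psi> y \<noteq> 0}"] by auto

lemma test_functionD:
  assumes "test_function V \<psi>"
  shows "smooth_on UNIV \<psi>" "compact (closure {y. \<psi> y \<noteq> 0})" "closure {y. \<psi> y \<noteq> 0} \<subseteq> V"
    "continuous_on UNIV \<psi>" "continuous_on UNIV (partial i \<psi>)" "\<psi> differentiable (at y)"
  using assms smooth_on_continuous[OF smooth_on_partial[OF open_UNIV]] smooth_on_continuous[of UNIV] smooth_on_differentiable[of UNIV]
  by (auto simp: test_function_def)

lemma test_functionI:
  assumes "smooth_on UNIV \<psi>" "compact K" "K \<subseteq> V" "\<And>y. y \<notin> K \<Longrightarrow> \<psi> y = 0"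
  shows "test_function V \<psi>"
proof -
  have "closure {y. \<psi> y \<noteq> 0} \<subseteq> K" using assms(2,4) by (intro closure_minimal compact_imp_closed) auto
  moreover from this have "compact (closure {y. \<psi> y \<noteq> 0})"
    using assms(2) by (metis closed_closure compact_Int_closed inf.absorb_iff2)
  ultimately show ?thesis using assms by (auto simp: test_function_def)
qed

lemma test_function_bump: "r > 0 \<Longrightarrow> k > 0 \<Longrightarrow> cball x r \<subseteq> V \<Longrightarrow> test_function V (bump k x r)"
  using smooth_on_bump[of k x r] bump_support[of k r x] by (simp add: test_function_def)

lemma continuous_compact_support_bounded:
  fixes \<phi> :: "'a::euclidean_space \<Rightarrow> real"
  assumes "continuous_on UNIV \<phi>" "compact K" "\<And>y. y \<notin> K \<Longrightarrow> \<phi> y = 0"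
  obtains B where "B \<ge> 0" "\<And>y. \<bar>\<phi> y\<bar> \<le> B"
proof -
  have "bounded (\<phi> ` K)"
    by (intro compact_imp_bounded compact_continuous_image continuous_on_subset[OF assms(1)] assms) auto
  then obtain B where B: "\<And>y. y \<in> K \<Longrightarrow> \<bar>\<phi> y\<bar> \<le> B" by (auto simp: bounded_iff)
  have "\<bar>\<phi> y\<bar> \<le> max B 0" for y using B[of y] assms(3)[of y] by (cases "y \<in> K") auto
  then show thesis by (rule that[rotated]) simp
qed

lemma integrable_times_continuous:
  fixes f \<phi> :: "'a::euclidean_space \<Rightarrow> real"
  assumes "set_integrable lborel K f" "continuous_on UNIV \<phi>" "compact K" "\<And>y. y \<notin> K \<Longrightarrow> \<phi> y = 0"
  shows "integrable lborel (\<lambda>y. f y * \<phi> y)"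
proof -
  obtain B where B: "B \<ge> 0" "\<And>y. \<bar>\<phi> y\<bar> \<le> B" by (rule continuous_compact_support_bounded[OF assms(2-4)]) (assumption, rule that)
  have i: "integrable lborel (\<lambda>y. indicator K y *\<^sub>R f y)" using assms(1) by (simp add: set_integrable_def)
  have [measurable]: "\<phi> \<in> borel_measurable borel" using assms(2) by (rule borel_measurable_continuous_onI)
  have e: "(\<lambda>y. (indicator K y *\<^sub>R f y) * \<phi> y) = (\<lambda>y. f y * \<phi> y)"
    using assms(4) by (auto simp: fun_eq_iff split: split_indicator)
  have "integrable lborel (\<lambda>y. (indicator K y *\<^sub>R f y) * \<phi> y)"
  proof (rule Bochner_Integration.integrable_bound)
    show "integrable lborel (\<lambda>y. B * (indicator K y *\<^sub>R f y))" using i by simp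
    show "(\<lambda>y. (indicator K y *\<^sub>R f y) * \<phi> y) \<in> borel_measurable lborel"
      using i by (intro borel_measurable_times) auto
    show "AE y in lborel. norm ((indicator K y *\<^sub>R f y) * \<phi> y) \<le> norm (B * (indicator K y *\<^sub>R f y))"
    proof (rule AE_I2)
      fix y
      have "\<bar>indicator K y * f y\<bar> * \<bar>\<phi> y\<bar> \<le> \<bar>indicator K y * f y\<bar> * B" by (intro mult_left_mono B) simp
      then show "norm ((indicator K y *\<^sub>R f y) * \<phi> y) \<le> norm (B * (indicator K y *\<^sub>R f y))"
        using B(1) by (simp add: abs_mult mult_ac)
    qed
  qed
  then show ?thesis unfolding e .
qed

lemma set_integrable_mult_continuous:
  fixes f \<phi> :: "'a::euclidean_space \<Rightarrow> real"
  assumes K: "compact K" and f: "set_integrable lborel K f" and \<phi>: "continuous_on K \<phi>"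
  shows "set_integrable lborel K (\<lambda>y. \<phi> y * f y)"
proof -
  have "bounded (\<phi> ` K)" by (intro compact_imp_bounded compact_continuous_image \<phi> K)
  then obtain B where B: "\<And>y. y \<in> K \<Longrightarrow> \<bar>\<phi> y\<bar> \<le> B" by (auto simp: bounded_iff)
  have i: "integrable lborel (\<lambda>y. indicator K y *\<^sub>R f y)" using f by (simp add: set_integrable_def)
  have m: "(\<lambda>y. indicator K y *\<^sub>R \<phi> y) \<in> borel_measurable borel"
    using compact_imp_closed[OF K] by (intro borel_measurable_continuous_on_indicator \<phi>) simp
  have e: "(\<lambda>y. (indicator K y *\<^sub>R \<phi> y) * (indicator K y *\<^sub>R f y)) = (\<lambda>y. indicator K y *\<^sub>R (\<phi> y * f y))"
    by (auto simp: fun_eq_iff split: split_indicator)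
  have "integrable lborel (\<lambda>y. (indicator K y *\<^sub>R \<phi> y) * (indicator K y *\<^sub>R f y))"
  proof (rule Bochner_Integration.integrable_bound)
    show "integrable lborel (\<lambda>y. B * (indicator K y *\<^sub>R f y))" using i by simp
    show "(\<lambda>y. (indicator K y *\<^sub>R \<phi> y) * (indicator K y *\<^sub>R f y)) \<in> borel_measurable lborel"
      using i m by (intro borel_measurable_times) auto
    show "AE y in lborel. norm ((indicator K y *\<^sub>R \<phi> y) * (indicator K y *\<^sub>R f y)) \<le> norm (B * (indicator K y *\<^sub>R f y))"
    proof (rule AE_I2)
      fix y
      show "norm ((indicator K y *\<^sub>R \<phi> y) * (indicator K y *\<^sub>R f y)) \<le> norm (B * (indicator K y *\<^sub>R f y))"
      proof (cases "y \<in> K")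
        case True
        with B[OF True] show ?thesis by (simp add: abs_mult mult_right_mono)
      qed simp
    qed
  qed
  then show ?thesis unfolding e set_integrable_def .
qed

lemma set_integrable_compact_continuous:
  fixes \<phi> :: "'a::euclidean_space \<Rightarrow> real"
  assumes "continuous_on K \<phi>" "compact K" shows "set_integrable lborel K \<phi>"
  using borel_integrable_compact[OF assms(2,1)] by (simp add: set_integrable_def)

lemma integrable_compact_support:
  fixes \<phi> :: "'a::euclidean_space \<Rightarrow> real"
  assumes "continuous_on UNIV \<phi>" "compact K" "\<And>y. y \<notin> K \<Longrightarrow> \<phi> y = 0"
  shows "integrable lborel \<phi>"
  using integrable_times_continuous[OF set_integrable_compact_continuous[OF continuous_on_const assms(2), of 1] assms] by simp

lemma set_integrable_vec:
  fixes D :: "'a \<Rightarrow> real^'n"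
  shows "set_integrable M K D \<longleftrightarrow> (\<forall>i. set_integrable M K (\<lambda>y. D y $ i))"
proof
  assume "set_integrable M K D"
  then show "\<forall>i. set_integrable M K (\<lambda>y. D y $ i)"
    unfolding set_integrable_def using integrable_bounded_linear[OF bounded_linear_vec_nth] by fastforce
next
  assume "\<forall>i. set_integrable M K (\<lambda>y. D y $ i)"
  then have "integrable M (\<lambda>y. \<Sum>i\<in>UNIV. (indicator K y *\<^sub>R (D y $ i)) *\<^sub>R (axis i 1 :: real^'n))"
    unfolding set_integrable_def by (intro Bochner_Integration.integrable_sum integrable_scaleR_left) auto
  moreover have "(\<Sum>i\<in>UNIV. (indicator K y *\<^sub>R (D y $ i)) *\<^sub>R (axis i 1 :: real^'n)) = indicator K y *\<^sub>R D y" for y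
    by (simp add: vec_eq_iff axis_def if_distrib cong: if_cong)
  ultimately show "set_integrable M K D" by (simp add: set_integrable_def)
qed

lemma weak_gradient_onI:
  assumes "\<And>K. compact K \<Longrightarrow> K \<subseteq> V \<Longrightarrow> set_integrable lborel K f"
    "\<And>K i. compact K \<Longrightarrow> K \<subseteq> V \<Longrightarrow> set_integrable lborel K (\<lambda>y. D y $ i)"
    "\<And>\<psi> i. test_function V \<psi> \<Longrightarrow> (LINT y|lborel. f y * partial i \<psi> y) = - (LINT y|lborel. D y $ i * \<psi> y)"
  shows "weak_gradient_on V f D"
  using assms unfolding weak_gradient_on_def set_integrable_vec by blast

lemma weak_gradient_onD:
  assumes "weak_gradient_on V f D"
  shows "compact K \<Longrightarrow> K \<subseteq> V \<Longrightarrow> set_integrable lborel K f"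
    "compact K \<Longrightarrow> K \<subseteq> V \<Longrightarrow> set_integrable lborel K (\<lambda>y. D y $ i)"
    "test_function V \<psi> \<Longrightarrow> (LINT y|lborel. f y * partial i \<psi> y) = - (LINT y|lborel. D y $ i * \<psi> y)"
    "test_function V \<psi> \<Longrightarrow> integrable lborel (\<lambda>y. f y * partial i \<psi> y)"
    "test_function V \<psi> \<Longrightarrow> integrable lborel (\<lambda>y. D y $ i * \<psi> y)"
proof -
  show 1: "compact K \<Longrightarrow> K \<subseteq> V \<Longrightarrow> set_integrable lborel K f" for K
    using assms unfolding weak_gradient_on_def by blast
  show 2: "compact K \<Longrightarrow> K \<subseteq> V \<Longrightarrow> set_integrable lborel K (\<lambda>y. D y $ i)" for K
    using assms unfolding weak_gradient_on_def set_integrable_vec by blast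
  show "test_function V \<psi> \<Longrightarrow> (LINT y|lborel. f y * partial i \<psi> y) = - (LINT y|lborel. D y $ i * \<psi> y)"
    using assms unfolding weak_gradient_on_def by blast
  assume \<psi>: "test_function V \<psi>"
  note t = test_functionD[OF \<psi>]
  show "integrable lborel (\<lambda>y. f y * partial i \<psi> y)"
    by (rule integrable_times_continuous[OF 1[OF t(2,3)] t(5) t(2)]) (rule partial_eq_0)
  show "integrable lborel (\<lambda>y. D y $ i * \<psi> y)"
    by (rule integrable_times_continuous[OF 2[OF t(2,3)] t(4) t(2)]) (rule support_0)
qed

lemma weak_gradient_on_subset: "weak_gradient_on V f D \<Longrightarrow> U \<subseteq> V \<Longrightarrow> weak_gradient_on U f D"
  unfolding weak_gradient_on_def test_function_def by blast

lemma weak_gradient_on_cong: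
  assumes "\<And>y. y \<in> V \<Longrightarrow> f y = f' y" "\<And>y. y \<in> V \<Longrightarrow> D y = D' y" "weak_gradient_on V f D"
  shows "weak_gradient_on V f' D'"
proof (rule weak_gradient_onI)
  note w = weak_gradient_onD[OF assms(3)]
  show "set_integrable lborel K f'" if "compact K" "K \<subseteq> V" for K
    using w(1)[OF that] assms(1) that unfolding set_integrable_def
    by (rule_tac iffD1[OF Bochner_Integration.integrable_cong[OF refl]]) (auto split: split_indicator)
  show "set_integrable lborel K (\<lambda>y. D' y $ i)" if "compact K" "K \<subseteq> V" for K i
    using w(2)[OF that, of i] assms(2) that unfolding set_integrable_def
    by (rule_tac iffD1[OF Bochner_Integration.integrable_cong[OF refl]]) (auto split: split_indicator)
  fix \<psi> i assume \<psi>: "test_function V \<psi>"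
  have e: "f y * partial i \<psi> y = f' y * partial i \<psi> y" "D y $ i * \<psi> y = D' y $ i * \<psi> y" for y
  proof -
    have "y \<in> V \<or> partial i \<psi> y = 0 \<and> \<psi> y = 0"
      using partial_eq_0[of y \<psi> i] support_0[of y \<psi>] test_functionD(3)[OF \<psi>] by blast
    then show "f y * partial i \<psi> y = f' y * partial i \<psi> y" "D y $ i * \<psi> y = D' y $ i * \<psi> y"
      using assms(1,2)[of y] by auto
  qed
  show "(LINT y|lborel. f' y * partial i \<psi> y) = - (LINT y|lborel. D' y $ i * \<psi> y)"
    by (simp only: e[symmetric] w(3)[OF \<psi>])
qed

lemma finite_ball_cover:
  fixes K :: "'a::euclidean_space set"
  assumes "compact K" "\<And>y. y \<in> K \<Longrightarrow> r y > 0"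
  obtains F where "finite F" "F \<subseteq> K" "K \<subseteq> (\<Union>y\<in>F. ball y (r y))"
proof -
  have "K \<subseteq> (\<Union>y\<in>K. ball y (r y))" using assms(2) by force
  from compactE_image[OF assms(1) _ this] obtain C where "C \<subseteq> K" "finite C" "K \<subseteq> (\<Union>y\<in>C. ball y (r y))"
    by (metis open_ball)
  then show thesis using that[of C] by simp
qed

text \<open>A partition of unity splits a test function into finitely many pieces supported in small
  balls, on each of which the identity is known.\<close>

lemma weak_gradient_on_local:
  fixes V :: "(real^'n) set"
  assumes loc: "\<And>y. y \<in> V \<Longrightarrow> \<exists>U. open U \<and> y \<in> U \<and> weak_gradient_on U f D"
  shows "weak_gradient_on V f D"
proof -
  have "\<exists>r>0. weak_gradient_on (cball y r) f D" if y: "y \<in> V" for y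
  proof -
    obtain U where U: "open U" "y \<in> U" "weak_gradient_on U f D" using loc[OF y] by blast
    then obtain r where "r > 0" "cball y r \<subseteq> U" by (metis open_contains_cball)
    with U show ?thesis using weak_gradient_on_subset by blast
  qed
  then obtain r where r: "\<And>y. y \<in> V \<Longrightarrow> r y > 0" "\<And>y. y \<in> V \<Longrightarrow> weak_gradient_on (cball y (r y)) f D" by metis
  have integr: "set_integrable lborel K h"
    if K: "compact K" "K \<subseteq> V" and h: "\<And>y. y \<in> V \<Longrightarrow> set_integrable lborel (cball y (r y)) h" for K and h :: "_ \<Rightarrow> real"
  proof -
    obtain F where F: "finite F" "F \<subseteq> K" "K \<subseteq> (\<Union>y\<in>F. ball y (r y))"
      by (rule finite_ball_cover[OF K(1), of r]) (use r K in auto)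
    have "set_integrable lborel (\<Union>y\<in>F. cball y (r y)) h"
      using F K h by (intro set_integrable_UN) auto
    then show ?thesis
    proof (rule set_integrable_subset)
      show "K \<in> sets lborel" using compact_imp_closed[OF K(1)] by simp
      show "K \<subseteq> (\<Union>y\<in>F. cball y (r y))" using F(3) ball_subset_cball by force
    qed
  qed
  show ?thesis
  proof (rule weak_gradient_onI)
    show "set_integrable lborel K f" if "compact K" "K \<subseteq> V" for K
      by (rule integr[OF that weak_gradient_onD(1)[OF r(2) compact_cball order.refl]])
    show "set_integrable lborel K (\<lambda>y. D y $ i)" if "compact K" "K \<subseteq> V" for K i
      by (rule integr[OF that weak_gradient_onD(2)[OF r(2) compact_cball order.refl]])
    fix \<psi> :: "real^'n \<Rightarrow> real" and i assume \<psi>: "test_function V \<psi>"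
    note t = test_functionD[OF \<psi>]
    let ?K = "closure {y. \<psi> y \<noteq> 0}"
    obtain F where F: "finite F" "F \<subseteq> ?K" "?K \<subseteq> (\<Union>y\<in>F. ball y (r y))"
      by (rule finite_ball_cover[OF t(2), of r]) (use r t(3) in auto)
    have FV: "r z > 0" "weak_gradient_on (cball z (r z)) f D" if "z \<in> F" for z using that F(2) t(3) r by auto
    define S where "S y = (\<Sum>z\<in>F. bump 1 z (r z) y)" for y
    \<comment> \<open>Each bump is divided by the sum \<open>S\<close>. That sum is positive on the
      union of the balls; elsewhere \<open>\<psi>\<close> vanishes, so the quotient is 0 whatever
      \<open>S\<close> is.\<close>
    define \<Psi> where "\<Psi> z y = \<psi> y * bump 1 z (r z) y / S y" for z y
    have Spos: "S y > 0" if y: "y \<in> (\<Union>z\<in>F. ball z (r z))" for y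
    proof -
      obtain z where "z \<in> F" "dist z y < r z" using y by auto
      then show ?thesis unfolding S_def using F(1) FV bump_pos_iff[of 1 "r z" z y]
        by (intro sum_pos2[of F z]) (auto simp: bump_nonneg)
    qed
    have \<Psi>: "test_function (cball z (r z)) (\<Psi> z)" if z: "z \<in> F" for z
    proof (rule test_functionI[OF _ compact_cball order.refl])
      show "smooth_on UNIV (\<Psi> z)"
      proof (rule smooth_on_local)
        fix y
        have o: "open (\<Union>z\<in>F. ball z (r z))" by auto
        have "smooth_on (\<Union>z\<in>F. ball z (r z)) (\<Psi> z)"
          unfolding \<Psi>_def[abs_def] S_def
        proof (intro smooth_on_divide smooth_on_mult smooth_on_sum o)
          show "smooth_on (\<Union>z\<in>F. ball z (r z)) \<psi>" using t(1) by (rule smooth_on_subset) simp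
          show "smooth_on (\<Union>z\<in>F. ball z (r z)) (bump 1 z (r z))" for z by (rule smooth_on_subset[OF smooth_on_bump]) simp
          then show "smooth_on (\<Union>z\<in>F. ball z (r z)) (bump 1 z (r z))" for z .
          show "(\<Sum>z\<in>F. bump 1 z (r z) y) \<noteq> 0" if "y \<in> (\<Union>z\<in>F. ball z (r z))" for y using Spos[OF that] by (simp add: S_def)
        qed
        moreover have "smooth_on (- ?K) (\<Psi> z)"
        proof (rule smooth_on_zero)
          fix y assume "y \<in> - ?K"
          then have "\<psi> y = 0" by (intro support_0) blast
          then show "\<Psi> z y = 0" unfolding \<Psi>_def by simp
        qed auto
        ultimately show "\<exists>U. open U \<and> y \<in> U \<and> smooth_on U (\<Psi> z)"
          using o F(3) by (cases "y \<in> ?K") (blast, meson ComplI closed_closure open_Compl)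
      qed
      show "\<Psi> z y = 0" if "y \<notin> cball z (r z)" for y
        using that bump_pos_iff[of 1 "r z" z y] FV[OF z] bump_nonneg[of 1 z "r z" y] by (simp add: \<Psi>_def)
    qed
    have sum: "\<psi> = (\<lambda>y. \<Sum>z\<in>F. \<Psi> z y)"
    proof
      fix y show "\<psi> y = (\<Sum>z\<in>F. \<Psi> z y)"
      proof (cases "y \<in> ?K")
        case True
        then have "S y \<noteq> 0" using Spos[OF subsetD[OF F(3)]] by fastforce
        moreover have "(\<Sum>z\<in>F. \<Psi> z y) = \<psi> y * S y / S y"
          by (simp add: \<Psi>_def S_def sum_distrib_left sum_divide_distrib)
        ultimately show ?thesis by simp
      next
        case False
        then have "\<psi> y = 0" by (rule support_0)
        then show ?thesis unfolding \<Psi>_def by simp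
      qed
    qed
    have p: "partial i \<psi> y = (\<Sum>z\<in>F. partial i (\<Psi> z) y)" for y
      by (subst sum, rule partial_sum) (use \<Psi> test_functionD(6) in blast)
    have "(LINT y|lborel. f y * partial i \<psi> y) = (LINT y|lborel. (\<Sum>z\<in>F. f y * partial i (\<Psi> z) y))"
      by (simp add: p sum_distrib_left)
    also have "\<dots> = (\<Sum>z\<in>F. LINT y|lborel. f y * partial i (\<Psi> z) y)"
      by (rule Bochner_Integration.integral_sum) (use FV \<Psi> weak_gradient_onD(4) in blast)
    also have "\<dots> = (\<Sum>z\<in>F. - (LINT y|lborel. D y $ i * \<Psi> z y))"
      by (rule sum.cong[OF refl]) (use FV \<Psi> weak_gradient_onD(3) in blast)
    also have "\<dots> = - (\<Sum>z\<in>F. (LINT y|lborel. D y $ i * \<Psi> z y))" by (rule sum_negf)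
    also have "(\<Sum>z\<in>F. (LINT y|lborel. D y $ i * \<Psi> z y)) = (LINT y|lborel. (\<Sum>z\<in>F. D y $ i * \<Psi> z y))"
      by (rule Bochner_Integration.integral_sum[symmetric]) (use FV \<Psi> weak_gradient_onD(5) in blast)
    also have "\<dots> = (LINT y|lborel. D y $ i * \<psi> y)"
      by (subst sum) (simp add: sum_distrib_left)
    finally show "(LINT y|lborel. f y * partial i \<psi> y) = - (LINT y|lborel. D y $ i * \<psi> y)" .
  qed
qed

lemma integral_translation:
  fixes \<phi> :: "'a::euclidean_space \<Rightarrow> real"
  assumes "continuous_on UNIV \<phi>"
  shows "(LINT y|lborel. \<phi> (y + c)) = (LINT y|lborel. \<phi> y)"
proof -
  have "(LINT y|lborel. \<phi> y) = (LINT y|distr lborel borel ((+) c). \<phi> y)" by (simp add: lborel_distr_plus)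
  also have "\<dots> = (LINT y|lborel. \<phi> (c + y))"
    using borel_measurable_continuous_onI[OF assms] by (subst integral_distr) auto
  finally show ?thesis by (simp add: add.commute)
qed

text \<open>The integral of a partial derivative is the limit of the integrals of difference quotients,
  which vanish by translation invariance.\<close>

lemma integral_partial_eq_0:
  fixes \<phi> :: "real^'n \<Rightarrow> real"
  assumes "test_function V \<phi>" shows "(LINT y|lborel. partial i \<phi> y) = 0"
proof -
  note t = test_functionD[OF assms]
  let ?K = "closure {y. \<phi> y \<noteq> 0}"
  obtain B where B: "B \<ge> 0" "\<And>y. \<bar>partial i \<phi> y\<bar> \<le> B"
    by (rule continuous_compact_support_bounded[OF t(5)[of i] t(2) partial_eq_0]) (assumption, rule that)
  obtain R where R: "\<And>y. y \<in> ?K \<Longrightarrow> norm y \<le> R"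
    using compact_imp_bounded[OF t(2)] by (auto simp: bounded_iff)
  define h where "h k = inverse (real (Suc k))" for k
  have h: "0 < h k" "h k \<le> 1" for k by (auto simp: h_def field_simps)
  define X where "X k y = (\<phi> (y + h k *\<^sub>R axis i 1) - \<phi> y) / h k" for k y
  have intphi: "integrable lborel (\<lambda>y. \<phi> (y + c))" for c
  proof (rule integrable_compact_support)
    show "continuous_on UNIV (\<lambda>y. \<phi> (y + c))" by (rule continuous_on_compose2[OF t(4)]) (auto intro: continuous_intros)
    show "compact ((\<lambda>y. y - c) ` ?K)" using t(2) by (intro compact_continuous_image continuous_intros)
    show "\<phi> (y + c) = 0" if "y \<notin> (\<lambda>y. y - c) ` ?K" for y
      using that support_0[of "y + c" \<phi>] by (force simp: image_iff)
  qed
  have "(LINT y|lborel. X k y) = 0" for k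
    using intphi[of "h k *\<^sub>R axis i 1"] intphi[of 0] integral_translation[OF t(4), of "h k *\<^sub>R axis i 1"]
    by (simp add: X_def)
  moreover have "(\<lambda>k. LINT y|lborel. X k y) \<longlonglongrightarrow> (LINT y|lborel. partial i \<phi> y)"
  proof (rule integral_dominated_convergence)
    show "partial i \<phi> \<in> borel_measurable lborel" using borel_measurable_continuous_onI[OF t(5)] by simp
    have [measurable]: "\<phi> \<in> borel_measurable borel" using borel_measurable_continuous_onI[OF t(4)] by simp
    show "X k \<in> borel_measurable lborel" for k unfolding X_def[abs_def] by measurable
    \<comment> \<open>The increments \<open>h k\<close> are at most 1, so all difference quotients
      vanish outside the ball of radius \<open>R + 1\<close>.\<close>
    have "emeasure lborel (cball 0 (R+1) :: (real^'n) set) < \<infinity>" by (rule emeasure_bounded_finite) simp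
    then show "integrable lborel (\<lambda>y::real^'n. B * indicator (cball 0 (R + 1)) y :: real)"
      by (intro integrable_mult_right integrable_real_indicator) auto
    show "AE y in lborel. (\<lambda>k. X k y) \<longlonglongrightarrow> partial i \<phi> y"
    proof (rule AE_I2)
      fix y
      have "((\<lambda>s. \<phi> (y + s *\<^sub>R axis i 1)) has_real_derivative partial i \<phi> (y + 0 *\<^sub>R axis i 1)) (at 0)"
        by (rule line_has_derivative) (simp add: t(6))
      then have "((\<lambda>s. (\<phi> (y + s *\<^sub>R axis i 1) - \<phi> y) / s) \<longlongrightarrow> partial i \<phi> y) (at 0)"
        by (simp add: has_field_derivative_iff)
      moreover have "filterlim h (at 0) sequentially"
        unfolding filterlim_at using h LIMSEQ_inverse_real_of_nat by (auto simp: h_def[abs_def])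
      ultimately show "(\<lambda>k. X k y) \<longlonglongrightarrow> partial i \<phi> y"
        unfolding X_def by (rule filterlim_compose)
    qed
    show "AE y in lborel. norm (X k y) \<le> B * indicator (cball 0 (R + 1)) y" for k
    proof (rule AE_I2)
      fix y
      show "norm (X k y) \<le> B * indicator (cball 0 (R + 1)) y"
      proof (cases "y \<in> cball 0 (R + 1)")
        case True
        have "\<And>s. 0 \<le> s \<Longrightarrow> s \<le> h k \<Longrightarrow> ((\<lambda>s. \<phi> (y + s *\<^sub>R axis i 1)) has_real_derivative partial i \<phi> (y + s *\<^sub>R axis i 1)) (at s)"
          by (rule line_has_derivative) (simp add: t(6))
        from MVT2[OF h(1) this] obtain s where "\<phi> (y + h k *\<^sub>R axis i 1) - \<phi> y = h k * partial i \<phi> (y + s *\<^sub>R axis i 1)" by auto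
        then have "X k y = partial i \<phi> (y + s *\<^sub>R axis i 1)" using h(1)[of k] by (simp add: X_def)
        then show ?thesis using B(2) True by simp
      next
        case False
        then have n: "norm y > R + 1" by simp
        have "norm y \<le> norm (y + h k *\<^sub>R axis i 1) + norm (h k *\<^sub>R axis i 1 :: real^'n)"
          by (metis add_diff_cancel_right' norm_triangle_ineq4)
        then have "norm (y + h k *\<^sub>R axis i 1) > R" using n h[of k] by simp
        then have "y \<notin> ?K" "y + h k *\<^sub>R axis i 1 \<notin> ?K" using R n by force+
        then have "\<phi> y = 0" "\<phi> (y + h k *\<^sub>R axis i 1) = 0" by (auto intro: support_0 simp del: not_le)
        then show ?thesis using False by (simp add: X_def)
      qed
    qed
  qed
  ultimately show ?thesis by (simp add: LIMSEQ_const_iff)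
qed

text \<open>Smoothness of \<open>m\<close> near the support of \<open>\<phi>\<close> is enough: away
  from the support the product is 0, whatever \<open>m\<close> is.\<close>

lemma test_function_mult:
  assumes "test_function V \<phi>" "open W" "closure {y. \<phi> y \<noteq> 0} \<subseteq> W" "smooth_on W m"
  shows "test_function V (\<lambda>y. \<phi> y * m y)"
proof (rule test_functionI[OF _ test_functionD(2,3)[OF assms(1)]])
  let ?K = "closure {y. \<phi> y \<noteq> 0}"
  show "smooth_on UNIV (\<lambda>y. \<phi> y * m y)"
  proof (rule smooth_on_local)
    fix y
    have "smooth_on W (\<lambda>y. \<phi> y * m y)"
      using assms by (intro smooth_on_mult) (auto intro: smooth_on_subset[OF test_functionD(1)])
    have "smooth_on (- ?K) (\<lambda>y. \<phi> y * m y)"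
    proof (rule smooth_on_zero)
      fix y assume "y \<in> - ?K"
      then have "\<phi> y = 0" by (intro support_0) blast
      then show "\<phi> y * m y = 0" by simp
    qed auto
    show "\<exists>U. open U \<and> y \<in> U \<and> smooth_on U (\<lambda>y. \<phi> y * m y)"
    proof (cases "y \<in> ?K")
      case True then show ?thesis using assms(2,3) \<open>smooth_on W (\<lambda>y. \<phi> y * m y)\<close> by blast
    next
      case False then show ?thesis using \<open>smooth_on (- ?K) _\<close> by (intro exI[of _ "- ?K"]) auto
    qed
  qed
next
  fix y assume "y \<notin> closure {y. \<phi> y \<noteq> 0}"
  then have "\<phi> y = 0" by (rule support_0)
  then show "\<phi> y * m y = 0" by simp
qed

lemma integral_by_parts:
  assumes "test_function V \<phi>" "open W" "closure {y. \<phi> y \<noteq> 0} \<subseteq> W" "smooth_on W m"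
  shows "(LINT y|lborel. \<phi> y * partial i m y) = - (LINT y|lborel. partial i \<phi> y * m y)"
    "integrable lborel (\<lambda>y. \<phi> y * partial i m y)" "integrable lborel (\<lambda>y. partial i \<phi> y * m y)"
proof -
  let ?K = "closure {y. \<phi> y \<noteq> 0}"
  note t = test_functionD[OF assms(1)]
  have smi: "smooth_on W (partial i m)" by (rule smooth_on_partial[OF assms(2,4)])
  have si: "set_integrable lborel ?K m" "set_integrable lborel ?K (partial i m)"
    using smooth_on_continuous[OF assms(4)] smooth_on_continuous[OF smi] assms(3)
    by (auto intro!: set_integrable_compact_continuous t(2) elim!: continuous_on_subset)
  have 1: "integrable lborel (\<lambda>y. partial i m y * \<phi> y)"
    by (rule integrable_times_continuous[OF si(2) t(4) t(2)]) (rule support_0)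
  have 2: "integrable lborel (\<lambda>y. m y * partial i \<phi> y)"
    by (rule integrable_times_continuous[OF si(1) t(5) t(2)]) (rule partial_eq_0)
  show i1: "integrable lborel (\<lambda>y. \<phi> y * partial i m y)" using 1 by (simp add: mult.commute)
  show i2: "integrable lborel (\<lambda>y. partial i \<phi> y * m y)" using 2 by (simp add: mult.commute)
  have "partial i (\<lambda>y. \<phi> y * m y) y = partial i \<phi> y * m y + \<phi> y * partial i m y" for y
  proof (cases "y \<in> W")
    case True then show ?thesis by (intro partial_mult t(6) smooth_on_differentiable[OF assms(4)])
  next
    case False
    then have y: "y \<notin> ?K" using assms(3) by auto
    moreover have "y \<notin> closure {y. \<phi> y * m y \<noteq> 0}"
      using y closure_mono[of "{y. \<phi> y * m y \<noteq> 0}" "{y. \<phi> y \<noteq> 0}"] by auto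
    ultimately show ?thesis using partial_eq_0[of y \<phi>] support_0[of y \<phi>] by (simp add: partial_eq_0[of y "\<lambda>y. \<phi> y * m y"])
  qed
  then have "(LINT y|lborel. partial i \<phi> y * m y + \<phi> y * partial i m y) = 0"
    using integral_partial_eq_0[OF test_function_mult[OF assms], of i] by simp
  then show "(LINT y|lborel. \<phi> y * partial i m y) = - (LINT y|lborel. partial i \<phi> y * m y)"
    using i1 i2 by simp
qed

subsection \<open>Weak gradients under diffeomorphisms\<close>

text \<open>Where \<open>h\<close> does not vanish it keeps its sign in a ball, and a bump supported
  there gives a nonzero integral.\<close>

lemma eq_0_if_orthogonal:
  fixes h :: "'a::euclidean_space \<Rightarrow> real"
  assumes h: "continuous_on UNIV h" and orth: "\<And>\<phi>. smooth_on UNIV \<phi> \<Longrightarrow> (LINT x|lborel. \<phi> x * h x) = 0"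
  shows "h x = 0"
proof (rule ccontr)
  assume nz: "h x \<noteq> 0"
  define s where "s = sgn (h x)"
  have sx: "s * h x > 0" using nz by (simp add: s_def sgn_if)
  have "continuous_on UNIV (\<lambda>y. s * h y)" using h by (intro continuous_intros)
  then have "open {y. s * h y > 0}" by (intro open_Collect_less continuous_on_const)
  then obtain r where r: "r > 0" "\<And>y. dist x y < r \<Longrightarrow> s * h y > 0"
    using sx unfolding open_dist by (metis dist_commute mem_Collect_eq)
  let ?b = "bump 1 x r"
  have c: "continuous_on UNIV ?b" by (rule smooth_on_continuous[OF smooth_on_bump])
  have z: "?b y = 0" if "y \<notin> cball x r" for y
    using bump_pos_iff[of 1 r x y] bump_nonneg[of 1 x r y] r(1) that by simp
  have nn: "0 \<le> s * (?b y * h y)" for y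
  proof (cases "dist x y < r")
    case True
    have "0 \<le> ?b y * (s * h y)" by (rule mult_nonneg_nonneg[OF bump_nonneg less_imp_le[OF r(2)[OF True]]])
    then show ?thesis by (simp only: mult.left_commute)
  next
    case False
    then have "?b y = 0" using bump_pos_iff[of 1 r x y] bump_nonneg[of 1 x r y] r(1) by simp
    then show ?thesis by simp
  qed
  have i: "integrable lborel (\<lambda>y. s * (?b y * h y))"
    by (rule integrable_compact_support[of _ "cball x r"]) (auto intro!: continuous_intros c h simp: z)
  have "(LINT y|lborel. s * (?b y * h y)) = 0"
    using orth[OF smooth_on_bump[of 1 x r]] by simp
  then have ae: "AE y in lborel. s * (?b y * h y) = 0"
    using integral_nonneg_eq_0_iff_AE[OF i] nn by simp
  have "closed {y. s * (?b y * h y) = 0}"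
    by (intro closed_Collect_eq continuous_intros c h)
  then have "x \<in> {y. s * (?b y * h y) = 0}"
    using AE_completion[OF ae] by (intro mem_closed_if_AE_lebesgue) auto
  moreover have "?b x > 0" using bump_pos_iff[of 1 r x x] r(1) by simp
  ultimately show False using sx by auto
qed

context diffeo
begin

text \<open>Change of variables controls \<open>\<bar>det (J y)\<bar> * h (F y)\<close>; on a
  compact set the determinant is bounded away from 0 and can be divided out.\<close>

lemma set_integrable_pullback:
  fixes h :: "real^'n \<Rightarrow> real"
  assumes K: "compact K" "K \<subseteq> U" and h: "set_integrable lborel (F ` K) h"
  shows "set_integrable lborel K (\<lambda>y. h (F y))"
proof -
  have cFK: "compact (F ` K)"
    by (rule compact_continuous_image[OF continuous_on_subset[OF smooth_on_continuous[OF smoothF] K(2)] K(1)])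
  have i: "integrable lborel (\<lambda>x. indicator (F ` K) x * h x)" using h by (simp add: set_integrable_def)
  have e: "(\<lambda>x. indicator V x * (indicator (F ` K) x * h x)) = (\<lambda>x. indicator (F ` K) x * h x)"
    using K FU by (auto simp: fun_eq_iff split: split_indicator)
  have eU: "(\<lambda>y. indicator U y * (\<bar>det (J y)\<bar> * (indicator (F ` K) (F y) * h (F y)))) = (\<lambda>y. \<bar>det (J y)\<bar> * (indicator K y * h (F y)))"
  proof
    fix y
    have "F y \<in> F ` K \<longleftrightarrow> y \<in> K" if "y \<in> U" using that K GF by (metis image_iff subsetD)
    then show "indicator U y * (\<bar>det (J y)\<bar> * (indicator (F ` K) (F y) * h (F y))) = \<bar>det (J y)\<bar> * (indicator K y * h (F y))"
      using K by (auto split: split_indicator)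
  qed
  have "integrable lborel (\<lambda>y. \<bar>det (J y)\<bar> * (indicator K y * h (F y)))"
    using integral_image(1)[of "\<lambda>x. indicator (F ` K) x * h x"] i unfolding e eU by auto
  moreover have "(\<lambda>y. \<bar>det (J y)\<bar> * (indicator K y * h (F y))) = (\<lambda>y. indicator K y *\<^sub>R (\<bar>det (J y)\<bar> * h (F y)))"
    by (auto simp: fun_eq_iff)
  ultimately have "set_integrable lborel K (\<lambda>y. \<bar>det (J y)\<bar> * h (F y))" by (simp add: set_integrable_def)
  then have "set_integrable lborel K (\<lambda>y. (1 / \<bar>det (J y)\<bar>) * (\<bar>det (J y)\<bar> * h (F y)))"
  proof (rule set_integrable_mult_continuous[OF K(1)])
    show "continuous_on K (\<lambda>y. 1 / \<bar>det (J y)\<bar>)"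
      using K(2) det_J by (intro continuous_intros continuous_on_subset[OF smooth_on_continuous[OF smooth_on_det[OF openU smoothJ]] K(2)]) auto
  qed
  then show ?thesis
    unfolding set_integrable_def
    by (rule iffD1[OF Bochner_Integration.integrable_cong[OF refl], rotated])
      (use K(2) det_J in \<open>auto split: split_indicator\<close>)
qed

lemma integral_pullback:
  fixes q :: "real^'n \<Rightarrow> real"
  assumes q: "integrable lborel q" "\<And>y. y \<notin> U \<Longrightarrow> q y = 0"
  shows "(LINT y|lborel. q y) = (LINT x|lborel. (if x \<in> V then q (G x) * \<bar>det (jacobian G x)\<bar> else 0))"
proof -
  interpret inv: diffeo V U G F by (rule swap)
  have e: "(\<lambda>y. indicator U y * q y) = q" using q(2) by (auto simp: fun_eq_iff split: split_indicator)
  have "(LINT y|lborel. indicator U y * q y) = (LINT x|lborel. indicator V x * (\<bar>det (jacobian G x)\<bar> * q (G x)))"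
    by (rule inv.integral_image(2)) (use q(1) e in auto)
  also have "\<dots> = (LINT x|lborel. (if x \<in> V then q (G x) * \<bar>det (jacobian G x)\<bar> else 0))"
    by (intro Bochner_Integration.integral_cong) (auto split: split_indicator)
  finally show ?thesis unfolding e .
qed

lemma test_function_pushforward:
  assumes \<psi>: "test_function U \<psi>" and m: "smooth_on V m"
  shows "test_function V (\<lambda>x. if x \<in> V then \<psi> (G x) * m x else 0)"
proof (rule test_functionI)
  let ?K = "closure {y. \<psi> y \<noteq> 0}"
  note t = test_functionD[OF \<psi>]
  show c: "compact (F ` ?K)"
    by (rule compact_continuous_image[OF continuous_on_subset[OF smooth_on_continuous[OF smoothF] t(3)] t(2)])
  show sub: "F ` ?K \<subseteq> V" using t(3) FU by blast
  show z: "(if x \<in> V then \<psi> (G x) * m x else 0) = 0" if "x \<notin> F ` ?K" for x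
  proof (cases "x \<in> V")
    case True
    then have "G x \<notin> ?K" using that FG by (metis imageI)
    then have "\<psi> (G x) = 0" by (rule support_0)
    then show ?thesis by simp
  qed simp
  show "smooth_on UNIV (\<lambda>x. if x \<in> V then \<psi> (G x) * m x else 0)"
  proof (rule smooth_on_local)
    fix x
    have 1: "smooth_on V (\<lambda>x. if x \<in> V then \<psi> (G x) * m x else 0)"
    proof (rule iffD2[OF smooth_on_cong[OF openV, of _ "\<lambda>x. \<psi> (G x) * m x"]])
      show "smooth_on V (\<lambda>x. \<psi> (G x) * m x)"
        by (intro smooth_on_mult openV m smooth_on_compose[OF openV open_UNIV _ smoothG t(1)]) simp
    qed simp
    have 2: "smooth_on (- (F ` ?K)) (\<lambda>x. if x \<in> V then \<psi> (G x) * m x else 0)"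
      using compact_imp_closed[OF c] z by (intro smooth_on_zero) auto
    show "\<exists>W. open W \<and> x \<in> W \<and> smooth_on W (\<lambda>x. if x \<in> V then \<psi> (G x) * m x else 0)"
    proof (cases "x \<in> V")
      case True then show ?thesis using openV 1 by blast
    next
      case False then show ?thesis using 2 sub compact_imp_closed[OF c] by (intro exI[of _ "- (F ` ?K)"]) auto
    qed
  qed
qed

text \<open>The identity below is the Piola identity in disguise: both sides are continuous and
  have the same integral against every smooth function.\<close>

lemma piola:
  fixes i :: 'n
  assumes \<psi>: "test_function U \<psi>"
  defines "B \<equiv> \<lambda>j x. if x \<in> V then \<psi> (G x) * (\<bar>det (jacobian G x)\<bar> * partial i F (G x) $ j) else 0"
  shows "test_function V (B j)"
    "(if x \<in> V then partial i \<psi> (G x) * \<bar>det (jacobian G x)\<bar> else 0) = (\<Sum>j\<in>UNIV. partial j (B j) x)"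
proof -
  interpret inv: diffeo V U G F by (rule swap)
  note t = test_functionD[OF \<psi>]
  have \<psi>0: "\<psi> y = 0" "partial i \<psi> y = 0" if "y \<notin> U" for y
    using that t(3) support_0[of y \<psi>] partial_eq_0[of y \<psi> i] by blast+
  define A where "A x = (if x \<in> V then partial i \<psi> (G x) * \<bar>det (jacobian G x)\<bar> else 0)" for x
  have sdet: "smooth_on V (\<lambda>x. \<bar>det (jacobian G x)\<bar>)"
    by (intro smooth_on_abs smooth_on_det openV inv.smoothJ inv.det_J)
  have spF: "smooth_on V (\<lambda>x. partial i F (G x) $ j)" for j
    by (rule smooth_on_vec_nth[OF openV smooth_on_compose[OF openV openU GV smoothG smooth_on_partial[OF openU smoothF]]])
  show B: "test_function V (B j)" for j
    unfolding B_def by (intro test_function_pushforward \<psi> smooth_on_mult openV sdet spF)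
  have \<psi>': "test_function U (partial i \<psi>)"
    by (rule test_functionI[OF smooth_on_partial[OF open_UNIV t(1)] t(2,3)]) (rule partial_eq_0)
  have A: "test_function V A" unfolding A_def[abs_def] by (rule test_function_pushforward[OF \<psi>' sdet])
  define h where "h x = A x - (\<Sum>j\<in>UNIV. partial j (B j) x)" for x
  have "h x = 0" for x
  proof (rule eq_0_if_orthogonal[of h])
    show "continuous_on UNIV h" unfolding h_def[abs_def]
      by (intro continuous_intros test_functionD(4)[OF A] test_functionD(5)[OF B])
    fix \<phi> :: "real^'n \<Rightarrow> real" assume \<phi>: "smooth_on UNIV \<phi>"
    have c\<phi>: "continuous_on UNIV \<phi>" by (rule smooth_on_continuous[OF \<phi>])
    have sF\<phi>: "smooth_on U (\<lambda>y. \<phi> (F y))" by (rule smooth_on_compose[OF openU open_UNIV _ smoothF \<phi>]) simp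
    have sp\<phi>: "smooth_on U (\<lambda>y. partial j \<phi> (F y))" for j
      by (rule smooth_on_compose[OF openU open_UNIV _ smoothF smooth_on_partial[OF open_UNIV \<phi>]]) simp
    have iA: "integrable lborel (\<lambda>x. A x * \<phi> x)"
    proof -
      have tA: "test_function V (\<lambda>x. A x * \<phi> x)" by (rule test_function_mult[OF A open_UNIV _ \<phi>]) simp
      show ?thesis by (rule integrable_compact_support[OF test_functionD(4,2)[OF tA]]) (rule support_0)
    qed
    note ibpB = integral_by_parts[OF B open_UNIV subset_UNIV \<phi>]
    note ibp\<psi> = integral_by_parts[OF \<psi> openU t(3) sF\<phi>, of i]
    have dF: "partial i (\<lambda>y. \<phi> (F y)) y = (\<Sum>j\<in>UNIV. partial i F y $ j * partial j \<phi> (F y))" if "y \<in> U" for y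
      using partial_compose[OF smooth_on_differentiable[OF smoothF that] smooth_on_differentiable[OF \<phi> UNIV_I]] by simp
    \<comment> \<open>The integral is carried to \<open>U\<close>, integrated by parts, expanded by
      the chain rule, carried back to \<open>V\<close> and integrated by parts again. In this way no
      second derivative of \<open>F\<close> is ever computed.\<close>
    have "(LINT x|lborel. A x * \<phi> x) = (LINT x|lborel. (if x \<in> V then partial i \<psi> (G x) * \<phi> (F (G x)) * \<bar>det (jacobian G x)\<bar> else 0))"
      by (intro Bochner_Integration.integral_cong refl) (auto simp: A_def FG)
    also have "\<dots> = (LINT y|lborel. partial i \<psi> y * \<phi> (F y))"
      by (rule integral_pullback[symmetric, OF ibp\<psi>(3)]) (simp add: \<psi>0)
    also have "\<dots> = - (LINT y|lborel. \<psi> y * partial i (\<lambda>y. \<phi> (F y)) y)" using ibp\<psi>(1) by simp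
    also have "(LINT y|lborel. \<psi> y * partial i (\<lambda>y. \<phi> (F y)) y) =
       (LINT x|lborel. (if x \<in> V then \<psi> (G x) * partial i (\<lambda>y. \<phi> (F y)) (G x) * \<bar>det (jacobian G x)\<bar> else 0))"
      by (rule integral_pullback[OF ibp\<psi>(2)]) (simp add: \<psi>0)
    also have "\<dots> = (LINT x|lborel. (\<Sum>j\<in>UNIV. B j x * partial j \<phi> x))"
      by (intro Bochner_Integration.integral_cong refl)
        (auto simp: B_def dF[OF G_in] FG sum_distrib_left sum_distrib_right mult_ac)
    also have "\<dots> = (\<Sum>j\<in>UNIV. (LINT x|lborel. B j x * partial j \<phi> x))"
      by (rule Bochner_Integration.integral_sum) (rule ibpB(2))
    also have "\<dots> = - (\<Sum>j\<in>UNIV. (LINT x|lborel. partial j (B j) x * \<phi> x))"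
      by (simp add: ibpB(1) sum_negf)
    finally have "(LINT x|lborel. A x * \<phi> x) = (\<Sum>j\<in>UNIV. (LINT x|lborel. partial j (B j) x * \<phi> x))" by simp
    also have "\<dots> = (LINT x|lborel. (\<Sum>j\<in>UNIV. partial j (B j) x * \<phi> x))"
      by (rule Bochner_Integration.integral_sum[symmetric]) (rule ibpB(3))
    finally have "(LINT x|lborel. A x * \<phi> x - (\<Sum>j\<in>UNIV. partial j (B j) x * \<phi> x)) = 0"
      using iA ibpB(3) by (subst Bochner_Integration.integral_diff) auto
    then show "(LINT x|lborel. \<phi> x * h x) = 0"
      by (simp add: h_def algebra_simps sum_distrib_left)
  qed
  then show "(if x \<in> V then partial i \<psi> (G x) * \<bar>det (jacobian G x)\<bar> else 0) = (\<Sum>j\<in>UNIV. partial j (B j) x)"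
    by (simp add: h_def A_def)
qed

text \<open>A test function on \<open>U\<close> turns into a family of test functions on
  \<open>V\<close> whose divergence is given by \<open>piola\<close>. Testing \<open>D\<close> with
  this family produces the transposed Jacobian; \<open>f\<close> itself is never
  approximated.\<close>

theorem weak_gradient_pullback:
  assumes w: "weak_gradient_on V f D"
  shows "weak_gradient_on U (\<lambda>y. f (F y)) (\<lambda>y. transpose (J y) *v D (F y))"
proof -
  interpret inv: diffeo V U G F by (rule swap)
  note wD = weak_gradient_onD[OF w]
  have D_nth: "(transpose (J y) *v D (F y)) $ i = (\<Sum>j\<in>UNIV. partial i F y $ j * D (F y) $ j)" for y i
    by (simp add: matrix_vector_mult_def transpose_def jacobian_def jacobian_eq_partial del: transpose_matrix_vector)
  have cFK: "compact (F ` K)" "F ` K \<subseteq> V" if "compact K" "K \<subseteq> U" for K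
    using compact_continuous_image[OF continuous_on_subset[OF smooth_on_continuous[OF smoothF] that(2)] that(1)] that FU by auto
  have si1: "set_integrable lborel K (\<lambda>y. f (F y))" if "compact K" "K \<subseteq> U" for K
    by (rule set_integrable_pullback[OF that wD(1)[OF cFK[OF that]]])
  have siD: "set_integrable lborel K (\<lambda>y. partial i F y $ j * D (F y) $ j)" if "compact K" "K \<subseteq> U" for K i j
    by (rule set_integrable_mult_continuous[OF that(1) set_integrable_pullback[OF that wD(2)[OF cFK[OF that]]]
        continuous_on_subset[OF smooth_on_continuous[OF smooth_on_vec_nth[OF openU smooth_on_partial[OF openU smoothF]]] that(2)]])
  have siDs: "set_integrable lborel K (\<lambda>y. (transpose (J y) *v D (F y)) $ i)" if "compact K" "K \<subseteq> U" for K i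
    unfolding D_nth using siD[OF that] unfolding set_integrable_def scaleR_sum_right
    by (intro Bochner_Integration.integrable_sum)
  show ?thesis
  proof (rule weak_gradient_onI[OF si1 siDs])
    fix \<psi> :: "real^'n \<Rightarrow> real" and i assume \<psi>: "test_function U \<psi>"
    note t = test_functionD[OF \<psi>]
    have \<psi>0: "\<psi> y = 0" "partial i \<psi> y = 0" if "y \<notin> U" for y
      using that t(3) support_0[of y \<psi>] partial_eq_0[of y \<psi> i] by blast+
    define B where "B j x = (if x \<in> V then \<psi> (G x) * (\<bar>det (jacobian G x)\<bar> * partial i F (G x) $ j) else 0)" for j x
    note P = piola[OF \<psi>, where i=i, folded B_def]
    have i1: "integrable lborel (\<lambda>y. f (F y) * partial i \<psi> y)"
      by (rule integrable_times_continuous[OF si1[OF t(2,3)] t(5) t(2)]) (rule partial_eq_0)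
    have i2: "integrable lborel (\<lambda>y. (transpose (J y) *v D (F y)) $ i * \<psi> y)"
      by (rule integrable_times_continuous[OF siDs[OF t(2,3)] t(4) t(2)]) (rule support_0)
    have "(LINT y|lborel. f (F y) * partial i \<psi> y) =
        (LINT x|lborel. (if x \<in> V then f (F (G x)) * partial i \<psi> (G x) * \<bar>det (jacobian G x)\<bar> else 0))"
      by (rule integral_pullback[OF i1]) (simp add: \<psi>0)
    also have "\<dots> = (LINT x|lborel. (\<Sum>j\<in>UNIV. f x * partial j (B j) x))"
      unfolding sum_distrib_left[symmetric] P(2)[symmetric]
      by (intro Bochner_Integration.integral_cong refl) (auto simp: FG)
    also have "\<dots> = (\<Sum>j\<in>UNIV. LINT x|lborel. f x * partial j (B j) x)"
      by (rule Bochner_Integration.integral_sum) (rule wD(4)[OF P(1)])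
    also have "\<dots> = - (\<Sum>j\<in>UNIV. LINT x|lborel. D x $ j * B j x)"
      by (simp add: wD(3)[OF P(1)] sum_negf)
    also have "(\<Sum>j\<in>UNIV. LINT x|lborel. D x $ j * B j x) = (LINT x|lborel. (\<Sum>j\<in>UNIV. D x $ j * B j x))"
      by (rule Bochner_Integration.integral_sum[symmetric]) (rule wD(5)[OF P(1)])
    also have "\<dots> = (LINT x|lborel. (if x \<in> V then (transpose (J (G x)) *v D (F (G x))) $ i * \<psi> (G x) * \<bar>det (jacobian G x)\<bar> else 0))"
      unfolding D_nth by (intro Bochner_Integration.integral_cong refl)
        (auto simp: FG B_def sum_distrib_left sum_distrib_right mult_ac)
    also have "\<dots> = (LINT y|lborel. (transpose (J y) *v D (F y)) $ i * \<psi> y)"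
      by (rule integral_pullback[symmetric, OF i2]) (simp add: \<psi>0)
    finally show "(LINT y|lborel. f (F y) * partial i \<psi> y) = - (LINT y|lborel. (transpose (J y) *v D (F y)) $ i * \<psi> y)" .
  qed
qed

end

text \<open>One chart around each point suffices, since weak gradients pull back along transition
  maps and are local.\<close>

lemma (in smooth_manifold) weak_differentialI:
  assumes law: "\<And>c d p. c \<in> A \<Longrightarrow> d \<in> A \<Longrightarrow> p \<in> fst c \<Longrightarrow> p \<in> fst d \<Longrightarrow> \<omega> c p = transpose (transition_jacobian c d p) *v \<omega> d p"
    and loc: "\<And>p. \<exists>c\<in>A. \<exists>W. open W \<and> p \<in> W \<and> W \<subseteq> fst c \<and>
        weak_gradient_on (snd c ` W) (\<lambda>y. u (chart_inv c y)) (\<lambda>y. \<omega> c (chart_inv c y))"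
  shows "weak_differential A u \<omega>"
  unfolding weak_differential_def
proof (intro conjI ballI)
  fix d assume d: "d \<in> A"
  note chd = is_chart_simps[OF chart[OF d]]
  show "weak_gradient_on (snd d ` fst d) (\<lambda>y. u (chart_inv d y)) (\<lambda>y. \<omega> d (chart_inv d y))"
  proof (rule weak_gradient_on_local)
    fix y assume "y \<in> snd d ` fst d"
    then obtain p where p: "p \<in> fst d" "y = snd d p" by auto
    obtain c W where c: "c \<in> A" "open W" "p \<in> W" "W \<subseteq> fst c"
      "weak_gradient_on (snd c ` W) (\<lambda>y. u (chart_inv c y)) (\<lambda>y. \<omega> c (chart_inv c y))" using loc[of p] by blast
    note chc = is_chart_simps[OF chart[OF c(1)]]
    define N where "N = W \<inter> fst d"
    have N: "open N" "N \<subseteq> fst d" "N \<subseteq> fst c" "p \<in> N" using c p open_chart[OF d] by (auto simp: N_def)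
    interpret diffeo "snd d ` N" "snd c ` N" "\<lambda>y. snd c (chart_inv d y)" "\<lambda>y. snd d (chart_inv c y)"
      by (rule transition_diffeo[OF d c(1) N(1-3)])
    have "weak_gradient_on (snd c ` N) (\<lambda>y. u (chart_inv c y)) (\<lambda>y. \<omega> c (chart_inv c y))"
      by (rule weak_gradient_on_subset[OF c(5)]) (auto simp: N_def)
    from weak_gradient_pullback[OF this]
    have "weak_gradient_on (snd d ` N) (\<lambda>y. u (chart_inv d y)) (\<lambda>y. \<omega> d (chart_inv d y))"
    proof (rule weak_gradient_on_cong[rotated 2])
      fix y assume "y \<in> snd d ` N"
      then obtain q where q: "q \<in> N" "y = snd d q" by auto
      then have e: "chart_inv d y = q" "chart_inv c (snd c q) = q" using chd(3) chc(3) N by auto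
      show "u (chart_inv c (snd c (chart_inv d y))) = u (chart_inv d y)" by (simp add: e)
      show "transpose (J y) *v \<omega> c (chart_inv c (snd c (chart_inv d y))) = \<omega> d (chart_inv d y)"
      proof -
        have "\<omega> d q = transpose (J y) *v \<omega> c q"
          using law[OF d c(1), of q] q N by (auto simp: jacobian_eq)
        then show ?thesis by (simp only: e)
      qed
    qed
    moreover have "open (snd d ` N)" "y \<in> snd d ` N" using openU p N by auto
    ultimately show "\<exists>U. open U \<and> y \<in> U \<and> weak_gradient_on U (\<lambda>y. u (chart_inv d y)) (\<lambda>y. \<omega> d (chart_inv d y))" by blast
  qed
next
  fix c d p assume "c \<in> A" "d \<in> A" "p \<in> fst c \<inter> fst d"
  then show "\<omega> c p = transpose (transition_jacobian c d p) *v \<omega> d p" by (intro law) blast+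
qed

subsection \<open>Testing against countably many functions\<close>

lemma test_function_bounded:
  assumes "test_function V \<psi>"
  obtains B where "\<And>y. \<bar>\<psi> y\<bar> \<le> B" "\<And>y. \<bar>partial i \<psi> y\<bar> \<le> B"
proof -
  note t = test_functionD[OF assms]
  obtain B1 where B1: "\<And>y. \<bar>\<psi> y\<bar> \<le> B1"
    by (rule continuous_compact_support_bounded[OF t(4,2)]) (rule support_0[of _ \<psi>], assumption, rule that)
  obtain B2 where B2: "\<And>y. \<bar>partial i \<psi> y\<bar> \<le> B2"
    by (rule continuous_compact_support_bounded[OF t(5)[of i] t(2)]) (rule partial_eq_0[of _ \<psi>], assumption, rule that)
  show thesis
  proof (rule that[of "max B1 B2"])
    show "\<bar>\<psi> y\<bar> \<le> max B1 B2" "\<bar>partial i \<psi> y\<bar> \<le> max B1 B2" for y using B1[of y] B2[of y] by linarith+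
  qed
qed

definition dense :: "'a::topological_space set \<Rightarrow> bool" where
  "dense Q \<longleftrightarrow> (\<forall>S. open S \<and> S \<noteq> {} \<longrightarrow> (\<exists>q\<in>Q. q \<in> S))"

lemma countable_dense: obtains Q :: "'a::second_countable_topology set" where "countable Q" "dense Q"
  by (rule countable_dense_setE[where 'a='a]) (auto simp: dense_def intro: that)

abbreviation rad :: "nat \<Rightarrow> real" where "rad k \<equiv> inverse (real (Suc k))"

lemma rad_small: assumes "e > 0" obtains N where "\<And>k. k \<ge> N \<Longrightarrow> rad k < e"
proof -
  have "(\<lambda>k. rad k) \<longlonglongrightarrow> 0" by (rule LIMSEQ_inverse_real_of_nat)
  then have "\<forall>\<^sub>F k in sequentially. rad k < e" using assms order_tendstoD(2) by blast
  then show thesis using that by (auto simp: eventually_sequentially)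
qed

lemma dense_near: assumes "dense Q" "e > 0" shows "\<exists>q\<in>Q. dist z q < e"
proof -
  have "open (ball z e)" "ball z e \<noteq> {}" using assms(2) by auto
  with assms(1) show ?thesis unfolding dense_def by (metis mem_ball)
qed

text \<open>Balls inside \<open>V\<close> with centres in a dense set and radii \<open>rad k\<close>
  already cover every compact subset finitely often; over a countable dense set there are only
  countably many of them.\<close>

lemma set_integrable_compact_from_balls:
  fixes h :: "'a::euclidean_space \<Rightarrow> real"
  assumes V: "open V" and Q: "dense Q"
    and h: "\<And>q k. q \<in> Q \<Longrightarrow> cball q (rad k) \<subseteq> V \<Longrightarrow> set_integrable lborel (cball q (rad k)) h"
    and K: "compact K" "K \<subseteq> V"
  shows "set_integrable lborel K h"
proof -
  define \<C> where "\<C> = {p \<in> Q \<times> (UNIV :: nat set). cball (fst p) (rad (snd p)) \<subseteq> V}"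
  have cover: "K \<subseteq> (\<Union>p\<in>\<C>. ball (fst p) (rad (snd p)))"
  proof
    fix x assume "x \<in> K"
    then obtain e where e: "e > 0" "cball x e \<subseteq> V" using V K(2) by (meson open_contains_cball subsetD)
    \<comment> \<open>Half of \<open>e\<close> for the distance to the centre, half for the
      radius.\<close>
    obtain N where N: "\<And>k. k \<ge> N \<Longrightarrow> rad k < e / 2" by (rule rad_small[of "e / 2"]) (use e in auto)
    obtain q where q: "q \<in> Q" "dist x q < rad N" using dense_near[OF Q, of "rad N" x] by auto
    have "cball q (rad N) \<subseteq> cball x e"
    proof
      fix y assume "y \<in> cball q (rad N)"
      then show "y \<in> cball x e" using dist_triangle[of x y q] q(2) N[of N] by simp
    qed
    with e q have "(q, N) \<in> \<C>" "x \<in> ball q (rad N)" by (auto simp: \<C>_def dist_commute)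
    then show "x \<in> (\<Union>p\<in>\<C>. ball (fst p) (rad (snd p)))" by (intro UN_I[of "(q, N)"]) auto
  qed
  obtain F where F: "F \<subseteq> \<C>" "finite F" "K \<subseteq> (\<Union>p\<in>F. ball (fst p) (rad (snd p)))"
    by (rule compactE_image[OF K(1) _ cover]) (rule open_ball, rule that)
  have "set_integrable lborel (\<Union>p\<in>F. cball (fst p) (rad (snd p))) h"
    using F(1,2) h by (intro set_integrable_UN) (auto simp: \<C>_def)
  then show ?thesis
  proof (rule set_integrable_subset)
    show "K \<in> sets lborel" using compact_imp_closed[OF K(1)] by simp
    show "K \<subseteq> (\<Union>p\<in>F. cball (fst p) (rad (snd p)))" using F(3) ball_subset_cball by force
  qed
qed

text \<open>Dominated convergence: the test functions are bounded by \<open>B\<close> and vanish off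
  \<open>K\<close>, where \<open>f\<close> and \<open>D\<close> are integrable.\<close>

lemma weak_limit:
  fixes f D :: "'a::euclidean_space \<Rightarrow> real"
  assumes f: "set_integrable lborel K f" and D: "set_integrable lborel K D"
    and m: "\<And>n. P n \<in> borel_measurable borel" "\<And>n. P' n \<in> borel_measurable borel"
      "p \<in> borel_measurable borel" "p' \<in> borel_measurable borel"
    and lim: "\<And>y. (\<lambda>n. P n y) \<longlonglongrightarrow> p y" "\<And>y. (\<lambda>n. P' n y) \<longlonglongrightarrow> p' y"
    and b: "\<And>n y. \<bar>P n y\<bar> \<le> B" "\<And>n y. \<bar>P' n y\<bar> \<le> B"
    and supp: "\<And>n y. y \<notin> K \<Longrightarrow> P n y = 0" "\<And>n y. y \<notin> K \<Longrightarrow> P' n y = 0"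
  shows "(\<lambda>n. LINT y|lborel. f y * P' n y + D y * P n y) \<longlonglongrightarrow> (LINT y|lborel. f y * p' y + D y * p y)"
proof -
  define f0 where "f0 y = indicator K y *\<^sub>R f y" for y
  define D0 where "D0 y = indicator K y *\<^sub>R D y" for y
  have i: "integrable lborel f0" "integrable lborel D0"
    using f D by (auto simp: set_integrable_def f0_def[abs_def] D0_def[abs_def])
  note [measurable] = borel_measurable_integrable[OF i(1), simplified] borel_measurable_integrable[OF i(2), simplified] m
  have p0: "p y = 0" "p' y = 0" if "y \<notin> K" for y
    using lim[of y] supp[OF that] by (auto simp: LIMSEQ_const_iff)
  have e: "f y * P' n y + D y * P n y = f0 y * P' n y + D0 y * P n y" for n y
    using supp[of y n] by (cases "y \<in> K") (auto simp: f0_def D0_def)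
  have e': "f y * p' y + D y * p y = f0 y * p' y + D0 y * p y" for y
    using p0[of y] by (cases "y \<in> K") (auto simp: f0_def D0_def)
  show ?thesis unfolding e e'
  proof (rule integral_dominated_convergence)
    show "integrable lborel (\<lambda>y. B * \<bar>f0 y\<bar> + B * \<bar>D0 y\<bar>)" using i by simp
    show "AE y in lborel. (\<lambda>n. f0 y * P' n y + D0 y * P n y) \<longlonglongrightarrow> f0 y * p' y + D0 y * p y"
      by (rule AE_I2) (intro tendsto_intros lim)
    show "AE y in lborel. norm (f0 y * P' n y + D0 y * P n y) \<le> B * \<bar>f0 y\<bar> + B * \<bar>D0 y\<bar>" for n
    proof (rule AE_I2)
      fix y
      have "\<bar>f0 y\<bar> * \<bar>P' n y\<bar> \<le> \<bar>f0 y\<bar> * B" "\<bar>D0 y\<bar> * \<bar>P n y\<bar> \<le> \<bar>D0 y\<bar> * B"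
        using b by (auto intro: mult_left_mono)
      then show "norm (f0 y * P' n y + D0 y * P n y) \<le> B * \<bar>f0 y\<bar> + B * \<bar>D0 y\<bar>"
        using abs_triangle_ineq[of "f0 y * P' n y" "D0 y * P n y"] by (simp add: abs_mult mult.commute)
    qed
  qed measurable
qed

lemma bump_translate: "bump k x r y = bump k 0 r (y - x)" by (simp add: bump_def)

lemma partial_bump_translate: "partial i (bump k x r) y = partial i (bump k 0 r) (y - x)"
proof -
  have d: "bump k 0 r differentiable (at (y - x))" by (rule smooth_on_differentiable[OF smooth_on_bump UNIV_I])
  have "((\<lambda>y. y - x) has_derivative (\<lambda>h. h)) (at y)" by (auto intro!: derivative_eq_intros)
  from diff_chain_at[OF this d[unfolded frechet_derivative_works]]
  have "(bump k x r has_derivative frechet_derivative (bump k 0 r) (at (y - x))) (at y)"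
    by (simp add: o_def bump_translate[of k x r, abs_def, symmetric])
  then show ?thesis by (simp add: partial_eqI) (simp add: partial_def)
qed

text \<open>A bump is an even function of \<open>y - x\<close>, so its derivative in the argument is
  minus the derivative in the centre.\<close>

lemma partial_bump_reflect: "partial i (bump k x r) y = - partial i (bump k y r) x"
proof -
  have d: "bump k y r differentiable (at x)" by (rule smooth_on_differentiable[OF smooth_on_bump UNIV_I])
  have e: "bump k x r = (\<lambda>z. bump k y r (x + y - z))"
    by (auto simp: fun_eq_iff bump_def inner_diff_left inner_diff_right inner_commute algebra_simps)
  have "((\<lambda>z. x + y - z) has_derivative (\<lambda>h. - h)) (at y)" by (auto intro!: derivative_eq_intros)
  from diff_chain_at[OF this, of "bump k y r"] d[unfolded frechet_derivative_works]
  have "(bump k x r has_derivative (\<lambda>h. frechet_derivative (bump k y r) (at x) (- h))) (at y)"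
    unfolding e by (simp add: o_def)
  then show ?thesis using linear_neg[OF linear_frechet_derivative[OF d]] by (simp add: partial_eqI) (simp add: partial_def)
qed

lemma integrable_pair_mult:
  fixes f :: "'a \<Rightarrow> real" and g :: "'b \<Rightarrow> real"
  assumes M: "sigma_finite_measure M" "sigma_finite_measure N" and f: "integrable M f" and g: "integrable N g"
  shows "integrable (M \<Otimes>\<^sub>M N) (\<lambda>(x, y). f x * g y)"
    "integral\<^sup>L (M \<Otimes>\<^sub>M N) (\<lambda>(x, y). f x * g y) = (LINT x|M. f x) * (LINT y|N. g y)"
proof -
  interpret pair_sigma_finite M N using M by (simp add: pair_sigma_finite_def)
  note [measurable] = borel_measurable_integrable[OF f] borel_measurable_integrable[OF g]
  show i: "integrable (M \<Otimes>\<^sub>M N) (\<lambda>(x, y). f x * g y)"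
  proof (rule Fubini_integrable)
    show "integrable M (\<lambda>x. \<integral>y. norm (case (x, y) of (x, y) \<Rightarrow> f x * g y) \<partial>N)"
      using f by (simp add: abs_mult)
    show "AE x in M. integrable N (\<lambda>y. case (x, y) of (x, y) \<Rightarrow> f x * g y)" using g by simp
  qed measurable
  have "integral\<^sup>L (M \<Otimes>\<^sub>M N) (\<lambda>(x, y). f x * g y) = (LINT x|M. LINT y|N. f x * g y)"
    using integral_fst'[OF i] by simp
  then show "integral\<^sup>L (M \<Otimes>\<^sub>M N) (\<lambda>(x, y). f x * g y) = (LINT x|M. f x) * (LINT y|N. g y)"
    by simp
qed

text \<open>Two limits. The identity is continuous in the centre of the bump, so it holds for every
  centre. A test function is then the limit of its convolutions with shrinking bumps, and by Fubini
  the identity for a convolution is an average of identities for bumps.\<close>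

lemma weak_identity_from_bumps:
  fixes f D :: "real^'n \<Rightarrow> real"
  assumes V: "open V" and Q: "dense Q"
    and f: "\<And>K. compact K \<Longrightarrow> K \<subseteq> V \<Longrightarrow> set_integrable lborel K f"
    and D: "\<And>K. compact K \<Longrightarrow> K \<subseteq> V \<Longrightarrow> set_integrable lborel K D"
    and bumps: "\<And>q k. q \<in> Q \<Longrightarrow> cball q (rad k) \<subseteq> V \<Longrightarrow>
      (LINT y|lborel. f y * partial i (bump 1 q (rad k)) y + D y * bump 1 q (rad k) y) = 0"
    and \<psi>: "test_function V \<psi>"
  shows "(LINT y|lborel. f y * partial i \<psi> y + D y * \<psi> y) = 0"
proof -
  note t = test_functionD[OF \<psi>]
  let ?K = "closure {y. \<psi> y \<noteq> 0}"
  have B: "\<exists>B. \<forall>y. \<bar>bump 1 0 r y\<bar> \<le> B \<and> \<bar>partial i (bump 1 0 r) y\<bar> \<le> B" if "r > 0" for r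
  proof -
    have tb: "test_function UNIV (bump 1 0 r)" using that by (intro test_function_bump) auto
    obtain B where "\<And>y. \<bar>bump 1 (0::real^'n) r y\<bar> \<le> B" "\<And>y. \<bar>partial i (bump 1 0 r) y\<bar> \<le> B"
      by (rule test_function_bounded[OF tb, of i]) (rule that)
    then show ?thesis by blast
  qed
  have cb: "continuous_on UNIV (bump 1 x r)" "continuous_on UNIV (partial i (bump 1 x r))" for x :: "real^'n" and r
    using smooth_on_continuous[OF smooth_on_bump] smooth_on_continuous[OF smooth_on_partial[OF open_UNIV smooth_on_bump]] by auto
  have mb: "bump 1 x r \<in> borel_measurable borel" "partial i (bump 1 x r) \<in> borel_measurable borel" for x :: "real^'n" and r
    using cb by (auto intro: borel_measurable_continuous_onI)
  have b0: "bump 1 x r y = 0" "partial i (bump 1 x r) y = 0" if "r > 0" "y \<notin> cball x r" for x y :: "real^'n" and r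
  proof -
    have "closure {y. bump 1 x r y \<noteq> 0} = cball x r" using that by (intro bump_support) auto
    then have "y \<notin> closure {y. bump 1 x r y \<noteq> 0}" using that(2) by simp
    then show "bump 1 x r y = 0" "partial i (bump 1 x r) y = 0" by (rule support_0, rule partial_eq_0)
  qed
  define a where "a k z = (LINT y|lborel. f y * partial i (bump 1 z (rad k)) y + D y * bump 1 z (rad k) y)" for k z
  \<comment> \<open>First limit: centres \<open>q n\<close> in the dense set tend to
    \<open>z\<close> while the radius stays fixed. All these balls lie in one slightly larger ball,
    still inside \<open>V\<close>, on which the limit is dominated.\<close>
  have a0: "a k z = 0" if sub0: "cball z (rad k) \<subseteq> V" for k z
  proof -
    obtain e where e: "e > 0" "(\<Union>x\<in>cball z (rad k). cball x e) \<subseteq> V"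
      by (rule compact_subset_open_imp_cball_epsilon_subset[OF compact_cball V sub0]) blast
    have sub: "cball q (rad k) \<subseteq> V \<and> cball q (rad k) \<subseteq> cball z (rad k + e)" if "dist z q < e" for q
    proof -
      have "y \<in> V \<and> y \<in> cball z (rad k + e)" if y: "y \<in> cball q (rad k)" for y
      proof
        have "y - (q - z) \<in> cball z (rad k)" using y by (simp add: dist_norm algebra_simps)
        moreover have "y \<in> cball (y - (q - z)) e" using \<open>dist z q < e\<close> by (simp add: dist_norm norm_minus_commute)
        ultimately show "y \<in> V" using e(2) by blast
        show "y \<in> cball z (rad k + e)" using y \<open>dist z q < e\<close> dist_triangle[of z y q] by simp
      qed
      then show ?thesis by blast
    qed
    have "\<forall>n. \<exists>q. q \<in> Q \<and> dist z q < min e (rad n)" using dense_near[OF Q] e(1) by (metis min_less_iff_conj inverse_positive_iff_positive of_nat_0_less_iff zero_less_Suc)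
    then obtain q where q: "\<And>n. q n \<in> Q" "\<And>n. dist z (q n) < min e (rad n)" by metis
    have lq: "q \<longlonglongrightarrow> z"
      by (rule metric_LIMSEQ_I) (metis (no_types, lifting) dist_commute min_less_iff_conj order_less_trans q(2) rad_small)
    obtain C where C: "\<forall>y. \<bar>bump 1 0 (rad k) y\<bar> \<le> C \<and> \<bar>partial i (bump 1 0 (rad k)) y\<bar> \<le> C" using B[of "rad k"] by auto
    define K' where "K' = V \<inter> cball z (rad k + e) \<inter> (\<Union>x\<in>cball z (rad k). cball x e)"
    have "(\<lambda>n. LINT y|lborel. f y * partial i (bump 1 (q n) (rad k)) y + D y * bump 1 (q n) (rad k) y) \<longlonglongrightarrow> a k z"
      unfolding a_def
    proof (rule weak_limit[where K="cball z (rad k + e)" and B=C])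
      have "cball z (rad k + e) \<subseteq> V"
      proof
        fix y assume y: "y \<in> cball z (rad k + e)"
        show "y \<in> V"
        proof (cases "y \<in> cball z (rad k)")
          case True then show ?thesis using sub0 by auto
        next
          case False
          \<comment> \<open>The point \<open>x\<close> on the segment from \<open>z\<close> to
            \<open>y\<close> at distance \<open>rad k\<close> from \<open>z\<close> is within
            \<open>e\<close> of \<open>y\<close>; so \<open>y\<close> belongs to the neighbourhood
            of the ball that lies in \<open>V\<close>.\<close>
          define R where "R = rad k"
          have pos: "R < dist z y" "0 < R" "0 < dist z y" using False by (auto simp: R_def)
          define s where "s = R / dist z y"
          have s: "0 < s" "s < 1" "s * dist z y = R" using pos by (auto simp: s_def divide_less_eq)
          define x where "x = z + s *\<^sub>R (y - z)"
          have "dist z x = s * dist z y" using s by (simp add: x_def dist_norm norm_minus_commute)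
          then have "x \<in> cball z (rad k)" by (simp add: s(3) R_def)
          moreover have "y - x = (1 - s) *\<^sub>R (y - z)" by (simp add: x_def algebra_simps)
          then have "dist x y = (1 - s) * dist z y" using s by (simp add: dist_norm norm_minus_commute[of x y] norm_minus_commute[of z y])
          then have "dist x y = dist z y - rad k" using s(3) by (simp add: R_def left_diff_distrib)
          then have "y \<in> cball x e" using y by simp
          ultimately show ?thesis using e(2) by blast
        qed
      qed
      then show "set_integrable lborel (cball z (rad k + e)) f" "set_integrable lborel (cball z (rad k + e)) D"
        by (auto intro: f D)
      show "(\<lambda>n. bump 1 (q n) (rad k) y) \<longlonglongrightarrow> bump 1 z (rad k) y" for y
        unfolding bump_translate[of 1 _ "rad k" y]
        by (rule continuous_on_tendsto_compose[OF cb(1)]) (auto intro!: tendsto_intros lq)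
      show "(\<lambda>n. partial i (bump 1 (q n) (rad k)) y) \<longlonglongrightarrow> partial i (bump 1 z (rad k)) y" for y
        unfolding partial_bump_translate[of i 1 _ "rad k" y]
        by (rule continuous_on_tendsto_compose[OF cb(2)]) (auto intro!: tendsto_intros lq)
      show "\<bar>bump 1 (q n) (rad k) y\<bar> \<le> C" "\<bar>partial i (bump 1 (q n) (rad k)) y\<bar> \<le> C" for n y
        using C by (auto simp: bump_translate[of 1 "q n"] partial_bump_translate[of i 1 "q n"])
      have "cball (q n) (rad k) \<subseteq> cball z (rad k + e)" for n using sub[of "q n"] q(2)[of n] by simp
      then have "y \<notin> cball (q n) (rad k)" if "y \<notin> cball z (rad k + e)" for n y using that by blast
      then show "bump 1 (q n) (rad k) y = 0" "partial i (bump 1 (q n) (rad k)) y = 0" if "y \<notin> cball z (rad k + e)" for n y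
        using that b0[of "rad k" y "q n"] by (metis inverse_positive_iff_positive of_nat_0_less_iff zero_less_Suc)+
    qed (rule mb)+
    moreover have "(LINT y|lborel. f y * partial i (bump 1 (q n) (rad k)) y + D y * bump 1 (q n) (rad k) y) = 0" for n
      using sub[of "q n"] q(2)[of n] by (intro bumps q(1)) simp
    ultimately show ?thesis by (simp add: LIMSEQ_const_iff)
  qed
  obtain e where e: "e > 0" "(\<Union>x\<in>?K. cball x e) \<subseteq> V"
    by (rule compact_subset_open_imp_cball_epsilon_subset[OF t(2) V t(3)]) blast
  define K' where "K' = (\<Union>x\<in>?K. cball x e)"
  have K': "compact K'" "K' \<subseteq> V" using compact_minkowski_sum_cball[OF t(2), of e] e by (auto simp: K'_def)
  \<comment> \<open>From this index on the radii are below \<open>e\<close>, so convolutions with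
    these bumps are supported in \<open>K'\<close>.\<close>
  obtain N where N: "\<And>k. k \<ge> N \<Longrightarrow> rad k < e" by (rule rad_small[OF e(1)]) blast
  define r where "r k = rad (k + N)" for k
  have r: "r k > 0" "r k < e" for k using N[of "k + N"] by (auto simp: r_def)
  have r0: "r \<longlonglongrightarrow> 0" unfolding r_def by (rule LIMSEQ_ignore_initial_segment[OF LIMSEQ_inverse_real_of_nat])
  define c where "c k = (LINT z|lborel. bump 1 (0::real^'n) (r k) z)" for k
  have ib: "integrable lborel (bump 1 x (r k))" for x :: "real^'n" and k
    by (rule integrable_compact_support[OF cb(1) compact_cball]) (rule b0(1)[OF r(1)])
  have c: "c k > 0" for k
  proof -
    have "c k \<noteq> 0"
    proof
      assume "c k = 0"
      then have ae: "AE z in lborel. bump 1 (0::real^'n) (r k) z = 0"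
      proof -
        have "AE z in lborel. 0 \<le> bump 1 (0::real^'n) (r k) z" by (simp add: bump_nonneg)
        from integral_nonneg_eq_0_iff_AE[OF ib[of 0 k] this] \<open>c k = 0\<close> show ?thesis by (simp add: c_def)
      qed
      have "closed {z. bump 1 (0::real^'n) (r k) z = 0}" by (intro closed_Collect_eq cb continuous_on_const)
      then have "(0::real^'n) \<in> {z. bump 1 (0::real^'n) (r k) z = 0}"
        using AE_completion[OF ae] by (intro mem_closed_if_AE_lebesgue) auto
      then show False using bump_pos_iff[of 1 "r k" "0::real^'n" 0] r(1) by simp
    qed
    moreover have "c k \<ge> 0" unfolding c_def by (rule integral_nonneg_AE) (simp add: bump_nonneg)
    ultimately show ?thesis by simp
  qed
  have reflect: "bump 1 z s y = bump 1 y s z" for y z :: "real^'n" and s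
    by (simp add: bump_def inner_diff_left inner_diff_right algebra_simps inner_commute)
  have cz: "(LINT z|lborel. bump 1 y (r k) z) = c k" for y :: "real^'n" and k
    using integral_translation[OF cb(1)[of 0 "r k"], of "- y"] by (simp add: c_def bump_translate[of 1 y])
  \<comment> \<open>Mollification of \<open>h\<close> with the bump of radius \<open>r k\<close>,
    normalized by its integral \<open>c k\<close>, which by translation is the same for every
    centre.\<close>
  define S where "S k h y = (LINT z|lborel. h z * bump 1 z (r k) y) / c k" for k and h :: "real^'n \<Rightarrow> real" and y
  have Sprop: "(\<lambda>k. S k h y) \<longlonglongrightarrow> h y" "\<And>k. \<bar>S k h y\<bar> \<le> C" "\<And>k. y \<notin> K' \<Longrightarrow> S k h y = 0" "\<And>k. S k h \<in> borel_measurable borel"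
    if h: "continuous_on UNIV h" "\<And>y. y \<notin> ?K \<Longrightarrow> h y = 0" "\<And>y. \<bar>h y\<bar> \<le> C" for h y C
  proof -
    have ih: "integrable lborel (\<lambda>z. h z * bump 1 z (r k) y)" for k y
      unfolding reflect[of _ _ y]
      by (rule integrable_compact_support[OF _ t(2)]) (auto intro!: continuous_intros h cb simp: h(2))
    have est: "\<bar>S k h y - v\<bar> \<le> \<epsilon>" if v: "\<And>z. dist z y \<le> r k \<Longrightarrow> \<bar>h z - v\<bar> \<le> \<epsilon>" for k v \<epsilon>
    proof -
      have iv: "integrable lborel (\<lambda>z. (h z - v) * bump 1 z (r k) y)"
        using ih[of k y] ib[of y k] by (simp add: left_diff_distrib reflect[of _ _ y])
      have "S k h y - v = (LINT z|lborel. (h z - v) * bump 1 z (r k) y) / c k"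
        using ih[of k y] ib[of y k] cz[of y k] c[of k]
        by (simp add: S_def left_diff_distrib reflect[of _ _ y] diff_divide_distrib)
      moreover have "\<bar>LINT z|lborel. (h z - v) * bump 1 z (r k) y\<bar> \<le> (LINT z|lborel. \<epsilon> * bump 1 y (r k) z)"
      proof (rule integral_abs_bound_integral[OF iv])
        show "integrable lborel (\<lambda>z. \<epsilon> * bump 1 y (r k) z)" using ib by simp
        fix z
        show "\<bar>(h z - v) * bump 1 z (r k) y\<bar> \<le> \<epsilon> * bump 1 y (r k) z"
        proof (cases "dist z y \<le> r k")
          case True
          then show ?thesis unfolding reflect[of z _ y] using v[OF True] bump_nonneg[of 1 y "r k" z]
            by (simp add: abs_mult mult_right_mono)
        next
          case False
          then have "bump 1 y (r k) z = 0" by (intro b0(1) r) (simp add: dist_commute)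
          then show ?thesis unfolding reflect[of z _ y] by simp
        qed
      qed
      then have "\<bar>LINT z|lborel. (h z - v) * bump 1 z (r k) y\<bar> \<le> \<epsilon> * c k" by (simp add: cz)
      then have "\<bar>(LINT z|lborel. (h z - v) * bump 1 z (r k) y) / c k\<bar> \<le> \<epsilon>"
        using c[of k] by (simp only: abs_divide abs_of_pos pos_divide_le_eq)
      ultimately show ?thesis by (simp only:)
    qed
    show "\<bar>S k h y\<bar> \<le> C" for k using est[of k 0 C] h(3) by simp
    show "S k h y = 0" if "y \<notin> K'" for k
    proof -
      have "h z * bump 1 z (r k) y = 0" for z
      proof (cases "z \<in> ?K")
        case True
        then have "y \<notin> cball z (r k)" using that r(2)[of k] unfolding K'_def by force
        then have "bump 1 z (r k) y = 0" by (intro b0(1) r)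
        then show ?thesis by simp
      next
        case False
        then show ?thesis by (simp add: h(2))
      qed
      then show ?thesis by (simp only: S_def Bochner_Integration.integral_zero div_0)
    qed
    show "(\<lambda>k. S k h y) \<longlonglongrightarrow> h y"
    proof (rule LIMSEQ_I)
      fix \<epsilon> :: real assume \<epsilon>: "\<epsilon> > 0"
      have "continuous (at y) h" using h(1) by (simp add: continuous_on_eq_continuous_at)
      then obtain d where d: "d > 0" "\<And>z. dist z y < d \<Longrightarrow> dist (h z) (h y) < \<epsilon> / 2"
        using \<epsilon> unfolding continuous_at by (metis half_gt_zero Lim_at dist_self zero_less_dist_iff)
      obtain M where M: "\<And>k. k \<ge> M \<Longrightarrow> \<bar>r k\<bar> < d" using LIMSEQ_D[OF r0 d(1)] by auto
      have "\<bar>S k h y - h y\<bar> < \<epsilon>" if "k \<ge> M" for k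
      proof -
        have "\<bar>S k h y - h y\<bar> \<le> \<epsilon> / 2"
        proof (rule est)
          fix z assume "dist z y \<le> r k"
          then have "dist z y < d" using M[OF that] by simp
          from d(2)[OF this] show "\<bar>h z - h y\<bar> \<le> \<epsilon> / 2" by (simp add: dist_real_def)
        qed
        then show ?thesis using \<epsilon> by simp
      qed
      then show "\<exists>no. \<forall>k\<ge>no. norm (S k h y - h y) < \<epsilon>" by auto
    qed
    show "S k h \<in> borel_measurable borel" for k
    proof -
      have [measurable]: "h \<in> borel_measurable borel" "bump 1 0 (r k) \<in> borel_measurable (borel :: (real^'n) measure)"
        using h(1) mb by (auto intro: borel_measurable_continuous_onI)
      have "(\<lambda>y. LINT z|lborel. h z * bump 1 0 (r k) (y - z)) \<in> borel_measurable borel"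
        by (rule sigma_finite_measure.borel_measurable_lebesgue_integral[OF lborel.sigma_finite_measure_axioms]) measurable
      moreover have "S k h = (\<lambda>y. (LINT z|lborel. h z * bump 1 0 (r k) (y - z)) / c k)"
        by (simp add: S_def fun_eq_iff bump_translate[symmetric])
      ultimately show ?thesis by simp
    qed
  qed
  obtain C where C: "\<And>y. \<bar>\<psi> y\<bar> \<le> C" "\<And>y. \<bar>partial i \<psi> y\<bar> \<le> C"
    by (rule test_function_bounded[OF \<psi>, of i]) (rule that)
  note S\<psi> = Sprop[OF t(4) support_0[of _ \<psi>] C(1)] and Sp = Sprop[OF t(5)[of i] partial_eq_0[of _ \<psi> i] C(2)]
  have "(\<lambda>k. LINT y|lborel. f y * S k (partial i \<psi>) y + D y * S k \<psi> y) \<longlonglongrightarrow> (LINT y|lborel. f y * partial i \<psi> y + D y * \<psi> y)"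
  proof (rule weak_limit[where K=K' and B=C])
    show "set_integrable lborel K' f" "set_integrable lborel K' D" using f[OF K'] D[OF K'] .
    show "\<psi> \<in> borel_measurable borel" "partial i \<psi> \<in> borel_measurable borel"
      using t by (auto intro: borel_measurable_continuous_onI)
  qed (use S\<psi> Sp in blast)+
  moreover have "(LINT y|lborel. f y * S k (partial i \<psi>) y + D y * S k \<psi> y) = 0" for k
  proof -
    obtain B1 where B1: "\<forall>y. \<bar>bump 1 0 (r k) y\<bar> \<le> B1 \<and> \<bar>partial i (bump 1 0 (r k)) y\<bar> \<le> B1" using B[OF r(1)] by blast
    define f0 where "f0 y = indicator K' y *\<^sub>R f y" for y
    define D0 where "D0 y = indicator K' y *\<^sub>R D y" for y
    have i0: "integrable lborel f0" "integrable lborel D0"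
      using f[OF K'] D[OF K'] by (auto simp: set_integrable_def f0_def[abs_def] D0_def[abs_def])
    note [measurable] = borel_measurable_integrable[OF i0(1), simplified] borel_measurable_integrable[OF i0(2), simplified]
    have [measurable]: "\<psi> \<in> borel_measurable borel" using t by (auto intro: borel_measurable_continuous_onI)
    have [measurable]: "bump 1 0 (r k) \<in> borel_measurable (borel::(real^'n) measure)" "partial i (bump 1 0 (r k)) \<in> borel_measurable borel"
      using mb by auto
    have i\<psi>: "integrable lborel \<psi>" by (rule integrable_compact_support[OF t(4) t(2)]) (rule support_0)
    define H where "H y z = \<psi> z * (f0 y * partial i (bump 1 0 (r k)) (y - z) + D0 y * bump 1 0 (r k) (y - z))" for y z
    have iH: "integrable (lborel \<Otimes>\<^sub>M lborel) (\<lambda>(y, z). H y z)"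
    proof (rule Bochner_Integration.integrable_bound)
      show "integrable (lborel \<Otimes>\<^sub>M lborel) (\<lambda>(y, z). (B1 * (\<bar>f0 y\<bar> + \<bar>D0 y\<bar>)) * \<bar>\<psi> z\<bar>)"
        using i0 i\<psi> by (intro integrable_pair_mult lborel.sigma_finite_measure_axioms) auto
      show "(\<lambda>(y, z). H y z) \<in> borel_measurable (lborel \<Otimes>\<^sub>M lborel)" unfolding H_def by measurable
      show "AE p in lborel \<Otimes>\<^sub>M lborel. norm (case p of (y, z) \<Rightarrow> H y z) \<le> norm (case p of (y, z) \<Rightarrow> (B1 * (\<bar>f0 y\<bar> + \<bar>D0 y\<bar>)) * \<bar>\<psi> z\<bar>)"
      proof (rule AE_I2, clarify)
        fix y z
        have B10: "B1 \<ge> 0" using B1 by (meson abs_ge_zero order_trans)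
        have "\<bar>f0 y\<bar> * \<bar>partial i (bump 1 0 (r k)) (y - z)\<bar> \<le> \<bar>f0 y\<bar> * B1" "\<bar>D0 y\<bar> * \<bar>bump 1 0 (r k) (y - z)\<bar> \<le> \<bar>D0 y\<bar> * B1"
          using B1 by (auto intro: mult_left_mono)
        then have "\<bar>f0 y * partial i (bump 1 0 (r k)) (y - z) + D0 y * bump 1 0 (r k) (y - z)\<bar> \<le> B1 * (\<bar>f0 y\<bar> + \<bar>D0 y\<bar>)"
          using abs_triangle_ineq[of "f0 y * partial i (bump 1 0 (r k)) (y - z)" "D0 y * bump 1 0 (r k) (y - z)"]
          by (simp add: abs_mult algebra_simps)
        then show "norm (H y z) \<le> norm ((B1 * (\<bar>f0 y\<bar> + \<bar>D0 y\<bar>)) * \<bar>\<psi> z\<bar>)"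
          using B10 by (simp add: H_def abs_mult mult.commute mult_left_mono)
      qed
    qed
    have "f y * S k (partial i \<psi>) y + D y * S k \<psi> y = (LINT z|lborel. H y z) / c k" for y
    proof -
      \<comment> \<open>The derivative is moved from \<open>\<psi>\<close> to the bump, and the
        reflection law turns it into a derivative in \<open>y\<close>, the variable in which the
        identity for bumps is stated.\<close>
      have "(LINT z|lborel. partial i \<psi> z * bump 1 z (r k) y) = (LINT z|lborel. \<psi> z * partial i (bump 1 z (r k)) y)"
      proof -
        have "(LINT z|lborel. \<psi> z * partial i (bump 1 y (r k)) z) = - (LINT z|lborel. partial i \<psi> z * bump 1 y (r k) z)"
          by (rule integral_by_parts(1)[OF \<psi> open_UNIV subset_UNIV smooth_on_bump])
        moreover have "partial i (bump 1 z (r k)) y = - partial i (bump 1 y (r k)) z" for z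
          by (rule partial_bump_reflect)
        ultimately show ?thesis by (simp add: reflect[of _ _ y])
      qed
      then have e1: "f y * S k (partial i \<psi>) y = f0 y * (LINT z|lborel. \<psi> z * partial i (bump 1 0 (r k)) (y - z)) / c k"
        using Sp(3)[of y k] by (cases "y \<in> K'") (auto simp: f0_def S_def partial_bump_translate[of i 1 _ "r k" y])
      have e2: "D y * S k \<psi> y = D0 y * (LINT z|lborel. \<psi> z * bump 1 0 (r k) (y - z)) / c k"
        using S\<psi>(3)[of y k] by (cases "y \<in> K'") (auto simp: D0_def S_def bump_translate[of 1 _ "r k" y])
      have ii: "integrable lborel (\<lambda>z. \<psi> z * partial i (bump 1 0 (r k)) (y - z))" "integrable lborel (\<lambda>z. \<psi> z * bump 1 0 (r k) (y - z))"
      proof -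
        have z: "\<psi> z * v = 0" if "z \<notin> ?K" for z v using support_0[OF that] by simp
        have cc: "continuous_on UNIV (\<lambda>z. \<psi> z * partial i (bump 1 0 (r k)) (y - z))" "continuous_on UNIV (\<lambda>z. \<psi> z * bump 1 0 (r k) (y - z))"
          by (intro continuous_on_mult t(4) continuous_on_compose2[OF cb(2)] continuous_on_compose2[OF cb(1)] continuous_intros; simp)+
        show "integrable lborel (\<lambda>z. \<psi> z * partial i (bump 1 0 (r k)) (y - z))" "integrable lborel (\<lambda>z. \<psi> z * bump 1 0 (r k) (y - z))"
          by (rule integrable_compact_support[OF cc(1) t(2) z], assumption, rule integrable_compact_support[OF cc(2) t(2) z], assumption)
      qed
      have "(LINT z|lborel. H y z) = f0 y * (LINT z|lborel. \<psi> z * partial i (bump 1 0 (r k)) (y - z)) + D0 y * (LINT z|lborel. \<psi> z * bump 1 0 (r k) (y - z))"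
      proof -
        have "H y z = f0 y * (\<psi> z * partial i (bump 1 0 (r k)) (y - z)) + D0 y * (\<psi> z * bump 1 0 (r k) (y - z))" for z
          by (simp only: H_def distrib_left mult.left_commute)
        then have "(LINT z|lborel. H y z) = (LINT z|lborel. f0 y * (\<psi> z * partial i (bump 1 0 (r k)) (y - z)) + D0 y * (\<psi> z * bump 1 0 (r k) (y - z)))"
          by (simp only:)
        also have "\<dots> = (LINT z|lborel. f0 y * (\<psi> z * partial i (bump 1 0 (r k)) (y - z))) + (LINT z|lborel. D0 y * (\<psi> z * bump 1 0 (r k) (y - z)))"
          by (rule Bochner_Integration.integral_add) (intro integrable_mult_right ii)+
        finally show ?thesis by (simp only: integral_mult_right_zero)
      qed
      then show ?thesis by (simp add: e1 e2 add_divide_distrib)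
    qed
    then have "(LINT y|lborel. f y * S k (partial i \<psi>) y + D y * S k \<psi> y) = (LINT y|lborel. LINT z|lborel. H y z) / c k" by simp
    \<comment> \<open>After the exchange the inner integral is, for fixed \<open>z\<close>, the
      value \<open>\<psi> z\<close> times the identity for the bump centred at \<open>z\<close>,
      which is 0.\<close>
    also have "(LINT y|lborel. LINT z|lborel. H y z) = (LINT z|lborel. LINT y|lborel. H y z)"
      by (rule lborel_pair.Fubini_integral[OF iH, symmetric])
    also have "(LINT y|lborel. H y z) = 0" for z
    proof (cases "z \<in> ?K")
      case True
      have sub: "cball z (r k) \<subseteq> K'" using True r(2)[of k] by (auto simp: K'_def intro!: bexI[of _ z])
      have "f0 y * partial i (bump 1 0 (r k)) (y - z) + D0 y * bump 1 0 (r k) (y - z)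
          = f y * partial i (bump 1 z (r k)) y + D y * bump 1 z (r k) y" for y
      proof (cases "y \<in> K'")
        case True then show ?thesis by (simp add: f0_def D0_def bump_translate[of 1 z] partial_bump_translate[of i 1 z])
      next
        case False
        then have "bump 1 z (r k) y = 0" "partial i (bump 1 z (r k)) y = 0" using sub by (auto intro!: b0 r)
        with False show ?thesis by (simp add: f0_def D0_def)
      qed
      then have "(LINT y|lborel. H y z) = \<psi> z * a (k + N) z" by (simp add: H_def a_def r_def)
      moreover have "a (k + N) z = 0" using sub K'(2) by (intro a0) (auto simp: r_def)
      ultimately show ?thesis by simp
    next
      case False
      then have "\<psi> z = 0" by (rule support_0)
      then show ?thesis by (simp add: H_def)
    qed
    then have "(LINT z|lborel. LINT y|lborel. H y z) / c k = 0" by simp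
    finally show ?thesis .
  qed
  ultimately show ?thesis by (simp add: LIMSEQ_const_iff)
qed

subsection \<open>Splitting off one coordinate\<close>

lemma abs_mult_le_bound: "\<bar>m\<bar> \<le> B \<Longrightarrow> \<bar>X * m\<bar> \<le> \<bar>B * X :: real\<bar>"
  using mult_left_mono[of "\<bar>m\<bar>" "\<bar>B\<bar>" "\<bar>X\<bar>"] by (simp add: abs_mult mult.commute)

text \<open>Growing \<open>k\<close> turns bumps into indicators, so \<open>a\<close> has integral 0
  over every interval. The measures whose densities are the positive and the negative part of
  \<open>a\<close> on \<open>{p..q}\<close> then agree on intervals and hence everywhere.\<close>

lemma AE_0_if_orthogonal_bumps:
  fixes a :: "real \<Rightarrow> real"
  assumes a: "\<And>K. compact K \<Longrightarrow> K \<subseteq> {1<..} \<Longrightarrow> set_integrable lborel K a"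
    and orth: "\<And>k c r. k > 0 \<Longrightarrow> r > 0 \<Longrightarrow> cball c r \<subseteq> {1<..} \<Longrightarrow> (LINT t|lborel. a t * bump k c r t) = 0"
  shows "AE t in lborel. t > 1 \<longrightarrow> a t = 0"
proof -
  have ball0: "(LINT t|lborel. indicator (ball c r) t * a t) = 0" if r: "r > 0" and cr: "cball c r \<subseteq> {1<..}" for c r :: real
  proof -
    define a0 where "a0 t = indicator (cball c r) t *\<^sub>R a t" for t
    have i: "integrable lborel a0" using a[OF compact_cball cr] by (simp add: set_integrable_def a0_def[abs_def])
    note [measurable] = borel_measurable_integrable[OF i, simplified]
    have bz: "bump (real (Suc k)) c r t = 0" if "t \<notin> cball c r" for k t
      using that bump_pos_iff[of "real (Suc k)" r c t] bump_nonneg[of "real (Suc k)" c r t] r by simp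
    have [measurable]: "bump (real (Suc k)) c r \<in> borel_measurable borel" for k
      by (rule borel_measurable_continuous_onI[OF smooth_on_continuous[OF smooth_on_bump]])
    have "(\<lambda>k. LINT t|lborel. a0 t * bump (real (Suc k)) c r t) \<longlonglongrightarrow> (LINT t|lborel. a0 t * indicator (ball c r) t)"
    proof (rule integral_dominated_convergence)
      show "integrable lborel (\<lambda>t. \<bar>a0 t\<bar>)" using i by simp
      show "AE t in lborel. (\<lambda>k. a0 t * bump (real (Suc k)) c r t) \<longlonglongrightarrow> a0 t * indicator (ball c r) t"
        by (rule AE_I2) (intro tendsto_intros bump_tendsto r)
      show "AE t in lborel. norm (a0 t * bump (real (Suc k)) c r t) \<le> \<bar>a0 t\<bar>" for k
      proof (rule AE_I2)
        fix t show "norm (a0 t * bump (real (Suc k)) c r t) \<le> \<bar>a0 t\<bar>"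
          using bump_nonneg[of "real (Suc k)" c r t] bump_le_1[of "real (Suc k)" c r t]
          by (simp add: abs_mult mult_left_le)
      qed
      have [measurable]: "ball c r \<in> sets borel" by simp
      show "(\<lambda>t. a0 t * indicator (ball c r) t) \<in> borel_measurable lborel" by measurable
      show "(\<lambda>t. a0 t * bump (real (Suc k)) c r t) \<in> borel_measurable lborel" for k
        by (intro borel_measurable_times) (auto intro: borel_measurable_continuous_onI[OF smooth_on_continuous[OF smooth_on_bump]])
    qed
    moreover have "a0 t * bump (real (Suc k)) c r t = a t * bump (real (Suc k)) c r t" for k t
      using bz[of t k] by (cases "t \<in> cball c r") (auto simp: a0_def)
    then have "(LINT t|lborel. a0 t * bump (real (Suc k)) c r t) = 0" for k
      using orth[OF _ r cr, of "real (Suc k)"] by (simp only:)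
    ultimately have "(LINT t|lborel. a0 t * indicator (ball c r) t) = 0" by (simp add: LIMSEQ_const_iff)
    moreover have "(\<lambda>t. a0 t * indicator (ball c r) t) = (\<lambda>t. indicator (ball c r) t * a t)"
      by (auto simp: a0_def fun_eq_iff split: split_indicator)
    ultimately show ?thesis by simp
  qed
  have part: "AE t in lborel. p < t \<and> t < q \<longrightarrow> a t = 0" if pq: "1 < p" "p < q" for p q
  proof -
    define b where "b t = indicator {p..q} t *\<^sub>R a t" for t
    have ib: "integrable lborel b" 
    proof -
      have "{p..q} \<subseteq> {1<..}" using pq by auto
      from a[OF _ this] show ?thesis by (simp add: set_integrable_def b_def[abs_def])
    qed
    note [measurable] = borel_measurable_integrable[OF ib, simplified]
    let ?M = "\<lambda>s. density lborel (\<lambda>t. ennreal (max 0 (s * b t)))"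
    have em: "emeasure (?M s) X = ennreal (LINT t|lborel. indicator X t * max 0 (s * b t))" if X: "X \<in> sets borel" for s X
    proof -
      have "emeasure (?M s) X = (\<integral>\<^sup>+t. ennreal (indicator X t * max 0 (s * b t)) \<partial>lborel)"
        using X by (subst emeasure_density) (auto intro!: nn_integral_cong split: split_indicator)
      also have "\<dots> = ennreal (LINT t|lborel. indicator X t * max 0 (s * b t))"
      proof (rule nn_integral_eq_integral)
        have "integrable lborel (\<lambda>t. max 0 (s * b t))" using ib by simp
        from integrable_mult_indicator[OF _ this, of X] X show "integrable lborel (\<lambda>t. indicator X t * max 0 (s * b t))" by simp
      qed (auto split: split_indicator)
      finally show ?thesis .
    qed
    have "?M 1 = ?M (-1)"
    proof (rule measure_eqI_generator_eq)
      let ?E = "range (\<lambda>(a, b). box a b :: real set)"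
      show "Int_stable ?E" by (auto simp: Int_stable_def box_Int_box)
      show "?E \<subseteq> Pow UNIV" "sets (?M 1) = sigma_sets UNIV ?E" "sets (?M (-1)) = sigma_sets UNIV ?E"
        by (simp_all add: borel_eq_box)
      let ?A = "\<lambda>n::nat. box (- (real n *\<^sub>R One)) (real n *\<^sub>R One) :: real set"
      show "range ?A \<subseteq> ?E" "(\<Union>i. ?A i) = UNIV" unfolding UN_box_eq_UNIV by auto
      show "emeasure (?M 1) (?A i) \<noteq> \<infinity>" for i by (subst em) auto
      fix X assume "X \<in> ?E"
      then obtain l u where X: "X = {l<..<u}" by auto
      have Xb: "X \<in> sets borel" by (simp add: X)
      have i: "integrable lborel (\<lambda>t. indicator X t * max 0 (s * b t))" for s
      proof -
        have "integrable lborel (\<lambda>t. max 0 (s * b t))" using ib by simp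
        from integrable_mult_indicator[OF _ this, of X] Xb show ?thesis by simp
      qed
      \<comment> \<open>The interval is clipped to \<open>{p..q}\<close>, outside of which
        \<open>b\<close> is 0; the two end points form a null set.\<close>
      define l' u' where "l' = max l p" and "u' = min u q"
      have "(LINT t|lborel. indicator X t * max 0 (1 * b t)) - (LINT t|lborel. indicator X t * max 0 (- 1 * b t))
          = (LINT t|lborel. indicator X t * max 0 (1 * b t) - indicator X t * max 0 (- 1 * b t))"
        by (rule Bochner_Integration.integral_diff[symmetric, OF i i])
      also have "\<dots> = (LINT t|lborel. indicator {l'<..<u'} t * a t)"
      proof (rule integral_cong_AE)
        show "AE t in lborel. indicator X t * max 0 (1 * b t) - indicator X t * max 0 (- 1 * b t) = indicator {l'<..<u'} t * a t"
          using AE_lborel_singleton[of p] AE_lborel_singleton[of q]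
          by eventually_elim (auto simp: X b_def l'_def u'_def max_def split: split_indicator)
        show "(\<lambda>t. indicator X t * max 0 (1 * b t) - indicator X t * max 0 (- 1 * b t)) \<in> borel_measurable lborel" using Xb by measurable
        have "(\<lambda>t. indicator {l'<..<u'} t * a t) = (\<lambda>t. indicator {l'<..<u'} t * b t)"
          by (auto simp: fun_eq_iff b_def l'_def u'_def split: split_indicator)
        then show "(\<lambda>t. indicator {l'<..<u'} t * a t) \<in> borel_measurable lborel" by simp
      qed
      also have "\<dots> = 0"
      proof (cases "l' < u'")
        case True
        have "{l'<..<u'} = ball ((l' + u') / 2) ((u' - l') / 2)" by (simp add: ball_eq_greaterThanLessThan field_simps)
        moreover have "cball ((l' + u') / 2) ((u' - l') / 2) \<subseteq> {1<..}"
          using pq True by (auto simp: cball_eq_atLeastAtMost field_simps l'_def)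
        ultimately show ?thesis using ball0[of "(u' - l') / 2" "(l' + u') / 2"] True by simp
      qed simp
      finally show "emeasure (?M 1) X = emeasure (?M (-1)) X" unfolding em[OF Xb] by simp
    qed
    then have "AE t in lborel. ennreal (max 0 (1 * b t)) = ennreal (max 0 (- 1 * b t))"
      by (intro sigma_finite_measure.density_unique[OF lborel.sigma_finite_measure_axioms]) auto
    then show ?thesis
      by eventually_elim (auto simp: b_def max_def split: if_splits)
  qed
  \<comment> \<open>Countably many intervals exhaust the half line. Since \<open>rad n\<close> is at
    most 1, the upper end \<open>n + 3\<close> exceeds the lower end for every \<open>n\<close>, as
    \<open>part\<close> demands.\<close>
  have "AE t in lborel. \<forall>n. 1 + rad n < t \<and> t < real n + 3 \<longrightarrow> a t = 0"
  proof (subst AE_all_countable, rule allI, rule part)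
    fix n
    have "rad n \<le> 1" by (simp add: field_simps)
    then show "1 + rad n < real n + 3" by linarith
  qed simp
  then show ?thesis
  proof eventually_elim
    case (elim t)
    show ?case
    proof
      assume "1 < t"
      then obtain N where N: "\<And>k. k \<ge> N \<Longrightarrow> rad k < t - 1" using rad_small[of "t - 1"] by auto
      obtain M where M: "t < real M" using reals_Archimedean2 by blast
      have "1 + rad (max N M) < t" using N[of "max N M"] by simp
      moreover have "t < real (max N M) + 3" using M by simp
      ultimately show "a t = 0" using elim by blast
    qed
  qed
qed

text \<open>Dimensions are types, so \<open>n = m + 1\<close> is witnessed by a bijection \<open>b\<close>; it induces the
  identification \<open>L\<close> of \<open>\<real>\<^sup>m \<times> \<real>\<close> with \<open>\<real>\<^sup>n\<close>, whose inverse is \<open>P\<close>.\<close>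

locale split_coords =
  fixes b :: "'m::finite option \<Rightarrow> 'n::finite"
  assumes bij_b: "bij b"
begin

definition L :: "(real^'m) \<times> real \<Rightarrow> real^'n" where
  "L p = (\<chi> k. case inv b k of Some i \<Rightarrow> fst p $ i | None \<Rightarrow> snd p)"

definition P :: "real^'n \<Rightarrow> (real^'m) \<times> real" where
  "P x = ((\<chi> i. x $ b (Some i)), x $ b None)"

lemma inv_b [simp]: "inv b (b k) = k" using bij_b by (simp add: bij_is_inj)

lemma b_eq_iff [simp]: "b k = b l \<longleftrightarrow> k = l" using bij_b by (metis inv_b)

lemma b_cases: obtains i where "k = b (Some i)" | "k = b None"
  using bij_b by (metis bij_pointE option.exhaust)

lemma L_nth [simp]: "L p $ b (Some i) = fst p $ i" "L p $ b None = snd p" by (simp_all add: L_def)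

lemma PL [simp]: "P (L p) = p" by (simp add: P_def prod_eq_iff vec_eq_iff)

lemma LP [simp]: "L (P x) = x"
proof -
  have "L (P x) $ k = x $ k" for k by (cases k rule: b_cases) (simp_all add: P_def)
  then show ?thesis by (simp add: vec_eq_iff)
qed

lemma sum_b: "(\<Sum>k\<in>UNIV. f k) = f (b None) + (\<Sum>i\<in>UNIV. f (b (Some i)))"
proof -
  have "(\<Sum>k\<in>UNIV. f k) = (\<Sum>k'\<in>UNIV. f (b k'))" using sum.reindex_bij_betw[OF bij_b, of f] by simp
  then show ?thesis by (simp add: UNIV_option_conv sum.reindex)
qed

lemma vec_eq_b: "x = y \<longleftrightarrow> (\<forall>i. x $ b (Some i) = y $ b (Some i)) \<and> x $ b None = y $ b None"
  by (metis (no_types, lifting) b_cases vec_eq_iff)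

lemma linear_L: "linear L" and linear_P: "linear P"
proof -
  show "linear L" by (rule linearI) (simp_all add: vec_eq_b)
  show "linear P" by (rule linearI) (simp_all add: P_def vec_eq_iff)
qed

lemma bounded_linear_L: "bounded_linear L" and bounded_linear_P: "bounded_linear P"
  using linear_L linear_P by (simp_all add: linear_conv_bounded_linear)

lemma continuous_L: "continuous_on S L" and continuous_P: "continuous_on S' P"
  using bounded_linear_L bounded_linear_P by (auto intro: linear_continuous_on)

lemma L_axis: "L (axis i 1, 0) = axis (b (Some i)) 1" "L (0, 1) = axis (b None) 1"
  by (auto simp: vec_eq_b axis_def)

lemma P_axis: "P (axis (b (Some i)) 1) = (axis i 1, 0)" "P (axis (b None) 1) = (0, 1)"
  by (metis L_axis PL)+

lemma open_L_image: "open S \<Longrightarrow> open (L ` S)"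
proof -
  assume "open S"
  moreover have "L ` S = P -` S" by (auto simp: image_iff) (metis LP)
  ultimately show ?thesis using open_vimage[OF \<open>open S\<close> continuous_P] by simp
qed

lemma bij_betw_L_Basis: "bij_betw L Basis Basis"
proof (rule bij_betw_byWitness[where f'=P])
  show "L ` Basis \<subseteq> Basis"
    by (auto simp: Basis_prod_def Basis_vec_def L_axis zero_prod_def[symmetric])
  show "P ` Basis \<subseteq> Basis"
  proof
    fix p assume "p \<in> P ` (Basis :: (real^'n) set)"
    then obtain k where "p = P (axis k 1)" by (auto simp: Basis_vec_def)
    then show "p \<in> Basis" by (cases k rule: b_cases) (auto simp: P_axis Basis_prod_def Basis_vec_def)
  qed
qed simp_all

lemma distr_L: "distr (lborel \<Otimes>\<^sub>M lborel) borel L = lborel"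
  using lborel_distr_basis[OF linear_L bij_betw_L_Basis] by (simp add: lborel_prod)

lemma L_measurable [measurable]: "L \<in> borel_measurable borel" "P \<in> borel_measurable borel"
  using continuous_L continuous_P by (auto intro: borel_measurable_continuous_onI)

lemma L_measurable' [measurable]: "L \<in> lborel \<Otimes>\<^sub>M lborel \<rightarrow>\<^sub>M borel" "L \<in> borel \<Otimes>\<^sub>M borel \<rightarrow>\<^sub>M borel"
  using L_measurable(1) by (simp_all add: lborel_prod borel_prod)

lemma nn_integral_L:
  assumes "f \<in> borel_measurable borel"
  shows "(\<integral>\<^sup>+x. f x \<partial>lborel) = (\<integral>\<^sup>+p. f (L p) \<partial>(lborel \<Otimes>\<^sub>M lborel))"
  using nn_integral_distr[of L "lborel \<Otimes>\<^sub>M lborel" borel f] assms by (simp add: distr_L)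

lemma integral_L:
  fixes f :: "_ \<Rightarrow> real"
  assumes "f \<in> borel_measurable borel"
  shows "integrable lborel f \<longleftrightarrow> integrable (lborel \<Otimes>\<^sub>M lborel) (\<lambda>p. f (L p))"
    "(LINT x|lborel. f x) = integral\<^sup>L (lborel \<Otimes>\<^sub>M lborel) (\<lambda>p. f (L p))"
  using integrable_distr_eq[of L "lborel \<Otimes>\<^sub>M lborel" borel f] integral_distr[of L "lborel \<Otimes>\<^sub>M lborel" borel f] assms
  by (simp_all add: distr_L)

lemma partial_fst_P:
  assumes "h differentiable (at (fst (P x)))"
  shows "partial (b (Some i)) (\<lambda>x. h (fst (P x))) x = partial i h (fst (P x))"
    "partial (b None) (\<lambda>x. h (fst (P x))) x = 0" "(\<lambda>x. h (fst (P x))) differentiable (at x)"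
proof -
  have "((\<lambda>x. fst (P x)) has_derivative (\<lambda>v. fst (P v))) (at x)"
    using bounded_linear_imp_has_derivative[OF bounded_linear_compose[OF bounded_linear_fst bounded_linear_P]] by (simp add: o_def)
  from diff_chain_at[OF this assms[unfolded frechet_derivative_works]]
  have d: "((\<lambda>x. h (fst (P x))) has_derivative (\<lambda>v. frechet_derivative h (at (fst (P x))) (fst (P v)))) (at x)"
    by (simp add: o_def)
  show "partial (b (Some i)) (\<lambda>x. h (fst (P x))) x = partial i h (fst (P x))"
    using partial_eqI[OF d] by (simp add: P_axis partial_def)
  show "partial (b None) (\<lambda>x. h (fst (P x))) x = 0"
    using partial_eqI[OF d] linear_0[OF linear_frechet_derivative[OF assms]] by (simp add: P_axis)
  show "(\<lambda>x. h (fst (P x))) differentiable (at x)" using d by (auto simp: differentiable_def)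
qed

lemma partial_snd_P:
  fixes h :: "real \<Rightarrow> real"
  assumes "h differentiable (at (snd (P x)))"
  shows "partial (b (Some i)) (\<lambda>x. h (snd (P x))) x = 0"
    "partial (b None) (\<lambda>x. h (snd (P x))) x = frechet_derivative h (at (snd (P x))) 1" "(\<lambda>x. h (snd (P x))) differentiable (at x)"
proof -
  have "((\<lambda>x. snd (P x)) has_derivative (\<lambda>v. snd (P v))) (at x)"
    using bounded_linear_imp_has_derivative[OF bounded_linear_compose[OF bounded_linear_snd bounded_linear_P]] by (simp add: o_def)
  from diff_chain_at[OF this assms[unfolded frechet_derivative_works]]
  have d: "((\<lambda>x. h (snd (P x))) has_derivative (\<lambda>v. frechet_derivative h (at (snd (P x))) (snd (P v)))) (at x)"
    by (simp add: o_def)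
  show "partial (b (Some i)) (\<lambda>x. h (snd (P x))) x = 0"
    using partial_eqI[OF d] linear_0[OF linear_frechet_derivative[OF assms]] by (simp add: P_axis)
  show "partial (b None) (\<lambda>x. h (snd (P x))) x = frechet_derivative h (at (snd (P x))) 1"
    using partial_eqI[OF d] by (simp add: P_axis)
  show "(\<lambda>x. h (snd (P x))) differentiable (at x)" using d by (auto simp: differentiable_def)
qed

lemma test_function_product:
  assumes \<psi>: "test_function V \<psi>" and \<eta>: "smooth_on UNIV \<eta>" "compact I" "I \<subseteq> {1<..}" "\<And>t. t \<notin> I \<Longrightarrow> \<eta> t = 0"
  shows "test_function (L ` (V \<times> {1<..})) (\<lambda>x. \<psi> (fst (P x)) * \<eta> (snd (P x)))"
proof (rule test_functionI)
  let ?K = "closure {y. \<psi> y \<noteq> 0}"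
  note t = test_functionD[OF \<psi>]
  show "smooth_on UNIV (\<lambda>x. \<psi> (fst (P x)) * \<eta> (snd (P x)))"
  proof (rule smooth_on_mult)
    show "smooth_on UNIV (\<lambda>x. \<psi> (fst (P x)))"
      by (rule smooth_on_compose[OF open_UNIV open_UNIV _ _ t(1)])
        (auto intro: smooth_on_fst smooth_on_bounded_linear[OF bounded_linear_P])
    show "smooth_on UNIV (\<lambda>x. \<eta> (snd (P x)))"
      by (rule smooth_on_compose[OF open_UNIV open_UNIV _ _ \<eta>(1)])
        (auto intro: smooth_on_snd smooth_on_bounded_linear[OF bounded_linear_P])
  qed simp
  show "compact (L ` (?K \<times> I))" using t(2) \<eta>(2) by (intro compact_continuous_image continuous_L compact_Times)
  show "L ` (?K \<times> I) \<subseteq> L ` (V \<times> {1<..})" using t(3) \<eta>(3) by blast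
  show "\<psi> (fst (P x)) * \<eta> (snd (P x)) = 0" if "x \<notin> L ` (?K \<times> I)" for x
  proof (cases "fst (P x) \<in> ?K")
    case True
    then have "snd (P x) \<notin> I" using that by (metis LP SigmaI imageI prod.collapse)
    then show ?thesis by (simp add: \<eta>(4))
  next
    case False
    from support_0[OF this] show ?thesis by simp
  qed
qed

lemma set_integrable_product:
  fixes h :: "real^'n \<Rightarrow> real"
  assumes h: "\<And>K. compact K \<Longrightarrow> K \<subseteq> L ` (V \<times> {1<..}) \<Longrightarrow> set_integrable lborel K h"
    and K: "compact K" "K \<subseteq> V" and I: "compact I" "I \<subseteq> {1<..}"
  shows "integrable (lborel \<Otimes>\<^sub>M lborel) (\<lambda>(y, t). indicator K y * indicator I t * h (L (y, t)))"
proof -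
  have "compact (L ` (K \<times> I))" using K I by (intro compact_continuous_image continuous_L compact_Times)
  moreover have "L ` (K \<times> I) \<subseteq> L ` (V \<times> {1<..})" using K I by blast
  ultimately have i: "integrable lborel (\<lambda>x. indicator (L ` (K \<times> I)) x * h x)"
    using h by (simp add: set_integrable_def)
  have "indicator (L ` (K \<times> I)) (L (y, t)) = (indicator K y * indicator I t :: real)" for y t
  proof -
    have "inj L" by (metis PL injI)
    then have "L (y, t) \<in> L ` (K \<times> I) \<longleftrightarrow> y \<in> K \<and> t \<in> I" by (simp add: inj_image_mem_iff)
    then show ?thesis by (auto split: split_indicator)
  qed
  then have "(\<lambda>(y, t). indicator K y * indicator I t * h (L (y, t))) = (\<lambda>p. indicator (L ` (K \<times> I)) (L p) * h (L p))"
    by (auto simp: fun_eq_iff)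
  then show ?thesis
    using integral_L(1)[of "\<lambda>x. indicator (L ` (K \<times> I)) x * h x"] borel_measurable_integrable[OF i] i by simp
qed

text \<open>Fubini on \<open>K\<close> times a compact interval; countably many intervals, the first
  ones empty, exhaust the half line t > 1.\<close>

lemma AE_slice_set_integrable:
  fixes h :: "real^'n \<Rightarrow> real"
  assumes h: "\<And>K. compact K \<Longrightarrow> K \<subseteq> L ` (V \<times> {1<..}) \<Longrightarrow> set_integrable lborel K h"
    and K: "compact K" "K \<subseteq> V"
  shows "AE t in lborel. t > 1 \<longrightarrow> set_integrable lborel K (\<lambda>y. h (L (y, t)))"
proof -
  have "AE t in lborel. \<forall>n. t \<in> {1 + rad n..real n} \<longrightarrow> set_integrable lborel K (\<lambda>y. h (L (y, t)))"
  proof (subst AE_all_countable, rule allI)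
    fix n
    have I: "compact {1 + rad n..real n}" "{1 + rad n..real n} \<subseteq> {1<..}" by (auto intro: less_le_trans[of 1 "1 + rad n"])
    have "integrable (lborel \<Otimes>\<^sub>M lborel) (\<lambda>(y, t). indicator K y * indicator {1 + rad n..real n} t * h (L (y, t)))"
      by (rule set_integrable_product[OF h K I])
    from lborel_pair.AE_integrable_snd[OF this]
    show "AE t in lborel. t \<in> {1 + rad n..real n} \<longrightarrow> set_integrable lborel K (\<lambda>y. h (L (y, t)))"
      by eventually_elim (auto simp: set_integrable_def)
  qed
  then show ?thesis
  proof eventually_elim
    case (elim t)
    show ?case
    proof
      assume "1 < t"
      then obtain N where N: "\<And>k. k \<ge> N \<Longrightarrow> rad k < t - 1" using rad_small[of "t - 1"] by auto
      obtain M where M: "t < real M" using reals_Archimedean2 by blast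
      have "1 + rad (max N M) \<le> t" using N[of "max N M"] by simp
      moreover have "t \<le> real (max N M)" using M by simp
      ultimately show "set_integrable lborel K (\<lambda>y. h (L (y, t)))" using elim by auto
    qed
  qed
qed

text \<open>Testing with products of a function of y and a bump in t shows that the defect
  \<open>a p i\<close> of the weak identity on slices is orthogonal to all bumps, hence 0 for almost
  every t. One null set serves the countably many balls in \<open>\<C>\<close>, and
  \<open>weak_identity_from_bumps\<close> passes to all test functions of a slice.\<close>

theorem slice_weak_gradient:
  assumes V: "open V" and w: "weak_gradient_on (L ` (V \<times> {1<..})) f D"
  shows "AE t in lborel. t > 1 \<longrightarrow>
    weak_gradient_on V (\<lambda>y. f (L (y, t))) (\<lambda>y. \<chi> i. D (L (y, t)) $ b (Some i))"
proof -
  note wD = weak_gradient_onD[OF w]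
  obtain Q :: "(real^'m) set" where Q: "countable Q" "dense Q" by (rule countable_dense)
  define \<C> where "\<C> = {p \<in> Q \<times> (UNIV :: nat set). cball (fst p) (rad (snd p)) \<subseteq> V}"
  have cC: "countable \<C>" unfolding \<C>_def using Q(1) by (intro countable_subset[OF _ countable_SIGMA[of Q "\<lambda>_. UNIV"]]) auto
  have C: "cball (fst p) (rad (snd p)) \<subseteq> V" if "p \<in> \<C>" for p using that by (simp add: \<C>_def)
  let ?\<rho> = "\<lambda>p. bump 1 (fst p) (rad (snd p))"
  have t\<rho>: "test_function V (?\<rho> p)" if "p \<in> \<C>" for p by (rule test_function_bump) (use C[OF that] in auto)
  define a where "a p i t = (LINT y|lborel. f (L (y, t)) * partial i (?\<rho> p) y + D (L (y, t)) $ b (Some i) * ?\<rho> p y)" for p i t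
  have a0: "AE t in lborel. t > 1 \<longrightarrow> a p i t = 0" if p: "p \<in> \<C>" for p i
  proof -
    note t = test_functionD[OF t\<rho>[OF p]]
    let ?K = "closure {y. ?\<rho> p y \<noteq> 0}"
    define H where "H y t = f (L (y, t)) * partial i (?\<rho> p) y + D (L (y, t)) $ b (Some i) * ?\<rho> p y" for y t
    obtain B where B: "\<And>y. \<bar>?\<rho> p y\<bar> \<le> B" "\<And>y. \<bar>partial i (?\<rho> p) y\<bar> \<le> B" by (rule test_function_bounded[OF t\<rho>[OF p], of i]) (rule that)
    have m\<rho> [measurable]: "?\<rho> p \<in> borel_measurable borel" "partial i (?\<rho> p) \<in> borel_measurable borel"
      using t by (auto intro: borel_measurable_continuous_onI)
    have zK: "?\<rho> p y = 0" "partial i (?\<rho> p) y = 0" if "y \<notin> ?K" for y using that by (rule support_0, rule partial_eq_0)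
    have iH: "integrable (lborel \<Otimes>\<^sub>M lborel) (\<lambda>(y, t). H y t * (indicator I t * \<eta> t))"
      if I: "compact I" "I \<subseteq> {1<..}" and \<eta>: "\<eta> \<in> borel_measurable borel" "\<And>t. \<bar>\<eta> t\<bar> \<le> 1" for I and \<eta> :: "real \<Rightarrow> real"
    proof -
      have "integrable (lborel \<Otimes>\<^sub>M lborel) (\<lambda>(y, t). (indicator ?K y * indicator I t * h (L (y, t))) * (m y * \<eta> t))"
        if h: "\<And>K. compact K \<Longrightarrow> K \<subseteq> L ` (V \<times> {1<..}) \<Longrightarrow> set_integrable lborel K h"
          and m: "m \<in> borel_measurable borel" "\<And>y. \<bar>m y\<bar> \<le> B" for h m
      proof (rule Bochner_Integration.integrable_bound)
        have i: "integrable (lborel \<Otimes>\<^sub>M lborel) (\<lambda>(y, t). indicator ?K y * indicator I t * h (L (y, t)))"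
          by (rule set_integrable_product[OF h t(2,3) I])
        then show "integrable (lborel \<Otimes>\<^sub>M lborel) (\<lambda>p. B * (case p of (y, t) \<Rightarrow> indicator ?K y * indicator I t * h (L (y, t))))" by simp
        note [measurable] = borel_measurable_integrable[OF i] m(1) \<eta>(1)
        have "(\<lambda>p. (case p of (y, t) \<Rightarrow> indicator ?K y * indicator I t * h (L (y, t))) * (m (fst p) * \<eta> (snd p))) \<in> borel_measurable (lborel \<Otimes>\<^sub>M lborel)"
          by measurable
        then show "(\<lambda>(y, t). (indicator ?K y * indicator I t * h (L (y, t))) * (m y * \<eta> t)) \<in> borel_measurable (lborel \<Otimes>\<^sub>M lborel)"
          by (simp add: case_prod_beta')
        show "AE p in lborel \<Otimes>\<^sub>M lborel. norm (case p of (y, t) \<Rightarrow> (indicator ?K y * indicator I t * h (L (y, t))) * (m y * \<eta> t))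
           \<le> norm (B * (case p of (y, t) \<Rightarrow> indicator ?K y * indicator I t * h (L (y, t))))"
        proof (rule AE_I2, clarify)
          fix y t
          have "B \<ge> 0" using m(2)[of 0] by linarith
          have "\<bar>m y * \<eta> t\<bar> \<le> B * 1" unfolding abs_mult using m(2) \<eta>(2) \<open>B \<ge> 0\<close> by (intro mult_mono) auto
          then show "norm ((indicator ?K y * indicator I t * h (L (y, t))) * (m y * \<eta> t)) \<le> norm (B * (indicator ?K y * indicator I t * h (L (y, t))))"
            unfolding real_norm_def by (intro abs_mult_le_bound) simp
        qed
      qed
      note this[of f "partial i (?\<rho> p)"] this[of "\<lambda>x. D x $ b (Some i)" "?\<rho> p"]
      then have "integrable (lborel \<Otimes>\<^sub>M lborel) (\<lambda>p'. (case p' of (y, t) \<Rightarrow> (indicator ?K y * indicator I t * f (L (y, t))) * (partial i (?\<rho> p) y * \<eta> t))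
         + (case p' of (y, t) \<Rightarrow> (indicator ?K y * indicator I t * D (L (y, t)) $ b (Some i)) * (?\<rho> p y * \<eta> t)))"
        by (intro Bochner_Integration.integrable_add) (use wD(1,2) B m\<rho> in blast)+
      moreover have "(case p' of (y, t) \<Rightarrow> (indicator ?K y * indicator I t * f (L (y, t))) * (partial i (?\<rho> p) y * \<eta> t))
         + (case p' of (y, t) \<Rightarrow> (indicator ?K y * indicator I t * D (L (y, t)) $ b (Some i)) * (?\<rho> p y * \<eta> t))
         = (case p' of (y, t) \<Rightarrow> H y t * (indicator I t * \<eta> t))" for p'
      proof (cases p')
        case (Pair y t)
        show ?thesis unfolding Pair
          using zK[of y] by (cases "y \<in> ?K") (simp_all add: H_def algebra_simps)
      qed
      ultimately show ?thesis by simp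
    qed
    have aH: "a p i t = (LINT y|lborel. H y t)" for t by (simp add: a_def H_def)
    show ?thesis
    proof (rule AE_0_if_orthogonal_bumps)
      fix I :: "real set" assume I: "compact I" "I \<subseteq> {1<..}"
      have "integrable lborel (\<lambda>t. LINT y|lborel. H y t * (indicator I t * 1))"
        using lborel_pair.integrable_snd[OF iH[OF I, of "\<lambda>_. 1"]] by simp
      moreover have "(\<lambda>t. LINT y|lborel. H y t * (indicator I t * 1)) = (\<lambda>t. indicator I t *\<^sub>R a p i t)"
        by (simp add: aH mult.commute)
      ultimately show "set_integrable lborel I (a p i)" by (simp add: set_integrable_def)
    next
      fix k c r :: real assume kr: "k > 0" "r > 0" "cball c r \<subseteq> {1<..}"
      let ?\<eta> = "bump k c r"
      have \<eta>z: "?\<eta> t = 0" if "t \<notin> cball c r" for t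
        using that bump_pos_iff[OF kr(1,2), of c t] bump_nonneg[of k c r t] by simp
      define \<Psi> where "\<Psi> x = ?\<rho> p (fst (P x)) * ?\<eta> (snd (P x))" for x
      have t\<Psi>: "test_function (L ` (V \<times> {1<..})) \<Psi>"
        unfolding \<Psi>_def[abs_def] by (rule test_function_product[OF t\<rho>[OF p] smooth_on_bump compact_cball kr(3) \<eta>z])
      have p\<Psi>: "partial (b (Some i)) \<Psi> x = partial i (?\<rho> p) (fst (P x)) * ?\<eta> (snd (P x))" for x
      proof -
        have d1: "?\<rho> p differentiable (at (fst (P x)))" by (rule t(6))
        have d2: "?\<eta> differentiable (at (snd (P x)))" by (rule smooth_on_differentiable[OF smooth_on_bump UNIV_I])
        show ?thesis unfolding \<Psi>_def[abs_def]
          by (subst partial_mult[OF partial_fst_P(3)[OF d1] partial_snd_P(3)[OF d2]])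
            (simp only: partial_fst_P[OF d1] partial_snd_P[OF d2] mult_zero_right add_0_right)
      qed
      have i: "integrable lborel (\<lambda>x. f x * partial (b (Some i)) \<Psi> x + D x $ b (Some i) * \<Psi> x)"
        using wD(4)[OF t\<Psi>] wD(5)[OF t\<Psi>] by (rule Bochner_Integration.integrable_add)
      have "(LINT x|lborel. f x * partial (b (Some i)) \<Psi> x + D x $ b (Some i) * \<Psi> x) = 0"
        using wD(3)[OF t\<Psi>, of "b (Some i)"] wD(4)[OF t\<Psi>] wD(5)[OF t\<Psi>] by (subst Bochner_Integration.integral_add) auto
      then have "0 = integral\<^sup>L (lborel \<Otimes>\<^sub>M lborel) (\<lambda>q. f (L q) * partial (b (Some i)) \<Psi> (L q) + D (L q) $ b (Some i) * \<Psi> (L q))"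
        using integral_L(2) borel_measurable_integrable[OF i] by simp
      also have "\<dots> = integral\<^sup>L (lborel \<Otimes>\<^sub>M lborel) (\<lambda>(y, t). H y t * (indicator (cball c r) t * ?\<eta> t))"
      proof (intro Bochner_Integration.integral_cong refl)
        fix q :: "(real^'m) \<times> real"
        obtain y t where q: "q = (y, t)" by (cases q)
        have "indicator (cball c r) t * ?\<eta> t = ?\<eta> t" using \<eta>z[of t] by (cases "t \<in> cball c r") auto
        then show "f (L q) * partial (b (Some i)) \<Psi> (L q) + D (L q) $ b (Some i) * \<Psi> (L q) = (case q of (y, t) \<Rightarrow> H y t * (indicator (cball c r) t * ?\<eta> t))"
          unfolding q p\<Psi> by (simp only: prod.case \<Psi>_def H_def PL fst_conv snd_conv distrib_right mult.assoc)
      qed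
      also have "\<dots> = (LINT t|lborel. LINT y|lborel. H y t * (indicator (cball c r) t * ?\<eta> t))"
        using bump_nonneg[of k c r] bump_le_1[of k c r]
        by (intro lborel_pair.integral_snd[symmetric] iH compact_cball kr borel_measurable_continuous_onI smooth_on_continuous[OF smooth_on_bump]) auto
      also have "\<dots> = (LINT t|lborel. a p i t * ?\<eta> t)"
      proof (intro Bochner_Integration.integral_cong refl)
        fix t
        have "indicator (cball c r) t * ?\<eta> t = ?\<eta> t" using \<eta>z[of t] by (cases "t \<in> cball c r") auto
        then show "(LINT y|lborel. H y t * (indicator (cball c r) t * ?\<eta> t)) = a p i t * ?\<eta> t" by (simp add: aH)
      qed
      finally show "(LINT t|lborel. a p i t * ?\<eta> t) = 0" by simp
    qed
  qed
  \<comment> \<open>Outside a single null set: the identities and the local integrability for all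
    balls and all components.\<close>
  have "AE t in lborel. \<forall>p\<in>\<C>. (\<forall>i. t > 1 \<longrightarrow> a p i t = 0) \<and>
     (t > 1 \<longrightarrow> set_integrable lborel (cball (fst p) (rad (snd p))) (\<lambda>y. f (L (y, t)))) \<and>
     (\<forall>i. t > 1 \<longrightarrow> set_integrable lborel (cball (fst p) (rad (snd p))) (\<lambda>y. D (L (y, t)) $ b (Some i)))"
  proof (subst AE_ball_countable[OF cC], intro ballI AE_conjI)
    fix p assume p: "p \<in> \<C>"
    show "AE t in lborel. \<forall>i. t > 1 \<longrightarrow> a p i t = 0" using a0[OF p] by (subst AE_all_countable) auto
    show "AE t in lborel. t > 1 \<longrightarrow> set_integrable lborel (cball (fst p) (rad (snd p))) (\<lambda>y. f (L (y, t)))"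
      by (rule AE_slice_set_integrable[OF wD(1) compact_cball C[OF p]])
    show "AE t in lborel. \<forall>i. t > 1 \<longrightarrow> set_integrable lborel (cball (fst p) (rad (snd p))) (\<lambda>y. D (L (y, t)) $ b (Some i))"
    proof (subst AE_all_countable, rule allI)
      fix i show "AE t in lborel. t > 1 \<longrightarrow> set_integrable lborel (cball (fst p) (rad (snd p))) (\<lambda>y. D (L (y, t)) $ b (Some i))"
        by (rule AE_slice_set_integrable[OF wD(2) compact_cball C[OF p]])
    qed
  qed
  then show ?thesis
  proof eventually_elim
    case (elim t)
    show ?case
    proof
      assume t: "1 < t"
      have \<C>I: "(q, k) \<in> \<C>" if "q \<in> Q" "cball q (rad k) \<subseteq> V" for q k using that by (simp add: \<C>_def)
      have sf: "set_integrable lborel K (\<lambda>y. f (L (y, t)))" if "compact K" "K \<subseteq> V" for K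
        by (rule set_integrable_compact_from_balls[OF V Q(2) _ that]) (use elim t \<C>I in force)
      have sD: "set_integrable lborel K (\<lambda>y. D (L (y, t)) $ b (Some i))" if "compact K" "K \<subseteq> V" for K i
        by (rule set_integrable_compact_from_balls[OF V Q(2) _ that]) (use elim t \<C>I in force)
      show "weak_gradient_on V (\<lambda>y. f (L (y, t))) (\<lambda>y. \<chi> i. D (L (y, t)) $ b (Some i))"
      proof (rule weak_gradient_onI)
        fix \<psi> :: "real^'m \<Rightarrow> real" and i assume \<psi>: "test_function V \<psi>"
        note tt = test_functionD[OF \<psi>]
        have "(LINT y|lborel. f (L (y, t)) * partial i \<psi> y + D (L (y, t)) $ b (Some i) * \<psi> y) = 0"
        proof (rule weak_identity_from_bumps[OF V Q(2) sf sD _ \<psi>])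
          fix q k assume "q \<in> Q" "cball q (rad k) \<subseteq> V"
          from \<C>I[OF this] elim t have "a (q, k) i t = 0" by blast
          then show "(LINT y|lborel. f (L (y, t)) * partial i (bump 1 q (rad k)) y + D (L (y, t)) $ b (Some i) * bump 1 q (rad k) y) = 0"
            by (simp add: a_def)
        qed
        moreover have "integrable lborel (\<lambda>y. f (L (y, t)) * partial i \<psi> y)"
          by (rule integrable_times_continuous[OF sf[OF tt(2,3)] tt(5) tt(2)]) (rule partial_eq_0)
        moreover have "integrable lborel (\<lambda>y. D (L (y, t)) $ b (Some i) * \<psi> y)"
          by (rule integrable_times_continuous[OF sD[OF tt(2,3)] tt(4) tt(2)]) (rule support_0)
        ultimately show "(LINT y|lborel. f (L (y, t)) * partial i \<psi> y) = - (LINT y|lborel. (\<chi> i. D (L (y, t)) $ b (Some i)) $ i * \<psi> y)"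
          by simp
      qed (use sf sD in auto)
    qed
  qed
qed

end

section \<open>Product metrics and changes of the atlas\<close>

context split_coords
begin

lemma mat_eq_b: "(A :: real^'n^'n) = B \<longleftrightarrow> (\<forall>k l. A $ b k $ b l = B $ b k $ b l)"
  using bij_b by (auto simp: vec_eq_iff) (metis bij_pointE)

lemma b_neq [simp]: "b (Some i) \<noteq> b None" "b None \<noteq> b (Some i)" by simp_all

text \<open>The Gram matrix of \<open>h + dt\<^sup>2\<close> in the coordinates given by \<^term>\<open>L\<close>.\<close>

definition product_form :: "real^'n^'n \<Rightarrow> real^'m^'m \<Rightarrow> bool" where
  "product_form H K \<longleftrightarrow> (\<forall>i j. H $ b (Some i) $ b (Some j) = K $ i $ j) \<and>
     (\<forall>i. H $ b (Some i) $ b None = 0 \<and> H $ b None $ b (Some i) = 0) \<and> H $ b None $ b None = 1"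

lemma product_formD:
  assumes "product_form H K"
  shows "H $ b (Some i) $ b (Some j) = K $ i $ j" "H $ b (Some i) $ b None = 0" "H $ b None $ b (Some i) = 0" "H $ b None $ b None = 1"
  using assms by (auto simp: product_form_def)

text \<open>In the Leibniz formula a permutation that moves \<open>b None\<close> meets a zero
  entry; the others are the permutations of the remaining indices, with unchanged sign.\<close>

lemma det_product_form:
  assumes H: "product_form H K" shows "det H = det K"
proof -
  let ?f = "\<lambda>i. b (Some i)"
  have inj: "inj ?f" by (simp add: inj_def)
  have rng: "range ?f = UNIV - {b None}"
  proof -
    have "k \<in> range ?f" if "k \<noteq> b None" for k using that by (cases k rule: b_cases) auto
    then show ?thesis by auto
  qed
  have invf: "inv_into UNIV ?f (b (Some i)) = i" for i using inv_f_f[OF inj, of i] by simp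
  have mp: "map_permutation UNIV ?f q (b (Some i)) = b (Some (q i))" for q i
    by (simp add: map_permutation_def restrict_id_def invf)
  have mpN: "map_permutation UNIV ?f q (b None) = b None" for q
    by (simp add: map_permutation_def restrict_id_def rng)
  have "det H = (\<Sum>p\<in>{p. p permutes (UNIV::'n set)}. of_int (sign p) * (\<Prod>k\<in>UNIV. H $ k $ p k))"
    by (simp add: det_def)
  also have "\<dots> = (\<Sum>p\<in>{p. p permutes range ?f}. of_int (sign p) * (\<Prod>k\<in>UNIV. H $ k $ p k))"
  proof (rule sum.mono_neutral_right)
    show "finite {p. p permutes (UNIV::'n set)}" by (simp add: finite_permutations)
    show "{p. p permutes range ?f} \<subseteq> {p. p permutes UNIV}" using permutes_subset by blast
    show "\<forall>p\<in>{p. p permutes UNIV} - {p. p permutes range ?f}. of_int (sign p) * (\<Prod>k\<in>UNIV. H $ k $ p k) = 0"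
    proof
      fix p assume p: "p \<in> {p. p permutes UNIV} - {p. p permutes range ?f}"
      then have "p (b None) \<noteq> b None" unfolding rng using permutes_superset[of p UNIV "UNIV - {b None}"] by auto
      then have "H $ b None $ p (b None) = 0" using product_formD(3)[OF H] by (cases "p (b None)" rule: b_cases) auto
      then show "of_int (sign p) * (\<Prod>k\<in>UNIV. H $ k $ p k) = 0" by (simp add: prod_zero_iff) blast
    qed
  qed
  also have "\<dots> = (\<Sum>q\<in>{q. q permutes (UNIV::'m set)}. of_int (sign (map_permutation UNIV ?f q)) * (\<Prod>k\<in>UNIV. H $ k $ map_permutation UNIV ?f q k))"
  proof (rule sum.reindex_bij_witness[where i="map_permutation UNIV ?f" and j="map_permutation (range ?f) (inv_into UNIV ?f)"])
    fix p assume "p \<in> {p. p permutes range ?f}"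
    then have p: "p permutes range ?f" by simp
    have bb: "bij_betw (inv_into UNIV ?f) (range ?f) UNIV" using inj by (simp add: inj_imp_bij_betw_inv)
    show "map_permutation (range ?f) (inv_into UNIV ?f) p \<in> {q. q permutes UNIV}"
      using map_permutation_permutes[OF bb p] by simp
    have "map_permutation UNIV ?f (map_permutation (range ?f) (inv_into UNIV ?f) p) = map_permutation (range ?f) (?f \<circ> inv_into UNIV ?f) p"
      using bb p inj by (intro map_permutation_compose) auto
    also have "\<dots> = map_permutation (range ?f) id p"
      using p by (intro map_permutation_cong) (auto simp: invf inj_on_def)
    also have "\<dots> = p" using p by simp
    finally show *: "map_permutation UNIV ?f (map_permutation (range ?f) (inv_into UNIV ?f) p) = p" .
    show "of_int (sign (map_permutation UNIV ?f (map_permutation (range ?f) (inv_into UNIV ?f) p))) *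
        (\<Prod>k\<in>UNIV. H $ k $ map_permutation UNIV ?f (map_permutation (range ?f) (inv_into UNIV ?f) p) k)
       = of_int (sign p) * (\<Prod>k\<in>UNIV. H $ k $ p k)" by (simp only: *)
  next
    fix q assume "q \<in> {q. q permutes (UNIV :: 'm set)}"
    then have q: "q permutes UNIV" by simp
    have bf: "bij_betw ?f UNIV (range ?f)" using inj by (simp add: bij_betw_def)
    show "map_permutation UNIV ?f q \<in> {p. p permutes range ?f}" using map_permutation_permutes[OF bf q] by simp
    have "map_permutation (range ?f) (inv_into UNIV ?f) (map_permutation UNIV ?f q) = map_permutation UNIV (inv_into UNIV ?f \<circ> ?f) q"
      using bf q inj by (intro map_permutation_compose) (auto simp: inj_on_inv_into)
    also have "inv_into UNIV ?f \<circ> ?f = id" using inj by simp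
    finally show "map_permutation (range ?f) (inv_into UNIV ?f) (map_permutation UNIV ?f q) = q" using q by simp
  qed
  also have "\<dots> = (\<Sum>q\<in>{q. q permutes (UNIV::'m set)}. of_int (sign q) * (\<Prod>i\<in>UNIV. K $ i $ q i))"
  proof (rule sum.cong[OF refl])
    fix q assume "q \<in> {q. q permutes (UNIV :: 'm set)}"
    then have "sign (map_permutation UNIV ?f q) = sign q" by (intro sign_map_permutation inj) auto
    moreover have "(\<Prod>k\<in>UNIV. H $ k $ map_permutation UNIV ?f q k) = (\<Prod>k'\<in>UNIV. H $ b k' $ map_permutation UNIV ?f q (b k'))"
      using prod.reindex_bij_betw[OF bij_b, of "\<lambda>k. H $ k $ map_permutation UNIV ?f q k"] by simp
    then have "(\<Prod>k\<in>UNIV. H $ k $ map_permutation UNIV ?f q k) = (\<Prod>i\<in>UNIV. K $ i $ q i)"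
      by (simp add: UNIV_option_conv prod.reindex mp mpN product_formD[OF H])
    ultimately show "of_int (sign (map_permutation UNIV ?f q)) * (\<Prod>k\<in>UNIV. H $ k $ map_permutation UNIV ?f q k)
       = of_int (sign q) * (\<Prod>i\<in>UNIV. K $ i $ q i)" by simp
  qed
  finally show ?thesis by (simp add: det_def)
qed

lemma matrix_inv_product_form:
  assumes H: "product_form H K" and K: "det K \<noteq> 0"
  shows "product_form (matrix_inv H) (matrix_inv K)"
proof -
  define N :: "real^'n^'n" where "N = (\<chi> k l. case inv b k of Some i \<Rightarrow> (case inv b l of Some j \<Rightarrow> matrix_inv K $ i $ j | None \<Rightarrow> 0)
      | None \<Rightarrow> (case inv b l of Some j \<Rightarrow> 0 | None \<Rightarrow> 1))"
  have N: "product_form N (matrix_inv K)" by (simp add: product_form_def N_def)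
  have KK: "(\<Sum>m\<in>UNIV. K $ i $ m * matrix_inv K $ m $ j) = (if i = j then 1 else 0)" for i j
    using matrix_inv_mult(1)[OF K] by (simp add: matrix_matrix_mult_def mat_def vec_eq_iff)
  have "H ** N = mat 1"
  proof -
    have "(H ** N) $ b k $ b l = mat 1 $ b k $ b l" for k l
      by (cases k; cases l) (simp_all add: matrix_matrix_mult_def sum_b product_formD[OF H] product_formD[OF N] mat_def KK)
    then show ?thesis by (simp add: mat_eq_b)
  qed
  then have "matrix_inv H = N"
    using matrix_inv_mult(2)[of H] K det_product_form[OF H] by (metis matrix_mul_assoc matrix_mul_lid matrix_mul_rid)
  with N show ?thesis by simp
qed

text \<open>Nothing depends on t and the metric components with a t-index are constant, so
  Christoffel symbols with such an index vanish, as does the Ricci component in direction t. Mixed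
  Ricci components meet zero entries of the inverse metric.\<close>

lemma scalar_curvature_product:
  assumes G: "metric_coords S G" and H: "metric_coords V H"
    and form: "\<And>x. x \<in> S \<Longrightarrow> product_form (G x) (H (fst (P x)))" and SV: "\<And>x. x \<in> S \<Longrightarrow> fst (P x) \<in> V"
    and x: "x \<in> S"
  shows "scalar_curvature_coord G x = scalar_curvature_coord H (fst (P x))"
proof -
  interpret G: metric_coords S G by (rule G)
  interpret H: metric_coords V H by (rule H)
  have inv: "product_form (matrix_inv (G x)) (matrix_inv (H (fst (P x))))" if "x \<in> S" for x
    by (rule matrix_inv_product_form[OF form[OF that] H.det[OF SV[OF that]]])
  have pc: "partial k f x = 0" if "x \<in> S" "\<And>z. z \<in> S \<Longrightarrow> f z = c" for k x c and f :: "real^'n \<Rightarrow> real"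
  proof -
    have "(f has_derivative (\<lambda>_. 0)) (at x)"
      by (rule has_derivative_transform_within_open[OF has_derivative_const G.openV that(1)]) (simp add: that(2))
    then show ?thesis by (simp add: partial_eqI)
  qed
  have pS: "partial (b (Some l)) f x = partial l h (fst (P x))" "partial (b None) f x = 0"
    if "x \<in> S" "\<And>z. z \<in> S \<Longrightarrow> f z = h (fst (P z))" "smooth_on V h" for l x and f :: "real^'n \<Rightarrow> real" and h
  proof -
    note d = smooth_on_differentiable[OF that(3) SV[OF that(1)]]
    have "partial k f x = partial k (\<lambda>x. h (fst (P x))) x" for k
      by (rule partial_cong[symmetric, OF G.openV that(1) _ partial_fst_P(3)[OF d]]) (simp add: that(2))
    then show "partial (b (Some l)) f x = partial l h (fst (P x))" "partial (b None) f x = 0"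
      by (simp_all add: partial_fst_P[OF d])
  qed
  have pG: "partial (b (Some l)) (\<lambda>x. G x $ b (Some i) $ b (Some j)) x = partial l (\<lambda>y. H y $ i $ j) (fst (P x))"
    "partial (b None) (\<lambda>x. G x $ b (Some i) $ b (Some j)) x = 0"
    "partial k (\<lambda>x. G x $ b None $ b k') x = 0" "partial k (\<lambda>x. G x $ b k' $ b None) x = 0" if "x \<in> S" for x i j k k' l
  proof -
    show "partial (b (Some l)) (\<lambda>x. G x $ b (Some i) $ b (Some j)) x = partial l (\<lambda>y. H y $ i $ j) (fst (P x))"
      "partial (b None) (\<lambda>x. G x $ b (Some i) $ b (Some j)) x = 0"
      by (rule pS[OF that _ H.smoothGc]; simp add: product_formD[OF form])+
    show "partial k (\<lambda>x. G x $ b None $ b k') x = 0" "partial k (\<lambda>x. G x $ b k' $ b None) x = 0"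
      by (rule pc[OF that, where c="if k' = None then 1 else 0"]; cases k'; simp add: product_formD[OF form])+
  qed
  have cS: "christoffel G (b (Some k)) (b (Some i)) (b (Some j)) x = christoffel H k i j (fst (P x))" if "x \<in> S" for x k i j
    by (simp add: christoffel_def sum_b pG[OF that] product_formD[OF inv[OF that]])
  have c0: "christoffel G (b None) (b i) (b j) x = 0" "christoffel G (b i) (b None) (b j) x = 0" "christoffel G (b i) (b j) (b None) x = 0"
    if "x \<in> S" for x i j
    by (cases i; cases j; simp add: christoffel_def sum_b pG[OF that] product_formD[OF inv[OF that]])+
  have p0: "partial m (christoffel G (b None) (b i) (b j)) x = 0" "partial m (christoffel G (b i) (b None) (b j)) x = 0"
     "partial m (christoffel G (b i) (b j) (b None)) x = 0" for m i j
    by (rule pc[OF x c0(1)], assumption, rule pc[OF x c0(2)], assumption, rule pc[OF x c0(3)], assumption)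
  have pSc: "partial (b (Some l)) (christoffel G (b (Some k)) (b (Some i)) (b (Some j))) x = partial l (christoffel H k i j) (fst (P x))"
    "partial (b None) (christoffel G (b (Some k)) (b (Some i)) (b (Some j))) x = 0" for l k i j
    by (rule pS[OF x cS H.smooth_christoffel]; assumption)+
  have rS: "ricci G (b (Some i)) (b (Some j)) x = ricci H i j (fst (P x))" for i j
    by (simp add: ricci_def sum_b p0 pSc c0[OF x] cS[OF x])
  have r0: "ricci G (b None) (b None) x = 0"
    by (simp add: ricci_def sum_b p0 c0[OF x])
  show ?thesis
    by (simp add: scalar_curvature_coord_def sum_b rS r0 product_formD[OF inv[OF x]])
qed

end

section \<open>Conorms and the enlarged atlas\<close>

lemma (in riemannian) conorm_chart:
  assumes law: "\<And>c d p. c \<in> A \<Longrightarrow> d \<in> A \<Longrightarrow> p \<in> fst c \<Longrightarrow> p \<in> fst d \<Longrightarrow> \<omega> c p = transpose (transition_jacobian c d p) *v \<omega> d p"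
    and c: "c \<in> A" "p \<in> fst c"
  shows "conorm_sq A g \<omega> p = \<omega> c p \<bullet> (matrix_inv (g c p) *v \<omega> c p)"
proof -
  define d where "d = chart_at A p"
  have d: "d \<in> A" "p \<in> fst d" using chart_at by (auto simp: d_def)
  let ?J = "transition_jacobian d c p"
  have J1: "transition_jacobian c d p ** ?J = mat 1" by (rule jacobian_inverse[OF d(1) c(1) d(2) c(2)])
  have J2: "?J ** transition_jacobian c d p = mat 1" by (rule jacobian_inverse[OF c(1) d(1) c(2) d(2)])
  let ?K = "transition_jacobian c d p"
  have gc: "det (g c p) \<noteq> 0" "det (g d p) \<noteq> 0" using det_metric c d by (auto simp: less_imp_neq[symmetric])
  have "matrix_inv (g d p) = ?K ** matrix_inv (g c p) ** transpose ?K"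
  proof -
    have "g d p ** (?K ** matrix_inv (g c p) ** transpose ?K) = transpose ?J ** (g c p ** (?J ** ?K) ** matrix_inv (g c p)) ** transpose ?K"
      by (simp add: metric_change[OF d(1) c(1) d(2) c(2)] matrix_mul_assoc)
    also have "\<dots> = transpose ?J ** transpose ?K" by (simp add: J2 matrix_inv_mult[OF gc(1)])
    also have "\<dots> = mat 1" by (simp add: matrix_transpose_mul[symmetric] J1 transpose_mat)
    finally show ?thesis using matrix_inv_mult(2)[OF gc(2)] by (metis matrix_mul_assoc matrix_mul_lid matrix_mul_rid)
  qed
  moreover have w: "\<omega> c p = transpose ?K *v \<omega> d p" by (rule law[OF c(1) d(1) c(2) d(2)])
  moreover have "\<omega> d p \<bullet> (?K *v v) = (transpose ?K *v \<omega> d p) \<bullet> v" for v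
    by (simp add: dot_lmul_matrix)
  ultimately have "\<omega> d p \<bullet> (matrix_inv (g d p) *v \<omega> d p) = \<omega> c p \<bullet> (matrix_inv (g c p) *v \<omega> c p)"
    by (simp only: matrix_vector_mul_assoc[symmetric])
  then show ?thesis by (simp add: conorm_sq_def Let_def d_def[symmetric])
qed

text \<open>Substituting \<open>w = H *v v\<close> turns the quadratic form of the inverse into that
  of \<open>H\<close>.\<close>

lemma matrix_inv_pos:
  fixes H :: "real^'n^'n"
  assumes "transpose H = H" "\<And>v. v \<noteq> 0 \<Longrightarrow> v \<bullet> (H *v v) > 0"
  shows "0 \<le> w \<bullet> (matrix_inv H *v w)"
proof -
  have d: "det H \<noteq> 0" using det_posdef[OF assms] by simp
  define v where "v = matrix_inv H *v w"
  have "H *v v = w" by (simp add: v_def matrix_vector_mul_assoc matrix_inv_mult[OF d])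
  then have "w \<bullet> (matrix_inv H *v w) = v \<bullet> (H *v v)" by (simp add: v_def inner_commute)
  also have "\<dots> \<ge> 0" using assms(2)[of v] by (cases "v = 0") auto
  finally show ?thesis .
qed

lemma (in riemannian) conorm_nonneg: "0 \<le> conorm_sq A g \<omega> p"
  using chart_at[of p] by (simp add: conorm_sq_def Let_def matrix_inv_pos metric_sym metric_pos)

text \<open>Charts adapted to the product structure of the end need not belong to the given atlas. Adding
  them changes neither measure, curvature nor weak differentials, so on the end everything may be
  computed in product coordinates.\<close>

definition extend_metric :: "('a, real^'n) chart set \<Rightarrow> ('a, 'n) metric \<Rightarrow> ('a, 'n) metric" where
  "extend_metric A g d p = (let c = chart_at A p; J = transition_jacobian d c p in transpose J ** g c p ** J)"

definition extend_covector :: "('a, real^'n) chart set \<Rightarrow> ('a, 'n) covector_field \<Rightarrow> ('a, 'n) covector_field" where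
  "extend_covector A \<omega> d p = (let c = chart_at A p; J = transition_jacobian d c p in transpose J *v \<omega> c p)"

locale atlas_extension = riemannian A g for A :: "('a::{t2_space,second_countable_topology}, real^'n) chart set" and g +
  fixes A'
  assumes atlas': "smooth_atlas A'" and sub: "A \<subseteq> A'"
begin

sublocale ext: smooth_manifold A' by unfold_locales (rule atlas')

abbreviation "g' \<equiv> extend_metric A g"

text \<open>The arbitrary \<open>chart_at\<close> in the definition drops out by the cocycle rule
  for Jacobians.\<close>

lemma extend_metric_eq:
  assumes "d \<in> A'" "c \<in> A" "p \<in> fst d" "p \<in> fst c"
  shows "g' d p = transpose (transition_jacobian d c p) ** g c p ** transition_jacobian d c p"
proof -
  define e where "e = chart_at A p"
  have e: "e \<in> A" "p \<in> fst e" using chart_at by (auto simp: e_def)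
  have eA: "e \<in> A'" "c \<in> A'" using e assms sub by auto
  have "transition_jacobian d c p = transition_jacobian e c p ** transition_jacobian d e p"
    by (rule ext.jacobian_cocycle) (use assms e eA in auto)
  moreover have "g e p = transpose (transition_jacobian e c p) ** g c p ** transition_jacobian e c p"
    by (rule metric_change) (use assms e in auto)
  ultimately show ?thesis
    by (simp add: extend_metric_def Let_def e_def[symmetric] matrix_transpose_mul matrix_mul_assoc)
qed

lemma extend_metric_same: "c \<in> A \<Longrightarrow> p \<in> fst c \<Longrightarrow> g' c p = g c p"
  using extend_metric_eq[of c c p] sub by (auto simp: jacobian_refl transpose_mat)

lemma extend_covector_eq:
  assumes law: "\<And>c d p. c \<in> A \<Longrightarrow> d \<in> A \<Longrightarrow> p \<in> fst c \<Longrightarrow> p \<in> fst d \<Longrightarrow> \<omega> c p = transpose (transition_jacobian c d p) *v \<omega> d p"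
    and "d \<in> A'" "c \<in> A" "p \<in> fst d" "p \<in> fst c"
  shows "extend_covector A \<omega> d p = transpose (transition_jacobian d c p) *v \<omega> c p"
proof -
  define e where "e = chart_at A p"
  have e: "e \<in> A" "p \<in> fst e" using chart_at by (auto simp: e_def)
  have eA: "e \<in> A'" "c \<in> A'" using e assms sub by auto
  have "transition_jacobian d c p = transition_jacobian e c p ** transition_jacobian d e p"
    by (rule ext.jacobian_cocycle) (use assms e eA in auto)
  moreover have "\<omega> e p = transpose (transition_jacobian e c p) *v \<omega> c p"
    by (rule law) (use assms e in auto)
  ultimately show ?thesis
    by (simp add: extend_covector_def Let_def e_def[symmetric] matrix_transpose_mul matrix_vector_mul_assoc del: transpose_matrix_vector)
qed

lemma extend_riemannian: "riemannian_metric A' g'"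
  unfolding riemannian_metric_def
proof (intro conjI ballI allI impI)
  fix d assume d: "d \<in> A'"
  note chd = is_chart_simps[OF ext.chart[OF d]]
  show "smooth_on (snd d ` fst d) (\<lambda>y. g' d (chart_inv d y))"
  proof (rule smooth_on_local)
    fix y assume "y \<in> snd d ` fst d"
    then obtain p where p: "p \<in> fst d" "y = snd d p" by auto
    obtain c where c: "c \<in> A" "p \<in> fst c" using chart_exists by metis
    then have c': "c \<in> A'" using sub by auto
    note chc = is_chart_simps[OF chart[OF c(1)]]
    define N where "N = fst d \<inter> fst c"
    have N: "open N" "N \<subseteq> fst d" "N \<subseteq> fst c" using open_chart[OF c(1)] ext.open_chart[OF d] by (auto simp: N_def)
    interpret diffeo "snd d ` N" "snd c ` N" "\<lambda>y. snd c (chart_inv d y)" "\<lambda>y. snd d (chart_inv c y)"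
      by (rule ext.transition_diffeo[OF d c' N])
    let ?F = "\<lambda>y. snd c (chart_inv d y)"
    have sJ: "smooth_on (snd d ` N) J" by (intro smooth_on_vec openU) (rule smoothJ)
    have sg: "smooth_on (snd d ` N) (\<lambda>y. g c (chart_inv c (?F y)))"
      by (rule smooth_on_compose[OF openU chc(2) order.trans[OF FU image_mono[OF N(3)]] smoothF smooth_metric[OF c(1)]])
    have "smooth_on (snd d ` N) (\<lambda>y. transpose (J y) ** g c (chart_inv c (?F y)) ** J y)"
      by (intro smooth_on_matrix_mult openU smooth_on_linear_compose[OF bounded_linear_transpose] sJ sg)
    moreover have "g' d (chart_inv d y) = transpose (J y) ** g c (chart_inv c (?F y)) ** J y" if y: "y \<in> snd d ` N" for y
    proof -
      obtain q where q: "q \<in> N" "y = snd d q" using y by auto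
      then have e: "chart_inv d y = q" "chart_inv c (snd c q) = q" using chd(3) chc(3) N by auto
      show ?thesis unfolding e using extend_metric_eq[OF d c(1), of q] q N by (auto simp: e ext.jacobian_eq)
    qed
    ultimately have "smooth_on (snd d ` N) (\<lambda>y. g' d (chart_inv d y))" by (subst smooth_on_cong[OF openU]) auto
    moreover have "y \<in> snd d ` N" using p c by (auto simp: N_def)
    ultimately show "\<exists>U. open U \<and> y \<in> U \<and> smooth_on U (\<lambda>y. g' d (chart_inv d y))" using openU by blast
  qed
  fix p assume p: "p \<in> fst d"
  obtain c where c: "c \<in> A" "p \<in> fst c" using chart_exists by metis
  then have c': "c \<in> A'" using sub by auto
  let ?J = "transition_jacobian d c p"
  note e = extend_metric_eq[OF d c(1) p c(2)]
  show "transpose (g' d p) = g' d p"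
    by (simp add: e matrix_transpose_mul metric_sym[OF c] matrix_mul_assoc)
  fix v :: "real^'n" assume v: "v \<noteq> 0"
  have "?J *v v \<noteq> 0"
  proof
    assume "?J *v v = 0"
    then have "(transition_jacobian c d p ** ?J) *v v = 0" by (simp add: matrix_vector_mul_assoc[symmetric])
    then show False using v by (simp add: ext.jacobian_inverse[OF d c' p c(2)])
  qed
  then have "0 < (?J *v v) \<bullet> (g c p *v (?J *v v))" by (rule metric_pos[OF c])
  also have "\<dots> = v \<bullet> (g' d p *v v)"
  proof -
    have "v \<bullet> (transpose ?J *v x) = (?J *v v) \<bullet> x" for x
      by (metis dot_lmul_matrix inner_commute transpose_matrix_vector)
    then show ?thesis by (simp only: e matrix_vector_mul_assoc[symmetric])
  qed
  finally show "0 < v \<bullet> (g' d p *v v)" .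
next
  fix d e p assume de: "d \<in> A'" "e \<in> A'" and "p \<in> fst d \<inter> fst e"
  then have p: "p \<in> fst d" "p \<in> fst e" by auto
  obtain c where c: "c \<in> A" "p \<in> fst c" using chart_exists by metis
  then have c': "c \<in> A'" using sub by auto
  show "g' d p = transpose (transition_jacobian d e p) ** g' e p ** transition_jacobian d e p"
    by (simp add: extend_metric_eq[OF _ c(1) _ c(2)] de p ext.jacobian_cocycle[OF de c' p c(2)] matrix_transpose_mul matrix_mul_assoc)
qed

sublocale ext: riemannian A' g' by unfold_locales (rule extend_riemannian)

text \<open>The old volume is characterized by the charts of \<open>A\<close> alone, and there the
  old and the new metric coincide; so the new volume meets that characterization.\<close>

lemma vol_extend: "riemannian_measure A g = riemannian_measure A' g'"
proof (rule vol_eqI)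
  have "emeasure ext.vol S = emeasure (chart_measure g c) S" if "c \<in> A" "S \<in> sets borel" "S \<subseteq> fst c" for c S
  proof -
    have "chart_measure g' c = chart_measure g c"
      unfolding chart_measure_def
      by (rule arg_cong[where f="\<lambda>f. distr (density lborel f) borel (chart_inv c)"])
        (use that is_chart_simps(5)[OF chart[OF that(1)]] extend_metric_same[OF that(1)] in \<open>auto simp: fun_eq_iff split: split_indicator\<close>)
    then show ?thesis using ext.emeasure_vol[of c S] that sub by auto
  qed
  then show "is_volume ext.vol" by (simp add: is_volume_def)
qed

lemma scalar_curvature_extend: "scalar_curvature A g p = scalar_curvature A' g' p"
proof -
  obtain c where c: "c \<in> A" "p \<in> fst c" using chart_exists by metis
  then have c': "c \<in> A'" using sub by auto
  note ch = is_chart_simps[OF chart[OF c(1)]]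
  \<comment> \<open>Curvature is compared under the identity map: the two Gram matrices agree only
    on the image of the chart, and invariance turns this into equal curvature there.\<close>
  interpret C: metric_change "snd c ` fst c" "\<lambda>y. g c (chart_inv c y)" "snd c ` fst c" "\<lambda>y. y" "\<lambda>y. g' c (chart_inv c y)"
    "\<lambda>y. matrix (frechet_derivative (\<lambda>y. y) (at y))"
  proof (rule metric_change.intro)
    have m: "matrix (\<lambda>x. x :: real^'n) = mat 1" by (simp add: matrix_def mat_def axis_def vec_eq_iff)
    show "metric_coords (snd c ` fst c) (\<lambda>y. g c (chart_inv c y))" by (rule metric_coords[OF c(1)])
    show "det (matrix (frechet_derivative (\<lambda>y. y) (at (y :: real^'n)))) \<noteq> 0" for y by (simp add: m)
    show "g' c (chart_inv c y) = transpose (matrix (frechet_derivative (\<lambda>y. y) (at y))) ** g c (chart_inv c y) ** matrix (frechet_derivative (\<lambda>y. y) (at y))"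
      if "y \<in> snd c ` fst c" for y
      using extend_metric_same[OF c(1) ch(5)[OF that]] by (simp add: m transpose_mat)
  qed (auto simp: ch(2))
  show ?thesis
    using C.scalar_curvature_coord_change[of "snd c p"] c
    by (simp add: scalar_curvature_chart[OF c] ext.scalar_curvature_chart[OF c' c(2)])
qed

lemma conorm_extend:
  assumes law: "\<And>c d p. c \<in> A' \<Longrightarrow> d \<in> A' \<Longrightarrow> p \<in> fst c \<Longrightarrow> p \<in> fst d \<Longrightarrow> \<omega>' c p = transpose (transition_jacobian c d p) *v \<omega>' d p"
    and eq: "\<And>c p. c \<in> A \<Longrightarrow> p \<in> fst c \<Longrightarrow> \<omega>' c p = \<omega> c p"
  shows "conorm_sq A g \<omega> p = conorm_sq A' g' \<omega>' p"
proof -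
  define c where "c = chart_at A p"
  have c: "c \<in> A" "p \<in> fst c" using chart_at by (auto simp: c_def)
  have "conorm_sq A' g' \<omega>' p = \<omega>' c p \<bullet> (matrix_inv (g' c p) *v \<omega>' c p)"
    by (rule ext.conorm_chart[OF law]) (use c sub in auto)
  then show ?thesis
    by (simp add: eq[OF c] extend_metric_same[OF c]) (simp add: conorm_sq_def Let_def c_def)
qed

lemma weak_differential_extend:
  assumes w: "weak_differential A u \<omega>"
  defines "\<omega>' \<equiv> extend_covector A \<omega>"
  shows "weak_differential A' u \<omega>'" "\<And>c p. c \<in> A \<Longrightarrow> p \<in> fst c \<Longrightarrow> \<omega>' c p = \<omega> c p"
proof -
  have law: "\<omega> c p = transpose (transition_jacobian c d p) *v \<omega> d p" if "c \<in> A" "d \<in> A" "p \<in> fst c" "p \<in> fst d" for c d p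
    using w that unfolding weak_differential_def by blast
  note eq = extend_covector_eq[of \<omega>, OF law, folded \<omega>'_def]
  show same: "\<omega>' c p = \<omega> c p" if "c \<in> A" "p \<in> fst c" for c p
    using eq[of c c p] that sub by (auto simp: jacobian_refl transpose_mat simp del: transpose_matrix_vector)
  show "weak_differential A' u \<omega>'"
  proof (rule ext.weak_differentialI)
    fix d e p assume de: "d \<in> A'" "e \<in> A'" and p: "p \<in> fst d" "p \<in> fst e"
    obtain c where c: "c \<in> A" "p \<in> fst c" using chart_exists by metis
    then have c': "c \<in> A'" using sub by auto
    show "\<omega>' d p = transpose (transition_jacobian d e p) *v \<omega>' e p"
      using eq[of d c p] eq[of e c p] de p c ext.jacobian_cocycle[OF de c' p c(2)]
      by (simp add: matrix_transpose_mul matrix_vector_mul_assoc del: transpose_matrix_vector)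
  next
    fix p
    obtain c where c: "c \<in> A" "p \<in> fst c" using chart_exists by metis
    have "weak_gradient_on (snd c ` fst c) (\<lambda>y. u (chart_inv c y)) (\<lambda>y. \<omega> c (chart_inv c y))"
      using w c unfolding weak_differential_def by blast
    then have "weak_gradient_on (snd c ` fst c) (\<lambda>y. u (chart_inv c y)) (\<lambda>y. \<omega>' c (chart_inv c y))"
      by (rule weak_gradient_on_cong[rotated 2]) (use same[OF c(1)] is_chart_simps(5)[OF chart[OF c(1)]] in auto)
    then show "\<exists>c\<in>A'. \<exists>W. open W \<and> p \<in> W \<and> W \<subseteq> fst c \<and> weak_gradient_on (snd c ` W) (\<lambda>y. u (chart_inv c y)) (\<lambda>y. \<omega>' c (chart_inv c y))"
      using c sub open_chart[OF c(1)] by blast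
  qed
qed

end

section \<open>The cylindrical end\<close>

lemma smooth_map_continuous:
  fixes f :: "'a::t2_space \<Rightarrow> 'b::topological_space"
  assumes "smooth_map A B S f" shows "continuous_on S f"
  unfolding continuous_on_eq_continuous_within
proof
  fix p assume p: "p \<in> S"
  obtain U F where U: "open U" "p \<in> U" "smooth_map_open A B U F" "\<And>q. q \<in> S \<inter> U \<Longrightarrow> F q = f q"
    using assms[unfolded smooth_map_def, rule_format, OF p] by metis
  have "continuous_on U F" using U(3) unfolding smooth_map_open_def by (rule conjunct1)
  then have "continuous_on (S \<inter> U) F" by (rule continuous_on_subset) blast
  then have "continuous_on (S \<inter> U) f" by (rule continuous_on_eq) (rule U(4))
  then have "continuous (at p within (S \<inter> U)) f" using p U(2) by (auto simp: continuous_on_eq_continuous_within)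
  moreover have "at p within (S \<inter> U) = at p within S" using U(1,2) by (intro at_within_nhd[of p U]) auto
  ultimately show "continuous (at p within S) f" by simp
qed

locale cylindrical_end = split_coords b for b :: "'m::finite option \<Rightarrow> 'n::finite" +
  fixes AX :: "('x::{t2_space,second_countable_topology}, real^'n) chart set"
    and AZ :: "('z::{t2_space,second_countable_topology}, real^'m) chart set"
    and W :: "'x set" and g :: "('x, 'n) metric" and h :: "('z, 'm) metric" and \<Phi> :: "'z \<times> real \<Rightarrow> 'x"
  assumes atlasX: "smooth_atlas AX" and atlasZ: "smooth_atlas AZ"
    and compactZ: "compact (UNIV :: 'z set)" and compactW: "compact (closure W)"
    and metricX: "riemannian_metric AX g" and metricZ: "riemannian_metric AZ h"
    and coords: "end_coordinates AX AZ W \<Phi>" and product: "product_on_end AX AZ g h \<Phi>"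
begin

sublocale X: riemannian AX g by unfold_locales (rule atlasX metricX)+
sublocale Z: riemannian AZ h by unfold_locales (rule atlasZ metricZ)+

abbreviation "cyl \<equiv> UNIV \<times> {0..} :: ('z \<times> real) set"

definition \<Psi> :: "'x \<Rightarrow> 'z \<times> real" where "\<Psi> = inv_into cyl \<Phi>"

lemma diffeo_\<Phi>: "diffeomorphism (cylinder_atlas AZ) AX cyl (- W) \<Phi>"
  using coords by (simp add: end_coordinates_def)

lemma bij_\<Phi>: "bij_betw \<Phi> cyl (- W)" and smooth_\<Phi>: "smooth_map (cylinder_atlas AZ) AX cyl \<Phi>"
  and smooth_\<Psi>: "smooth_map AX (cylinder_atlas AZ) (- W) \<Psi>"
  using diffeo_\<Phi> by (auto simp: diffeomorphism_def \<Psi>_def)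

lemma inj_\<Phi>: "inj_on \<Phi> cyl" using bij_\<Phi> by (simp add: bij_betw_def)

lemma \<Psi>_\<Phi> [simp]: "0 \<le> t \<Longrightarrow> \<Psi> (\<Phi> (z, t)) = (z, t)"
  using inj_\<Phi> by (simp add: \<Psi>_def)

lemma \<Phi>_notin_W: "0 \<le> t \<Longrightarrow> \<Phi> (z, t) \<in> - W"
  using bij_\<Phi> by (auto simp: bij_betw_def)

lemma continuous_\<Phi>: "continuous_on cyl \<Phi>" by (rule smooth_map_continuous[OF smooth_\<Phi>])

lemma continuous_\<Psi>: "continuous_on (- W) \<Psi>" by (rule smooth_map_continuous[OF smooth_\<Psi>])

definition cyl_chart :: "('z, real^'m) chart \<Rightarrow> ('z \<times> real, (real^'m) \<times> real) chart" where
  "cyl_chart c = (fst c \<times> UNIV, \<lambda>(x, t). (snd c x, t))"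

lemma cyl_chart_in: "c \<in> AZ \<Longrightarrow> cyl_chart c \<in> cylinder_atlas AZ"
  by (auto simp: cylinder_atlas_def cyl_chart_def)

lemma cyl_chart_simps:
  assumes c: "c \<in> AZ"
  shows "is_chart (cyl_chart c)" "fst (cyl_chart c) = fst c \<times> UNIV" "snd (cyl_chart c) (z, t) = (snd c z, t)"
    "y \<in> snd c ` fst c \<Longrightarrow> chart_inv (cyl_chart c) (y, t) = (chart_inv c y, t)"
proof -
  note ch = is_chart_simps[OF Z.chart[OF c]]
  show f: "fst (cyl_chart c) = fst c \<times> UNIV" and s: "snd (cyl_chart c) (z, t) = (snd c z, t)" for z t by (simp_all add: cyl_chart_def)
  have inj: "inj_on (snd (cyl_chart c)) (fst (cyl_chart c))" using ch(8) by (auto simp: f inj_on_def s)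
  show inv: "chart_inv (cyl_chart c) (y, t) = (chart_inv c y, t)" if "y \<in> snd c ` fst c" for y t
    by (rule inv_into_f_eq[OF inj]) (auto simp: f s ch(4,5)[OF that])
  have im: "snd (cyl_chart c) ` fst (cyl_chart c) = (snd c ` fst c) \<times> UNIV" by (force simp: f s)
  show "is_chart (cyl_chart c)"
    unfolding is_chart_def homeomorphism_def im
  proof (intro conjI ballI)
    show "open (fst (cyl_chart c))" "open ((snd c ` fst c) \<times> (UNIV :: real set))" using ch(1,2) by (auto simp: f intro: open_Times)
    show "chart_inv (cyl_chart c) (snd (cyl_chart c) x) = x" if "x \<in> fst (cyl_chart c)" for x
      using inj that by simp
    show "snd c ` fst c \<times> UNIV = snd c ` fst c \<times> (UNIV :: real set)" ..
    have "continuous_on (fst c \<times> UNIV) (\<lambda>p. (snd c (fst p), snd p))"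
      by (intro continuous_intros continuous_on_compose2[OF ch(6)]) auto
    then show "continuous_on (fst (cyl_chart c)) (snd (cyl_chart c))" by (simp add: cyl_chart_def case_prod_beta')
    show "snd (cyl_chart c) (chart_inv (cyl_chart c) y) = y" if "y \<in> snd c ` fst c \<times> UNIV" for y
      using that ch(4) by (auto simp: inv s)
    show "chart_inv (cyl_chart c) ` (snd c ` fst c \<times> UNIV) = fst (cyl_chart c)"
      unfolding im[symmetric] by (rule inv_into_image_cancel[OF inj order.refl])
    have "continuous_on (snd c ` fst c \<times> UNIV) (\<lambda>p. (chart_inv c (fst p), snd p))"
      by (intro continuous_intros continuous_on_compose2[OF ch(7)]) auto
    then show "continuous_on (snd c ` fst c \<times> UNIV) (chart_inv (cyl_chart c))"
      by (rule continuous_on_eq) (auto simp: inv)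
  qed
qed

abbreviation end_point :: "('z, real^'m) chart \<Rightarrow> real^'n \<Rightarrow> 'z \<times> real" where
  "end_point c x \<equiv> (chart_inv c (fst (P x)), snd (P x))"

text \<open>Restricted to t > 0: at t = 0 smoothness of \<open>\<Phi>\<close> means that a smooth
  extension exists, and it may differ from \<open>\<Phi>\<close> on the other side.\<close>

definition end_domain :: "('z, real^'m) chart \<Rightarrow> ('x, real^'n) chart \<Rightarrow> (real^'n) set" where
  "end_domain c d = {x. fst (P x) \<in> snd c ` fst c \<and> snd (P x) > 0 \<and> \<Phi> (end_point c x) \<in> fst d}"

text \<open>Near a point with t > 0 the local extension provided by \<open>smooth_map\<close>
  coincides with \<open>\<Phi>\<close> on a full neighbourhood.\<close>

lemma \<Phi>_coord_smooth:
  assumes c: "c \<in> AZ" and d: "d \<in> AX"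
  shows "open (end_domain c d)" "smooth_on (end_domain c d) (\<lambda>x. snd d (\<Phi> (end_point c x)))"
proof -
  note cy = cyl_chart_simps[OF c]
  note ch = is_chart_simps[OF Z.chart[OF c]]
  have loc: "\<exists>N. open N \<and> x0 \<in> N \<and> N \<subseteq> end_domain c d \<and> smooth_on N (\<lambda>x. snd d (\<Phi> (end_point c x)))"
    if x0: "x0 \<in> end_domain c d" for x0
  proof -
    have "end_point c x0 \<in> cyl" using x0 by (simp add: end_domain_def)
    then obtain U F where U: "open U" "end_point c x0 \<in> U" "smooth_map_open (cylinder_atlas AZ) AX U F" "\<And>q. q \<in> cyl \<inter> U \<Longrightarrow> F q = \<Phi> q"
      using smooth_\<Phi> unfolding smooth_map_def by metis
    define M where "M = U \<inter> fst (cyl_chart c) \<inter> F -` fst d"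
    have cF: "continuous_on U F" and sF: "smooth_on (snd (cyl_chart c) ` M) (snd d \<circ> F \<circ> chart_inv (cyl_chart c))"
      using U(3) cyl_chart_in[OF c] d by (auto simp: smooth_map_open_def M_def)
    have "open (F -` fst d \<inter> U)" by (rule continuous_on_open_vimage[THEN iffD1, rule_format, OF U(1) cF X.open_chart[OF d]])
    then have "open ((F -` fst d \<inter> U) \<inter> fst c \<times> UNIV)" by (rule open_Int[OF _ open_Times[OF ch(1) open_UNIV]])
    moreover have "M = (F -` fst d \<inter> U) \<inter> fst c \<times> UNIV" unfolding M_def cy(2) by blast
    ultimately have "open M" by simp
    then have oM: "open (snd (cyl_chart c) ` M)" by (rule is_chart_image_open[OF cy(1)]) (auto simp: M_def)
    define N where "N = P -` (snd (cyl_chart c) ` M \<inter> UNIV \<times> {0<..})"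
    have N: "open N" unfolding N_def by (rule open_vimage[OF open_Int[OF oM open_Times[OF open_UNIV open_greaterThan]] continuous_P])
    have NM: "\<exists>z s. P x = (snd c z, s) \<and> (z, s) \<in> M \<and> s > 0 \<and> z \<in> fst c \<and> end_point c x = (z, s) \<and> \<Phi> (z, s) = F (z, s)" if "x \<in> N" for x
    proof -
      obtain z s where zs: "(z, s) \<in> M" "P x = (snd c z, s)" "s > 0" using \<open>x \<in> N\<close> by (auto simp: N_def cy(3))
      then have z: "z \<in> fst c" by (simp add: M_def cy(2))
      with zs U(4)[of "(z, s)"] show ?thesis by (auto simp: M_def ch(3))
    qed
    have sub: "N \<subseteq> end_domain c d"
    proof
      fix x assume "x \<in> N"
      from NM[OF this] obtain z s where "P x = (snd c z, s)" "(z, s) \<in> M" "s > 0" "z \<in> fst c" "end_point c x = (z, s)" "\<Phi> (z, s) = F (z, s)" by blast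
      then show "x \<in> end_domain c d" by (auto simp: end_domain_def M_def)
    qed
    have x0N: "x0 \<in> N"
    proof -
      have e: "fst (P x0) \<in> snd c ` fst c" "snd (P x0) > 0" "\<Phi> (end_point c x0) \<in> fst d" using x0 by (auto simp: end_domain_def)
      have "end_point c x0 \<in> M" using U(2) U(4)[of "end_point c x0"] e ch(5)[OF e(1)] by (auto simp: M_def cy(2))
      moreover have "snd (cyl_chart c) (end_point c x0) = P x0" by (simp add: cy(3) ch(4)[OF e(1)])
      ultimately have "P x0 \<in> snd (cyl_chart c) ` M" by (metis image_eqI)
      then show ?thesis using e(2) by (auto simp: N_def mem_Times_iff)
    qed
    have "smooth_on N (\<lambda>x. (snd d \<circ> F \<circ> chart_inv (cyl_chart c)) (P x))"
      by (rule smooth_on_compose[OF N oM _ smooth_on_bounded_linear[OF bounded_linear_P] sF]) (auto simp: N_def)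
    moreover have "(snd d \<circ> F \<circ> chart_inv (cyl_chart c)) (P x) = snd d (\<Phi> (end_point c x))" if "x \<in> N" for x
    proof -
      from NM[OF that] obtain z s where "P x = (snd c z, s)" "z \<in> fst c" "end_point c x = (z, s)" "\<Phi> (z, s) = F (z, s)" by blast
      then show ?thesis by (simp add: cy(4) ch(3))
    qed
    ultimately have "smooth_on N (\<lambda>x. snd d (\<Phi> (end_point c x)))" by (subst smooth_on_cong[OF N, symmetric]) auto
    with N x0N sub show ?thesis by blast
  qed
  show "open (end_domain c d)" by (subst open_subopen) (use loc in blast)
  show "smooth_on (end_domain c d) (\<lambda>x. snd d (\<Phi> (end_point c x)))" by (rule smooth_on_local) (use loc in blast)
qed

lemma end_point_open:
  assumes c: "c \<in> AZ" and "open T"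
  shows "open {x. fst (P x) \<in> snd c ` fst c \<and> end_point c x \<in> T}"
proof -
  note ch = is_chart_simps[OF Z.chart[OF c]]
  let ?D = "{x. fst (P x) \<in> snd c ` fst c}"
  have D: "open ?D"
    using open_vimage[OF ch(2) continuous_on_fst[OF continuous_P]] by (simp add: vimage_def)
  have "continuous_on ?D (end_point c)"
    by (intro continuous_intros continuous_on_compose2[OF ch(7)] continuous_P) auto
  from continuous_on_open_vimage[OF D, THEN iffD1, OF this] assms(2) have "open (end_point c -` T \<inter> ?D)" by blast
  moreover have "end_point c -` T \<inter> ?D = {x. fst (P x) \<in> snd c ` fst c \<and> end_point c x \<in> T}" by auto
  ultimately show ?thesis by simp
qed

text \<open>Invariance of domain: in coordinates \<open>\<Phi>\<close> is continuous and injective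
  between Euclidean spaces of equal dimension.\<close>

lemma \<Phi>_open:
  assumes T: "open T" "T \<subseteq> UNIV \<times> {0<..}" shows "open (\<Phi> ` T)"
proof (subst open_subopen, intro ballI)
  fix q assume "q \<in> \<Phi> ` T"
  then obtain z s where p: "(z, s) \<in> T" "q = \<Phi> (z, s)" by auto
  have s: "s > 0" using p T(2) by auto
  obtain c where c: "c \<in> AZ" "z \<in> fst c" using Z.chart_exists by metis
  obtain d where d: "d \<in> AX" "q \<in> fst d" using X.chart_exists by metis
  note chc = is_chart_simps[OF Z.chart[OF c(1)]] and chd = is_chart_simps[OF X.chart[OF d(1)]]
  let ?f = "\<lambda>x. snd d (\<Phi> (end_point c x))"
  define N where "N = end_domain c d \<inter> {x. fst (P x) \<in> snd c ` fst c \<and> end_point c x \<in> T}"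
  have N: "open N" unfolding N_def by (intro open_Int \<Phi>_coord_smooth(1) end_point_open c d T)
  have inj: "inj_on ?f N"
  proof (rule inj_onI)
    fix x y assume xy: "x \<in> N" "y \<in> N" "?f x = ?f y"
    then have "\<Phi> (end_point c x) = \<Phi> (end_point c y)" using chd(8) by (auto simp: N_def end_domain_def inj_on_def)
    moreover have "end_point c x \<in> cyl" "end_point c y \<in> cyl" using xy by (simp_all add: N_def end_domain_def)
    ultimately have "end_point c x = end_point c y" using inj_onD[OF inj_\<Phi>] by metis
    then have "chart_inv c (fst (P x)) = chart_inv c (fst (P y))" and s: "snd (P x) = snd (P y)" by auto
    moreover have "fst (P x) \<in> snd c ` fst c" "fst (P y) \<in> snd c ` fst c" using xy by (auto simp: N_def)
    ultimately have "fst (P x) = fst (P y)" using chc(4) by metis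
    then have "P x = P y" using s by (rule prod_eqI)
    then show "x = y" by (metis LP)
  qed
  have "open (?f ` N)"
    by (rule invariance_of_domain_gen[OF N _ inj order.refl])
      (rule continuous_on_subset[OF smooth_on_continuous[OF \<Phi>_coord_smooth(2)[OF c(1) d(1)]]], simp add: N_def)
  then have o: "open (snd d -` (?f ` N) \<inter> fst d)" using continuous_on_open_vimage[OF chd(1), THEN iffD1, OF chd(6)] by blast
  have "q \<in> snd d -` (?f ` N) \<inter> fst d"
  proof -
    have "L (snd c z, s) \<in> N" using c d p s by (simp add: N_def end_domain_def chc(3))
    then show ?thesis using d p c by (force simp: chc(3) intro: image_eqI[of _ _ "L (snd c z, s)"])
  qed
  moreover have "snd d -` (?f ` N) \<inter> fst d \<subseteq> \<Phi> ` T"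
  proof
    fix r assume r: "r \<in> snd d -` (?f ` N) \<inter> fst d"
    then obtain x where x: "x \<in> N" "snd d r = ?f x" by auto
    then have "r = \<Phi> (end_point c x)" using r chd(8) by (auto simp: N_def end_domain_def inj_on_def)
    then show "r \<in> \<Phi> ` T" using x by (auto simp: N_def)
  qed
  ultimately show "\<exists>T'. open T' \<and> q \<in> T' \<and> T' \<subseteq> \<Phi> ` T" using o by blast
qed

text \<open>A chart of \<open>Z\<close> times the coordinate t, through the identification
  \<open>L\<close>. It is cut off at t > 1, an open condition under which the metric is a
  product.\<close>

definition ec :: "('z, real^'m) chart \<Rightarrow> ('x, real^'n) chart" where
  "ec c = (\<Phi> ` (fst c \<times> {1<..}), \<lambda>p. L (snd c (fst (\<Psi> p)), snd (\<Psi> p)))"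

lemma ec_simps:
  assumes c: "c \<in> AZ"
  shows "is_chart (ec c)" "fst (ec c) = \<Phi> ` (fst c \<times> {1<..})" "0 \<le> t \<Longrightarrow> snd (ec c) (\<Phi> (z, t)) = L (snd c z, t)"
    "snd (ec c) ` fst (ec c) = L ` (snd c ` fst c \<times> {1<..})"
    "y \<in> snd c ` fst c \<Longrightarrow> 1 < t \<Longrightarrow> chart_inv (ec c) (L (y, t)) = \<Phi> (chart_inv c y, t)"
proof -
  note ch = is_chart_simps[OF Z.chart[OF c]]
  show f: "fst (ec c) = \<Phi> ` (fst c \<times> {1<..})" by (simp add: ec_def)
  show s: "snd (ec c) (\<Phi> (z, t)) = L (snd c z, t)" if "0 \<le> t" for z t using that by (simp add: ec_def)
  have im: "snd (ec c) ` W' = (\<lambda>p. L (snd c (fst p), snd p)) ` T" if "W' = \<Phi> ` T" "T \<subseteq> cyl" for W' T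
    unfolding that(1) image_image using that(2) by (intro image_cong refl) (auto simp: s)
  show im1: "snd (ec c) ` fst (ec c) = L ` (snd c ` fst c \<times> {1<..})"
    by (subst im[OF f]) (auto, force)
  have inj: "inj_on (snd (ec c)) (fst (ec c))"
  proof (rule inj_onI)
    fix p q assume pq: "p \<in> fst (ec c)" "q \<in> fst (ec c)" "snd (ec c) p = snd (ec c) q"
    then obtain z t z' t' where zt: "p = \<Phi> (z, t)" "q = \<Phi> (z', t')" "z \<in> fst c" "z' \<in> fst c" "1 < t" "1 < t'" by (auto simp: f)
    with pq(3) have "L (snd c z, t) = L (snd c z', t')" by (simp add: s)
    then have "(snd c z, t) = (snd c z', t')" by (metis PL)
    then show "p = q" using zt ch(8) by (auto simp: inj_on_def)
  qed
  show inv: "chart_inv (ec c) (L (y, t)) = \<Phi> (chart_inv c y, t)" if "y \<in> snd c ` fst c" "1 < t" for y t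
    by (rule inv_into_f_eq[OF inj]) (use that ch(4,5)[OF that(1)] in \<open>auto simp: f s\<close>)
  have fW: "fst (ec c) \<subseteq> - W" using \<Phi>_notin_W by (auto simp: f)
  show "is_chart (ec c)"
    unfolding is_chart_def homeomorphism_def
  proof (intro conjI ballI)
    show "open (fst (ec c))" unfolding f by (rule \<Phi>_open) (auto intro!: open_Times ch(1))
    show "open (snd (ec c) ` fst (ec c))" unfolding im1 by (intro open_L_image open_Times ch(2) open_greaterThan)
    show "chart_inv (ec c) (snd (ec c) x) = x" if "x \<in> fst (ec c)" for x using inj that by simp
    show "snd (ec c) ` fst (ec c) = snd (ec c) ` fst (ec c)" ..
    have c\<Psi>: "continuous_on (fst (ec c)) \<Psi>" by (rule continuous_on_subset[OF continuous_\<Psi> fW])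
    have "continuous_on (fst (ec c)) (\<lambda>p. L (snd c (fst (\<Psi> p)), snd (\<Psi> p)))"
      by (rule continuous_on_compose2[OF continuous_L[of UNIV]], intro continuous_on_Pair continuous_on_compose2[OF ch(6)] continuous_on_fst continuous_on_snd c\<Psi>)
        (auto simp: f)
    then show "continuous_on (fst (ec c)) (snd (ec c))" by (simp add: ec_def)
    show "snd (ec c) (chart_inv (ec c) y) = y" if "y \<in> snd (ec c) ` fst (ec c)" for y using that by (simp add: f_inv_into_f)
    show "chart_inv (ec c) ` snd (ec c) ` fst (ec c) = fst (ec c)" using inj by simp
    have "continuous_on (L ` (snd c ` fst c \<times> {1<..})) (\<lambda>x. \<Phi> (end_point c x))"
      by (intro continuous_on_compose2[OF continuous_\<Phi>] continuous_intros continuous_on_compose2[OF ch(7)] continuous_P) auto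
    then show "continuous_on (snd (ec c) ` fst (ec c)) (chart_inv (ec c))" unfolding im1
      by (rule continuous_on_eq) (auto simp: inv)
  qed
qed

lemma \<Psi>_coord_smooth:
  assumes c: "c \<in> AZ" and d: "d \<in> AX"
  shows "smooth_on (snd d ` (fst d \<inter> fst (ec c))) (\<lambda>y. snd (ec c) (chart_inv d y))"
proof (rule smooth_on_local)
  fix y0 assume "y0 \<in> snd d ` (fst d \<inter> fst (ec c))"
  then obtain q where q: "q \<in> fst d" "q \<in> fst (ec c)" "y0 = snd d q" by auto
  note e = ec_simps[OF c] and cy = cyl_chart_simps[OF c]
  note chd = is_chart_simps[OF X.chart[OF d]]
  have fW: "fst (ec c) \<subseteq> - W" using \<Phi>_notin_W by (auto simp: e(2))
  obtain U F where U: "open U" "q \<in> U" "smooth_map_open AX (cylinder_atlas AZ) U F" "\<And>q. q \<in> - W \<inter> U \<Longrightarrow> F q = \<Psi> q"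
    using smooth_\<Psi> q(2) fW unfolding smooth_map_def by (metis subsetD)
  define M where "M = U \<inter> fst d \<inter> F -` fst (cyl_chart c)"
  have cF: "continuous_on U F" and sF: "smooth_on (snd d ` M) (snd (cyl_chart c) \<circ> F \<circ> chart_inv d)"
    using U(3) cyl_chart_in[OF c] d by (auto simp: smooth_map_open_def M_def)
  define M' where "M' = U \<inter> fst d \<inter> fst (ec c)"
  have oM': "open M'" unfolding M'_def using U(1) chd(1) is_chart_simps(1)[OF e(1)] by auto
  have M'F: "F r = \<Psi> r" "fst (\<Psi> r) \<in> fst c" if "r \<in> M'" for r
    using that U(4)[of r] fW by (auto simp: M'_def e(2))
  have M'M: "M' \<subseteq> M" using M'F by (auto simp: M'_def M_def cy(2) mem_Times_iff)
  have oi: "open (snd d ` M')" by (rule is_chart_image_open[OF X.chart[OF d] oM']) (auto simp: M'_def)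
  have "smooth_on (snd d ` M') (\<lambda>y. L ((snd (cyl_chart c) \<circ> F \<circ> chart_inv d) y))"
    by (rule smooth_on_linear_compose[OF bounded_linear_L oi smooth_on_subset[OF sF image_mono[OF M'M]]])
  moreover have "L ((snd (cyl_chart c) \<circ> F \<circ> chart_inv d) y) = snd (ec c) (chart_inv d y)" if "y \<in> snd d ` M'" for y
  proof -
    obtain r where r: "r \<in> M'" "y = snd d r" using \<open>y \<in> snd d ` M'\<close> by auto
    then have "chart_inv d y = r" using chd(3) by (auto simp: M'_def)
    then show ?thesis using M'F[OF r(1)] cy(3)[of "fst (\<Psi> r)" "snd (\<Psi> r)"] by (simp add: ec_def)
  qed
  ultimately have "smooth_on (snd d ` M') (\<lambda>y. snd (ec c) (chart_inv d y))" by (subst smooth_on_cong[OF oi, symmetric]) auto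
  moreover have "y0 \<in> snd d ` M'" using q U(2) by (auto simp: M'_def)
  ultimately show "\<exists>U. open U \<and> y0 \<in> U \<and> smooth_on U (\<lambda>y. snd (ec c) (chart_inv d y))" using oi by blast
qed

definition A' where "A' = AX \<union> ec ` AZ"

lemma ec_in [simp]: "c \<in> AZ \<Longrightarrow> ec c \<in> A'" by (simp add: A'_def)

text \<open>Transitions between an end chart and an old chart are smooth because
  \<open>\<Phi>\<close> and \<open>\<Psi>\<close> are; a transition between two end charts is a
  transition of \<open>Z\<close> times the identity in t.\<close>

lemma atlas_A': "smooth_atlas A'"
  unfolding smooth_atlas_def
proof (intro conjI ballI)
  show "is_chart c" if c: "c \<in> A'" for c
  proof (cases "c \<in> AX")
    case True then show ?thesis by (rule X.chart)
  next
    case False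
    then obtain d where "d \<in> AZ" "c = ec d" using c by (auto simp: A'_def)
    then show ?thesis using ec_simps(1) by metis
  qed
  show "(\<Union>c\<in>A'. fst c) = UNIV" using atlasX by (auto simp: A'_def smooth_atlas_def)
  fix c d assume cd: "c \<in> A'" "d \<in> A'"
  consider "c \<in> AX" "d \<in> AX" | c' where "c' \<in> AZ" "c = ec c'" "d \<in> AX" | d' where "d' \<in> AZ" "c \<in> AX" "d = ec d'"
    | c' d' where "c' \<in> AZ" "c = ec c'" "d' \<in> AZ" "d = ec d'" using cd by (auto simp: A'_def)
  then show "smooth_on (snd c ` (fst c \<inter> fst d)) (snd d \<circ> chart_inv c)"
  proof cases
    case 1 then show ?thesis using X.smooth_transition by (simp add: o_def)
  next
    case 2
    note e = ec_simps[OF 2(1)] and ch = is_chart_simps[OF Z.chart[OF 2(1)]]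
    have op: "open (snd c ` (fst c \<inter> fst d))"
      using 2 is_chart_simps(1)[OF e(1)] X.open_chart[OF 2(3)] by (intro is_chart_image_open) (auto simp: e(1))
    have *: "x \<in> end_domain c' d \<and> snd d (\<Phi> (end_point c' x)) = (snd d \<circ> chart_inv c) x" if x: "x \<in> snd c ` (fst c \<inter> fst d)" for x
    proof -
      obtain z t where zt: "z \<in> fst c'" "1 < t" "\<Phi> (z, t) \<in> fst d" "x = snd c (\<Phi> (z, t))" using x 2 by (auto simp: e(2))
      then have "x = L (snd c' z, t)" using 2 by (simp add: e(3))
      then show ?thesis using zt 2 by (simp add: end_domain_def ch(3) e(5))
    qed
    have "smooth_on (snd c ` (fst c \<inter> fst d)) (\<lambda>x. snd d (\<Phi> (end_point c' x)))"
      by (rule smooth_on_subset[OF \<Phi>_coord_smooth(2)[OF 2(1,3)]]) (use * in blast)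
    then show ?thesis by (subst smooth_on_cong[OF op, symmetric]) (use * in auto)
  next
    case 3 then show ?thesis using \<Psi>_coord_smooth[OF 3(1,2)] by (simp add: o_def)
  next
    case 4
    note e = ec_simps[OF 4(1)] and e' = ec_simps[OF 4(3)] and ch = is_chart_simps[OF Z.chart[OF 4(1)]]
    let ?T = "snd c' ` (fst c' \<inter> fst d')"
    have oT: "open ?T" using Z.open_chart[OF 4(1)] Z.open_chart[OF 4(3)] by (intro is_chart_image_open[OF Z.chart[OF 4(1)]]) auto
    have oLT: "open (L ` (?T \<times> {1<..}))" by (intro open_L_image open_Times oT open_greaterThan)
    have im: "snd c ` (fst c \<inter> fst d) = L ` (?T \<times> {1<..})"
    proof -
      have "fst c \<inter> fst d = \<Phi> ` ((fst c' \<inter> fst d') \<times> {1<..})"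
        unfolding 4 e(2) e'(2) using inj_\<Phi> by (subst inj_on_image_Int[symmetric, OF inj_\<Phi>]) (auto simp: Times_Int_Times)
      then have "snd c ` (fst c \<inter> fst d) = (\<lambda>p. snd c (\<Phi> p)) ` ((fst c' \<inter> fst d') \<times> {1<..})" by (simp add: image_image)
      also have "\<dots> = (\<lambda>p. L (snd c' (fst p), snd p)) ` ((fst c' \<inter> fst d') \<times> {1<..})"
        by (intro image_cong refl) (auto simp: 4 e(3))
      also have "\<dots> = L ` (?T \<times> {1<..})" by (auto, force)
      finally show ?thesis .
    qed
    have "smooth_on (L ` (?T \<times> {1<..})) (\<lambda>x. snd d' (chart_inv c' (fst (P x))))"
      by (rule smooth_on_compose[OF oLT oT _ smooth_on_fst[OF oLT smooth_on_bounded_linear[OF bounded_linear_P]] Z.smooth_transition[OF 4(1,3)]]) auto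
    then have "smooth_on (L ` (?T \<times> {1<..})) (\<lambda>x. L (snd d' (chart_inv c' (fst (P x))), snd (P x)))"
      by (rule smooth_on_linear_compose[OF bounded_linear_L oLT smooth_on_Pair[OF oLT _ smooth_on_snd[OF oLT smooth_on_bounded_linear[OF bounded_linear_P]]]])
    moreover have "L (snd d' (chart_inv c' (fst (P x))), snd (P x)) = (snd d \<circ> chart_inv c) x" if "x \<in> L ` (?T \<times> {1<..})" for x
      using that by (auto simp: 4 e(5) e'(3) ch(3))
    ultimately show ?thesis unfolding im by (subst smooth_on_cong[OF oLT, symmetric]) auto
  qed
qed

sublocale atlas_extension AX g A'
proof
  show "smooth_atlas A'" by (rule atlas_A')
  show "AX \<subseteq> A'" unfolding A'_def by blast
qed

lemma ec_jacobian:
  assumes c: "c \<in> AZ" "d \<in> AZ" "z \<in> fst c" "z \<in> fst d" and t: "1 < t"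
  shows "product_form (transition_jacobian (ec c) (ec d) (\<Phi> (z, t))) (transition_jacobian c d z)"
proof -
  note e = ec_simps[OF c(1)] and e' = ec_simps[OF c(2)] and ch = is_chart_simps[OF Z.chart[OF c(1)]]
  let ?T = "snd c ` (fst c \<inter> fst d)"
  have oT: "open ?T" using Z.open_chart[OF c(1)] Z.open_chart[OF c(2)] by (intro is_chart_image_open[OF Z.chart[OF c(1)]]) auto
  have oLT: "open (L ` (?T \<times> {1<..}))" by (intro open_L_image open_Times oT open_greaterThan)
  let ?x = "L (snd c z, t)"
  let ?F = "\<lambda>y. snd d (chart_inv c y)" and ?H = "\<lambda>x. snd (ec d) (chart_inv (ec c) x)"
  have x: "?x \<in> L ` (?T \<times> {1<..})" using c t by blast
  have sF: "smooth_on ?T ?F" by (rule Z.smooth_transition[OF c(1,2)])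
  have zT: "snd c z \<in> ?T" using c by auto
  have H: "?H x = L (?F (fst (P x)), snd (P x))" if "x \<in> L ` (?T \<times> {1<..})" for x
    using that by (auto simp: e(5) e'(3) ch(3))
  have dF: "(\<lambda>y. ?F y $ i) differentiable (at (fst (P ?x)))" for i
    using smooth_on_differentiable[OF smooth_on_vec_nth[OF oT sF] zT] by simp
  have dId: "(\<lambda>t. t) differentiable (at (snd (P ?x)))" by simp
  have sH: "smooth_on (L ` (?T \<times> {1<..})) ?H"
  proof (rule smooth_on_subset[OF ext.smooth_transition[OF ec_in[OF c(1)] ec_in[OF c(2)]]], rule subsetI)
    fix x assume "x \<in> L ` (?T \<times> {1<..})"
    then obtain z s where zs: "x = L (snd c z, s)" "z \<in> fst c" "z \<in> fst d" "1 < s" by auto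
    then have "x = snd (ec c) (\<Phi> (z, s))" by (simp add: e(3))
    then show "x \<in> snd (ec c) ` (fst (ec c) \<inter> fst (ec d))" using zs by (auto simp: e(2) e'(2))
  qed
  have J: "transition_jacobian (ec c) (ec d) (\<Phi> (z, t)) $ a $ k = partial k (\<lambda>x. ?H x $ a) ?x" for a k
    using partial_nth[OF smooth_on_differentiable[OF sH x]] t by (simp add: transition_jacobian_def o_def jacobian_eq_partial e(3))
  have pc: "partial k (\<lambda>x. ?H x $ a) ?x = partial k (\<lambda>x. L (?F (fst (P x)), snd (P x)) $ a) ?x" for k a
    by (rule partial_cong[OF oLT x]) (auto simp: H intro: smooth_on_differentiable[OF smooth_on_vec_nth[OF oLT sH] x])
  have JZ: "transition_jacobian c d z $ i $ j = partial j (\<lambda>y. ?F y $ i) (snd c z)" for i j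
    using partial_nth[OF smooth_on_differentiable[OF sF zT]] by (simp add: transition_jacobian_def o_def jacobian_eq_partial)
  show ?thesis unfolding product_form_def J JZ pc
    using partial_fst_P[OF dF] partial_snd_P[OF dId] by simp
qed

text \<open>\<open>product_on_end\<close> differentiates on a product space, the Jacobian on
  \<open>real^'n\<close>; \<open>L\<close> converts one into the other. Inserting basis vectors in
  the resulting bilinear identity gives the matrix entries.\<close>

lemma ec_metric:
  assumes c: "c \<in> AZ" "z \<in> fst c" and t: "1 < t"
  shows "product_form (g' (ec c) (\<Phi> (z, t))) (h c z)"
proof -
  note e = ec_simps[OF c(1)] and ch = is_chart_simps[OF Z.chart[OF c(1)]]
  obtain d where d: "d \<in> AX" "\<Phi> (z, t) \<in> fst d" using X.chart_exists by metis
  let ?y = "snd c z"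
  define D where "D = frechet_derivative (\<lambda>(y, s). snd d (\<Phi> (chart_inv c y, s))) (at (?y, t))"
  have prod: "D v \<bullet> (g d (\<Phi> (z, t)) *v D w) = fst v \<bullet> (h c z *v fst w) + snd v * snd w" for v w
    using product[unfolded product_on_end_def Let_def, rule_format, OF c(1) d(1) c(2) less_imp_le[OF t] d(2)] unfolding D_def by blast
  let ?f = "\<lambda>x. snd d (\<Phi> (end_point c x))"
  have x: "L (?y, t) \<in> end_domain c d" using c d t by (simp add: end_domain_def ch(3))
  have d1: "(?f has_derivative frechet_derivative ?f (at (L (?y, t)))) (at (L (?y, t)))"
    by (rule smooth_on_has_derivative[OF \<Phi>_coord_smooth(2)[OF c(1) d(1)] x])
  have "((\<lambda>p. ?f (L p)) has_derivative (\<lambda>v. frechet_derivative ?f (at (L (?y, t))) (L v))) (at (?y, t))"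
    using diff_chain_at[OF bounded_linear_imp_has_derivative[OF bounded_linear_L] d1] by (simp add: o_def)
  moreover have "(\<lambda>p. ?f (L p)) = (\<lambda>(y, s). snd d (\<Phi> (chart_inv c y, s)))" by (auto simp: fun_eq_iff)
  ultimately have DL: "D v = frechet_derivative ?f (at (L (?y, t))) (L v)" for v
    by (simp add: D_def frechet_derivative_eqI)
  let ?J = "transition_jacobian (ec c) d (\<Phi> (z, t))"
  have oe: "open (snd (ec c) ` (fst (ec c) \<inter> fst d))"
    using is_chart_simps(1)[OF e(1)] X.open_chart[OF d(1)] by (intro is_chart_image_open[OF e(1)]) auto
  have xe: "L (?y, t) \<in> snd (ec c) ` (fst (ec c) \<inter> fst d)"
    using c d t e(3)[of t z] by (force simp: e(2) image_iff)
  have "((\<lambda>x. snd d (chart_inv (ec c) x)) has_derivative frechet_derivative ?f (at (L (?y, t)))) (at (L (?y, t)))"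
  proof (rule has_derivative_transform_within_open[OF d1 oe xe])
    fix x assume "x \<in> snd (ec c) ` (fst (ec c) \<inter> fst d)"
    then have "x \<in> L ` (snd c ` fst c \<times> {1<..})" using e(4) by blast
    then show "?f x = snd d (chart_inv (ec c) x)" by (auto simp: e(5))
  qed
  then have "?J = matrix (frechet_derivative ?f (at (L (?y, t))))"
    using t by (simp add: transition_jacobian_def o_def frechet_derivative_eqI e(3))
  then have Jv: "?J *v v = D (P v)" for v
    using has_derivative_linear[OF d1] by (simp add: DL matrix_works linear_matrix_vector_mul_eq)
  have pe: "\<Phi> (z, t) \<in> fst (ec c)" using c t by (auto simp: e(2))
  have ge: "v \<bullet> (g' (ec c) (\<Phi> (z, t)) *v w) = fst (P v) \<bullet> (h c z *v fst (P w)) + snd (P v) * snd (P w)" for v w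
  proof -
    have "v \<bullet> (transpose ?J *v x) = (?J *v v) \<bullet> x" for x
      by (metis dot_lmul_matrix inner_commute transpose_matrix_vector)
    then have "v \<bullet> (g' (ec c) (\<Phi> (z, t)) *v w) = (?J *v v) \<bullet> (g d (\<Phi> (z, t)) *v (?J *v w))"
      by (simp only: extend_metric_eq[OF ec_in[OF c(1)] d(1) pe d(2)] matrix_vector_mul_assoc[symmetric])
    then show ?thesis by (simp only: Jv prod)
  qed
  have ent: "H $ k $ l = axis k 1 \<bullet> (H *v axis l 1)" for H :: "real^'k^'k" and k l
    by (simp add: matrix_vector_mult_basis column_def inner_axis_axis inner_axis')
  show ?thesis
    unfolding product_form_def
    by (simp add: ent[of "g' (ec c) (\<Phi> (z, t))"] ge P_axis) (simp add: ent[of "h c z"])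
qed

end

section \<open>Integration over the cylindrical end\<close>

text \<open>\<open>V\<close> is a countable union of compact sets, and integrability over each of
  them includes measurability on it.\<close>

lemma measurable_from_compact:
  fixes f :: "'a::euclidean_space \<Rightarrow> real"
  assumes V: "open V" and f: "\<And>K. compact K \<Longrightarrow> K \<subseteq> V \<Longrightarrow> set_integrable lborel K f"
  shows "f \<in> borel_measurable (restrict_space borel V)"
proof -
  obtain C :: "nat \<Rightarrow> 'a set" where C: "\<And>n. compact (C n)" "\<And>n. C n \<subseteq> V" "\<Union>(range C) = V"
    by (rule open_Union_compact_subsets[OF V]) (rule that)
  show ?thesis
  proof (rule measurable_piecewise_restrict[of "range C"])
    show "countable (range C)" by simp
    show "space (restrict_space borel V) \<subseteq> \<Union>(range C)" using C(3) by (simp add: space_restrict_space)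
    fix \<Omega> assume "\<Omega> \<in> range C"
    then obtain n where n: "\<Omega> = C n" by auto
    have s: "C n \<in> sets borel" using C(1) by (simp add: borel_compact)
    show "\<Omega> \<inter> space (restrict_space borel V) \<in> sets (restrict_space borel V)"
      using s V by (auto simp: n space_restrict_space sets_restrict_space)
    have "restrict_space (restrict_space borel V) (C n) = restrict_space borel (C n)"
      using C(2)[of n] s V by (subst restrict_restrict_space) (auto simp: Int_absorb1)
    moreover have "f \<in> borel_measurable (restrict_space borel (C n))"
      using borel_measurable_integrable[OF f[OF C(1,2), unfolded set_integrable_def]] s
      by (simp add: borel_measurable_restrict_space_iff)
    ultimately show "f \<in> borel_measurable (restrict_space (restrict_space borel V) \<Omega>)" by (simp add: n)
  qed
qed

lemma (in smooth_manifold) countable_atlas: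
  obtains c where "\<And>n :: nat. c n \<in> A" "(\<Union>n. fst (c n)) = UNIV"
proof -
  have o: "open U" if "U \<in> fst ` A" for U using that open_chart by auto
  have ne: "fst ` A \<noteq> {}" using chart_exists by blast
  obtain U :: "nat \<Rightarrow> 'a set" where U: "\<And>n. U n \<in> fst ` A" "(\<Union>n. U n) = \<Union>(fst ` A)"
    using countable_cover_nat[OF o ne] by metis
  have "\<forall>n. \<exists>c. c \<in> A \<and> U n = fst c" using U(1) by blast
  then obtain c where c: "\<And>n. c n \<in> A" "\<And>n. U n = fst (c n)" by metis
  with that[of c] U(2) show thesis by (simp add: Union_charts)
qed

text \<open>Measurability of a covector field comes from the local integrability of weak gradients.
  As \<open>chart_at\<close> may jump arbitrarily, the argument runs over countably many charts, on
  each of which \<open>conorm_chart\<close> gives a formula in that single chart.\<close>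

lemma (in riemannian) conorm_measurable:
  assumes w: "weak_differential A u \<omega>"
  shows "conorm_sq A g \<omega> \<in> borel_measurable borel"
proof -
  have law: "\<omega> c p = transpose (transition_jacobian c d p) *v \<omega> d p" if "c \<in> A" "d \<in> A" "p \<in> fst c" "p \<in> fst d" for c d p
    using w that unfolding weak_differential_def by blast
  have loc: "conorm_sq A g \<omega> \<in> borel_measurable (restrict_space borel (fst c))" if c: "c \<in> A" for c
  proof -
    note ch = is_chart_simps[OF chart[OF c]]
    let ?V = "snd c ` fst c"
    interpret G: metric_coords ?V "\<lambda>y. g c (chart_inv c y)" by (rule metric_coords[OF c])
    have wg: "weak_gradient_on ?V (\<lambda>y. u (chart_inv c y)) (\<lambda>y. \<omega> c (chart_inv c y))"
      using w c unfolding weak_differential_def by blast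
    have [measurable]: "(\<lambda>y. \<omega> c (chart_inv c y) $ i) \<in> borel_measurable (restrict_space borel ?V)" for i
      by (rule measurable_from_compact[OF ch(2) weak_gradient_onD(2)[OF wg]])
    have [measurable]: "(\<lambda>y. matrix_inv (g c (chart_inv c y)) $ i $ j) \<in> borel_measurable (restrict_space borel ?V)" for i j
      by (rule borel_measurable_continuous_on_restrict[OF smooth_on_continuous[OF smooth_on_matrix_inv[OF ch(2) G.smoothGc G.det]]])
    have m: "(\<lambda>y. \<Sum>i\<in>UNIV. \<omega> c (chart_inv c y) $ i * (\<Sum>j\<in>UNIV. matrix_inv (g c (chart_inv c y)) $ i $ j * \<omega> c (chart_inv c y) $ j))
        \<in> borel_measurable (restrict_space borel ?V)" by measurable
    have s: "snd c \<in> measurable (restrict_space borel (fst c)) (restrict_space borel ?V)"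
      by (rule measurable_restrict_space2) (auto simp: space_restrict_space intro: borel_measurable_continuous_on_restrict ch(6))
    from measurable_compose[OF s m]
    show ?thesis
      by (rule measurable_cong[THEN iffD1, rotated])
        (auto simp: space_restrict_space conorm_chart[OF law c] ch(3) inner_vec_def matrix_vector_mult_def)
  qed
  obtain cn where cn: "\<And>n :: nat. cn n \<in> A" "(\<Union>n. fst (cn n)) = UNIV" by (rule countable_atlas) (rule that)
  show ?thesis
  proof (rule measurable_piecewise_restrict[of "range (\<lambda>n. fst (cn n))"])
    show "space borel \<subseteq> \<Union>(range (\<lambda>n. fst (cn n)))" using cn(2) by simp
    fix \<Omega> assume "\<Omega> \<in> range (\<lambda>n. fst (cn n))"
    then obtain n where n: "\<Omega> = fst (cn n)" by auto
    show "\<Omega> \<inter> space borel \<in> sets borel" using n open_chart[OF cn(1)] by simp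
    show "conorm_sq A g \<omega> \<in> borel_measurable (restrict_space borel \<Omega>)" unfolding n by (rule loc[OF cn(1)])
  qed simp
qed

context cylindrical_end
begin

sublocale Zfin: finite_measure Z.vol
  by (rule finite_measureI) (use Z.vol_compact_finite[OF compactZ] in simp)

sublocale ZL: pair_sigma_finite Z.vol lborel ..

abbreviation "ZT \<equiv> Z.vol \<Otimes>\<^sub>M (lborel :: real measure)"

lemma sets_ZT: "sets ZT = sets borel"
proof -
  have "sets ZT = sets ((borel :: 'z measure) \<Otimes>\<^sub>M (borel :: real measure))"
    by (rule sets_pair_measure_cong) simp_all
  then show ?thesis by (simp only: borel_prod)
qed

definition E :: "'x set" where "E = \<Phi> ` (UNIV \<times> {1<..})"

lemma open_E: "open E" unfolding E_def by (rule \<Phi>_open) (auto intro!: open_Times)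

lemma E_borel [measurable]: "E \<in> sets borel" using open_E by simp

lemma \<Phi>_in_E: "0 \<le> t \<Longrightarrow> \<Phi> (z, t) \<in> E \<longleftrightarrow> 1 < t"
proof
  assume t: "0 \<le> t" and "\<Phi> (z, t) \<in> E"
  then obtain z' t' where e: "1 < t'" "\<Phi> (z, t) = \<Phi> (z', t')" by (auto simp: E_def)
  then have "(z, t) = (z', t')" using inj_onD[OF inj_\<Phi>, of "(z, t)" "(z', t')"] t by simp
  then show "1 < t" using e by simp
qed (auto simp: E_def)

text \<open>Smoothness gives continuity of \<open>\<Phi>\<close> on the half cylinder only; a
  constant value off t > 1 makes a Borel function on the whole product.\<close>

definition \<Phi>1 where "\<Phi>1 p = (if p \<in> UNIV \<times> {1<..} then \<Phi> p else \<Phi> (undefined, 2))"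

lemma \<Phi>1_eq: "1 < t \<Longrightarrow> \<Phi>1 (z, t) = \<Phi> (z, t)" by (simp add: \<Phi>1_def)

lemma \<Phi>1_measurable [measurable]: "\<Phi>1 \<in> borel_measurable borel"
  unfolding \<Phi>1_def[abs_def]
proof (rule borel_measurable_continuous_on_if)
  show "UNIV \<times> {1<..} \<in> sets (borel :: ('z \<times> real) measure)" by (intro borel_open open_Times) auto
  show "continuous_on (UNIV \<times> {1<..}) \<Phi>" by (rule continuous_on_subset[OF continuous_\<Phi>]) auto
qed simp

lemma \<Phi>1_measurable' [measurable]: "\<Phi>1 \<in> ZT \<rightarrow>\<^sub>M borel" "\<Phi>1 \<in> borel \<Otimes>\<^sub>M borel \<rightarrow>\<^sub>M borel"
  using \<Phi>1_measurable by (simp_all add: measurable_cong_sets[OF sets_ZT refl] borel_prod)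

text \<open>On the end the volume is the product of the volume of \<open>Z\<close> and Lebesgue
  measure. By \<open>measure_eqI_cover\<close> it suffices to look inside one end chart, where
  \<open>det_product_form\<close> equates the densities.\<close>

lemma end_measure:
  "density X.vol (\<lambda>p. ennreal (indicator E p)) = distr (density ZT (\<lambda>p. ennreal (indicator {1<..} (snd p)))) borel \<Phi>1"
proof (rule measure_eqI_cover[where \<U>="(\<lambda>c. fst (ec c)) ` AZ"])
  have UE: "\<Union>((\<lambda>c. fst (ec c)) ` AZ) = E"
  proof
    show "\<Union>((\<lambda>c. fst (ec c)) ` AZ) \<subseteq> E" by (auto simp: ec_simps(2) E_def)
    show "E \<subseteq> \<Union>((\<lambda>c. fst (ec c)) ` AZ)"
    proof
      fix p assume "p \<in> E"
      then obtain z t where zt: "p = \<Phi> (z, t)" "1 < t" by (auto simp: E_def)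
      obtain c where "c \<in> AZ" "z \<in> fst c" using Z.chart_exists by metis
      then show "p \<in> \<Union>((\<lambda>c. fst (ec c)) ` AZ)" using zt by (auto simp: ec_simps(2))
    qed
  qed
  show "sets (density X.vol (\<lambda>p. ennreal (indicator E p))) = sets borel" by simp
  show "sets (distr (density ZT (\<lambda>p. ennreal (indicator {1<..} (snd p)))) borel \<Phi>1) = sets borel" by simp
  show "open U" if "U \<in> (\<lambda>c. fst (ec c)) ` AZ" for U using that is_chart_simps(1)[OF ec_simps(1)] by auto
  have mE: "(\<lambda>p. ennreal (indicator E p)) \<in> borel_measurable X.vol" by (simp add: measurable_cong_sets[OF X.sets_vol refl])
  have mT: "(\<lambda>p. ennreal (indicator {1<..} (snd p))) \<in> borel_measurable ZT" by measurable
  have m\<Phi>: "\<Phi>1 \<in> density ZT (\<lambda>p. ennreal (indicator {1<..} (snd p))) \<rightarrow>\<^sub>M borel" by (simp add: measurable_cong_sets[OF sets_density refl])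
  have R: "emeasure (distr (density ZT (\<lambda>p. ennreal (indicator {1<..} (snd p)))) borel \<Phi>1) S =
      (\<integral>\<^sup>+p. ennreal (indicator {1<..} (snd p)) * indicator S (\<Phi>1 p) \<partial>ZT)" if S: "S \<in> sets borel" for S
  proof -
    have v: "\<Phi>1 -` S \<in> sets ZT" using measurable_sets_borel[OF \<Phi>1_measurable S] by (simp only: sets_ZT)
    have "emeasure (distr (density ZT (\<lambda>p. ennreal (indicator {1<..} (snd p)))) borel \<Phi>1) S
       = emeasure (density ZT (\<lambda>p. ennreal (indicator {1<..} (snd p)))) (\<Phi>1 -` S)"
      by (subst emeasure_distr[OF m\<Phi> S]) (simp add: space_pair_measure)
    also have "\<dots> = (\<integral>\<^sup>+p. ennreal (indicator {1<..} (snd p)) * indicator (\<Phi>1 -` S) p \<partial>ZT)"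
      by (rule emeasure_density[OF mT v])
    finally show ?thesis by (simp add: indicator_def vimage_def)
  qed
  show "emeasure (density X.vol (\<lambda>p. ennreal (indicator E p))) (- \<Union>((\<lambda>c. fst (ec c)) ` AZ)) = 0"
  proof -
    have "ennreal (indicator E p) * indicator (- E) p = 0" for p by (simp add: indicator_def)
    then show ?thesis unfolding UE by (subst emeasure_density[OF mE]) (simp_all only: nn_integral_const mult_zero_left X.sets_vol borel_comp E_borel)
  qed
  show "emeasure (distr (density ZT (\<lambda>p. ennreal (indicator {1<..} (snd p)))) borel \<Phi>1) (- \<Union>((\<lambda>c. fst (ec c)) ` AZ)) = 0"
  proof -
    have "ennreal (indicator {1<..} (snd p)) * indicator (- E) (\<Phi>1 p) = 0" for p
      by (cases p) (auto simp: indicator_def \<Phi>1_def \<Phi>_in_E)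
    then show ?thesis unfolding UE by (subst R) (simp_all only: nn_integral_const mult_zero_left borel_comp E_borel)
  qed
  fix U S assume "U \<in> (\<lambda>c. fst (ec c)) ` AZ" and S: "S \<in> sets borel" "S \<subseteq> U"
  then obtain c where c: "c \<in> AZ" "S \<subseteq> fst (ec c)" by auto
  note e = ec_simps[OF c(1)] and ch = is_chart_simps[OF Z.chart[OF c(1)]]
  let ?V = "snd c ` fst c"
  let ?f = "\<lambda>x. ennreal (indicator (snd (ec c) ` fst (ec c)) x * sqrt (det (g' (ec c) (chart_inv (ec c) x)))) * indicator S (chart_inv (ec c) x)"
  have [measurable]: "chart_inv (ec c) \<in> borel_measurable borel" by (rule chart_inv_measurable[OF e(1)])
  note [measurable] = S(1) ext.volume_density_measurable[OF ec_in[OF c(1)]]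
  have mf: "?f \<in> borel_measurable borel" by measurable
  have mS: "(\<lambda>p. indicator S p :: ennreal) \<in> borel_measurable borel" by measurable
  have "emeasure (density X.vol (\<lambda>p. ennreal (indicator E p))) S = (\<integral>\<^sup>+p. ennreal (indicator E p) * indicator S p \<partial>X.vol)"
    using S(1) by (intro emeasure_density[OF mE]) simp
  also have "\<dots> = (\<integral>\<^sup>+p. indicator (fst (ec c)) p * indicator S p \<partial>ext.vol)"
  proof -
    have "ennreal (indicator E p) * indicator S p = indicator (fst (ec c)) p * indicator S p" for p
      using c(2) by (auto simp: indicator_def E_def e(2))
    then show ?thesis by (simp only: vol_extend)
  qed
  also have "\<dots> = (\<integral>\<^sup>+x. ?f x \<partial>lborel)" by (rule ext.nn_integral_chart[OF ec_in[OF c(1)] mS])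
  also have "\<dots> = (\<integral>\<^sup>+p. ?f (L p) \<partial>(lborel \<Otimes>\<^sub>M lborel))" by (rule nn_integral_L[OF mf])
  also have "\<dots> = (\<integral>\<^sup>+t. \<integral>\<^sup>+y. ?f (L (y, t)) \<partial>lborel \<partial>lborel)"
    by (rule lborel_pair.nn_integral_snd[symmetric], rule measurable_compose[OF L_measurable'(1) mf])
  also have "\<dots> = (\<integral>\<^sup>+t. \<integral>\<^sup>+z. ennreal (indicator {1<..} t) * indicator S (\<Phi>1 (z, t)) \<partial>Z.vol \<partial>lborel)"
  proof (rule nn_integral_cong)
    fix t :: real
    show "(\<integral>\<^sup>+y. ?f (L (y, t)) \<partial>lborel) = (\<integral>\<^sup>+z. ennreal (indicator {1<..} t) * indicator S (\<Phi>1 (z, t)) \<partial>Z.vol)"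
    proof (cases "1 < t")
      case False
      then have "L (y, t) \<notin> snd (ec c) ` fst (ec c)" for y unfolding e(4) by (auto dest: arg_cong[where f=P])
      then show ?thesis using False by simp
    next
      case t: True
      have mt: "(\<lambda>z. indicator S (\<Phi>1 (z, t)) :: ennreal) \<in> borel_measurable borel"
        by (rule measurable_compose[OF _ mS]) (rule measurable_compose[OF _ \<Phi>1_measurable'(2)], measurable)
      have "?f (L (y, t)) = ennreal (indicator ?V y * sqrt (det (h c (chart_inv c y)))) * indicator S (\<Phi>1 (chart_inv c y, t))" for y
      proof (cases "y \<in> ?V")
        case y: True
        have "det (g' (ec c) (\<Phi> (chart_inv c y, t))) = det (h c (chart_inv c y))"
          by (rule det_product_form[OF ec_metric[OF c(1) ch(5)[OF y] t]])
        moreover have "L (y, t) \<in> snd (ec c) ` fst (ec c)" unfolding e(4) using y t by auto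
        ultimately show ?thesis using y t by (simp add: e(5)[OF y t] \<Phi>1_eq)
      next
        case False
        then have "L (y, t) \<notin> snd (ec c) ` fst (ec c)" unfolding e(4) by (auto dest: arg_cong[where f=P])
        then show ?thesis using False by simp
      qed
      then have "(\<integral>\<^sup>+y. ?f (L (y, t)) \<partial>lborel) = (\<integral>\<^sup>+z. indicator (fst c) z * indicator S (\<Phi>1 (z, t)) \<partial>Z.vol)"
        by (simp only: Z.nn_integral_chart[OF c(1) mt])
      also have "\<dots> = (\<integral>\<^sup>+z. ennreal (indicator {1<..} t) * indicator S (\<Phi>1 (z, t)) \<partial>Z.vol)"
      proof (rule nn_integral_cong)
        fix z
        have "z \<in> fst c" if zS: "\<Phi> (z, t) \<in> S"
        proof -
          obtain z' t' where "z' \<in> fst c" "1 < t'" "\<Phi> (z, t) = \<Phi> (z', t')" using zS c(2) unfolding e(2) by blast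
          then show ?thesis using inj_onD[OF inj_\<Phi>, of "(z, t)" "(z', t')"] t by simp
        qed
        then show "(indicator (fst c) z * indicator S (\<Phi>1 (z, t)) :: ennreal) = ennreal (indicator {1<..} t) * indicator S (\<Phi>1 (z, t))"
          using t by (auto simp: indicator_def \<Phi>1_eq)
      qed
      finally show ?thesis .
    qed
  qed
  also have "\<dots> = (\<integral>\<^sup>+p. ennreal (indicator {1<..} (snd p)) * indicator S (\<Phi>1 p) \<partial>ZT)"
  proof -
    have "(\<lambda>p. ennreal (indicator {1<..} (snd p)) * indicator S (\<Phi>1 p)) \<in> borel_measurable ZT" by measurable
    from ZL.nn_integral_snd[OF this] show ?thesis by simp
  qed
  also have "\<dots> = emeasure (distr (density ZT (\<lambda>p. ennreal (indicator {1<..} (snd p)))) borel \<Phi>1) S" by (rule R[OF S(1), symmetric])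
  finally show "emeasure (density X.vol (\<lambda>p. ennreal (indicator E p))) S = emeasure (distr (density ZT (\<lambda>p. ennreal (indicator {1<..} (snd p)))) borel \<Phi>1) S" .
qed

lemma end_integral:
  fixes f :: "'x \<Rightarrow> real"
  assumes f [measurable]: "f \<in> borel_measurable borel"
  shows "integrable X.vol (\<lambda>p. indicator E p * f p) \<longleftrightarrow> integrable ZT (\<lambda>p. indicator {1<..} (snd p) * f (\<Phi> p))"
    "(LINT p|X.vol. indicator E p * f p) = (LINT p|ZT. indicator {1<..} (snd p) * f (\<Phi> p))"
    "(\<lambda>p. indicator {1<..} (snd p) * f (\<Phi> p)) \<in> borel_measurable ZT"
proof -
  have eq: "(\<lambda>p. indicator {1<..} (snd p) * f (\<Phi> p)) = (\<lambda>p. indicator {1<..} (snd p) *\<^sub>R f (\<Phi>1 p))"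
    by (auto simp: fun_eq_iff \<Phi>1_def indicator_def)
  show "(\<lambda>p. indicator {1<..} (snd p) * f (\<Phi> p)) \<in> borel_measurable ZT" unfolding eq by measurable
  have mE: "f \<in> borel_measurable X.vol" "indicator E \<in> borel_measurable X.vol" by (simp_all add: measurable_cong_sets[OF X.sets_vol refl])
  have mT: "(\<lambda>p. f (\<Phi>1 p)) \<in> borel_measurable ZT" "(\<lambda>p. indicator {1<..} (snd p) :: real) \<in> borel_measurable ZT" by measurable
  have m\<Phi>: "\<Phi>1 \<in> density ZT (\<lambda>p. ennreal (indicator {1<..} (snd p))) \<rightarrow>\<^sub>M borel" by (simp add: measurable_cong_sets[OF sets_density refl])
  show "integrable X.vol (\<lambda>p. indicator E p * f p) \<longleftrightarrow> integrable ZT (\<lambda>p. indicator {1<..} (snd p) * f (\<Phi> p))"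
    unfolding eq using integrable_density[OF mE] integrable_density[OF mT] integrable_distr_eq[OF m\<Phi> f]
    by (simp add: end_measure)
  show "(LINT p|X.vol. indicator E p * f p) = (LINT p|ZT. indicator {1<..} (snd p) * f (\<Phi> p))"
    unfolding eq using integral_density[OF mE] integral_density[OF mT] integral_distr[OF m\<Phi> f]
    by (simp add: end_measure)
qed

lemma scalar_curvature_end:
  assumes t: "1 < t" shows "scalar_curvature AX g (\<Phi> (z, t)) = scalar_curvature AZ h z"
proof -
  obtain c where c: "c \<in> AZ" "z \<in> fst c" using Z.chart_exists by metis
  note e = ec_simps[OF c(1)] and ch = is_chart_simps[OF Z.chart[OF c(1)]]
  have p: "\<Phi> (z, t) \<in> fst (ec c)" using c t by (auto simp: e(2))
  have "scalar_curvature AX g (\<Phi> (z, t)) = scalar_curvature_coord (\<lambda>x. g' (ec c) (chart_inv (ec c) x)) (L (snd c z, t))"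
    unfolding scalar_curvature_extend ext.scalar_curvature_chart[OF ec_in[OF c(1)] p] using t by (simp add: e(3))
  also have "\<dots> = scalar_curvature_coord (\<lambda>y. h c (chart_inv c y)) (fst (P (L (snd c z, t))))"
  proof (rule scalar_curvature_product[OF ext.metric_coords[OF ec_in[OF c(1)]] Z.metric_coords[OF c(1)]])
    show "L (snd c z, t) \<in> snd (ec c) ` fst (ec c)" unfolding e(4) using c t by auto
    fix x assume "x \<in> snd (ec c) ` fst (ec c)"
    then obtain y s where ys: "x = L (y, s)" "y \<in> snd c ` fst c" "1 < s" unfolding e(4) by auto
    then show "fst (P x) \<in> snd c ` fst c" by simp
    show "product_form (g' (ec c) (chart_inv (ec c) x)) (h c (chart_inv c (fst (P x))))"
      using ec_metric[OF c(1) ch(5)[OF ys(2)] ys(3)] by (simp add: ys(1) e(5)[OF ys(2,3)])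
  qed
  also have "\<dots> = scalar_curvature AZ h z" by (simp add: Z.scalar_curvature_chart[OF c])
  finally show ?thesis .
qed

text \<open>The pullback of \<open>\<omega>\<close> to the slice at height t: only the components
  along \<open>Z\<close> in the end charts enter, and the remaining one is the derivative in
  t.\<close>

definition slice :: "('x, 'n) covector_field \<Rightarrow> real \<Rightarrow> ('z, 'm) covector_field" where
  "slice \<omega> t c z = (\<chi> i. \<omega> (ec c) (\<Phi> (z, t)) $ b (Some i))"

lemma covector_split:
  assumes "c \<in> AZ" "d \<in> AZ" "z \<in> fst c" "z \<in> fst d" "1 < t"
  shows "w = transpose (transition_jacobian (ec c) (ec d) (\<Phi> (z, t))) *v w' \<longleftrightarrow>
    (\<chi> i. w $ b (Some i)) = transpose (transition_jacobian c d z) *v (\<chi> i. w' $ b (Some i)) \<and> w $ b None = w' $ b None"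
  by (simp add: vec_eq_b matrix_vector_mult_def transpose_def sum_b product_formD[OF ec_jacobian[OF assms]] vec_eq_iff
      del: transpose_matrix_vector)

text \<open>Pythagoras: the inverse metric is block diagonal in an end chart, so the tangential part
  and the t-component contribute separately.\<close>

lemma conorm_end:
  assumes law: "\<And>c d p. c \<in> A' \<Longrightarrow> d \<in> A' \<Longrightarrow> p \<in> fst c \<Longrightarrow> p \<in> fst d \<Longrightarrow> \<omega> c p = transpose (transition_jacobian c d p) *v \<omega> d p"
    and t: "1 < t"
  shows "c \<in> AZ \<Longrightarrow> d \<in> AZ \<Longrightarrow> z \<in> fst c \<Longrightarrow> z \<in> fst d \<Longrightarrow> slice \<omega> t c z = transpose (transition_jacobian c d z) *v slice \<omega> t d z"
    "c \<in> AZ \<Longrightarrow> z \<in> fst c \<Longrightarrow> conorm_sq A' g' \<omega> (\<Phi> (z, t)) = conorm_sq AZ h (slice \<omega> t) z + (\<omega> (ec c) (\<Phi> (z, t)) $ b None)\<^sup>2"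
proof -
  have p: "\<Phi> (z, t) \<in> fst (ec c)" if "c \<in> AZ" "z \<in> fst c" for c z using that t by (auto simp: ec_simps(2))
  show sl: "slice \<omega> t c z = transpose (transition_jacobian c d z) *v slice \<omega> t d z"
    if "c \<in> AZ" "d \<in> AZ" "z \<in> fst c" "z \<in> fst d" for c d z
    using law[of "ec c" "ec d" "\<Phi> (z, t)"] covector_split[OF that t] p that unfolding slice_def[abs_def] by simp
  show "conorm_sq A' g' \<omega> (\<Phi> (z, t)) = conorm_sq AZ h (slice \<omega> t) z + (\<omega> (ec c) (\<Phi> (z, t)) $ b None)\<^sup>2" if c: "c \<in> AZ" "z \<in> fst c" for c z
  proof -
    have H: "product_form (matrix_inv (g' (ec c) (\<Phi> (z, t)))) (matrix_inv (h c z))"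
      by (rule matrix_inv_product_form[OF ec_metric[OF c t]]) (use Z.det_metric[OF c] in simp)
    have 1: "conorm_sq A' g' \<omega> (\<Phi> (z, t)) = \<omega> (ec c) (\<Phi> (z, t)) \<bullet> (matrix_inv (g' (ec c) (\<Phi> (z, t))) *v \<omega> (ec c) (\<Phi> (z, t)))"
      by (rule ext.conorm_chart[OF law ec_in[OF c(1)] p[OF c]])
    have 2: "conorm_sq AZ h (slice \<omega> t) z = slice \<omega> t c z \<bullet> (matrix_inv (h c z) *v slice \<omega> t c z)"
      by (rule Z.conorm_chart[OF sl c])
    show ?thesis
      unfolding 1 2 by (simp add: inner_vec_def matrix_vector_mult_def sum_b product_formD[OF H] slice_def power2_eq_square)
  qed
qed

text \<open>The null set from \<open>slice_weak_gradient\<close> depends on the chart. Countably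
  many charts keep the union null, and \<open>weak_differentialI\<close> supplies the other
  charts.\<close>

lemma slice_weak_differential:
  assumes w: "weak_differential A' u \<omega>"
  shows "AE t in lborel. 1 < t \<longrightarrow> weak_differential AZ (\<lambda>z. u (\<Phi> (z, t))) (slice \<omega> t)"
proof -
  have law: "\<omega> c p = transpose (transition_jacobian c d p) *v \<omega> d p" if "c \<in> A'" "d \<in> A'" "p \<in> fst c" "p \<in> fst d" for c d p
    using w that unfolding weak_differential_def by blast
  obtain cn where cn: "\<And>n :: nat. cn n \<in> AZ" "(\<Union>n. fst (cn n)) = UNIV" by (rule Z.countable_atlas) (rule that)
  have "AE t in lborel. \<forall>n. 1 < t \<longrightarrow> weak_gradient_on (snd (cn n) ` fst (cn n)) (\<lambda>y. u (\<Phi> (chart_inv (cn n) y, t)))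
      (\<lambda>y. slice \<omega> t (cn n) (chart_inv (cn n) y))"
  proof (subst AE_all_countable, rule allI)
    fix n
    note e = ec_simps[OF cn(1)[of n]] and ch = is_chart_simps[OF Z.chart[OF cn(1)[of n]]]
    have "weak_gradient_on (L ` (snd (cn n) ` fst (cn n) \<times> {1<..})) (\<lambda>y. u (chart_inv (ec (cn n)) y)) (\<lambda>y. \<omega> (ec (cn n)) (chart_inv (ec (cn n)) y))"
      using w ec_in[OF cn(1)] unfolding weak_differential_def e(4)[symmetric] by blast
    from slice_weak_gradient[OF ch(2) this]
    show "AE t in lborel. 1 < t \<longrightarrow> weak_gradient_on (snd (cn n) ` fst (cn n)) (\<lambda>y. u (\<Phi> (chart_inv (cn n) y, t)))
      (\<lambda>y. slice \<omega> t (cn n) (chart_inv (cn n) y))"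
    proof eventually_elim
      case (elim t)
      show ?case
      proof
        assume t: "1 < t"
        show "weak_gradient_on (snd (cn n) ` fst (cn n)) (\<lambda>y. u (\<Phi> (chart_inv (cn n) y, t))) (\<lambda>y. slice \<omega> t (cn n) (chart_inv (cn n) y))"
          by (rule weak_gradient_on_cong[OF _ _ elim[rule_format, OF t]]) (simp_all add: e(5)[OF _ t] slice_def)
      qed
    qed
  qed
  then show ?thesis
  proof eventually_elim
    case (elim t)
    show ?case
    proof
      assume t: "1 < t"
      show "weak_differential AZ (\<lambda>z. u (\<Phi> (z, t))) (slice \<omega> t)"
      proof (rule Z.weak_differentialI)
        show "slice \<omega> t c z = transpose (transition_jacobian c d z) *v slice \<omega> t d z"
          if "c \<in> AZ" "d \<in> AZ" "z \<in> fst c" "z \<in> fst d" for c d z by (rule conorm_end(1)[OF law t that])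
        fix z
        obtain n where "z \<in> fst (cn n)" using cn(2) by blast
        then show "\<exists>c\<in>AZ. \<exists>W. open W \<and> z \<in> W \<and> W \<subseteq> fst c \<and>
            weak_gradient_on (snd c ` W) (\<lambda>y. u (\<Phi> (chart_inv c y, t))) (\<lambda>y. slice \<omega> t c (chart_inv c y))"
          using elim[rule_format, OF t] cn(1) Z.open_chart[OF cn(1)] by blast
      qed
    qed
  qed
qed

end

section \<open>The lower bound\<close>

text \<open>A crude form of the Hoelder inequality, obtained from a pointwise estimate. The summand
  1 in the constant comes from the term with the power \<open>p\<close>.\<close>

lemma square_integral_bound:
  fixes u :: "'a \<Rightarrow> real"
  assumes u: "u \<in> borel_measurable M" and S: "S \<in> sets M" "emeasure M S < \<infinity>" and p: "2 < p"
    and N: "0 < (LINT x|M. \<bar>u x\<bar> powr p)"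
  shows "integrable M (\<lambda>x. indicator S x * (u x)\<^sup>2)"
    "(LINT x|M. indicator S x * (u x)\<^sup>2) \<le> (measure M S + 1) * (LINT x|M. \<bar>u x\<bar> powr p) powr (2 / p)"
proof -
  define N where "N = (LINT x|M. \<bar>u x\<bar> powr p)"
  define s where "s = N powr (2 / p)"
  have N0: "N > 0" and s0: "s > 0" using assms(5) by (auto simp: N_def s_def)
  \<comment> \<open>A non-integrable function has integral 0, so a positive integral certifies
    integrability.\<close>
  have int: "integrable M (\<lambda>x. \<bar>u x\<bar> powr p)" using assms(5) not_integrable_integral_eq by force
  \<comment> \<open>the choice of \<open>s\<close> makes both terms contribute a multiple of \<open>s\<close> after integration\<close>
  have pt: "y\<^sup>2 \<le> s + s powr (1 - p / 2) * \<bar>y\<bar> powr p" for y :: real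
  proof (cases "y\<^sup>2 \<le> s")
    case True
    have "0 \<le> s powr (1 - p / 2) * \<bar>y\<bar> powr p" by simp
    with True show ?thesis by linarith
  next
    case False
    then have y: "s \<le> y\<^sup>2" "0 < y\<^sup>2" "0 < \<bar>y\<bar>" using s0 by auto
    have e0: "y\<^sup>2 = \<bar>y\<bar> powr 2" using y(3) by simp
    have "\<bar>y\<bar> powr p = (y\<^sup>2) powr (p / 2)" unfolding e0 powr_powr by simp
    also have "(y\<^sup>2) powr (p / 2) = y\<^sup>2 * (y\<^sup>2) powr (p / 2 - 1)"
      using y(2) powr_add[of "y\<^sup>2" 1 "p / 2 - 1"] by simp
    finally have e: "\<bar>y\<bar> powr p = y\<^sup>2 * (y\<^sup>2) powr (p / 2 - 1)" .
    have "s powr (p / 2 - 1) \<le> (y\<^sup>2) powr (p / 2 - 1)" using y(1) s0 p by (intro powr_mono2) auto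
    then have "s powr (1 - p / 2) * (y\<^sup>2 * s powr (p / 2 - 1)) \<le> s powr (1 - p / 2) * \<bar>y\<bar> powr p"
      unfolding e by (intro mult_left_mono) auto
    moreover have "s powr (1 - p / 2) * s powr (p / 2 - 1) = 1" using s0 by (simp add: powr_add[symmetric])
    then have "s powr (1 - p / 2) * (y\<^sup>2 * s powr (p / 2 - 1)) = y\<^sup>2" by (simp add: algebra_simps)
    ultimately show ?thesis using s0 by linarith
  qed
  have le: "indicator S x * (u x)\<^sup>2 \<le> s * indicator S x + s powr (1 - p / 2) * \<bar>u x\<bar> powr p" for x
    using pt[of "u x"] by (auto simp: indicator_def)
  have iS: "integrable M (indicator S :: 'a \<Rightarrow> real)" using S by (simp add: integrable_indicator_iff)
  have ib: "integrable M (\<lambda>x. s * indicator S x + s powr (1 - p / 2) * \<bar>u x\<bar> powr p)"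
    using iS int by simp
  show i: "integrable M (\<lambda>x. indicator S x * (u x)\<^sup>2)"
  proof (rule Bochner_Integration.integrable_bound[OF ib])
    show "(\<lambda>x. indicator S x * (u x)\<^sup>2) \<in> borel_measurable M" using u S(1) by measurable
    show "AE x in M. norm (indicator S x * (u x)\<^sup>2) \<le> norm (s * indicator S x + s powr (1 - p / 2) * \<bar>u x\<bar> powr p)"
      using le by (intro AE_I2) (smt (verit) indicator_pos_le mult_nonneg_nonneg real_norm_def zero_le_power2)
  qed
  have "(LINT x|M. indicator S x * (u x)\<^sup>2) \<le> (LINT x|M. s * indicator S x + s powr (1 - p / 2) * \<bar>u x\<bar> powr p)"
    by (rule integral_mono[OF i ib le])
  also have "\<dots> = s * measure M S + s powr (1 - p / 2) * N"
    using iS int S by (simp add: N_def)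
  also have "s powr (1 - p / 2) * N = s"
  proof -
    have "s powr (1 - p / 2) * N = N powr ((2 / p) * (1 - p / 2)) * N powr 1" using N0 by (simp add: s_def powr_powr)
    also have "\<dots> = N powr ((2 / p) * (1 - p / 2) + 1)" by (simp only: powr_add)
    also have "(2 / p) * (1 - p / 2) + 1 = 2 / p" using p by (simp add: field_simps)
    finally show ?thesis by (simp add: s_def)
  qed
  finally show "(LINT x|M. indicator S x * (u x)\<^sup>2) \<le> (measure M S + 1) * (LINT x|M. \<bar>u x\<bar> powr p) powr (2 / p)"
    by (simp add: s_def N_def algebra_simps)
qed

lemma alpha_nonneg: "0 \<le> alpha (CARD('k::finite) + 1)"
  using zero_less_card_finite[where 'a='k] by (simp add: alpha_def)

context riemannian
begin

lemma measurable_vol [simp]: "borel_measurable vol = (borel_measurable borel :: ('a \<Rightarrow> real) set)"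
  by (rule measurable_cong_sets) simp_all

lemma curvature_measurable [measurable]: "scalar_curvature A g \<in> borel_measurable borel"
  by (rule borel_measurable_continuous_onI[OF continuous_scalar_curvature])

lemma curvature_bounded:
  assumes "compact K" obtains C where "C \<ge> 0" "\<And>p. p \<in> K \<Longrightarrow> \<bar>scalar_curvature A g p\<bar> \<le> C"
proof -
  have "bounded (scalar_curvature A g ` K)"
    by (intro compact_imp_bounded compact_continuous_image continuous_on_subset[OF continuous_scalar_curvature] assms) simp
  then obtain C where "\<And>p. p \<in> K \<Longrightarrow> \<bar>scalar_curvature A g p\<bar> \<le> C" by (auto simp: bounded_iff)
  then have "\<And>p. p \<in> K \<Longrightarrow> \<bar>scalar_curvature A g p\<bar> \<le> max C 0" by (simp add: le_max_iff_disj)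
  then show thesis using that[of "max C 0"] by simp
qed

lemma curvature_term_integrable:
  assumes K: "compact (UNIV :: 'a set)" and u: "integrable vol (\<lambda>p. (u p)\<^sup>2)"
  shows "integrable vol (\<lambda>p. scalar_curvature A g p * (u p)\<^sup>2)"
proof -
  obtain C where C: "C \<ge> 0" "\<And>p. \<bar>scalar_curvature A g p\<bar> \<le> C" by (rule curvature_bounded[OF K]) (use that in blast)
  show ?thesis
  proof (rule Bochner_Integration.integrable_bound)
    show "integrable vol (\<lambda>p. C * (u p)\<^sup>2)" using u by simp
    show "(\<lambda>p. scalar_curvature A g p * (u p)\<^sup>2) \<in> borel_measurable vol"
      using borel_measurable_integrable[OF u] by simp
    show "AE p in vol. norm (scalar_curvature A g p * (u p)\<^sup>2) \<le> norm (C * (u p)\<^sup>2)"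
      using C by (intro AE_I2) (simp add: abs_mult mult_right_mono)
  qed
qed

lemma first_eigenvalue_nonneg:
  assumes "\<And>p. 0 \<le> scalar_curvature A g p" shows "0 \<le> first_eigenvalue A g"
  unfolding first_eigenvalue_def
proof (rule INF_greatest, clarify)
  fix u \<omega>
  have "0 \<le> yamabe_energy (alpha (CARD('n) + 1)) A g u \<omega>"
    unfolding yamabe_energy_def using assms conorm_nonneg alpha_nonneg
    by (intro integral_nonneg_AE AE_I2 add_nonneg_nonneg mult_nonneg_nonneg) auto
  moreover have "0 \<le> (LINT p|vol. (u p)\<^sup>2)" by (intro integral_nonneg_AE AE_I2) simp
  ultimately show "0 \<le> ereal (yamabe_energy (alpha (CARD('n) + 1)) A g u \<omega> / (LINT p|vol. (u p)\<^sup>2))" by simp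
qed

text \<open>If the infimum of the quotients is nonnegative, so is every energy. Functions vanishing
  almost everywhere are excluded from the infimum and treated directly.\<close>

lemma energy_nonneg:
  assumes ev: "0 \<le> first_eigenvalue A g" and u: "(u, \<omega>) \<in> sobolev A g"
  shows "0 \<le> yamabe_energy (alpha (CARD('n) + 1)) A g u \<omega>"
proof (cases "AE p in vol. u p = 0")
  case True
  show ?thesis unfolding yamabe_energy_def
  proof (rule integral_nonneg_AE)
    show "AE p in vol. 0 \<le> alpha (CARD('n) + 1) * conorm_sq A g \<omega> p + scalar_curvature A g p * (u p)\<^sup>2"
      using True
    proof eventually_elim
      case (elim p)
      show ?case using mult_nonneg_nonneg[OF alpha_nonneg[where 'k='n] conorm_nonneg[of \<omega> p]] by (simp only: elim) simp
    qed
  qed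
next
  case False
  have i: "integrable vol (\<lambda>p. (u p)\<^sup>2)" using u by (simp add: sobolev_def)
  have "(LINT p|vol. (u p)\<^sup>2) \<noteq> 0"
    using False integral_nonneg_eq_0_iff_AE[OF i] by simp
  moreover have "0 \<le> (LINT p|vol. (u p)\<^sup>2)" by (intro integral_nonneg_AE AE_I2) simp
  ultimately have pos: "0 < (LINT p|vol. (u p)\<^sup>2)" by linarith
  have "(u, \<omega>) \<in> sobolev_nonzero A g" using u False by (simp add: sobolev_nonzero_def)
  then have "first_eigenvalue A g \<le> ereal (yamabe_energy (alpha (CARD('n) + 1)) A g u \<omega> / (LINT p|vol. (u p)\<^sup>2))"
    unfolding first_eigenvalue_def by (rule INF_lower2) simp
  with ev have "0 \<le> yamabe_energy (alpha (CARD('n) + 1)) A g u \<omega> / (LINT p|vol. (u p)\<^sup>2)"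
    by (metis ereal_less_eq(5) order_trans)
  with pos show ?thesis by (simp add: zero_le_divide_iff)
qed

end

context cylindrical_end
begin

lemma card_n: "CARD('n) = CARD('m) + 1"
proof -
  have "CARD('n) = card (UNIV :: 'm option set)" using bij_betw_same_card[OF bij_b] by simp
  then show ?thesis by (simp add: UNIV_option_conv card_image)
qed

lemma end_slices:
  fixes f :: "'x \<Rightarrow> real"
  assumes f: "f \<in> borel_measurable borel" and i: "integrable X.vol (\<lambda>p. indicator E p * f p)"
  shows "AE t in lborel. 1 < t \<longrightarrow> integrable Z.vol (\<lambda>z. f (\<Phi> (z, t)))"
    "(LINT p|X.vol. indicator E p * f p) = (LINT t|lborel. indicator {1<..} t * (LINT z|Z.vol. f (\<Phi> (z, t))))"
proof -
  note ei = end_integral[OF f]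
  have iT: "integrable ZT (\<lambda>(z, t). indicator {1<..} t * f (\<Phi> (z, t)))"
    using ei(1) i by (simp add: case_prod_beta')
  show "AE t in lborel. 1 < t \<longrightarrow> integrable Z.vol (\<lambda>z. f (\<Phi> (z, t)))"
    using ZL.AE_integrable_snd[OF iT] by eventually_elim (auto simp: indicator_def)
  have "(LINT p|ZT. indicator {1<..} (snd p) * f (\<Phi> p)) = (LINT t|lborel. LINT z|Z.vol. indicator {1<..} t * f (\<Phi> (z, t)))"
    using ZL.integral_snd[OF iT] by (simp add: case_prod_beta')
  then show "(LINT p|X.vol. indicator E p * f p) = (LINT t|lborel. indicator {1<..} t * (LINT z|Z.vol. f (\<Phi> (z, t))))"
    by (simp add: ei(2))
qed

lemma end_integrable: "integrable X.vol f \<Longrightarrow> integrable X.vol (\<lambda>p. indicator E p * f p)" for f :: "'x \<Rightarrow> real"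
  using integrable_mult_indicator[of E X.vol f] E_borel by simp

text \<open>On each slice the square of the t-derivative is discarded and the energy for
  \<open>h\<close> remains. Before \<open>energy_nonneg\<close> applies, almost every slice must be
  shown to lie in \<open>sobolev\<close>, including square-integrability of its
  differential.\<close>

lemma end_energy_nonneg:
  assumes ev: "0 \<le> first_eigenvalue AZ h" and u: "(u, \<omega>) \<in> sobolev AX g"
  defines "F \<equiv> \<lambda>p. alpha CARD('n) * conorm_sq AX g \<omega> p + scalar_curvature AX g p * (u p)\<^sup>2"
  assumes F: "integrable X.vol F"
  shows "0 \<le> (LINT p|X.vol. indicator E p * F p)"
proof -
  define \<omega>' where "\<omega>' = extend_covector AX \<omega>"
  have mu [measurable]: "u \<in> borel_measurable borel" and wd: "weak_differential AX u \<omega>"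
    and iu: "integrable X.vol (\<lambda>p. (u p)\<^sup>2)" and ic: "integrable X.vol (conorm_sq AX g \<omega>)"
    using u by (auto simp: sobolev_def)
  note wd' = weak_differential_extend[OF wd, folded \<omega>'_def]
  have law: "\<omega>' c p = transpose (transition_jacobian c d p) *v \<omega>' d p" if "c \<in> A'" "d \<in> A'" "p \<in> fst c" "p \<in> fst d" for c d p
    using wd'(1) that unfolding weak_differential_def by blast
  have con: "conorm_sq AX g \<omega> p = conorm_sq A' g' \<omega>' p" for p by (rule conorm_extend[OF law wd'(2)])
  have mc [measurable]: "conorm_sq AX g \<omega> \<in> borel_measurable borel" by (rule X.conorm_measurable[OF wd])
  have mu2: "(\<lambda>p. (u p)\<^sup>2) \<in> borel_measurable borel" by measurable
  have mF: "F \<in> borel_measurable borel" unfolding F_def by measurable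
  \<comment> \<open>The eigenvalue on \<open>Z\<close> is defined with the constant of dimension
    \<open>CARD('m) + 1\<close>, which is the dimension of \<open>X\<close>.\<close>
  have a: "alpha CARD('n) = alpha (CARD('m) + 1)" by (simp add: card_n)
  note eF = end_slices[OF mF end_integrable[OF F]]
  have "AE t in lborel. 0 \<le> indicator {1<..} t * (LINT z|Z.vol. F (\<Phi> (z, t)))"
    using eF(1) end_slices(1)[OF mu2 end_integrable[OF iu]] end_slices(1)[OF mc end_integrable[OF ic]] slice_weak_differential[OF wd'(1)]
  proof eventually_elim
    case (elim t)
    show ?case
    proof (cases "1 < t")
      case t: True
      let ?v = "\<lambda>z. u (\<Phi> (z, t))" and ?\<nu> = "slice \<omega>' t"
      have w: "weak_differential AZ ?v ?\<nu>" and i2: "integrable Z.vol (\<lambda>z. (?v z)\<^sup>2)"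
        and i3: "integrable Z.vol (\<lambda>z. conorm_sq AX g \<omega> (\<Phi> (z, t)))" and i1: "integrable Z.vol (\<lambda>z. F (\<Phi> (z, t)))" using elim t by auto
      have "(\<lambda>z. u (\<Phi>1 (z, t))) \<in> borel_measurable borel" by measurable
      then have mv: "?v \<in> borel_measurable borel" using t by (simp add: \<Phi>1_eq)
      have split: "conorm_sq AZ h ?\<nu> z \<le> conorm_sq AX g \<omega> (\<Phi> (z, t))" for z
      proof -
        obtain c where "c \<in> AZ" "z \<in> fst c" using Z.chart_exists by metis
        from conorm_end(2)[OF law t this] show ?thesis by (simp add: con)
      qed
      have i4: "integrable Z.vol (conorm_sq AZ h ?\<nu>)"
      proof (rule Bochner_Integration.integrable_bound[OF i3])
        show "conorm_sq AZ h ?\<nu> \<in> borel_measurable Z.vol" using Z.conorm_measurable[OF w] by simp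
        show "AE z in Z.vol. norm (conorm_sq AZ h ?\<nu> z) \<le> norm (conorm_sq AX g \<omega> (\<Phi> (z, t)))"
          using split Z.conorm_nonneg X.conorm_nonneg by simp
      qed
      have "(?v, ?\<nu>) \<in> sobolev AZ h" using mv w i2 i4 by (simp add: sobolev_def)
      then have "0 \<le> yamabe_energy (alpha CARD('n)) AZ h ?v ?\<nu>" unfolding a by (rule Z.energy_nonneg[OF ev])
      also have "\<dots> \<le> (LINT z|Z.vol. F (\<Phi> (z, t)))"
        unfolding yamabe_energy_def
      proof (rule integral_mono)
        show "integrable Z.vol (\<lambda>z. alpha CARD('n) * conorm_sq AZ h ?\<nu> z + scalar_curvature AZ h z * (?v z)\<^sup>2)"
          using i4 Z.curvature_term_integrable[OF compactZ i2] by simp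
        show "integrable Z.vol (\<lambda>z. F (\<Phi> (z, t)))" by (rule i1)
        show "alpha CARD('n) * conorm_sq AZ h ?\<nu> z + scalar_curvature AZ h z * (?v z)\<^sup>2 \<le> F (\<Phi> (z, t))" for z
          using mult_left_mono[OF split alpha_nonneg[where 'k='m]] by (simp add: F_def scalar_curvature_end[OF t] a)
      qed
      finally show ?thesis using t by simp
    qed simp
  qed
  then have "0 \<le> (LINT t|lborel. indicator {1<..} t * (LINT z|Z.vol. F (\<Phi> (z, t))))" by (rule integral_nonneg_AE)
  then show ?thesis by (simp add: eF(2))
qed

text \<open>The complement of the open end is a closed subset of the closure of \<open>W\<close>
  together with the collar where t lies in [0,1], and both of these are compact.\<close>

lemma compact_core: "compact (- E)"
proof -
  have "compact (\<Phi> ` (UNIV \<times> {0..1}))"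
    by (intro compact_continuous_image continuous_on_subset[OF continuous_\<Phi>] compact_Times compactZ compact_Icc) auto
  then have "compact ((closure W \<union> \<Phi> ` (UNIV \<times> {0..1})) \<inter> - E)"
    using open_E by (intro compact_Int_closed compact_Un compactW) auto
  moreover have "- E \<subseteq> closure W \<union> \<Phi> ` (UNIV \<times> {0..1})"
  proof
    fix p assume p: "p \<in> - E"
    show "p \<in> closure W \<union> \<Phi> ` (UNIV \<times> {0..1})"
    proof (cases "p \<in> W")
      case False
      then obtain z t where zt: "p = \<Phi> (z, t)" "0 \<le> t" using bij_\<Phi> unfolding bij_betw_def by blast
      then have "t \<le> 1" using p \<Phi>_in_E by force
      with zt show ?thesis by auto
    qed (use closure_subset in blast)
  qed
  ultimately show ?thesis by (metis Int_absorb1)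
qed

theorem cyl_yamabe_bounded_below:
  assumes n: "CARD('n) \<ge> 3" and ev: "0 \<le> first_eigenvalue AZ h"
  shows "cyl_yamabe AX g > -\<infinity>"
proof -
  define n where "n = real CARD('n)"
  have n3: "n \<ge> 3" using n by (simp add: n_def)
  obtain C where C: "C \<ge> 0" "\<And>p. p \<in> - E \<Longrightarrow> \<bar>scalar_curvature AX g p\<bar> \<le> C" using X.curvature_bounded[OF compact_core] by metis
  \<comment> \<open>\<open>C\<close> bounds the curvature on the core, and the other factor is the
    constant of \<open>square_integral_bound\<close> for the core; neither depends on
    \<open>u\<close>.\<close>
  define D where "D = C * (measure X.vol (- E) + 1)"
  have D0: "D \<ge> 0" using C(1) by (simp add: D_def)
  have "ereal (- D) \<le> cyl_yamabe AX g"
    unfolding cyl_yamabe_def Let_def n_def[symmetric]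
  proof (rule INF_greatest, clarify)
    fix u \<omega> assume "(u, \<omega>) \<in> sobolev_nonzero AX g"
    then have u: "(u, \<omega>) \<in> sobolev AX g" by (simp add: sobolev_nonzero_def)
    then have mu: "u \<in> borel_measurable borel" by (simp add: sobolev_def)
    define N where "N = (LINT p|X.vol. \<bar>u p\<bar> powr (2 * n / (n - 2)))"
    define F where "F p = alpha CARD('n) * conorm_sq AX g \<omega> p + scalar_curvature AX g p * (u p)\<^sup>2" for p
    have en: "yamabe_energy (alpha CARD('n)) AX g u \<omega> = integral\<^sup>L X.vol F" by (simp add: yamabe_energy_def F_def[abs_def])
    have N0: "N \<ge> 0" unfolding N_def by (intro integral_nonneg_AE AE_I2) simp
    have "- D \<le> yamabe_energy (alpha CARD('n)) AX g u \<omega> / N powr ((n - 2) / n)"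
    \<comment> \<open>Degenerate cases. If \<open>N = 0\<close>, which includes a non-integrable
      power of \<open>u\<close>, the denominator is 0; if \<open>F\<close> is not integrable, the
      numerator is 0. Either way the quotient is 0.\<close>
    proof (cases "N = 0 \<or> \<not> integrable X.vol F")
      case True
      then have z: "yamabe_energy (alpha CARD('n)) AX g u \<omega> / N powr ((n - 2) / n) = 0"
        by (auto simp: en not_integrable_integral_eq)
      show ?thesis unfolding z using D0 by simp
    next
      case False
      then have Np: "N > 0" and F: "integrable X.vol F" using N0 by auto
      have q: "2 / (2 * n / (n - 2)) = (n - 2) / n" "2 < 2 * n / (n - 2)" using n3 by (auto simp: field_simps)
      have S: "- E \<in> sets X.vol" "emeasure X.vol (- E) < \<infinity>" using X.vol_compact_finite[OF compact_core] by auto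
      have sq: "integrable X.vol (\<lambda>p. indicator (- E) p * (u p)\<^sup>2)"
        "(LINT p|X.vol. indicator (- E) p * (u p)\<^sup>2) \<le> (measure X.vol (- E) + 1) * N powr ((n - 2) / n)"
        using square_integral_bound[OF _ S q(2), of u] mu Np unfolding N_def q(1) by auto
      have iE: "integrable X.vol (\<lambda>p. indicator E p * F p)" by (rule end_integrable[OF F])
      have iK: "integrable X.vol (\<lambda>p. indicator (- E) p * F p)" using integrable_mult_indicator[OF S(1) F] by simp
      have "- D * N powr ((n - 2) / n) \<le> - C * (LINT p|X.vol. indicator (- E) p * (u p)\<^sup>2)"
        using mult_left_mono[OF sq(2) C(1)] by (simp add: D_def)
      also have "\<dots> = (LINT p|X.vol. - C * (indicator (- E) p * (u p)\<^sup>2))" using sq(1) by simp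
      also have "\<dots> \<le> (LINT p|X.vol. indicator (- E) p * F p)"
      proof (rule integral_mono[OF _ iK])
        show "integrable X.vol (\<lambda>p. - C * (indicator (- E) p * (u p)\<^sup>2))" using sq(1) by simp
        fix p
        show "- C * (indicator (- E) p * (u p)\<^sup>2) \<le> indicator (- E) p * F p"
        proof (cases "p \<in> E")
          case False
          have "0 \<le> alpha CARD('n) * conorm_sq AX g \<omega> p"
            using X.conorm_nonneg alpha_nonneg[where 'k='m] by (simp add: card_n)
          moreover have "- C * (u p)\<^sup>2 \<le> scalar_curvature AX g p * (u p)\<^sup>2"
            using C(2)[of p] False by (intro mult_right_mono) auto
          ultimately show ?thesis using False by (simp add: F_def)
        qed simp
      qed
      also have "\<dots> \<le> (LINT p|X.vol. indicator E p * F p) + (LINT p|X.vol. indicator (- E) p * F p)"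
        using end_energy_nonneg[OF ev u] F unfolding F_def[abs_def] by simp
      also have "\<dots> = (LINT p|X.vol. indicator E p * F p + indicator (- E) p * F p)" using iE iK by simp
      also have "(\<lambda>p. indicator E p * F p + indicator (- E) p * F p) = F" by (auto simp: indicator_def)
      finally show ?thesis using Np by (simp add: en pos_le_divide_eq)
    qed
    then show "ereal (- D) \<le> ereal (yamabe_energy (alpha CARD('n)) AX g u \<omega> /
       (LINT p|X.vol. \<bar>u p\<bar> powr (2 * n / (n - 2))) powr ((n - 2) / n))" by (simp add: N_def)
  qed
  then show ?thesis by (metis ereal_infty_less(2) less_ereal.simps(4) less_le_trans MInfty_neq_ereal(1) ereal_less(6))
qed

end

section \<open>Products with functions of the cylinder coordinate\<close>

lemma integral_derivative_eq_0:
  fixes \<theta> :: "real \<Rightarrow> real"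
  assumes d: "\<And>t. (\<theta> has_field_derivative \<theta>' t) (at t)" and c: "continuous_on UNIV \<theta>'"
    and K: "compact K" "\<And>t. t \<notin> K \<Longrightarrow> \<theta> t = 0"
  shows "(LINT t|lborel. \<theta>' t) = 0"
proof -
  obtain B where B: "\<And>t. t \<in> K \<Longrightarrow> \<bar>t\<bar> \<le> B" using compact_imp_bounded[OF K(1)] by (auto simp: bounded_iff)
  define M where "M = \<bar>B\<bar> + 1"
  have out: "t \<notin> K" if "\<bar>t\<bar> \<ge> M" for t using B[of t] that by (auto simp: M_def)
  have z: "\<theta>' t = 0" if "t \<notin> K" for t
  proof -
    have "(\<theta> has_field_derivative 0) (at t)"
      by (rule has_field_derivative_transform_within_open[of "\<lambda>_. 0" 0 t "- K"])
        (use that K compact_imp_closed in auto)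
    then show ?thesis using d DERIV_unique by blast
  qed
  have "\<theta>' t * indicator {- M..M} t = \<theta>' t" for t
  proof (cases "\<bar>t\<bar> \<le> M")
    case False
    then have "\<theta>' t = 0" using z out by simp
    then show ?thesis by simp
  qed (auto simp: indicator_def)
  then have e: "(\<lambda>t. \<theta>' t * indicator {- M..M} t) = \<theta>'" by (rule ext)
  have "(LINT t|lborel. \<theta>' t * indicator {- M..M} t) = \<theta> M - \<theta> (- M)"
    using c by (intro integral_FTC_Icc_real d) (auto simp: M_def continuous_on_eq_continuous_at)
  moreover have "\<theta> M = 0" "\<theta> (- M) = 0" by (rule K(2)[OF out], simp)+
  ultimately show ?thesis unfolding e by simp
qed

context split_coords
begin

lemma partial_slice:
  assumes \<psi>: "smooth_on UNIV \<psi>"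
  shows "partial i (\<lambda>y. \<psi> (L (y, t))) y = partial (b (Some i)) \<psi> (L (y, t))"
    "((\<lambda>t. \<psi> (L (y, t))) has_field_derivative partial (b None) \<psi> (L (y, t))) (at t)"
    "smooth_on UNIV (\<lambda>y. \<psi> (L (y, t)))"
proof -
  have d: "(\<psi> has_derivative frechet_derivative \<psi> (at (L (y, t)))) (at (L (y, t)))"
    by (rule smooth_on_has_derivative[OF \<psi> UNIV_I])
  have "((\<lambda>y. (y, t)) has_derivative (\<lambda>v. (v, 0))) (at y)" by (auto intro!: derivative_eq_intros)
  from diff_chain_at[OF diff_chain_at[OF this bounded_linear_imp_has_derivative[OF bounded_linear_L]]] d
  have "((\<lambda>y. \<psi> (L (y, t))) has_derivative (\<lambda>v. frechet_derivative \<psi> (at (L (y, t))) (L (v, 0)))) (at y)"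
    by (simp add: o_def)
  from partial_eqI[OF this]
  show "partial i (\<lambda>y. \<psi> (L (y, t))) y = partial (b (Some i)) \<psi> (L (y, t))" by (simp add: L_axis partial_def)
  have "((\<lambda>t. (y, t)) has_derivative (\<lambda>s. (0, s))) (at t)" by (auto intro!: derivative_eq_intros)
  from diff_chain_at[OF diff_chain_at[OF this bounded_linear_imp_has_derivative[OF bounded_linear_L]]] d
  have 1: "((\<lambda>t. \<psi> (L (y, t))) has_derivative (\<lambda>s. frechet_derivative \<psi> (at (L (y, t))) (L (0, s)))) (at t)"
    by (simp add: o_def)
  have "(\<lambda>s. frechet_derivative \<psi> (at (L (y, t))) (L (0, s))) = (*) (partial (b None) \<psi> (L (y, t)))"
  proof
    fix s
    have "L (0, s) = s *\<^sub>R axis (b None) 1" using linear_scale[OF linear_L, of s "(0, 1)"] by (simp add: L_axis)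
    then show "frechet_derivative \<psi> (at (L (y, t))) (L (0, s)) = partial (b None) \<psi> (L (y, t)) * s"
      using linear_scale[OF has_derivative_linear[OF d]] by (simp add: partial_def)
  qed
  with 1 show "((\<lambda>t. \<psi> (L (y, t))) has_field_derivative partial (b None) \<psi> (L (y, t))) (at t)"
    by (simp add: has_field_derivative_def)
  have "smooth_on UNIV (\<lambda>y. L (y, t))"
    by (rule smooth_on_linear_compose[OF bounded_linear_L open_UNIV smooth_on_Pair[OF open_UNIV smooth_on_ident smooth_on_const]])
  then show "smooth_on UNIV (\<lambda>y. \<psi> (L (y, t)))"
    by (rule smooth_on_compose[OF open_UNIV open_UNIV subset_UNIV _ \<psi>])
qed

text \<open>Both orders of integration are recorded: tangential derivatives need the integral over y
  inside, the derivative in t needs the integral over t inside.\<close>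

lemma integral_separated:
  fixes \<phi> :: "real^'m \<Rightarrow> real" and \<eta> :: "real \<Rightarrow> real" and \<psi> :: "real^'n \<Rightarrow> real"
  assumes \<phi>: "integrable lborel \<phi>" and \<eta>: "integrable lborel \<eta>"
  shows "integrable lborel (\<lambda>x. \<eta> (snd (P x)) * \<phi> (fst (P x)))"
    "\<psi> \<in> borel_measurable borel \<Longrightarrow> (\<And>x. \<bar>\<psi> x\<bar> \<le> B) \<Longrightarrow>
      (LINT x|lborel. \<eta> (snd (P x)) * \<phi> (fst (P x)) * \<psi> x) = (LINT t|lborel. \<eta> t * (LINT y|lborel. \<phi> y * \<psi> (L (y, t))))"
    "\<psi> \<in> borel_measurable borel \<Longrightarrow> (\<And>x. \<bar>\<psi> x\<bar> \<le> B) \<Longrightarrow>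
      (LINT x|lborel. \<eta> (snd (P x)) * \<phi> (fst (P x)) * \<psi> x) = (LINT y|lborel. \<phi> y * (LINT t|lborel. \<eta> t * \<psi> (L (y, t))))"
proof -
  have [measurable]: "\<phi> \<in> borel_measurable borel" "\<eta> \<in> borel_measurable borel"
    using borel_measurable_integrable[OF \<phi>] borel_measurable_integrable[OF \<eta>] by simp_all
  have [measurable]: "(\<lambda>x. \<phi> (fst (P x))) \<in> borel_measurable borel" "(\<lambda>x. \<eta> (snd (P x))) \<in> borel_measurable borel"
  proof -
    have "(\<lambda>x. fst (P x)) \<in> borel_measurable borel" "(\<lambda>x. snd (P x)) \<in> borel_measurable borel"
      by (intro borel_measurable_continuous_onI continuous_on_fst continuous_on_snd continuous_P)+
    then show "(\<lambda>x. \<phi> (fst (P x))) \<in> borel_measurable borel" "(\<lambda>x. \<eta> (snd (P x))) \<in> borel_measurable borel"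
      by (auto intro: measurable_compose)
  qed
  have m: "(\<lambda>x. \<eta> (snd (P x)) * \<phi> (fst (P x))) \<in> borel_measurable borel" by measurable
  have ip: "integrable (lborel \<Otimes>\<^sub>M lborel) (\<lambda>(y, t). \<phi> y * \<eta> t)"
    by (rule integrable_pair_mult(1)[OF sigma_finite_lborel sigma_finite_lborel \<phi> \<eta>])
  show i: "integrable lborel (\<lambda>x. \<eta> (snd (P x)) * \<phi> (fst (P x)))"
    unfolding integral_L(1)[OF m] using ip by (simp add: case_prod_beta' mult.commute)
  assume \<psi> [measurable]: "\<psi> \<in> borel_measurable borel" and B: "\<And>x. \<bar>\<psi> x\<bar> \<le> B"
  have m2: "(\<lambda>x. \<eta> (snd (P x)) * \<phi> (fst (P x)) * \<psi> x) \<in> borel_measurable borel" by measurable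
  have i2: "integrable lborel (\<lambda>x. \<eta> (snd (P x)) * \<phi> (fst (P x)) * \<psi> x)"
  proof (rule Bochner_Integration.integrable_bound)
    show "integrable lborel (\<lambda>x. B * (\<eta> (snd (P x)) * \<phi> (fst (P x))))" using i by simp
    have "0 \<le> B" using B[of 0] by linarith
    then show "AE x in lborel. norm (\<eta> (snd (P x)) * \<phi> (fst (P x)) * \<psi> x) \<le> norm (B * (\<eta> (snd (P x)) * \<phi> (fst (P x))))"
      using B by (intro AE_I2) (simp add: abs_mult mult.commute[of B] mult_left_mono)
  qed (use m2 in simp)
  have i3: "integrable (lborel \<Otimes>\<^sub>M lborel) (\<lambda>(y, t). \<eta> t * \<phi> y * \<psi> (L (y, t)))"
    using i2 unfolding integral_L(1)[OF m2] by (simp add: case_prod_beta')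
  have e: "(LINT x|lborel. \<eta> (snd (P x)) * \<phi> (fst (P x)) * \<psi> x) = integral\<^sup>L (lborel \<Otimes>\<^sub>M lborel) (\<lambda>(y, t). \<eta> t * \<phi> y * \<psi> (L (y, t)))"
    unfolding integral_L(2)[OF m2] by (simp add: case_prod_beta')
  show "(LINT x|lborel. \<eta> (snd (P x)) * \<phi> (fst (P x)) * \<psi> x) = (LINT t|lborel. \<eta> t * (LINT y|lborel. \<phi> y * \<psi> (L (y, t))))"
    unfolding e lborel_pair.integral_snd[OF i3, symmetric] by (simp add: mult.assoc)
  have "integral\<^sup>L (lborel \<Otimes>\<^sub>M lborel) (\<lambda>(y, t). \<eta> t * \<phi> y * \<psi> (L (y, t))) = (LINT y|lborel. LINT t|lborel. \<eta> t * \<phi> y * \<psi> (L (y, t)))"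
    using lborel_pair.integral_fst'[OF i3] by simp
  also have "\<dots> = (LINT y|lborel. LINT t|lborel. \<phi> y * (\<eta> t * \<psi> (L (y, t))))" by (simp add: mult_ac)
  finally show "(LINT x|lborel. \<eta> (snd (P x)) * \<phi> (fst (P x)) * \<psi> x) = (LINT y|lborel. \<phi> y * (LINT t|lborel. \<eta> t * \<psi> (L (y, t))))"
    unfolding e by simp
qed

text \<open>Leibniz rule for a weakly differentiable function of y times a continuously
  differentiable function of t. Tangential derivatives are tested slice by slice with the weak
  gradient of \<open>f\<close>; for the t-derivative, at fixed y, integration by parts is
  classical.\<close>

theorem weak_gradient_product:
  fixes \<xi> \<xi>' :: "real \<Rightarrow> real"
  assumes w: "weak_gradient_on V f D"
    and \<xi>: "\<And>t. (\<xi> has_field_derivative \<xi>' t) (at t)" and c\<xi>': "continuous_on UNIV \<xi>'"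
  shows "weak_gradient_on (L ` (V \<times> {1<..})) (\<lambda>x. \<xi> (snd (P x)) * f (fst (P x)))
     (\<lambda>x. L (\<xi> (snd (P x)) *\<^sub>R D (fst (P x)), \<xi>' (snd (P x)) * f (fst (P x))))"
proof -
  note wD = weak_gradient_onD[OF w]
  have c\<xi>: "continuous_on UNIV \<xi>" using \<xi> DERIV_isCont by (auto simp: continuous_on_eq_continuous_at)
  have K12: "compact (fst ` P ` K)" "compact (snd ` P ` K)" "fst ` P ` K \<subseteq> V" if "compact K" "K \<subseteq> L ` (V \<times> {1<..})" for K
  proof -
    have "compact (P ` K)" by (rule compact_continuous_image[OF continuous_P that(1)])
    then show "compact (fst ` P ` K)" "compact (snd ` P ` K)"
      by (auto intro!: compact_continuous_image continuous_on_fst continuous_on_snd continuous_on_id)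
    show "fst ` P ` K \<subseteq> V" using that(2) by auto
  qed
  have in1: "integrable lborel (\<lambda>y. indicator (fst ` P ` K) y * \<phi> y)"
    and in2: "integrable lborel (\<lambda>t. indicator (snd ` P ` K) t * \<eta> t)"
    if "compact K" "K \<subseteq> L ` (V \<times> {1<..})" "\<And>K. compact K \<Longrightarrow> K \<subseteq> V \<Longrightarrow> set_integrable lborel K \<phi>" "continuous_on UNIV \<eta>"
    for K and \<phi> :: "real^'m \<Rightarrow> real" and \<eta> :: "real \<Rightarrow> real"
    using that(3)[OF K12(1,3)[OF that(1,2)]] set_integrable_compact_continuous[OF continuous_on_subset[OF that(4) subset_UNIV] K12(2)[OF that(1,2)]]
    by (simp_all add: set_integrable_def)
  \<comment> \<open>The factors are only locally integrable, so both are cut off by the indicators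
    of the projections of \<open>K\<close>, which changes nothing on \<open>K\<close>.\<close>
  have si: "set_integrable lborel K (\<lambda>x. \<eta> (snd (P x)) * \<phi> (fst (P x)))"
    if K: "compact K" "K \<subseteq> L ` (V \<times> {1<..})" and \<phi>: "\<And>K. compact K \<Longrightarrow> K \<subseteq> V \<Longrightarrow> set_integrable lborel K \<phi>" and \<eta>: "continuous_on UNIV \<eta>"
    for K and \<phi> :: "real^'m \<Rightarrow> real" and \<eta> :: "real \<Rightarrow> real"
  proof -
    have "K \<in> sets lborel" using K(1) by (simp add: borel_compact)
    from integrable_mult_indicator[OF this integral_separated(1)[OF in1[OF K \<phi> \<eta>] in2[OF K \<phi> \<eta>]]]
    have i: "integrable lborel (\<lambda>x. indicator K x *\<^sub>R (indicator (snd ` P ` K) (snd (P x)) * \<eta> (snd (P x)) * (indicator (fst ` P ` K) (fst (P x)) * \<phi> (fst (P x)))))" .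
    have eq: "indicator K x *\<^sub>R (indicator (snd ` P ` K) (snd (P x)) * \<eta> (snd (P x)) * (indicator (fst ` P ` K) (fst (P x)) * \<phi> (fst (P x))))
      = indicator K x *\<^sub>R (\<eta> (snd (P x)) * \<phi> (fst (P x)))" for x by (cases "x \<in> K") auto
    show ?thesis using i unfolding set_integrable_def eq .
  qed
  have int: "(LINT x|lborel. \<eta> (snd (P x)) * \<phi> (fst (P x)) * \<psi> x) = (LINT t|lborel. \<eta> t * (LINT y|lborel. \<phi> y * \<psi> (L (y, t))))"
    "(LINT x|lborel. \<eta> (snd (P x)) * \<phi> (fst (P x)) * \<psi> x) = (LINT y|lborel. \<phi> y * (LINT t|lborel. \<eta> t * \<psi> (L (y, t))))"
    if K: "compact K" "K \<subseteq> L ` (V \<times> {1<..})" and \<phi>: "\<And>K. compact K \<Longrightarrow> K \<subseteq> V \<Longrightarrow> set_integrable lborel K \<phi>" and \<eta>: "continuous_on UNIV \<eta>"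
      and \<psi>: "continuous_on UNIV \<psi>" "\<And>x. x \<notin> K \<Longrightarrow> \<psi> x = 0"
    for K \<psi> and \<phi> :: "real^'m \<Rightarrow> real" and \<eta> :: "real \<Rightarrow> real"
  proof -
    let ?\<phi> = "\<lambda>y. indicator (fst ` P ` K) y * \<phi> y" and ?\<eta> = "\<lambda>t. indicator (snd ` P ` K) t * \<eta> t"
    have m: "\<psi> \<in> borel_measurable borel" using \<psi>(1) by (rule borel_measurable_continuous_onI)
    obtain B where "\<And>x. \<bar>\<psi> x\<bar> \<le> B" using continuous_compact_support_bounded[OF \<psi>(1) K(1) \<psi>(2)] by metis
    note s = integral_separated(2,3)[OF in1[OF K \<phi> \<eta>] in2[OF K \<phi> \<eta>] m this]
    have 1: "?\<eta> (snd (P x)) * ?\<phi> (fst (P x)) * \<psi> x = \<eta> (snd (P x)) * \<phi> (fst (P x)) * \<psi> x" for x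
      using \<psi>(2)[of x] by (cases "x \<in> K") auto
    have LK: "y \<in> fst ` P ` K" "t \<in> snd ` P ` K" if "L (y, t) \<in> K" for y t
      using imageI[OF imageI[OF that, of P], of fst] imageI[OF imageI[OF that, of P], of snd] by simp_all
    have 2: "?\<eta> t * (?\<phi> y * \<psi> (L (y, t))) = \<eta> t * (\<phi> y * \<psi> (L (y, t)))" for t y
      using \<psi>(2)[of "L (y, t)"] LK[of y t] by (cases "L (y, t) \<in> K") auto
    have 3: "?\<phi> y * (?\<eta> t * \<psi> (L (y, t))) = \<phi> y * (\<eta> t * \<psi> (L (y, t)))" for t y using 2[of t y] by (simp only: mult_ac)
    have "(LINT t|lborel. ?\<eta> t * (LINT y|lborel. ?\<phi> y * \<psi> (L (y, t)))) = (LINT t|lborel. \<eta> t * (LINT y|lborel. \<phi> y * \<psi> (L (y, t))))"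
      unfolding integral_mult_right_zero[symmetric] 2 ..
    with s(1) show "(LINT x|lborel. \<eta> (snd (P x)) * \<phi> (fst (P x)) * \<psi> x) = (LINT t|lborel. \<eta> t * (LINT y|lborel. \<phi> y * \<psi> (L (y, t))))"
      unfolding 1 by simp
    have "(LINT y|lborel. ?\<phi> y * (LINT t|lborel. ?\<eta> t * \<psi> (L (y, t)))) = (LINT y|lborel. \<phi> y * (LINT t|lborel. \<eta> t * \<psi> (L (y, t))))"
      unfolding integral_mult_right_zero[symmetric] 3 ..
    with s(2) show "(LINT x|lborel. \<eta> (snd (P x)) * \<phi> (fst (P x)) * \<psi> x) = (LINT y|lborel. \<phi> y * (LINT t|lborel. \<eta> t * \<psi> (L (y, t))))"
      unfolding 1 by simp
  qed
  have cmp: "L (\<xi> (snd (P x)) *\<^sub>R D (fst (P x)), \<xi>' (snd (P x)) * f (fst (P x))) $ b (Some i) = \<xi> (snd (P x)) * D (fst (P x)) $ i"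
    "L (\<xi> (snd (P x)) *\<^sub>R D (fst (P x)), \<xi>' (snd (P x)) * f (fst (P x))) $ b None = \<xi>' (snd (P x)) * f (fst (P x))" for x i
    by simp_all
  show ?thesis
  proof (rule weak_gradient_onI)
    fix K assume K: "compact K" "K \<subseteq> L ` (V \<times> {1<..})"
    show "set_integrable lborel K (\<lambda>x. \<xi> (snd (P x)) * f (fst (P x)))" by (rule si[OF K wD(1) c\<xi>])
    show "set_integrable lborel K (\<lambda>x. L (\<xi> (snd (P x)) *\<^sub>R D (fst (P x)), \<xi>' (snd (P x)) * f (fst (P x))) $ k)" for k
    proof (cases k rule: b_cases)
      case (1 i) then show ?thesis unfolding 1 cmp by (intro si[OF K _ c\<xi>]) (rule wD(2))
    next
      case 2 show ?thesis unfolding 2 cmp by (rule si[OF K wD(1) c\<xi>'])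
    qed
  next
    fix \<psi> k assume \<psi>: "test_function (L ` (V \<times> {1<..})) \<psi>"
    note t = test_functionD[OF \<psi>]
    let ?K = "closure {x. \<psi> x \<noteq> 0}"
    have z: "\<psi> x = 0" "partial k \<psi> x = 0" if "x \<notin> ?K" for x k using that by (rule support_0, rule partial_eq_0)
    note K = t(2,3)
    show "(LINT x|lborel. \<xi> (snd (P x)) * f (fst (P x)) * partial k \<psi> x)
       = - (LINT x|lborel. L (\<xi> (snd (P x)) *\<^sub>R D (fst (P x)), \<xi>' (snd (P x)) * f (fst (P x))) $ k * \<psi> x)"
    proof (cases k rule: b_cases)
      case (1 i)
      have inner: "(LINT y|lborel. f y * partial k \<psi> (L (y, s))) = - (LINT y|lborel. D y $ i * \<psi> (L (y, s)))" for s
      proof -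
        have "test_function V (\<lambda>y. \<psi> (L (y, s)))"
        proof (rule test_functionI[OF partial_slice(3)[OF t(1)] K12(1,3)[OF K]])
          fix y assume "y \<notin> fst ` P ` ?K"
          then have "L (y, s) \<notin> ?K" by (metis PL fst_conv imageI)
          then show "\<psi> (L (y, s)) = 0" by (rule z(1))
        qed
        from wD(3)[OF this, of i] show ?thesis by (simp add: partial_slice(1)[OF t(1)] 1)
      qed
      have "(LINT x|lborel. \<xi> (snd (P x)) * f (fst (P x)) * partial k \<psi> x) = (LINT s|lborel. \<xi> s * (LINT y|lborel. f y * partial k \<psi> (L (y, s))))"
        by (rule int(1)[OF K wD(1) c\<xi> t(5) z(2)])
      also have "\<dots> = - (LINT s|lborel. \<xi> s * (LINT y|lborel. D y $ i * \<psi> (L (y, s))))" unfolding inner by simp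
      also have "(LINT s|lborel. \<xi> s * (LINT y|lborel. D y $ i * \<psi> (L (y, s)))) = (LINT x|lborel. \<xi> (snd (P x)) * D (fst (P x)) $ i * \<psi> x)"
        by (rule int(1)[OF K wD(2) c\<xi> t(4) z(1), symmetric])
      finally show ?thesis unfolding 1 cmp .
    next
      case 2
      have inner: "(LINT s|lborel. \<xi> s * partial k \<psi> (L (y, s))) = - (LINT s|lborel. \<xi>' s * \<psi> (L (y, s)))" for y
      proof -
        have zo: "\<psi> (L (y, s)) = 0" "partial k \<psi> (L (y, s)) = 0" if "s \<notin> snd ` P ` ?K" for s
        proof -
          have "L (y, s) \<notin> ?K" using that by (metis PL snd_conv imageI)
          then show "\<psi> (L (y, s)) = 0" "partial k \<psi> (L (y, s)) = 0" by (rule z)+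
        qed
        have cL: "continuous_on UNIV (\<lambda>s. L (y, s))"
          by (intro continuous_on_compose2[OF continuous_L[of UNIV]] continuous_intros) auto
        have c1: "continuous_on UNIV (\<lambda>s. \<xi> s * partial k \<psi> (L (y, s)))" "continuous_on UNIV (\<lambda>s. \<xi>' s * \<psi> (L (y, s)))"
          by (intro continuous_on_mult c\<xi> c\<xi>' continuous_on_compose2[OF t(4) cL] continuous_on_compose2[OF t(5) cL]; simp)+
        have i1: "integrable lborel (\<lambda>s. \<xi> s * partial k \<psi> (L (y, s)))" "integrable lborel (\<lambda>s. \<xi>' s * \<psi> (L (y, s)))"
          by (rule integrable_compact_support[OF c1(1) K12(2)[OF K]], simp add: zo)
            (rule integrable_compact_support[OF c1(2) K12(2)[OF K]], simp add: zo)
        have "(LINT s|lborel. \<xi>' s * \<psi> (L (y, s)) + \<xi> s * partial k \<psi> (L (y, s))) = 0"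
        proof (rule integral_derivative_eq_0[OF _ _ K12(2)[OF K]])
          show "((\<lambda>s. \<xi> s * \<psi> (L (y, s))) has_field_derivative \<xi>' s * \<psi> (L (y, s)) + \<xi> s * partial k \<psi> (L (y, s))) (at s)" for s
            using DERIV_mult[OF \<xi>[of s] partial_slice(2)[OF t(1), of y s]] by (simp add: 2 mult.commute add.commute)
          show "continuous_on UNIV (\<lambda>s. \<xi>' s * \<psi> (L (y, s)) + \<xi> s * partial k \<psi> (L (y, s)))" by (intro continuous_on_add c1)
        qed (simp add: zo)
        then show ?thesis using i1 by simp
      qed
      have "(LINT x|lborel. \<xi> (snd (P x)) * f (fst (P x)) * partial k \<psi> x) = (LINT y|lborel. f y * (LINT s|lborel. \<xi> s * partial k \<psi> (L (y, s))))"
        by (rule int(2)[OF K wD(1) c\<xi> t(5) z(2)])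
      also have "\<dots> = - (LINT y|lborel. f y * (LINT s|lborel. \<xi>' s * \<psi> (L (y, s))))" unfolding inner by simp
      also have "(LINT y|lborel. f y * (LINT s|lborel. \<xi>' s * \<psi> (L (y, s)))) = (LINT x|lborel. \<xi>' (snd (P x)) * f (fst (P x)) * \<psi> x)"
        by (rule int(2)[OF K wD(1) c\<xi>' t(4) z(1), symmetric])
      finally show ?thesis unfolding 2 cmp .
    qed
  qed
qed

end

section \<open>The upper bound\<close>

lemma (in riemannian) weak_differential_const:
  "weak_differential A (\<lambda>_. k) (\<lambda>_ _. 0)"
proof (rule weak_differentialI)
  fix p
  obtain c where c: "c \<in> A" "p \<in> fst c" using chart_exists by metis
  have "weak_gradient_on (snd c ` fst c) (\<lambda>y. k) (\<lambda>y. 0)"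
  proof (rule weak_gradient_onI)
    show "set_integrable lborel K (\<lambda>y. k)" if "compact K" for K :: "(real^'n) set"
      by (rule set_integrable_compact_continuous[OF continuous_on_const that])
    show "set_integrable lborel K (\<lambda>y. (0 :: real^'n) $ i)" for K :: "(real^'n) set" and i by (simp add: set_integrable_def)
    fix \<psi> :: "real^'n \<Rightarrow> real" and i assume "test_function (snd c ` fst c) \<psi>"
    from integral_partial_eq_0[OF this, of i]
    show "(LINT y|lborel. k * partial i \<psi> y) = - (LINT y|lborel. (0 :: real^'n) $ i * \<psi> y)" by simp
  qed
  then show "\<exists>c\<in>A. \<exists>W. open W \<and> p \<in> W \<and> W \<subseteq> fst c \<and> weak_gradient_on (snd c ` W) (\<lambda>y. k) (\<lambda>y. 0)"
    using c open_chart[OF c(1)] by blast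
qed simp

text \<open>Ensures that the constant 1 counts as a nonzero function. Zero total volume would make
  the nonempty open image of a chart negligible, since the density is positive.\<close>

lemma (in riemannian) vol_nonzero: "emeasure vol UNIV \<noteq> 0"
proof
  assume z: "emeasure vol UNIV = 0"
  obtain c :: "('a, real^'n) chart" and p where c: "c \<in> A" "p \<in> fst c" using chart_exists by metis
  note ch = is_chart_simps[OF chart[OF c(1)]]
  let ?w = "\<lambda>y. ennreal (indicator (snd c ` fst c) y * sqrt (det (g c (chart_inv c y))))"
  have "emeasure vol (fst c) \<le> emeasure vol UNIV" by (rule emeasure_mono) auto
  then have "emeasure vol (fst c) = 0" using z by simp
  moreover have "(\<integral>\<^sup>+p. indicator (fst c) p * 1 \<partial>vol) = emeasure vol (fst c)" using open_chart[OF c(1)] by simp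
  ultimately have "(\<integral>\<^sup>+y. ?w y \<partial>lborel) = 0" using nn_integral_chart[OF c(1), of "\<lambda>_. 1"] by simp
  then have "AE y in lborel. ?w y = 0"
    using nn_integral_0_iff_AE[of ?w lborel] volume_density_measurable[OF c(1)] by simp
  then have "AE y in lborel. y \<notin> snd c ` fst c"
  proof eventually_elim
    case (elim y)
    show ?case
    proof
      assume y: "y \<in> snd c ` fst c"
      then show False using elim det_metric[OF c(1) ch(5)[OF y]] by (simp add: ennreal_eq_0_iff)
    qed
  qed
  then have "snd c ` fst c \<in> null_sets lborel" using AE_iff_null_sets[of "snd c ` fst c" lborel] ch(2) by simp
  then have "negligible (snd c ` fst c)" by (simp add: negligible_iff_null_sets null_sets_completionI)
  then show False using open_not_negligible[OF ch(2)] c(2) by blast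
qed

text \<open>With vanishing curvature the constant function has zero energy, and on a compact space
  it is square-integrable.\<close>

lemma (in riemannian) first_eigenvalue_flat:
  assumes K: "compact (UNIV :: 'a set)" and R: "\<And>p. scalar_curvature A g p = 0"
  shows "first_eigenvalue A g = 0"
proof (rule antisym)
  have fin: "finite_measure vol" by (rule finite_measureI) (use vol_compact_finite[OF K] in simp)
  have z: "conorm_sq A g (\<lambda>_ _. 0) = (\<lambda>_. 0)" by (simp add: conorm_sq_def fun_eq_iff)
  have "\<not> (AE p in vol. (1::real) = 0)" using vol_nonzero by (simp add: eventually_False ae_filter_eq_bot_iff)
  then have "((\<lambda>_. 1), \<lambda>_ _. 0) \<in> sobolev_nonzero A g"
    using weak_differential_const[of 1] finite_measure.integrable_const[OF fin, of "1::real"]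
    by (simp add: sobolev_nonzero_def sobolev_def z)
  then show "first_eigenvalue A g \<le> 0"
    unfolding first_eigenvalue_def by (rule INF_lower2) (simp add: yamabe_energy_def z R)
  show "0 \<le> first_eigenvalue A g" by (rule first_eigenvalue_nonneg) (simp add: R)
qed

section \<open>Products of a cutoff in t with a function on \<open>Z\<close>\<close>

context cylindrical_end
begin

definition cutoff :: "(real \<Rightarrow> real) \<Rightarrow> ('z \<Rightarrow> real) \<Rightarrow> 'x \<Rightarrow> real" where
  "cutoff \<xi> v p = (if p \<in> E then \<xi> (snd (\<Psi> p)) * v (fst (\<Psi> p)) else 0)"

text \<open>The differential of the product, with tangential part \<open>\<xi>\<close> times
  \<open>\<nu>\<close> and t-component \<open>\<xi>'\<close> times \<open>v\<close>, written in the
  end chart over a chosen chart of \<open>Z\<close> and carried to \<open>d\<close> by the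
  transformation law.\<close>

definition cutoff_covector ::
  "(real \<Rightarrow> real) \<Rightarrow> (real \<Rightarrow> real) \<Rightarrow> ('z \<Rightarrow> real) \<Rightarrow> ('z, 'm) covector_field \<Rightarrow> ('x, 'n) covector_field" where
  "cutoff_covector \<xi> \<xi>' v \<nu> d p = (if p \<in> E then
     let c = chart_at AZ (fst (\<Psi> p)) in transpose (transition_jacobian d (ec c) p) *v
       L (\<xi> (snd (\<Psi> p)) *\<^sub>R \<nu> c (fst (\<Psi> p)), \<xi>' (snd (\<Psi> p)) * v (fst (\<Psi> p))) else 0)"

lemma cutoff_\<Phi>: "1 < t \<Longrightarrow> cutoff \<xi> v (\<Phi> (z, t)) = \<xi> t * v z"
  by (simp add: cutoff_def \<Phi>_in_E)

lemma in_E_cases: assumes "p \<in> E" obtains z t c where "p = \<Phi> (z, t)" "1 < t" "c \<in> AZ" "z \<in> fst c"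
proof -
  obtain z t where zt: "p = \<Phi> (z, t)" "1 < t" using assms unfolding E_def by auto
  obtain c where "c \<in> AZ" "z \<in> fst c" using Z.chart_exists by metis
  with that zt show thesis by blast
qed

lemma \<Phi>_in_ec: "c \<in> AZ \<Longrightarrow> z \<in> fst c \<Longrightarrow> 1 < t \<Longrightarrow> \<Phi> (z, t) \<in> fst (ec c)"
  by (auto simp: ec_simps(2))

lemma cutoff_measurable:
  assumes v: "v \<in> borel_measurable borel" and \<xi>: "\<xi> \<in> borel_measurable borel"
  shows "cutoff \<xi> v \<in> borel_measurable borel"
proof -
  have "E \<subseteq> - W" using \<Phi>_notin_W by (auto simp: E_def)
  then have "\<Psi> \<in> borel_measurable (restrict_space borel E)"
    by (intro borel_measurable_continuous_on_restrict continuous_on_subset[OF continuous_\<Psi>])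
  then have [measurable]: "\<Psi> \<in> restrict_space borel E \<rightarrow>\<^sub>M borel \<Otimes>\<^sub>M borel" by (simp add: borel_prod)
  note [measurable] = assms
  have "(\<lambda>p. \<xi> (snd (\<Psi> p)) * v (fst (\<Psi> p))) \<in> borel_measurable (restrict_space borel E)" by measurable
  then have "(\<lambda>p. indicator E p *\<^sub>R (\<xi> (snd (\<Psi> p)) * v (fst (\<Psi> p)))) \<in> borel_measurable borel"
    by (simp add: borel_measurable_restrict_space_iff)
  moreover have "(\<lambda>p. indicator E p *\<^sub>R (\<xi> (snd (\<Psi> p)) * v (fst (\<Psi> p)))) = cutoff \<xi> v"
    by (auto simp: cutoff_def fun_eq_iff)
  ultimately show ?thesis by simp
qed

text \<open>Two separated terms, because the energy density of a product has one term with the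
  square of \<open>\<xi>\<close> and one with the square of \<open>\<xi>'\<close>.\<close>

lemma integral_separated_end:
  fixes f :: "'x \<Rightarrow> real"
  assumes f: "f \<in> borel_measurable borel" "\<And>p. p \<notin> E \<Longrightarrow> f p = 0"
    and eq: "\<And>z t. 1 < t \<Longrightarrow> f (\<Phi> (z, t)) = f1 z * k1 t + f2 z * k2 t"
    and k: "\<And>t. t \<le> 1 \<Longrightarrow> k1 t = 0" "\<And>t. t \<le> 1 \<Longrightarrow> k2 t = 0"
    and i: "integrable Z.vol f1" "integrable Z.vol f2" "integrable lborel k1" "integrable lborel k2"
  shows "integrable X.vol f"
    "(LINT p|X.vol. f p) = (LINT z|Z.vol. f1 z) * (LINT t|lborel. k1 t) + (LINT z|Z.vol. f2 z) * (LINT t|lborel. k2 t)"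
proof -
  have sf: "sigma_finite_measure Z.vol" ..
  have e: "indicator {1<..} (snd p) * f (\<Phi> p) = (case p of (z, t) \<Rightarrow> f1 z * k1 t) + (case p of (z, t) \<Rightarrow> f2 z * k2 t)" for p
  proof (cases p)
    case (Pair z t)
    then show ?thesis by (cases "1 < t") (simp_all add: eq k)
  qed
  have fE: "indicator E p * f p = f p" for p by (cases "p \<in> E") (simp_all add: f(2))
  note ip = integrable_pair_mult[OF sf sigma_finite_lborel i(1,3)] integrable_pair_mult[OF sf sigma_finite_lborel i(2,4)]
  show "integrable X.vol f" using end_integral(1)[OF f(1)] ip(1,3) unfolding fE e by simp
  show "(LINT p|X.vol. f p) = (LINT z|Z.vol. f1 z) * (LINT t|lborel. k1 t) + (LINT z|Z.vol. f2 z) * (LINT t|lborel. k2 t)"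
    using end_integral(2)[OF f(1)] ip unfolding fE e by simp
qed

context
  fixes v :: "'z \<Rightarrow> real" and \<nu> :: "('z, 'm) covector_field" and \<xi> \<xi>' :: "real \<Rightarrow> real" and I :: "real set"
  assumes v\<nu>: "(v, \<nu>) \<in> sobolev AZ h"
    and d\<xi>: "\<And>t. (\<xi> has_field_derivative \<xi>' t) (at t)" and c\<xi>': "continuous_on UNIV \<xi>'"
    and I: "compact I" "I \<subseteq> {1<..}" "\<And>t. t \<notin> I \<Longrightarrow> \<xi> t = 0"
begin

abbreviation "U \<equiv> cutoff \<xi> v"
abbreviation "\<Omega> \<equiv> cutoff_covector \<xi> \<xi>' v \<nu>"
abbreviation "w c z t \<equiv> L (\<xi> t *\<^sub>R \<nu> c z, \<xi>' t * v z)"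

lemma \<xi>'_0: assumes "t \<notin> I" shows "\<xi>' t = 0"
proof -
  have "(\<xi> has_field_derivative 0) (at t)"
    by (rule has_field_derivative_transform_within_open[of "\<lambda>_. 0" 0 t "- I"])
      (use assms I compact_imp_closed in auto)
  then show ?thesis using d\<xi> DERIV_unique by blast
qed

lemma continuous_\<xi>: "continuous_on UNIV \<xi>" using d\<xi> DERIV_isCont by (auto simp: continuous_on_eq_continuous_at)

lemma v_weak: "weak_differential AZ v \<nu>" using v\<nu> by (simp add: sobolev_def)

text \<open>The chart of \<open>Z\<close> chosen in the definition is immaterial: changing it acts
  on the tangential part by the Jacobian of \<open>Z\<close>, in accordance with the law of
  \<open>\<nu>\<close>, and fixes the t-component.\<close>

lemma \<Omega>_eq:
  assumes d: "d \<in> A'" "c \<in> AZ" "z \<in> fst c" "1 < t" "\<Phi> (z, t) \<in> fst d"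
  shows "\<Omega> d (\<Phi> (z, t)) = transpose (transition_jacobian d (ec c) (\<Phi> (z, t))) *v w c z t"
proof -
  define e where "e = chart_at AZ z"
  have e: "e \<in> AZ" "z \<in> fst e" using Z.chart_at by (auto simp: e_def)
  have l: "\<nu> c z = transpose (transition_jacobian c e z) *v \<nu> e z"
    using v_weak d e unfolding weak_differential_def by blast
  have "w c z t = transpose (transition_jacobian (ec c) (ec e) (\<Phi> (z, t))) *v w e z t"
    unfolding covector_split[OF d(2) e(1) d(3) e(2) d(4)]
  proof
    have "(\<chi> i. w k z t $ b (Some i)) = \<xi> t *\<^sub>R \<nu> k z" for k by (simp add: vec_eq_iff)
    note this[of c] this[of e]
    then show "(\<chi> i. w c z t $ b (Some i)) = transpose (transition_jacobian c e z) *v (\<chi> i. w e z t $ b (Some i))"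
      by (simp only: l matrix_vector_mult_scaleR)
  qed simp
  moreover have "transition_jacobian d (ec e) (\<Phi> (z, t)) = transition_jacobian (ec c) (ec e) (\<Phi> (z, t)) ** transition_jacobian d (ec c) (\<Phi> (z, t))"
    by (rule ext.jacobian_cocycle) (use d e \<Phi>_in_ec in auto)
  ultimately show ?thesis
    using d(4) by (simp add: cutoff_covector_def \<Phi>_in_E Let_def e_def[symmetric] matrix_transpose_mul matrix_vector_mul_assoc del: transpose_matrix_vector)
qed

lemma \<Omega>_0: "p \<notin> E \<Longrightarrow> \<Omega> d p = 0" by (simp add: cutoff_covector_def)

lemma \<Omega>_ec: "c \<in> AZ \<Longrightarrow> z \<in> fst c \<Longrightarrow> 1 < t \<Longrightarrow> \<Omega> (ec c) (\<Phi> (z, t)) = w c z t"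
  by (subst \<Omega>_eq[of "ec c" c]) (simp_all add: \<Phi>_in_ec ext.jacobian_refl transpose_mat del: transpose_matrix_vector)

lemma \<Omega>_law:
  assumes "c \<in> A'" "d \<in> A'" "p \<in> fst c" "p \<in> fst d"
  shows "\<Omega> c p = transpose (transition_jacobian c d p) *v \<Omega> d p"
proof (cases "p \<in> E")
  case True
  then obtain z t e where e: "p = \<Phi> (z, t)" "1 < t" "e \<in> AZ" "z \<in> fst e" by (rule in_E_cases)
  have "transition_jacobian c (ec e) p = transition_jacobian d (ec e) p ** transition_jacobian c d p"
    by (rule ext.jacobian_cocycle) (use assms e \<Phi>_in_ec in auto)
  moreover have "\<Omega> c p = transpose (transition_jacobian c (ec e) p) *v w e z t" "\<Omega> d p = transpose (transition_jacobian d (ec e) p) *v w e z t"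
    using \<Omega>_eq[OF _ e(3,4,2)] assms e(1) by auto
  ultimately show ?thesis by (simp add: matrix_transpose_mul matrix_vector_mul_assoc del: transpose_matrix_vector)
qed (simp add: \<Omega>_0)

text \<open>On the end the claim is \<open>weak_gradient_product\<close> in an end chart; at any
  other point everything vanishes nearby.\<close>

lemma \<Omega>_weak: "weak_differential A' U \<Omega>"
proof (rule ext.weak_differentialI[OF \<Omega>_law])
  fix p
  show "\<exists>c\<in>A'. \<exists>W. open W \<and> p \<in> W \<and> W \<subseteq> fst c \<and> weak_gradient_on (snd c ` W) (\<lambda>y. U (chart_inv c y)) (\<lambda>y. \<Omega> c (chart_inv c y))"
  proof (cases "p \<in> E")
    case True
    then obtain z t c where c: "p = \<Phi> (z, t)" "1 < t" "c \<in> AZ" "z \<in> fst c" by (rule in_E_cases)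
    note e = ec_simps[OF c(3)] and ch = is_chart_simps[OF Z.chart[OF c(3)]]
    have "weak_gradient_on (snd c ` fst c) (\<lambda>y. v (chart_inv c y)) (\<lambda>y. \<nu> c (chart_inv c y))"
      using v_weak c unfolding weak_differential_def by blast
    from weak_gradient_product[OF this d\<xi> c\<xi>']
    have "weak_gradient_on (snd (ec c) ` fst (ec c)) (\<lambda>y. U (chart_inv (ec c) y)) (\<lambda>y. \<Omega> (ec c) (chart_inv (ec c) y))"
      unfolding e(4)
    proof (rule weak_gradient_on_cong[rotated 2])
      fix x assume "x \<in> L ` (snd c ` fst c \<times> {1<..})"
      then obtain y s where ys: "x = L (y, s)" "y \<in> snd c ` fst c" "1 < s" by auto
      show "\<xi> (snd (P x)) * v (chart_inv c (fst (P x))) = U (chart_inv (ec c) x)"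
        using ys(3) by (simp add: ys(1) e(5)[OF ys(2,3)] cutoff_\<Phi>)
      show "w c (chart_inv c (fst (P x))) (snd (P x)) = \<Omega> (ec c) (chart_inv (ec c) x)"
        by (simp add: ys(1) e(5)[OF ys(2,3)] \<Omega>_ec[OF c(3) ch(5)[OF ys(2)] ys(3)])
    qed
    then show ?thesis using ec_in[OF c(3)] \<Phi>_in_ec[OF c(3,4,2)] is_chart_simps(1)[OF e(1)] c(1) by blast
  next
    case False
    obtain d where d: "d \<in> AX" "p \<in> fst d" using X.chart_exists by metis
    note ch = is_chart_simps[OF X.chart[OF d(1)]]
    \<comment> \<open>\<open>S\<close> is compact because \<open>Z\<close> and \<open>I\<close> are,
      hence closed. A point outside the end, even on its boundary, therefore has a neighbourhood
      that misses \<open>S\<close>.\<close>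
    define S where "S = \<Phi> ` (UNIV \<times> I)"
    have "compact S" unfolding S_def
      by (intro compact_continuous_image continuous_on_subset[OF continuous_\<Phi>] compact_Times compactZ I(1)) (use I(2) in auto)
    then have cS: "closed S" by (rule compact_imp_closed)
    have pS: "p \<notin> S" using False I(2) by (auto simp: S_def E_def)
    define N where "N = fst d \<inter> - S"
    have N: "open N" "p \<in> N" "N \<subseteq> fst d" using ch(1) cS d pS by (auto simp: N_def)
    have z: "U q = 0" "\<Omega> d q = 0" if q: "q \<in> N" for q
    proof -
      have "U q = 0 \<and> \<Omega> d q = 0"
      proof (cases "q \<in> E")
        case True
        then obtain z t c where c: "q = \<Phi> (z, t)" "1 < t" "c \<in> AZ" "z \<in> fst c" by (rule in_E_cases)
        have "t \<notin> I" using q c(1) by (auto simp: N_def S_def)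
        then have 0: "\<xi> t = 0" "\<xi>' t = 0" using I(3) \<xi>'_0 by auto
        have w0: "w c z t = 0" by (simp add: 0 vec_eq_b)
        have "\<Omega> d q = 0"
          using \<Omega>_eq[OF _ c(3,4,2), of d] d(1) q unfolding w0 c(1)[symmetric] by (simp add: A'_def N_def)
        then show ?thesis using c by (simp add: cutoff_\<Phi> 0)
      qed (simp add: \<Omega>_0 cutoff_def)
      then show "U q = 0" "\<Omega> d q = 0" by auto
    qed
    have "weak_gradient_on (snd d ` N) (\<lambda>y. 0) (\<lambda>y. 0)"
      by (rule weak_gradient_onI) (simp_all add: set_integrable_def)
    then have "weak_gradient_on (snd d ` N) (\<lambda>y. U (chart_inv d y)) (\<lambda>y. \<Omega> d (chart_inv d y))"
    proof (rule weak_gradient_on_cong[rotated 2])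
      fix y assume "y \<in> snd d ` N"
      then have "chart_inv d y \<in> N" using ch(3) N(3) by auto
      then show "0 = U (chart_inv d y)" "0 = \<Omega> d (chart_inv d y)" using z by auto
    qed
    then show ?thesis using d(1) N by (auto simp: A'_def)
  qed
qed

lemma conorm_cutoff:
  "conorm_sq AX g \<Omega> p = conorm_sq A' g' \<Omega> p"
  "1 < t \<Longrightarrow> conorm_sq AX g \<Omega> (\<Phi> (z, t)) = conorm_sq AZ h \<nu> z * (\<xi> t)\<^sup>2 + (v z)\<^sup>2 * (\<xi>' t)\<^sup>2"
  "p \<notin> E \<Longrightarrow> conorm_sq AX g \<Omega> p = 0"
proof -
  show eq: "conorm_sq AX g \<Omega> p = conorm_sq A' g' \<Omega> p" for p by (rule conorm_extend[OF \<Omega>_law refl])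
  show "conorm_sq AX g \<Omega> p = 0" if "p \<notin> E" by (simp add: conorm_sq_def Let_def \<Omega>_0[OF that])
  assume t: "1 < t"
  define c where "c = chart_at AZ z"
  have c: "c \<in> AZ" "z \<in> fst c" using Z.chart_at by (auto simp: c_def)
  have "slice \<Omega> t c z = \<xi> t *\<^sub>R \<nu> c z" by (simp add: slice_def \<Omega>_ec[OF c t] vec_eq_iff)
  then have "conorm_sq AZ h (slice \<Omega> t) z = conorm_sq AZ h \<nu> z * (\<xi> t)\<^sup>2"
    by (simp add: conorm_sq_def Let_def c_def[symmetric] matrix_vector_mult_scaleR power2_eq_square)
  moreover have "conorm_sq A' g' \<Omega> (\<Phi> (z, t)) = conorm_sq AZ h (slice \<Omega> t) z + (\<Omega> (ec c) (\<Phi> (z, t)) $ b None)\<^sup>2"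
    by (rule conorm_end(2)[OF \<Omega>_law t c])
  ultimately show "conorm_sq AX g \<Omega> (\<Phi> (z, t)) = conorm_sq AZ h \<nu> z * (\<xi> t)\<^sup>2 + (v z)\<^sup>2 * (\<xi>' t)\<^sup>2"
    by (simp add: eq \<Omega>_ec[OF c t] power_mult_distrib mult.commute)
qed

text \<open>On the end the curvature of \<open>X\<close> is that of \<open>Z\<close>, so all
  densities are sums of separated products and the integrals factor into integrals over
  \<open>Z\<close> and over t.\<close>

lemma cutoff_sobolev:
  shows "(U, \<Omega>) \<in> sobolev AX g"
    "(LINT p|X.vol. (U p)\<^sup>2) = (LINT z|Z.vol. (v z)\<^sup>2) * (LINT t|lborel. (\<xi> t)\<^sup>2)"
    "yamabe_energy a AX g U \<Omega> = yamabe_energy a AZ h v \<nu> * (LINT t|lborel. (\<xi> t)\<^sup>2) + a * (LINT z|Z.vol. (v z)\<^sup>2) * (LINT t|lborel. (\<xi>' t)\<^sup>2)"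
proof -
  have mv: "v \<in> borel_measurable borel" and iv: "integrable Z.vol (\<lambda>z. (v z)\<^sup>2)" and ic: "integrable Z.vol (conorm_sq AZ h \<nu>)"
    using v\<nu> by (auto simp: sobolev_def)
  have iR: "integrable Z.vol (\<lambda>z. scalar_curvature AZ h z * (v z)\<^sup>2)" by (rule Z.curvature_term_integrable[OF compactZ iv])
  have mU [measurable]: "U \<in> borel_measurable borel"
    by (rule cutoff_measurable[OF mv borel_measurable_continuous_onI[OF continuous_\<xi>]])
  have wd: "weak_differential AX U \<Omega>" using \<Omega>_weak sub unfolding weak_differential_def by blast
  note [measurable] = X.conorm_measurable[OF wd]
  have i\<xi>: "integrable lborel (\<lambda>t. (\<xi> t)\<^sup>2)" "integrable lborel (\<lambda>t. (\<xi>' t)\<^sup>2)"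
    by (rule integrable_compact_support[OF _ I(1)]; use I(3) \<xi>'_0 continuous_\<xi> c\<xi>' in \<open>auto intro!: continuous_intros\<close>)+
  have k0: "(\<xi> t)\<^sup>2 = 0" "(\<xi>' t)\<^sup>2 = 0" if "t \<le> 1" for t
  proof -
    have "t \<notin> I" using I(2) that by auto
    then show "(\<xi> t)\<^sup>2 = 0" "(\<xi>' t)\<^sup>2 = 0" using I(3) \<xi>'_0 by auto
  qed
  have mU2: "(\<lambda>p. (U p)\<^sup>2) \<in> borel_measurable borel" by measurable
  have U0: "U p = 0" if "p \<notin> E" for p using that by (simp add: cutoff_def)
  note s = integral_separated_end[OF mU2 _ _ k0(1) k0(1) iv _ i\<xi>(1) i\<xi>(1), of "\<lambda>_. 0"]
  have iU: "integrable X.vol (\<lambda>p. (U p)\<^sup>2)" by (rule s(1)) (simp_all add: U0 cutoff_\<Phi> power_mult_distrib)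
  have "(LINT p|X.vol. (U p)\<^sup>2) = (LINT z|Z.vol. (v z)\<^sup>2) * (LINT t|lborel. (\<xi> t)\<^sup>2) + (LINT z|Z.vol. 0) * (LINT t|lborel. (\<xi> t)\<^sup>2)"
    by (rule s(2)) (simp_all add: U0 cutoff_\<Phi> power_mult_distrib)
  then show "(LINT p|X.vol. (U p)\<^sup>2) = (LINT z|Z.vol. (v z)\<^sup>2) * (LINT t|lborel. (\<xi> t)\<^sup>2)" by simp
  have iC: "integrable X.vol (conorm_sq AX g \<Omega>)"
    by (rule integral_separated_end(1)[OF _ conorm_cutoff(3) conorm_cutoff(2) k0 ic iv i\<xi>]) (simp_all add: X.conorm_measurable[OF wd])
  show "(U, \<Omega>) \<in> sobolev AX g" by (simp add: sobolev_def wd iU iC)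
  have "yamabe_energy a AX g U \<Omega> = (LINT z|Z.vol. a * conorm_sq AZ h \<nu> z + scalar_curvature AZ h z * (v z)\<^sup>2) * (LINT t|lborel. (\<xi> t)\<^sup>2)
      + (LINT z|Z.vol. a * (v z)\<^sup>2) * (LINT t|lborel. (\<xi>' t)\<^sup>2)"
    unfolding yamabe_energy_def
  proof (rule integral_separated_end(2)[OF _ _ _ k0 _ _ i\<xi>])
    show "(\<lambda>p. a * conorm_sq AX g \<Omega> p + scalar_curvature AX g p * (U p)\<^sup>2) \<in> borel_measurable borel" by measurable
    show "a * conorm_sq AX g \<Omega> p + scalar_curvature AX g p * (U p)\<^sup>2 = 0" if "p \<notin> E" for p
      by (simp add: conorm_cutoff(3)[OF that] U0[OF that])
    show "a * conorm_sq AX g \<Omega> (\<Phi> (z, t)) + scalar_curvature AX g (\<Phi> (z, t)) * (U (\<Phi> (z, t)))\<^sup>2 =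
       (a * conorm_sq AZ h \<nu> z + scalar_curvature AZ h z * (v z)\<^sup>2) * (\<xi> t)\<^sup>2 + a * (v z)\<^sup>2 * (\<xi>' t)\<^sup>2" if "1 < t" for z t
      by (simp add: conorm_cutoff(2)[OF that] scalar_curvature_end[OF that] cutoff_\<Phi>[OF that] algebra_simps power_mult_distrib)
    show "integrable Z.vol (\<lambda>z. a * conorm_sq AZ h \<nu> z + scalar_curvature AZ h z * (v z)\<^sup>2)" "integrable Z.vol (\<lambda>z. a * (v z)\<^sup>2)"
      using ic iv iR by simp_all
  qed
  then show "yamabe_energy a AX g U \<Omega> = yamabe_energy a AZ h v \<nu> * (LINT t|lborel. (\<xi> t)\<^sup>2) + a * (LINT z|Z.vol. (v z)\<^sup>2) * (LINT t|lborel. (\<xi>' t)\<^sup>2)"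
    by (simp add: yamabe_energy_def)
qed

end

end


section \<open>Test functions of growing length on the end\<close>

context cylindrical_end
begin

theorem cyl_yamabe_nonpos:
  assumes n: "CARD('n) \<ge> 3" and ev: "first_eigenvalue AZ h = 0"
  shows "cyl_yamabe AX g \<le> 0"
proof -
  define n a where "n = real CARD('n)" and "a = alpha CARD('n)"
  \<comment> \<open>Centre and radius one half place the support exactly on the unit
    interval.\<close>
  define \<beta> \<beta>' :: "real \<Rightarrow> real" where "\<beta> = bump 1 (1/2) (1/2)" and "\<beta>' s = frechet_derivative \<beta> (at s) 1" for s
  have n3: "n \<ge> 3" using n by (simp add: n_def)
  have a0: "a \<ge> 0" using alpha_nonneg[where 'k='m] by (simp add: a_def card_n)
  have sm: "smooth_on UNIV \<beta>" unfolding \<beta>_def by (rule smooth_on_bump)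
  have c\<beta>: "continuous_on UNIV \<beta>" by (rule smooth_on_continuous[OF sm])
  have c\<beta>': "continuous_on UNIV \<beta>'"
    using smooth_on_continuous[OF smooth_on_frechet_derivative[OF open_UNIV sm]] by (simp add: \<beta>'_def[abs_def])
  have d\<beta>: "(\<beta> has_field_derivative \<beta>' s) (at s)" for s
  proof -
    have d: "(\<beta> has_derivative frechet_derivative \<beta> (at s)) (at s)" by (rule smooth_on_has_derivative[OF sm UNIV_I])
    have "frechet_derivative \<beta> (at s) x = \<beta>' s * x" for x
      using linear_scale[OF has_derivative_linear[OF d], of x 1] by (simp add: \<beta>'_def mult.commute)
    then have "frechet_derivative \<beta> (at s) = (*) (\<beta>' s)" by (rule ext)
    with d show ?thesis by (simp add: has_field_derivative_def)
  qed
  have \<beta>pos: "0 < \<beta> s \<longleftrightarrow> s \<in> {0<..<1}" for s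
    unfolding \<beta>_def by (subst bump_pos_iff) (auto simp: dist_real_def abs_if field_simps)
  have \<beta>0: "\<beta> s = 0" if "s \<notin> {0..1}" for s
  proof -
    have "\<not> 0 < \<beta> s" using that by (auto simp: \<beta>pos)
    moreover have "0 \<le> \<beta> s" unfolding \<beta>_def by (rule bump_nonneg)
    ultimately show ?thesis by linarith
  qed
  define \<kappa> \<kappa>' where "\<kappa> = (LINT s|lborel. (\<beta> s)\<^sup>2)" and "\<kappa>' = (LINT s|lborel. (\<beta>' s)\<^sup>2)"
  have \<kappa>'0: "\<kappa>' \<ge> 0" unfolding \<kappa>'_def by (intro integral_nonneg_AE AE_I2) simp
  have \<kappa>0: "\<kappa> > 0"
  proof -
    have i: "integrable lborel (\<lambda>s. (\<beta> s)\<^sup>2)"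
      by (rule integrable_compact_support[of _ "{0..1}"]) (auto intro!: continuous_intros c\<beta> simp: \<beta>0)
    have "\<kappa> \<noteq> 0"
    proof
      assume "\<kappa> = 0"
      then have "AE s in lborel. (\<beta> s)\<^sup>2 = 0" using integral_nonneg_eq_0_iff_AE[OF i] by (simp add: \<kappa>_def)
      then have "AE s in lborel. s \<notin> {0<..<1::real}"
      proof eventually_elim
        case (elim s) then show ?case using \<beta>pos[of s] by auto
      qed
      then have "{0<..<1::real} \<in> null_sets lborel" using AE_iff_null_sets[of "{0<..<1::real}" lborel] by simp
      then show False by (simp add: null_sets_def)
    qed
    moreover have "\<kappa> \<ge> 0" unfolding \<kappa>_def by (intro integral_nonneg_AE AE_I2) simp
    ultimately show ?thesis by simp
  qed
  define V where "V = measure Z.vol UNIV"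
  \<comment> \<open>The energy will be at most \<open>m * ((\<kappa> + a * \<kappa>') / T)\<close>,
    and \<open>m * \<kappa>\<close> at most \<open>V + 1\<close> times the denominator;
    \<open>Q\<close> is the quotient of the two with T split off.\<close>
  define Q where "Q = (\<kappa> + a * \<kappa>') * (V + 1) / \<kappa>"
  have V0: "V \<ge> 0" by (simp add: V_def)
  have main: "cyl_yamabe AX g \<le> ereal (Q / T)" if T: "T \<ge> 1" for T
  proof -
    \<comment> \<open>The infimum 0 lies strictly below \<open>1 / T^2\<close>, so some competitor
      does too; this approximate minimizer takes the place of an eigenfunction.\<close>
    have "(INF (u, \<omega>)\<in>sobolev_nonzero AZ h. ereal (yamabe_energy (alpha (CARD('m) + 1)) AZ h u \<omega> / (LINT p|Z.vol. (u p)\<^sup>2))) < ereal (1 / T\<^sup>2)"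
      using ev T by (simp add: first_eigenvalue_def)
    then obtain v \<nu> where v: "(v, \<nu>) \<in> sobolev_nonzero AZ h" "yamabe_energy a AZ h v \<nu> / (LINT p|Z.vol. (v p)\<^sup>2) < 1 / T\<^sup>2"
      unfolding INF_less_iff by (auto simp: a_def card_n)
    then have vs: "(v, \<nu>) \<in> sobolev AZ h" and vn: "\<not> (AE p in Z.vol. v p = 0)" by (auto simp: sobolev_nonzero_def)
    define m where "m = (LINT z|Z.vol. (v z)\<^sup>2)"
    have m0: "m > 0"
    proof -
      have i: "integrable Z.vol (\<lambda>z. (v z)\<^sup>2)" using vs by (simp add: sobolev_def)
      have "m \<noteq> 0" using vn integral_nonneg_eq_0_iff_AE[OF i] by (simp add: m_def)
      moreover have "m \<ge> 0" unfolding m_def by (intro integral_nonneg_AE AE_I2) simp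
      ultimately show ?thesis by simp
    qed
    have Ev: "yamabe_energy a AZ h v \<nu> \<le> m / T\<^sup>2" using v(2) m0 by (simp add: m_def[symmetric] pos_divide_less_eq)
    \<comment> \<open>The shift by 2 keeps the support, inside \<open>{2..2 + T}\<close>, within the
      region t > 1 where the metric is a product.\<close>
    define \<xi> \<xi>' where "\<xi> t = \<beta> ((t - 2) / T)" and "\<xi>' t = \<beta>' ((t - 2) / T) / T" for t
    define I where "I = {2..2 + T}"
    have d\<xi>: "(\<xi> has_field_derivative \<xi>' t) (at t)" for t
    proof -
      have "((\<lambda>t. (t - 2) / T) has_field_derivative 1 / T) (at t)" using T by (auto intro!: derivative_eq_intros)
      from DERIV_chain2[OF d\<beta> this] show ?thesis by (simp add: \<xi>_def[abs_def] \<xi>'_def)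
    qed
    have c\<xi>': "continuous_on UNIV \<xi>'"
      unfolding \<xi>'_def[abs_def] using T by (intro continuous_intros continuous_on_compose2[OF c\<beta>']) auto
    have I: "compact I" "I \<subseteq> {1<..}" "\<xi> t = 0" if "t \<notin> I" for t
    proof -
      show "compact I" "I \<subseteq> {1<..}" by (auto simp: I_def)
      have "(t - 2) / T \<notin> {0..1}" using that T by (auto simp: I_def field_simps)
      then show "\<xi> t = 0" by (simp add: \<xi>_def \<beta>0)
    qed
    have I12: "compact I" "I \<subseteq> {1<..}" by (auto simp: I_def)
    let ?U = "cutoff \<xi> v" and ?\<Omega> = "cutoff_covector \<xi> \<xi>' v \<nu>"
    note cs = cutoff_sobolev[OF vs d\<xi> c\<xi>' I12 I(3)]
    have sub: "(LINT t|lborel. f ((t - 2) / T)) = T * (LINT s|lborel. f s)" for f :: "real \<Rightarrow> real"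
      using lborel_integral_real_affine[of T "\<lambda>t. f ((t - 2) / T)" 2] T by simp
    have i\<xi>: "(LINT t|lborel. (\<xi> t)\<^sup>2) = T * \<kappa>" unfolding \<xi>_def \<kappa>_def by (rule sub)
    \<comment> \<open>The chain rule contributes the factor T^-2, the substitution the factor
      T.\<close>
    have i\<xi>': "(LINT t|lborel. (\<xi>' t)\<^sup>2) = \<kappa>' / T"
      using sub[of "\<lambda>s. (\<beta>' s / T)\<^sup>2"] T by (simp add: \<xi>'_def \<kappa>'_def power_divide power2_eq_square)
    have U2: "(LINT p|X.vol. (?U p)\<^sup>2) = m * (T * \<kappa>)" using cs(2) by (simp add: i\<xi> m_def)
    have en: "yamabe_energy a AX g ?U ?\<Omega> \<le> m * ((\<kappa> + a * \<kappa>') / T)"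
    proof -
      have "yamabe_energy a AZ h v \<nu> * (T * \<kappa>) \<le> m / T\<^sup>2 * (T * \<kappa>)" using Ev T \<kappa>0 by (intro mult_right_mono) auto
      also have "\<dots> = m * \<kappa> / T" using T by (simp add: power2_eq_square)
      finally show ?thesis by (simp add: cs(3) i\<xi> i\<xi>' m_def[symmetric] add_divide_distrib distrib_left mult_ac)
    qed
    have mU: "?U \<in> borel_measurable borel" using cs(1) by (simp add: sobolev_def)
    define S where "S = \<Phi> ` (UNIV \<times> I)"
    have cS: "compact S" unfolding S_def
      by (intro compact_continuous_image continuous_on_subset[OF continuous_\<Phi>] compact_Times compactZ I12(1)) (use I12(2) in auto)
    have bS: "S \<in> sets borel" using cS by (simp add: borel_compact)
    have SE: "p \<notin> S" if "p \<notin> E" for p using that I12(2) by (auto simp: S_def E_def)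
    have iS: "indicator S (\<Phi> (z, t)) = (indicator I t :: real)" if "1 < t" for z t
    proof -
      have "t \<in> I" if "\<Phi> (z, t) = \<Phi> (z', t')" "t' \<in> I" for z' t'
        using inj_onD[OF inj_\<Phi> that(1)] \<open>1 < t\<close> that(2) I12(2) by auto
      then have "\<Phi> (z, t) \<in> S \<longleftrightarrow> t \<in> I" by (auto simp: S_def)
      then show ?thesis by (simp add: indicator_def)
    qed
    have mS: "measure X.vol S = V * T"
    proof -
      have "(LINT p|X.vol. indicator S p :: real) = (LINT z|Z.vol. 1) * (LINT t|lborel. indicator I t) + (LINT z|Z.vol. 0) * (LINT t|lborel. indicator I t)"
      proof (rule integral_separated_end(2))
        show "(\<lambda>p. indicator S p :: real) \<in> borel_measurable borel" using bS by measurable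
        show "integrable lborel (indicator I :: real \<Rightarrow> real)" using T by (simp add: I_def integrable_indicator_iff)
        then show "integrable lborel (indicator I :: real \<Rightarrow> real)" .
        show "indicator S (\<Phi> (z, t)) = 1 * indicator I t + 0 * (indicator I t :: real)" if "1 < t" for z t by (simp add: iS[OF that])
      qed (use SE I12(2) in \<open>auto simp: indicator_def\<close>)
      moreover have "(LINT p|X.vol. indicator S p :: real) = measure X.vol S" by simp
      ultimately show ?thesis using T by (simp add: V_def I_def)
    qed
    define N where "N = (LINT p|X.vol. \<bar>?U p\<bar> powr (2 * n / (n - 2)))"
    have N0: "N \<ge> 0" unfolding N_def by (intro integral_nonneg_AE AE_I2) simp
    have quot: "yamabe_energy a AX g ?U ?\<Omega> / N powr ((n - 2) / n) \<le> Q / T"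
    \<comment> \<open>If \<open>N = 0\<close>, in particular if the power of the test function is
      not integrable, the quotient is 0 by division by zero, and \<open>Q / T\<close> is
      nonnegative.\<close>
    proof (cases "N = 0")
      case True
      then show ?thesis using T a0 \<kappa>0 \<kappa>'0 V0 by (simp add: Q_def)
    next
      case False
      then have Np: "N > 0" using N0 by simp
      have q: "2 / (2 * n / (n - 2)) = (n - 2) / n" "2 < 2 * n / (n - 2)" using n3 by (auto simp: field_simps)
      have S: "S \<in> sets X.vol" "emeasure X.vol S < \<infinity>" using bS X.vol_compact_finite[OF cS] by auto
      have US: "indicator S p * (?U p)\<^sup>2 = (?U p)\<^sup>2" for p
      proof (cases "p \<in> S")
        case False
        have "?U p = 0"
        proof (cases "p \<in> E")
          case True
          then obtain z t c where c: "p = \<Phi> (z, t)" "1 < t" "c \<in> AZ" "z \<in> fst c" by (rule in_E_cases)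
          then have "t \<notin> I" using False by (auto simp: S_def)
          then show ?thesis using c I(3) by (simp add: cutoff_\<Phi>)
        qed (simp add: cutoff_def)
        then show ?thesis by simp
      qed simp
      have "m * (T * \<kappa>) \<le> (V * T + 1) * N powr ((n - 2) / n)"
        using square_integral_bound(2)[OF _ S q(2), of ?U] mU Np unfolding N_def q(1) by (simp add: US U2 mS)
      \<comment> \<open>Here \<open>T \<ge> 1\<close> absorbs the summand 1, so that T cancels
        against the length of the cutoff on the left.\<close>
      also have "\<dots> \<le> ((V + 1) * T) * N powr ((n - 2) / n)" using T by (intro mult_right_mono) (auto simp: algebra_simps)
      finally have "m * \<kappa> \<le> (V + 1) * N powr ((n - 2) / n)" using T by (simp add: mult_ac)
      then have mb: "m \<le> (V + 1) * N powr ((n - 2) / n) / \<kappa>" using \<kappa>0 by (simp add: pos_le_divide_eq)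
      have "yamabe_energy a AX g ?U ?\<Omega> \<le> ((V + 1) * N powr ((n - 2) / n) / \<kappa>) * ((\<kappa> + a * \<kappa>') / T)"
        using en mult_right_mono[OF mb, of "(\<kappa> + a * \<kappa>') / T"] T a0 \<kappa>0 \<kappa>'0 by simp
      also have "\<dots> = Q / T * N powr ((n - 2) / n)" by (simp add: Q_def mult_ac)
      finally show ?thesis using Np by (simp add: pos_divide_le_eq)
    qed
    have nz: "\<not> (AE p in X.vol. ?U p = 0)"
    proof
      assume "AE p in X.vol. ?U p = 0"
      then have "(LINT p|X.vol. (?U p)\<^sup>2) = (LINT p|X.vol. 0)" using mU by (intro integral_cong_AE) auto
      then show False using U2 m0 T \<kappa>0 by simp
    qed
    have "(?U, ?\<Omega>) \<in> sobolev_nonzero AX g" using cs(1) nz by (simp add: sobolev_nonzero_def)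
    then show ?thesis
      unfolding cyl_yamabe_def Let_def n_def[symmetric] a_def[symmetric]
      by (rule INF_lower2) (use quot in \<open>simp add: N_def\<close>)
  qed
  have lim: "(\<lambda>k. ereal (Q / real k)) \<longlonglongrightarrow> ereal 0" by (intro tendsto_ereal lim_const_over_n)
  have "\<exists>k0. \<forall>k\<ge>k0. cyl_yamabe AX g \<le> ereal (Q / real k)" by (rule exI[of _ 1]) (use main in auto)
  from LIMSEQ_le_const[OF lim this] show ?thesis by (simp add: zero_ereal_def)
qed

end

theorem lemma2p9:
  fixes AX :: "('x::{t2_space,second_countable_topology}, real^'n) chart set"
    and AZ :: "('z::{t2_space,second_countable_topology}, real^'m) chart set"
    and W :: "'x set"
    and g :: "('x, 'n) metric"
    and h :: "('z, 'm) metric"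
  assumes "CARD('n) \<ge> 3"
    and "tame_ends AX AZ W"
    and "cylindrical_metric AX AZ W g h"
  shows "(first_eigenvalue AZ h \<ge> 0 \<longrightarrow>
            cyl_yamabe AX g > -\<infinity> \<and> h_cyl_yamabe AX AZ W h > -\<infinity>) \<and>
         ((\<forall>z. scalar_curvature AZ h z \<ge> 0) \<longrightarrow>
            cyl_yamabe AX g > -\<infinity> \<and> h_cyl_yamabe AX AZ W h > -\<infinity>) \<and>
         (first_eigenvalue AZ h = 0 \<longrightarrow>
            cyl_yamabe AX g \<le> 0 \<and> h_cyl_yamabe AX AZ W h \<le> 0) \<and>
         ((\<forall>z. scalar_curvature AZ h z = 0) \<longrightarrow>
            cyl_yamabe AX g \<le> 0 \<and> h_cyl_yamabe AX AZ W h \<le> 0)"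
proof -
  have tame: "CARD('n) = CARD('m) + 1" "smooth_atlas AX" "smooth_atlas AZ" "compact (UNIV :: 'z set)" "compact (closure W)"
    using assms(2) by (auto simp: tame_ends_def)
  \<comment> \<open>The dimension formula becomes a bijection of index types, which is what
    \<open>split_coords\<close> asks for.\<close>
  have "card (UNIV :: 'm option set) = CARD('n)" by (simp add: tame(1) UNIV_option_conv card_image)
  then obtain b :: "'m option \<Rightarrow> 'n" where b: "bij b"
    using finite_same_card_bij[of "UNIV :: 'm option set" "UNIV :: 'n set"] by auto
  have cyl: "\<exists>\<Phi>. cylindrical_end b AX AZ W g' h \<Phi>" if "cylindrical_metric AX AZ W g' h" for g'
    using that b tame unfolding cylindrical_metric_def cylindrical_end_def split_coords_def cylindrical_end_axioms_def by blast
  have "riemannian_metric AZ h" using assms(3) by (simp add: cylindrical_metric_def)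
  then interpret Z: riemannian AZ h using tame(3) by unfold_locales
  have lower: "cyl_yamabe AX g > -\<infinity> \<and> h_cyl_yamabe AX AZ W h > -\<infinity>" if ev: "0 \<le> first_eigenvalue AZ h"
  proof -
    obtain \<Phi> where "cylindrical_end b AX AZ W g h \<Phi>" using cyl[OF assms(3)] by blast
    from cylindrical_end.cyl_yamabe_bounded_below[OF this assms(1) ev] have "cyl_yamabe AX g > -\<infinity>" .
    \<comment> \<open>The metric \<open>g\<close> itself competes in the supremum.\<close>
    moreover have "cyl_yamabe AX g \<le> h_cyl_yamabe AX AZ W h"
      unfolding h_cyl_yamabe_def by (rule SUP_upper) (use assms(3) in simp)
    ultimately show ?thesis by (metis less_le_trans)
  qed
  have upper: "cyl_yamabe AX g \<le> 0 \<and> h_cyl_yamabe AX AZ W h \<le> 0" if ev: "first_eigenvalue AZ h = 0"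
  proof -
    \<comment> \<open>The hypothesis concerns \<open>h\<close> alone, so the bound holds for every
      competitor, each with its own coordinates \<open>\<Phi>\<close> on the end.\<close>
    have "cyl_yamabe AX g' \<le> 0" if g': "cylindrical_metric AX AZ W g' h" for g'
    proof -
      obtain \<Phi> where "cylindrical_end b AX AZ W g' h \<Phi>" using cyl[OF g'] by blast
      from cylindrical_end.cyl_yamabe_nonpos[OF this assms(1) ev] show ?thesis .
    qed
    then show ?thesis using assms(3) unfolding h_cyl_yamabe_def by (auto intro!: SUP_least)
  qed
  show ?thesis
    using lower upper Z.first_eigenvalue_nonneg Z.first_eigenvalue_flat[OF tame(4)] by blast
qed


end
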